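(* Let $0<q<p<\infty$, $0<r<1$, $\omega\in\mathcal{D}$, let $\varphi,\psi$ be holomorphic self-maps of $\mathbb{B}_n$, $u,v$ weights (Borel functions on $\mathbb{B}_n$), and $\mu$ a positive Borel measure on $\mathbb{B}_n$. If $\eta+\sigma_{\varphi,r}$ or $\eta+\sigma_{\psi,r}$ is a $q$-Carleson measure for $A^p_\omega$, then $uC_\varphi-vC_\psi:A^p_\omega\to L^q_\mu$ is compact. Here $$\eta=(|\rho u|^qd\mu)\circ\varphi^{-1}+(|\rho v|^qd\mu)\circ\psi^{-1},\ \ \sigma_{\varphi,r}=(\chi_{G_r}|u-v|^qd\mu)\circ\varphi^{-1},\ \ \sigma_{\psi,r}=(\chi_{G_r}|u-v|^qd\mu)\circ\psi^{-1},$$ with $\rho(z)=\rho(\varphi(z),\psi(z))$ and $G_r=\{z:\rho(z)<r\}$.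
   Context: $\mathbb{B}_n$ is the open unit ball of $\mathbb{C}^n$, $dV$ the normalized volume measure. A radial weight is a positive, measurable, integrable $\omega$ with $\omega(z)=\omega(|z|)$; $\hat\omega(r)=\int_r^1\omega(s)ds$. $\omega\in\hat{\mathcal D}$ if there is $C\ge1$ with $\hat\omega(r)\le C\hat\omega(\frac{1+r}{2})$ for all $r\in[0,1)$; $\omega\in\check{\mathcal D}$ if there are $C,K>1$ with $\hat\omega(r)\ge C\hat\omega(1-\frac{1-r}{K})$ for all $r\in[0,1)$; $\mathcal D=\hat{\mathcal D}\cap\check{\mathcal D}$. $A^p_\omega$ is the space of holomorphic $f$ with $\|f\|^p_{A^p_\omega}=\int|f|^p\omega\,dV<\infty$; $L^q_\mu$ the space of measurable $g$ with $\int|g|^qd\mu<\infty$. $(uC_\varphi f)(z)=u(z)f(\varphi(z))$. The pseudohyperbolic distance is $\rho(a,z)=|\varphi_a(z)|$ with $\varphi_a$ the involutive automorphism exchanging $a$ and $0$. $(\nu\circ\varphi^{-1})(E)=\nu(\varphi^{-1}(E))$. A positive Borel measure $\nu$ is a $q$-Carleson measure for $A^p_\omega$ if the identity $A^p_\omega\to L^q_\nu$ is bounded; a linear map is compact if it maps bounded sequences to sequences with a convergent subsequence. *)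

theory Defs
  imports "HOL-Analysis.Analysis"
begin

abbreviation unit_ball :: "(complex ^ 'n) set" where
  "unit_ball \<equiv> ball 0 1"

definition ball_space :: "(complex ^ 'n) measure" where
  "ball_space = restrict_space borel unit_ball"

definition dV :: "(complex ^ 'n) measure" where
  "dV = uniform_measure lborel unit_ball"

definition holo_on :: "(complex ^ 'n) set \<Rightarrow> (complex ^ 'n \<Rightarrow> complex) \<Rightarrow> bool" where
  "holo_on U f \<longleftrightarrow> (\<forall>z\<in>U. \<exists>L. (f has_derivative L) (at z) \<and> (\<forall>c x. L (c *s x) = c * L x))"

definition holo_self_map :: "(complex ^ 'n \<Rightarrow> complex ^ 'n) \<Rightarrow> bool" where
  "holo_self_map \<phi> \<longleftrightarrow> (\<forall>i. holo_on unit_ball (\<lambda>z. \<phi> z $ i)) \<and> \<phi> ` unit_ball \<subseteq> unit_ball"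

definition cinner :: "complex ^ 'n \<Rightarrow> complex ^ 'n \<Rightarrow> complex" where
  "cinner z w = (\<Sum>i\<in>UNIV. z $ i * cnj (w $ i))"

text \<open>The involutive automorphism exchanging a and 0:
  phi_a(z) = (a - P_a z - s_a Q_a z) / (1 - <z,a>), with P_a the orthogonal projection onto C a,
  Q_a = I - P_a, s_a = sqrt(1 - |a|^2); phi_0 = -id.\<close>
definition ball_aut :: "complex ^ 'n \<Rightarrow> complex ^ 'n \<Rightarrow> complex ^ 'n" where
  "ball_aut a z =
    (if a = 0 then - z else
     (let Pz = (cinner z a / cinner a a) *s a;
          Qz = z - Pz;
          s = complex_of_real (sqrt (1 - (norm a)\<^sup>2))
      in (1 / (1 - cinner z a)) *s (a - Pz - s *s Qz)))"

definition pseudo_hyp :: "complex ^ 'n \<Rightarrow> complex ^ 'n \<Rightarrow> real" where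
  "pseudo_hyp a z = norm (ball_aut a z)"

definition radial_weight :: "'n::finite itself \<Rightarrow> (real \<Rightarrow> real) \<Rightarrow> bool" where
  "radial_weight _ \<omega> \<longleftrightarrow>
     (\<forall>s\<in>{0..<1}. 0 < \<omega> s) \<and> \<omega> \<in> borel_measurable borel \<and>
     (\<integral>\<^sup>+ z. ennreal (\<omega> (norm z)) \<partial>(dV :: (complex ^ 'n) measure)) < \<infinity>"

definition omega_hat :: "(real \<Rightarrow> real) \<Rightarrow> real \<Rightarrow> ennreal" where
  "omega_hat \<omega> r = (\<integral>\<^sup>+ s. ennreal (\<omega> s) * indicator {r..<1} s \<partial>lborel)"

definition D_hat :: "'n::finite itself \<Rightarrow> (real \<Rightarrow> real) \<Rightarrow> bool" where
  "D_hat T \<omega> \<longleftrightarrow> radial_weight T \<omega> \<and>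
     (\<exists>C\<ge>1. \<forall>r\<in>{0..<1}. omega_hat \<omega> r \<le> ennreal C * omega_hat \<omega> ((1 + r) / 2))"

definition D_check :: "'n::finite itself \<Rightarrow> (real \<Rightarrow> real) \<Rightarrow> bool" where
  "D_check T \<omega> \<longleftrightarrow> radial_weight T \<omega> \<and>
     (\<exists>C>1. \<exists>K>1. \<forall>r\<in>{0..<1}. omega_hat \<omega> r \<ge> ennreal C * omega_hat \<omega> (1 - (1 - r) / K))"

definition D_class :: "'n::finite itself \<Rightarrow> (real \<Rightarrow> real) \<Rightarrow> bool" where
  "D_class T \<omega> \<longleftrightarrow> D_hat T \<omega> \<and> D_check T \<omega>"

definition Ap_norm_p :: "real \<Rightarrow> (real \<Rightarrow> real) \<Rightarrow> (complex ^ 'n \<Rightarrow> complex) \<Rightarrow> ennreal" where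
  "Ap_norm_p p \<omega> f = (\<integral>\<^sup>+ z. ennreal (norm (f z) powr p * \<omega> (norm z)) \<partial>dV)"

definition Bergman :: "real \<Rightarrow> (real \<Rightarrow> real) \<Rightarrow> (complex ^ 'n \<Rightarrow> complex) set" where
  "Bergman p \<omega> = {f. holo_on unit_ball f \<and> Ap_norm_p p \<omega> f < \<infinity>}"

definition measure_add :: "'a measure \<Rightarrow> 'a measure \<Rightarrow> 'a measure" where
  "measure_add M N = measure_of (space M) (sets M) (\<lambda>A. emeasure M A + emeasure N A)"

text \<open>nu is a q-Carleson measure for A^p_omega: the identity A^p_omega \<rightarrow> L^q_nu is bounded,
  i.e. ||f||_{L^q_nu} \<le> C ||f||_{A^p_omega}, written with q-th powers.\<close>
definition carleson :: "real \<Rightarrow> real \<Rightarrow> (real \<Rightarrow> real) \<Rightarrow> (complex ^ 'n) measure \<Rightarrow> bool" where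
  "carleson q p \<omega> \<nu> \<longleftrightarrow>
     (\<exists>C. \<forall>f\<in>Bergman p \<omega>.
        (\<integral>\<^sup>+ z. ennreal (norm (f z) powr q) \<partial>\<nu>) \<le> ennreal (C * (enn2real (Ap_norm_p p \<omega> f)) powr (q / p)))"

definition compact_op ::
  "((complex ^ 'n \<Rightarrow> complex) \<Rightarrow> (complex ^ 'n \<Rightarrow> complex)) \<Rightarrow> real \<Rightarrow> (real \<Rightarrow> real)
     \<Rightarrow> real \<Rightarrow> (complex ^ 'n) measure \<Rightarrow> bool" where
  "compact_op T p \<omega> q \<mu> \<longleftrightarrow>
     (\<forall>f\<in>Bergman p \<omega>. T f \<in> borel_measurable \<mu> \<and> (\<integral>\<^sup>+ z. ennreal (norm (T f z) powr q) \<partial>\<mu>) < \<infinity>) \<and>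
     (\<forall>fs :: nat \<Rightarrow> (complex ^ 'n \<Rightarrow> complex).
        (\<forall>k. fs k \<in> Bergman p \<omega>) \<and> (\<exists>M. \<forall>k. Ap_norm_p p \<omega> (fs k) \<le> ennreal M) \<longrightarrow>
        (\<exists>s g. strict_mono s \<and> g \<in> borel_measurable \<mu> \<and>
           (\<integral>\<^sup>+ z. ennreal (norm (g z) powr q) \<partial>\<mu>) < \<infinity> \<and>
           (\<lambda>k. \<integral>\<^sup>+ z. ennreal (norm (T (fs (s k)) z - g z) powr q) \<partial>\<mu>) \<longlonglongrightarrow> 0))"

end

theory Submission
  imports Defs "HOL-Complex_Analysis.Complex_Analysis"
begin

text \<open>Both maps are compared through a lattice \<open>(a\<^sub>j)\<close> of the ball with disjoint cells \<open>Q\<^sub>j\<close>.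
  Testing the Carleson inequality for \<open>\<nu> = \<eta> + \<sigma>\<close> on random signed sums of kernels peaking at
  the \<open>a\<^sub>j\<close> and averaging with Khinchine's inequality gives
  \<open>\<Sum> c\<^sub>j\<^bsup>q\<^esup> \<nu>(Q\<^sub>j) \<le> C (\<Sum> c\<^sub>j\<^bsup>p\<^esup> W\<^sub>j)\<^bsup>q/p\<^esup>\<close>, where \<open>W\<^sub>j\<close> is the \<open>\<omega>\<close>-mass of a
  cell; since \<open>q < p\<close>, this says that a certain positive series determined by \<open>\<nu>\<close> converges.
  For holomorphic \<open>f\<close>, the value \<open>|u f(\<phi>) - v f(\<psi>)|\<^bsup>q\<^esup>\<close> is dominated by local suprema of \<open>|f|\<^bsup>q\<^esup>\<close>
  integrated against \<open>\<nu>\<close>: trivially where the pseudohyperbolic distance \<open>\<rho>\<close> of the two maps is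
  bounded below, and by the Schwarz lemma where it is small. Young's inequality then makes the
  contribution of all but finitely many cells uniformly small on bounded sets of functions. On the
  remaining cells, Montel's theorem provides locally uniform convergence of a subsequence, so its
  image is Cauchy in \<open>L\<^bsup>q\<^esup>\<close>, and Fatou's lemma identifies the limit.

  The geometry needs no automorphisms: with \<open>h = z - a\<close>,
  \<open>\<rho>(a,z)\<^sup>2 |1 - \<langle>z,a\<rangle>|\<^sup>2 = (1 - |a|\<^sup>2) |h|\<^sup>2 + |\<langle>h,a\<rangle>|\<^sup>2\<close>.\<close>

section \<open>Circular means of holomorphic functions\<close>

text \<open>Two obstacles shape the development. First, \<omega> is controlled only through its
  tails and may be tiny on most of a cell, so |f|^p cannot be averaged locally against it. Local
  averages use Lebesgue measure, and the passage to \<omega> is made once, radially, through the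
  monotonicity of spherical means of |f|^p. Since p may be below 1, that monotonicity is reduced to
  one variable, where zeros are divided out and the zero-free case becomes p = 2. Second, a sum of
  kernels may cancel exactly where it should be large. Random signs replace its modulus by a square
  function, which on each cell is bounded below by one of its terms. The condition q < p makes
  boundedness imply compactness: with optimal coefficients the discrete inequality reads s <= C
  s^(q/p), and q/p < 1 turns this into an a priori bound on s. What results is one convergent series
  serving all functions of a bounded set at once, hence uniformly small tails. The Schwarz step
  works for distances below 1/64, so the two regimes are separated at min r (1/64) and not at
  r.\<close>

definition circle_mean :: "real \<Rightarrow> (complex \<Rightarrow> complex) \<Rightarrow> real \<Rightarrow> real" where
  "circle_mean p f s = integral {0..2*pi} (\<lambda>t. norm (f (of_real s * cis t)) powr p)"

lemma integral_shift_periodic: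
  fixes g :: "real \<Rightarrow> real"
  assumes cont: "continuous_on UNIV g" and per: "\<And>t. g (t + T) = g t"
    and "0 \<le> \<alpha>" "\<alpha> \<le> T"
  shows "integral {0..T} (\<lambda>t. g (t + \<alpha>)) = integral {0..T} g"
proof -
  have int: "g integrable_on {a..b}" for a b
    by (rule integrable_continuous_real) (rule continuous_on_subset[OF cont], simp)
  have shift: "integral {a..b} (\<lambda>t. g (t + c)) = integral {a+c..b+c} g" for a b c
  proof -
    have "(g has_integral (integral {a+c..b+c} g)) {a+c..b+c}"
      using int by (simp add: integrable_integral)
    then have "((g \<circ> ((+) c)) has_integral (integral {a+c..b+c} g)) {a..b}"
      by (simp add: has_integral_shift_Icc_real)
    then show ?thesis by (simp add: o_def add.commute integral_unique)
  qed
  have "integral {0..T} (\<lambda>t. g (t + \<alpha>)) = integral {\<alpha>..T+\<alpha>} g"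
    using shift[of 0 T \<alpha>] by simp
  also have "\<dots> = integral {\<alpha>..T} g + integral {T..T+\<alpha>} g"
    using Henstock_Kurzweil_Integration.integral_combine[of \<alpha> T "T+\<alpha>" g] assms int by simp
  also have "integral {T..T+\<alpha>} g = integral {0..\<alpha>} (\<lambda>t. g (t + T))"
    using shift[of 0 \<alpha> T] by (simp add: add.commute)
  also have "\<dots> = integral {0..\<alpha>} g" by (simp add: per)
  finally show ?thesis
    using Henstock_Kurzweil_Integration.integral_combine[of 0 \<alpha> T g] assms int by simp
qed

lemma continuous_on_circle_powr:
  assumes "continuous_on (ball 0 R) f" "p > 0"
  shows "continuous_on ({0..<R} \<times> A) (\<lambda>(s, t). norm (f (of_real s * cis t)) powr p)"
proof -
  have "continuous_on ({0..<R} \<times> A) (\<lambda>x. f (of_real (fst x) * cis (snd x)))"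
    by (rule continuous_on_compose2[OF assms(1)])
       (auto intro!: continuous_intros simp: norm_mult)
  then show ?thesis
    unfolding case_prod_unfold using assms(2)
    by (intro continuous_on_powr' continuous_intros) auto
qed

lemma circle_powr_integrable:
  assumes "continuous_on (ball 0 R) f" "p > 0" "0 \<le> s" "s < R"
  shows "(\<lambda>t. norm (f (of_real s * cis t)) powr p) integrable_on {a..b}"
proof (rule integrable_continuous_real)
  have "continuous_on {a..b} ((\<lambda>(s, t). norm (f (of_real s * cis t)) powr p) \<circ> (\<lambda>t. (s,t)))"
    by (rule continuous_on_compose)
       (auto intro!: continuous_intros continuous_on_subset[OF continuous_on_circle_powr[OF assms(1,2), of UNIV]] 
         simp: assms)
  then show "continuous_on {a..b} (\<lambda>t. norm (f (of_real s * cis t)) powr p)" by (simp add: o_def)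
qed

lemma continuous_on_circle_mean:
  assumes "continuous_on (ball 0 R) f" "p > 0"
  shows "continuous_on {0..<R} (circle_mean p f)"
proof -
  have "continuous_on {0..<R} (\<lambda>s. integral (cbox 0 (2*pi)) (\<lambda>t. norm (f (of_real s * cis t)) powr p))"
    by (rule integral_continuous_on_param) (rule continuous_on_circle_powr[OF assms])
  then show ?thesis by (simp add: circle_mean_def[abs_def])
qed

text \<open>Compare $F$ on the circle of radius $s$ with its own restriction to the circle of radius $r$:
  the pairing $G(z) = \int F(z e^{it}) \overline{F(r e^{it})}\,dt$ is holomorphic, equals the
  mean at $z = r$, and the maximum principle with AM-GM closes the argument.\<close>
lemma circle_mean_2_mono:
  assumes F: "F holomorphic_on ball 0 R" and rs: "0 \<le> r" "r \<le> s" "s < R"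
  shows "circle_mean 2 F r \<le> circle_mean 2 F s"
proof (cases "s = 0")
  case True
  then show ?thesis using rs by simp
next
  case False
  with rs have s0: "0 < s" by simp
  have cF: "continuous_on (ball 0 R) F" using F by (rule holomorphic_on_imp_continuous_on)
  define f where "f z t = F (z * cis t) * cnj (F (of_real r * cis t))" for z t
  define G where "G z = integral (cbox 0 (2*pi)) (f z)" for z
  have cr: "continuous_on A (\<lambda>t. F (of_real r * cis t))" for A
    by (rule continuous_on_compose2[OF cF]) (use rs in \<open>auto intro!: continuous_intros simp: norm_mult\<close>)
  have cz: "continuous_on A (\<lambda>t. F (z * cis t))" if "z \<in> ball 0 R" for A z
    by (rule continuous_on_compose2[OF cF]) (use that in \<open>auto intro!: continuous_intros simp: norm_mult\<close>)
  have G: "G holomorphic_on ball 0 R"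
    unfolding G_def
  proof (rule leibniz_rule_holomorphic)
    fix x t assume x: "x \<in> ball (0::complex) R"
    have "(F has_field_derivative deriv F (x * cis t)) (at (x * cis t))"
      using holomorphic_derivI[OF F open_ball] x by (simp add: norm_mult)
    then have d: "((\<lambda>x. F (x * cis t)) has_field_derivative deriv F (x * cis t) * cis t) (at x)"
      by (rule DERIV_chain2[where f = F and g = "\<lambda>x. x * cis t"]) (auto intro!: derivative_eq_intros)
    show "((\<lambda>x. f x t) has_field_derivative deriv F (x * cis t) * cis t * cnj (F (of_real r * cis t)))
        (at x within ball 0 R)"
      unfolding f_def by (rule DERIV_cmult_right[OF has_field_derivative_at_within[OF d]])
  next
    fix x assume x: "x \<in> ball (0::complex) R"
    show "f x integrable_on cbox 0 (2*pi)"
      unfolding f_def using x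
      by (intro integrable_continuous continuous_intros cr cz)
  next
    have cd: "continuous_on (ball 0 R) (deriv F)"
      using F holomorphic_deriv holomorphic_on_imp_continuous_on open_ball by blast
    have "continuous_on (ball 0 R \<times> cbox 0 (2*pi)) (\<lambda>x. deriv F (fst x * cis (snd x)))"
      by (rule continuous_on_compose2[OF cd]) (auto intro!: continuous_intros simp: norm_mult)
    moreover have "continuous_on (ball 0 R \<times> cbox 0 (2*pi)) (\<lambda>x. F (of_real r * cis (snd x)))"
      by (rule continuous_on_compose2[OF cr[of UNIV]]) (auto intro!: continuous_intros)
    ultimately show "continuous_on (ball 0 R \<times> cbox 0 (2*pi))
       (\<lambda>(x, t). deriv F (x * cis t) * cis t * cnj (F (of_real r * cis t)))"
      unfolding case_prod_unfold by (intro continuous_intros)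
  qed auto
  have sq: "norm z powr 2 = (norm z)\<^sup>2" for z :: complex
    by (simp add: powr_numeral)
  have M: "circle_mean 2 F x = integral {0..2*pi} (\<lambda>t. (norm (F (of_real x * cis t)))\<^sup>2)" for x
    by (simp add: circle_mean_def sq)
  have Gr: "G (of_real r) = of_real (circle_mean 2 F r)"
  proof -
    have "G (of_real r) = integral {0..2*pi} (\<lambda>t. complex_of_real ((norm (F (of_real r * cis t)))\<^sup>2))"
      unfolding G_def f_def cbox_interval by (intro integral_cong) (simp add: complex_norm_square[symmetric])
    also have "\<dots> = of_real (integral {0..2*pi} (\<lambda>t. (norm (F (of_real r * cis t)))\<^sup>2))"
      using integral_linear[where h = complex_of_real and f = "\<lambda>t. (norm (F (of_real r * cis t)))\<^sup>2"
          and S = "{0..2*pi}", OF _ bounded_linear_of_real]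
        circle_powr_integrable[OF cF, of 2 r 0 "2*pi"] rs by (simp add: sq o_def)
    finally show ?thesis by (simp add: M)
  qed
  have Gs: "norm (G z) \<le> (circle_mean 2 F s + circle_mean 2 F r) / 2" if z: "norm z = s" for z
  proof -
    have zR: "z \<in> ball 0 R" using z rs by simp
    define \<alpha> where "\<alpha> = Arg2pi z"
    have za: "z = of_real s * cis \<alpha>"
      using Arg2pi_eq[of z] z by (simp add: \<alpha>_def cis_conv_exp)
    define g where "g t = (norm (F (of_real s * cis t)))\<^sup>2" for t
    have i1: "(\<lambda>t. (norm (F (z * cis t)))\<^sup>2) integrable_on {0..2*pi}"
      by (intro integrable_continuous_real continuous_intros cz zR)
    have i2: "(\<lambda>t. (norm (F (of_real r * cis t)))\<^sup>2) integrable_on {0..2*pi}"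
      by (intro integrable_continuous_real continuous_intros cr)
    \<comment> \<open>The mean over the circle of radius s does not depend on the argument \<alpha>
      of the starting point z, by periodicity.\<close>
    have "integral {0..2*pi} (\<lambda>t. g (t + \<alpha>)) = integral {0..2*pi} g"
    proof (rule integral_shift_periodic)
      have "continuous_on UNIV (\<lambda>t. F (of_real s * cis t))"
        by (rule cz) (use rs in auto)
      then show "continuous_on UNIV g"
        unfolding g_def by (intro continuous_intros)
      show "g (t + 2 * pi) = g t" for t by (simp add: g_def cis.ctr)
      show "0 \<le> \<alpha>" "\<alpha> \<le> 2*pi" using Arg2pi[of z] by (auto simp: \<alpha>_def)
    qed
    moreover have "g (t + \<alpha>) = (norm (F (z * cis t)))\<^sup>2" for t
      by (simp add: g_def za cis_mult[symmetric] mult_ac)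
    ultimately have Ms: "circle_mean 2 F s = integral {0..2*pi} (\<lambda>t. (norm (F (z * cis t)))\<^sup>2)"
      by (simp add: M g_def[abs_def])
    have "norm (G z) \<le> integral {0..2*pi} (\<lambda>t. ((norm (F (z * cis t)))\<^sup>2 + (norm (F (of_real r * cis t)))\<^sup>2) / 2)"
      unfolding G_def cbox_interval
    proof (rule integral_norm_bound_integral)
      show "f z integrable_on {0..2*pi}"
        unfolding f_def using zR by (intro integrable_continuous_real continuous_intros cr cz)
      show "(\<lambda>t. ((norm (F (z * cis t)))\<^sup>2 + (norm (F (of_real r * cis t)))\<^sup>2) / 2) integrable_on {0..2*pi}"
        by (intro integrable_continuous_real continuous_intros cz zR cr) auto
      show "norm (f z t) \<le> ((norm (F (z * cis t)))\<^sup>2 + (norm (F (of_real r * cis t)))\<^sup>2) / 2" for t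
        using sum_squares_bound[of "norm (F (z * cis t))" "norm (F (of_real r * cis t))"]
        by (simp add: f_def norm_mult)
    qed
    also have "\<dots> = (circle_mean 2 F s + circle_mean 2 F r) / 2"
      unfolding Ms M[of r] using i1 i2 by (simp add: Henstock_Kurzweil_Integration.integral_add)
    finally show ?thesis .
  qed
  \<comment> \<open>With m(x) the mean at radius x, the maximum principle yields m(r) <= (m(s) +
    m(r)) / 2, which rearranges to m(r) <= m(s).\<close>
  have "norm (G (of_real r)) \<le> (circle_mean 2 F s + circle_mean 2 F r) / 2"
  proof (rule maximum_modulus_frontier[where S = "cball 0 s" and f = G])
    show "G holomorphic_on interior (cball 0 s)" 
      by (rule holomorphic_on_subset[OF G]) (use rs in auto)
    show "continuous_on (closure (cball 0 s)) G"
      by (rule continuous_on_subset[OF holomorphic_on_imp_continuous_on[OF G]]) (use rs in auto)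
  qed (use rs Gs s0 in auto)
  moreover have "0 \<le> circle_mean 2 F r"
    unfolding M by (rule integral_nonneg) (auto intro!: integrable_continuous_real continuous_intros cr)
  ultimately show ?thesis by (simp add: Gr)
qed

text \<open>A zero-free f on a disc is exp g, so |f|^p = |F|^2 with F = exp (p g / 2), and the case
  p = 2 applies to F.\<close>

lemma circle_mean_mono_nonzero:
  assumes f: "f holomorphic_on ball 0 R" and nz: "\<And>z. z \<in> ball 0 R \<Longrightarrow> f z \<noteq> 0"
    and p: "p > 0" and rs: "0 \<le> r" "r \<le> s" "s < R"
  shows "circle_mean p f r \<le> circle_mean p f s"
proof -
  obtain g where g: "g holomorphic_on ball 0 R" "\<And>x. x \<in> ball 0 R \<Longrightarrow> exp (g x) = f x"
    using holomorphic_logarithm_exists[OF convex_ball open_ball f nz, of 0] rs by auto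
  define F where "F z = exp (of_real (p/2) * g z)" for z
  have F: "F holomorphic_on ball 0 R"
    unfolding F_def by (intro holomorphic_intros g)
  have eq: "norm (f z) powr p = norm (F z) powr 2" if "z \<in> ball 0 R" for z
  proof -
    have "norm (f z) = exp (Re (g z))" using g(2)[OF that] by (metis norm_exp_eq_Re)
    then show ?thesis by (simp add: F_def powr_def)
  qed
  have "circle_mean p f x = circle_mean 2 F x" if "0 \<le> x" "x < R" for x
    unfolding circle_mean_def by (rule integral_cong) (rule eq, use that in \<open>simp add: norm_mult\<close>)
  then show ?thesis using circle_mean_2_mono[OF F rs] rs by simp
qed

text \<open>\<open>zorder_exist_zero\<close> factors f only near a. Away from a the quotient by (z -
  a)^m is holomorphic, and the two pieces agree where both are defined. The point w excludes the
  zero function.\<close>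

lemma holomorphic_factor_zero:
  assumes f: "f holomorphic_on S" "open S" "connected S" "a \<in> S" "w \<in> S" "f w \<noteq> 0"
  obtains g m where "g holomorphic_on S" "g a \<noteq> 0" "\<And>z. z \<in> S \<Longrightarrow> f z = (z - a) ^ m * g z"
proof -
  define h where "h = zor_poly f a"
  define m where "m = nat (zorder f a)"
  obtain r where r: "r > 0" "cball a r \<subseteq> S" "h holomorphic_on cball a r"
    "\<And>w. w \<in> cball a r \<Longrightarrow> f w = h w * (w - a) ^ m \<and> h w \<noteq> 0"
    using zorder_exist_zero[OF f(1-4)] f(5,6) unfolding h_def m_def by blast
  define g where "g z = (if z \<in> ball a r then h z else f z / (z - a) ^ m)" for z
  have gh: "g z = f z / (z - a) ^ m" if "z \<in> S - {a}" for z
    using r(4)[of z] that by (auto simp: g_def)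
  have "g holomorphic_on (S - {a})"
  proof -
    have "(\<lambda>z. f z / (z - a) ^ m) holomorphic_on (S - {a})"
      by (intro holomorphic_intros holomorphic_on_subset[OF f(1)]) auto
    then show ?thesis using gh by (metis (no_types, lifting) holomorphic_transform)
  qed
  moreover have "g holomorphic_on ball a r"
  proof -
    have "h holomorphic_on ball a r" using r(3) by (rule holomorphic_on_subset) auto
    then show ?thesis by (rule holomorphic_transform) (simp add: g_def)
  qed
  ultimately have "g holomorphic_on (S - {a}) \<union> ball a r"
    using f(2) by (intro holomorphic_on_Un) auto
  moreover have "(S - {a}) \<union> ball a r = S" using r(1,2) f(4) by (auto)
  ultimately have "g holomorphic_on S" by simp
  moreover have "g a \<noteq> 0" using r(1) r(4)[of a] by (simp add: g_def)
  moreover have "f z = (z - a) ^ m * g z" if "z \<in> S" for z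
  proof (cases "z = a")
    case True
    then show ?thesis using r(1) r(4)[of a] by (simp add: g_def)
  next
    case False
    then show ?thesis using gh[of z] that by simp
  qed
  ultimately show ?thesis using that by blast
qed

text \<open>Both parts come from |s^2 - cnj a z|^2 - s^2 |z - a|^2 = (s^2 - |a|^2) (s^2 - |z|^2):
  the inverse of a Blaschke factor has modulus at least 1 inside the circle and exactly 1 on
  it.\<close>

lemma Blaschke_le:
  assumes s: "s > 0" and a: "norm a < s" and z: "norm z \<le> s"
  shows "s * norm (z - a) \<le> norm (of_real (s\<^sup>2) - cnj a * z)"
    and "norm z = s \<Longrightarrow> s * norm (z - a) = norm (of_real (s\<^sup>2) - cnj a * z)"
proof -
  have id: "(norm (of_real (s\<^sup>2) - cnj a * z))\<^sup>2 - (s * norm (z - a))\<^sup>2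
      = (s\<^sup>2 - (norm a)\<^sup>2) * (s\<^sup>2 - (norm z)\<^sup>2)"
    unfolding power_mult_distrib cmod_power2
    by (simp add: algebra_simps power2_eq_square power4_eq_xxxx)
  have "0 \<le> (s\<^sup>2 - (norm a)\<^sup>2) * (s\<^sup>2 - (norm z)\<^sup>2)"
    using a z s by (intro mult_nonneg_nonneg) (auto intro!: power_mono)
  with id have "(s * norm (z - a))\<^sup>2 \<le> (norm (of_real (s\<^sup>2) - cnj a * z))\<^sup>2" by linarith
  then show "s * norm (z - a) \<le> norm (of_real (s\<^sup>2) - cnj a * z)"
    by (rule power2_le_imp_le) (rule norm_ge_zero)
  show "s * norm (z - a) = norm (of_real (s\<^sup>2) - cnj a * z)" if zs: "norm z = s"
  proof -
    have "(norm (of_real (s\<^sup>2) - cnj a * z))\<^sup>2 = (s * norm (z - a))\<^sup>2"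
      using id unfolding zs by simp
    then show ?thesis using s by (simp only: power2_eq_iff_nonneg norm_ge_zero mult_nonneg_nonneg less_imp_le)
  qed
qed

text \<open>Induction on the zeros. A zero a is removed with its full multiplicity m by putting
  ((s^2 - cnj a z) / s)^m in place of (z - a)^m. The new factor has no zero in the closed disc, is
  larger inside and equal in modulus on the circle.\<close>

lemma Blaschke_majorant:
  assumes "finite Z" "f holomorphic_on ball 0 R" "0 < s" "s < R"
    "{z \<in> cball 0 s. f z = 0} = Z" "\<And>z. norm z = s \<Longrightarrow> f z \<noteq> 0"
  shows "\<exists>g. g holomorphic_on ball 0 R \<and> (\<forall>z\<in>cball 0 s. g z \<noteq> 0 \<and> norm (f z) \<le> norm (g z)) \<and>
      (\<forall>z. norm z = s \<longrightarrow> norm (f z) = norm (g z))"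
  using assms
proof (induction Z arbitrary: f rule: finite_induct)
  case empty
  then show ?case by (intro exI[of _ f]) auto
next
  case (insert a Z)
  have a: "f a = 0" "norm a < s"
    using insert.prems(4,5) by (auto simp: order.order_iff_strict)
  obtain g m where g: "g holomorphic_on ball 0 R" "g a \<noteq> 0" "\<And>z. z \<in> ball 0 R \<Longrightarrow> f z = (z - a) ^ m * g z"
    using holomorphic_factor_zero[OF insert.prems(1) open_ball connected_ball, of a "of_real s"]
      insert.prems(2,3,5) a(2) by (auto simp del: of_real_eq_0_iff)
  define h where "h z = g z * ((of_real (s\<^sup>2) - cnj a * z) / of_real s) ^ m" for z
  have m: "m > 0" using g(3)[of a] a g(2) insert.prems by (cases m) auto
  have nz: "of_real (s\<^sup>2) - cnj a * z \<noteq> 0" if "norm z \<le> s" for z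
  proof
    assume "of_real (s\<^sup>2) - cnj a * z = 0"
    then have "s\<^sup>2 = norm a * norm z" 
      by (metis complex_mod_cnj eq_iff_diff_eq_0 norm_mult norm_of_real abs_power2)
    also have "\<dots> \<le> norm a * s" using that by (intro mult_left_mono) auto
    also have "\<dots> < s * s" using a insert.prems(2) by simp
    finally show False by (simp add: power2_eq_square)
  qed
  have "\<exists>k. k holomorphic_on ball 0 R \<and> (\<forall>z\<in>cball 0 s. k z \<noteq> 0 \<and> norm (h z) \<le> norm (k z)) \<and>
      (\<forall>z. norm z = s \<longrightarrow> norm (h z) = norm (k z))"
  proof (rule insert.IH)
    show "h holomorphic_on ball 0 R"
      unfolding h_def using insert.prems(2) by (intro holomorphic_intros g) auto
    have hz: "h z = 0 \<longleftrightarrow> g z = 0" if "norm z \<le> s" for z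
      using nz[OF that] insert.prems(2) by (simp add: h_def)
    have gz: "g z = 0 \<longleftrightarrow> f z = 0 \<and> z \<noteq> a" if "norm z \<le> s" for z
      using g(2) g(3)[of z] that insert.prems(3) m by auto
    show "{z \<in> cball 0 s. h z = 0} = Z"
      using insert.prems(4) insert.hyps(2) hz gz by auto
    show "h z \<noteq> 0" if "norm z = s" for z
      using hz[of z] gz[of z] that insert.prems(5)[of z] by auto
  qed (use insert.prems in auto)
  then obtain k where k: "k holomorphic_on ball 0 R" "\<And>z. z\<in>cball 0 s \<Longrightarrow> k z \<noteq> 0 \<and> norm (h z) \<le> norm (k z)"
    "\<And>z. norm z = s \<Longrightarrow> norm (h z) = norm (k z)" by blast
  have fh: "norm (f z) \<le> norm (h z)" if "norm z \<le> s" for z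
  proof -
    have "norm (z - a) \<le> norm (of_real (s\<^sup>2) - cnj a * z) / s"
      using Blaschke_le(1)[OF insert.prems(2) a(2) that] insert.prems(2) by (simp add: field_simps)
    then show ?thesis
      using g(3)[of z] that insert.prems(2,3) mult_right_mono[OF power_mono[of "norm (z - a)" _ m], of _ "norm (g z)"]
      by (simp add: h_def norm_mult norm_power norm_divide mult.commute[of "norm (g z)"])
  qed
  have fh': "norm (f z) = norm (h z)" if "norm z = s" for z
  proof -
    have "norm (z - a) = norm (of_real (s\<^sup>2) - cnj a * z) / s"
      using Blaschke_le(2)[OF insert.prems(2) a(2) _ that] that insert.prems(2) by (simp add: field_simps)
    then show ?thesis
      using g(3)[of z] that insert.prems(2,3)
      by (simp add: h_def norm_mult norm_power norm_divide)
  qed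
  show ?case
    using k fh' order_trans[OF fh] by (intro exI[of _ k]) auto
qed

text \<open>With g the zero-free majorant, the mean of f at r is at most that of g at r, hence at
  most that of g at s, which is that of f at s. Only the disc of radius s is known to be free of
  zeros of g, so the middle step is taken at radii x < s and extended by continuity of the
  mean.\<close>

lemma circle_mean_mono_strict:
  assumes f: "f holomorphic_on ball 0 R" and p: "p > 0" and rs: "0 \<le> r" "r < s" "s < R"
    and nz: "\<And>z. norm z = s \<Longrightarrow> f z \<noteq> 0"
  shows "circle_mean p f r \<le> circle_mean p f s"
proof -
  have s: "0 < s" using rs by simp
  have cf: "continuous_on (ball 0 R) f" using f by (rule holomorphic_on_imp_continuous_on)
  have fin: "finite {z \<in> cball 0 s. f z = 0}"
  proof (cases "f constant_on ball 0 R")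
    case True
    then obtain c where c: "\<And>z. z \<in> ball 0 R \<Longrightarrow> f z = c" by (auto simp: constant_on_def)
    have "c \<noteq> 0" using nz[of "of_real s"] c[of "of_real s"] rs s by simp
    then have "{z \<in> cball 0 s. f z = 0} = {}" using c rs by auto
    then show ?thesis by (simp only: finite.emptyI)
  next
    case False
    then show ?thesis
      by (intro holomorphic_compact_finite_zeros[OF f open_ball connected_ball]) (use rs in auto)
  qed
  obtain g where g: "g holomorphic_on ball 0 R" 
     "\<And>z. norm z \<le> s \<Longrightarrow> g z \<noteq> 0 \<and> norm (f z) \<le> norm (g z)" "\<And>z. norm z = s \<Longrightarrow> norm (f z) = norm (g z)"
    using Blaschke_majorant[OF fin f s rs(3) refl nz] by auto
  have cg: "continuous_on (ball 0 R) g" using g(1) by (rule holomorphic_on_imp_continuous_on)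
  have "circle_mean p f r \<le> circle_mean p g r"
    unfolding circle_mean_def using g(2) rs p
    by (intro integral_le circle_powr_integrable[OF cf] circle_powr_integrable[OF cg])
       (auto intro!: powr_mono2 simp: norm_mult)
  also have "circle_mean p g r \<le> circle_mean p g s"
  proof (rule tendsto_lowerbound)
    show "(circle_mean p g \<longlongrightarrow> circle_mean p g s) (at_left s)"
    proof -
      have "continuous_on {0<..<R} (circle_mean p g)"
        by (rule continuous_on_subset[OF continuous_on_circle_mean[OF cg p]]) auto
      then have "isCont (circle_mean p g) s"
        using rs \<open>r < s\<close> by (simp add: continuous_on_eq_continuous_at)
      then show ?thesis unfolding isCont_def by (rule tendsto_within_subset) auto
    qed
    have "eventually (\<lambda>x. x \<in> {r<..<s}) (at_left s)"
      using rs by (intro eventually_at_left_real)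
    then show "eventually (\<lambda>x. circle_mean p g r \<le> circle_mean p g x) (at_left s)"
    proof eventually_elim
      case (elim x)
      show ?case
        by (rule circle_mean_mono_nonzero[of g s])
           (use elim rs p g(2) in \<open>auto intro: holomorphic_on_subset[OF g(1)]\<close>)
    qed
  qed simp
  also have "circle_mean p g s = circle_mean p f s"
    unfolding circle_mean_def using rs g(3) by (intro integral_cong) (auto simp: norm_mult)
  finally show ?thesis .
qed

text \<open>A nonzero f has finitely many zeros in the closed disc, so all radii close enough to s
  from the left avoid them; continuity of the mean reaches s itself.\<close>

lemma circle_mean_mono:
  assumes f: "f holomorphic_on ball 0 R" and p: "p > 0" and rs: "0 \<le> r" "r \<le> s" "s < R"
  shows "circle_mean p f r \<le> circle_mean p f s"
proof (cases "r = s \<or> (\<forall>z\<in>ball 0 R. f z = 0)")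
  case True
  moreover have "circle_mean p f x = 0" if "\<forall>z\<in>ball 0 R. f z = 0" "0 \<le> x" "x < R" for x
  proof -
    have "circle_mean p f x = integral {0..2*pi} (\<lambda>_. 0)"
      unfolding circle_mean_def using that by (intro integral_cong) (auto simp: norm_mult)
    then show ?thesis by simp
  qed
  ultimately show ?thesis using rs by auto
next
  case False
  then obtain w where w: "w \<in> ball 0 R" "f w \<noteq> 0" and "r < s" using rs by auto
  have cf: "continuous_on (ball 0 R) f" using f by (rule holomorphic_on_imp_continuous_on)
  have fin: "finite {z \<in> cball 0 s. f z = 0}"
  proof (cases "f constant_on ball 0 R")
    case True
    then have "{z \<in> cball 0 s. f z = 0} = {}" using w rs by (auto simp: constant_on_def)
    then show ?thesis by (simp only: finite.emptyI)
  next
    case False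
    then show ?thesis
      by (intro holomorphic_compact_finite_zeros[OF f open_ball connected_ball]) (use rs in auto)
  qed
  show ?thesis
  proof (rule tendsto_lowerbound)
    show "(circle_mean p f \<longlongrightarrow> circle_mean p f s) (at_left s)"
    proof -
      have "continuous_on {0<..<R} (circle_mean p f)"
        by (rule continuous_on_subset[OF continuous_on_circle_mean[OF cf p]]) auto
      then have "isCont (circle_mean p f) s"
        using rs \<open>r < s\<close> by (simp add: continuous_on_eq_continuous_at)
      then show ?thesis unfolding isCont_def by (rule tendsto_within_subset) auto
    qed
    have "eventually (\<lambda>x. x \<in> {r<..<s}) (at_left s)"
      using \<open>r < s\<close> by (intro eventually_at_left_real)
    moreover have "eventually (\<lambda>x. x \<notin> norm ` {z \<in> cball 0 s. f z = 0}) (at_left s)"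
    proof -
      \<comment> \<open>The radius s is taken out because a zero may lie on the limiting circle; a
        left neighbourhood of s omits s anyway.\<close>
      have "closed (norm ` {z \<in> cball 0 s. f z = 0} - {s})"
        using fin by (intro finite_imp_closed) auto
      then have "eventually (\<lambda>x. x \<in> - (norm ` {z \<in> cball 0 s. f z = 0} - {s})) (nhds s)"
        by (intro eventually_nhds_in_open) (simp_all only: open_Compl Compl_iff Diff_iff singleton_iff, simp)
      then have "eventually (\<lambda>x. x \<in> - (norm ` {z \<in> cball 0 s. f z = 0} - {s})) (at_left s)"
        by (auto simp: eventually_at_filter elim: eventually_mono)
      moreover have "eventually (\<lambda>x. x \<noteq> s) (at_left s)"
        by (auto simp: eventually_at_filter)
      ultimately show ?thesis by eventually_elim auto
    qed
    ultimately show "eventually (\<lambda>x. circle_mean p f r \<le> circle_mean p f x) (at_left s)"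
    proof eventually_elim
      case (elim x)
      show ?case
        by (rule circle_mean_mono_strict[OF f p]) (use elim rs in \<open>auto simp: image_iff\<close>)
    qed
  qed simp
qed

lemma nn_integral_circle_mean:
  assumes f: "f holomorphic_on ball 0 R" and p: "p > 0" and rs: "0 \<le> s" "s < R"
  shows "(\<integral>\<^sup>+t\<in>{0..2*pi}. ennreal (norm (f (of_real s * cis t)) powr p) \<partial>lborel) = ennreal (circle_mean p f s)"
proof -
  have cf: "continuous_on (ball 0 R) f" using f by (rule holomorphic_on_imp_continuous_on)
  have c: "continuous_on {0..2*pi} (\<lambda>t. norm (f (of_real s * cis t)) powr p)"
  proof -
    have "continuous_on {0..2*pi} ((\<lambda>(s, t). norm (f (of_real s * cis t)) powr p) \<circ> (\<lambda>t. (s,t)))"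
      by (rule continuous_on_compose)
         (auto intro!: continuous_intros continuous_on_subset[OF continuous_on_circle_powr[OF cf p, of UNIV]] 
           simp: rs)
    then show ?thesis by (simp add: o_def)
  qed
  have si: "set_integrable lborel {0..2*pi} (\<lambda>t. norm (f (of_real s * cis t)) powr p)"
    by (rule borel_integrable_atLeastAtMost') (rule c)
  show ?thesis
    unfolding circle_mean_def
  proof (rule set_nn_integral_lborel_eq_integral)
    show "set_borel_measurable borel {0..2*pi} (\<lambda>t. norm (f (of_real s * cis t)) powr p)"
      using si unfolding set_integrable_def set_borel_measurable_def by auto
    have "(\<integral>\<^sup>+t\<in>{0..2*pi}. ennreal (norm (f (of_real s * cis t)) powr p) \<partial>lborel)
       = (\<integral>\<^sup>+t. ennreal (indicator {0..2*pi} t *\<^sub>R norm (f (of_real s * cis t)) powr p) \<partial>lborel)"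
      by (intro nn_integral_cong) (auto simp: indicator_def)
    also have "\<dots> < \<infinity>"
      using si unfolding set_integrable_def by (simp add: real_integrable_def less_top)
    finally show "(\<integral>\<^sup>+t\<in>{0..2*pi}. ennreal (norm (f (of_real s * cis t)) powr p) \<partial>lborel) < \<infinity>" .
  qed auto
qed

theorem nn_integral_circle_mono:
  assumes f: "f holomorphic_on ball 0 R" and p: "p > 0" and rs: "0 \<le> r" "r \<le> s" "s < R"
  shows "(\<integral>\<^sup>+t\<in>{0..2*pi}. ennreal (norm (f (of_real r * cis t)) powr p) \<partial>lborel)
    \<le> (\<integral>\<^sup>+t\<in>{0..2*pi}. ennreal (norm (f (of_real s * cis t)) powr p) \<partial>lborel)"
  using nn_integral_circle_mean[OF f p] circle_mean_mono[OF f p rs] rs by (simp add: ennreal_leI)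

section \<open>Lebesgue measure, isometries and polar coordinates\<close>

lemma nn_integral_lborel_translate:
  fixes f :: "'a::euclidean_space \<Rightarrow> ennreal"
  assumes [measurable]: "f \<in> borel_measurable borel"
  shows "(\<integral>\<^sup>+x. f (c + x) \<partial>lborel) = (\<integral>\<^sup>+x. f x \<partial>lborel)"
proof -
  have "(\<integral>\<^sup>+x. f x \<partial>lborel) = (\<integral>\<^sup>+x. f x \<partial>distr lborel borel ((+) c))"
    by (simp add: lborel_distr_plus)
  also have "\<dots> = (\<integral>\<^sup>+x. f (c + x) \<partial>lborel)" by (subst nn_integral_distr) auto
  finally show ?thesis by simp
qed

lemma nn_integral_lborel_scale:
  fixes f :: "'a::euclidean_space \<Rightarrow> ennreal"
  assumes [measurable]: "f \<in> borel_measurable borel" and c: "c \<noteq> 0"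
  shows "(\<integral>\<^sup>+x. f x \<partial>lborel) = ennreal (\<bar>c\<bar> ^ DIM('a)) * (\<integral>\<^sup>+x. f (c *\<^sub>R x) \<partial>lborel)"
  by (subst lborel_affine[OF c, of 0])
     (simp add: nn_integral_density nn_integral_distr nn_integral_cmult)

lemma nn_integral_lborel_reflect:
  fixes f :: "'a::euclidean_space \<Rightarrow> ennreal"
  assumes [measurable]: "f \<in> borel_measurable borel"
  shows "(\<integral>\<^sup>+x. f (c - x) \<partial>lborel) = (\<integral>\<^sup>+x. f x \<partial>lborel)"
proof -
  have "(\<integral>\<^sup>+x. f (c - x) \<partial>lborel) = (\<integral>\<^sup>+x. f (c + x) \<partial>lborel)"
    using nn_integral_lborel_scale[of "\<lambda>x. f (c - x)" "-1"] by simp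
  then show ?thesis by (simp add: nn_integral_lborel_translate)
qed

text \<open>Uniqueness of translation-invariant measures: integrate $1_A(y) 1_B(x+y)$ against
  $dx\,d\nu(y)$, where $\nu$ is the image of Lebesgue measure and $B$ the unit ball.\<close>
lemma distr_lborel_linear_isometry:
  fixes L :: "'a::euclidean_space \<Rightarrow> 'a"
  assumes L: "linear L" and iso: "\<And>x. norm (L x) = norm x"
  shows "distr lborel borel L = lborel"
proof -
  have mL[measurable]: "L \<in> borel \<rightarrow>\<^sub>M borel"
    using L by (intro borel_measurable_continuous_onI linear_continuous_on linear_conv_bounded_linear[THEN iffD1])
  have inj: "inj L"
    using L iso by (subst linear_injective_0) (metis norm_eq_zero)+
  then have surj: "surj L" using L by (simp add: linear_injective_imp_surjective)
  define \<nu> where "\<nu> = distr lborel borel L"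
  define B where "B = (ball 0 1 :: 'a set)"
  have sets\<nu>[measurable_cong]: "sets \<nu> = sets borel" by (simp add: \<nu>_def)
  have [measurable]: "B \<in> sets borel" by (simp add: B_def)
  \<comment> \<open>Tonelli requires this; an isometry fixing 0 preserves the balls about 0, so they
    exhaust the space with finite measure.\<close>
  interpret \<nu>: sigma_finite_measure \<nu>
  proof
    show "\<exists>A. countable A \<and> A \<subseteq> sets \<nu> \<and> \<Union>A = space \<nu> \<and> (\<forall>a\<in>A. emeasure \<nu> a \<noteq> \<infinity>)"
    proof (intro exI[of _ "range (\<lambda>n::nat. ball 0 (real n))"] conjI ballI)
      show "\<Union> (range (\<lambda>n::nat. ball (0::'a) (real n))) = space \<nu>"
        by (auto simp: \<nu>_def intro: reals_Archimedean2)
      fix a assume "a \<in> range (\<lambda>n::nat. ball (0::'a) (real n))"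
      then obtain n where a: "a = ball 0 (real n)" by auto
      have "emeasure \<nu> a = emeasure lborel (ball (0::'a) (real n))"
        by (simp add: \<nu>_def a emeasure_distr) (rule arg_cong[where f = "emeasure lborel"], auto simp: iso)
      then show "emeasure \<nu> a \<noteq> \<infinity>" by (simp add: emeasure_ball)
    qed (auto simp: \<nu>_def)
  qed
  interpret pair_sigma_finite \<nu> "lborel :: 'a measure" ..
  have trans\<nu>: "(\<integral>\<^sup>+y. f (c + y) \<partial>\<nu>) = (\<integral>\<^sup>+y. f y \<partial>\<nu>)" if [measurable]: "f \<in> borel_measurable borel" for f and c :: 'a
  proof -
    obtain c' where c': "c = L c'" using surj by (metis surjD)
    have "(\<integral>\<^sup>+y. f (c + y) \<partial>\<nu>) = (\<integral>\<^sup>+x. f (L (c' + x)) \<partial>lborel)"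
      by (simp add: \<nu>_def nn_integral_distr c' linear_add[OF L])
    also have "\<dots> = (\<integral>\<^sup>+x. f (L x) \<partial>lborel)"
      by (rule nn_integral_lborel_translate) measurable
    finally show ?thesis by (simp add: \<nu>_def nn_integral_distr)
  qed
  have \<nu>B: "emeasure \<nu> B = emeasure lborel B"
    by (simp add: \<nu>_def B_def emeasure_distr) (rule arg_cong[where f = "emeasure lborel"], auto simp: iso)
  have B0: "emeasure lborel B \<noteq> 0" "emeasure lborel B \<noteq> \<infinity>"
  proof -
    have "0 < unit_ball_vol (real DIM('a))" by simp
    then show "emeasure lborel B \<noteq> 0" by (simp add: B_def emeasure_ball del: unit_ball_vol_pos)
    show "emeasure lborel B \<noteq> \<infinity>" by (simp add: B_def emeasure_ball)
  qed
  have "emeasure \<nu> A = emeasure lborel A" if A: "A \<in> sets borel" for A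
  proof -
    note A[measurable]
    let ?f = "\<lambda>(y::'a) (x::'a). indicator A y * indicator B (x + y) :: ennreal"
    have "emeasure \<nu> A * emeasure lborel B = (\<integral>\<^sup>+y. indicator A y * emeasure lborel B \<partial>\<nu>)"
      by (simp add: nn_integral_multc)
    also have "\<dots> = (\<integral>\<^sup>+y. \<integral>\<^sup>+x. indicator A y * indicator B (x + y) \<partial>lborel \<partial>\<nu>)"
      by (intro nn_integral_cong)
         (simp add: nn_integral_cmult add.commute nn_integral_lborel_translate[of "indicator B"])
    also have "\<dots> = (\<integral>\<^sup>+x. \<integral>\<^sup>+y. indicator A y * indicator B (x + y) \<partial>\<nu> \<partial>lborel)"
      using Fubini'[of ?f] by simp
    also have "\<dots> = (\<integral>\<^sup>+x. \<integral>\<^sup>+y. indicator A (y - x) * indicator B y \<partial>\<nu> \<partial>lborel)"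
    proof (rule nn_integral_cong)
      fix x :: 'a
      show "(\<integral>\<^sup>+y. indicator A y * indicator B (x + y) \<partial>\<nu>) = (\<integral>\<^sup>+y. indicator A (y - x) * indicator B y \<partial>\<nu>)"
        using trans\<nu>[of "\<lambda>y. indicator A (y - x) * indicator B y" x] by simp
    qed
    also have "\<dots> = (\<integral>\<^sup>+y. \<integral>\<^sup>+x. indicator A (y - x) * indicator B y \<partial>lborel \<partial>\<nu>)"
      using Fubini'[of "\<lambda>y x. indicator A (y - x) * indicator B y"] by simp
    also have "\<dots> = (\<integral>\<^sup>+y. emeasure lborel A * indicator B y \<partial>\<nu>)"
      by (intro nn_integral_cong)
         (simp add: nn_integral_multc nn_integral_lborel_reflect[of "indicator A"])
    also have "\<dots> = emeasure lborel A * emeasure lborel B"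
      by (simp add: nn_integral_cmult \<nu>B)
    finally show ?thesis using B0 by (metis mult_divide_eq_ennreal infinity_ennreal_def)
  qed
  then show ?thesis
    unfolding \<nu>_def[symmetric] by (intro measure_eqI) (auto simp: sets\<nu>)
qed

lemma nn_integral_inverse_power:
  assumes "x > 0" "N \<ge> (1::nat)"
  shows "(\<integral>\<^sup>+t\<in>{x<..}. ennreal (real N * t powr (- real N - 1)) \<partial>lborel) = ennreal (x powr (- real N))"
proof -
  have "(\<integral>\<^sup>+t\<in>{x..}. ennreal (real N * t powr (- real N - 1)) \<partial>lborel) = ennreal (0 - (- (x powr (- real N))))"
  proof (rule nn_integral_FTC_atLeast[where F = "\<lambda>t. - (t powr (- real N))"])
    show "((\<lambda>t. - (t powr (- real N))) has_real_derivative real N * t powr (- real N - 1)) (at t)" if "x \<le> t" for t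
      using that assms by (auto intro!: derivative_eq_intros)
    show "((\<lambda>t. - (t powr (- real N))) \<longlongrightarrow> 0) at_top"
      using tendsto_minus[OF tendsto_neg_powr[of "- real N" "\<lambda>x. x" at_top]] assms
      by (simp add: filterlim_ident)
  qed auto
  moreover have "(\<integral>\<^sup>+t\<in>{x<..}. ennreal (real N * t powr (- real N - 1)) \<partial>lborel) = (\<integral>\<^sup>+t\<in>{x..}. ennreal (real N * t powr (- real N - 1)) \<partial>lborel)"
  proof (rule nn_integral_cong_AE)
    have "AE t in lborel. t \<noteq> x" by (rule AE_lborel_singleton)
    then show "AE t in lborel. ennreal (real N * t powr (- real N - 1)) * indicator {x<..} t = ennreal (real N * t powr (- real N - 1)) * indicator {x..} t"
      by eventually_elim (auto simp: indicator_def)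
  qed
  ultimately show ?thesis by simp
qed

text \<open>The substitutions $s = t|w|$ for fixed $w$ and $z = tw$ for fixed $t$ turn the right-hand side
  into $\int_B g(z) |z|^N \int_{|z|}^\infty N t^{-N-1}\,dt\,dz$.\<close>
lemma nn_integral_ball_polar:
  fixes g :: "'a::euclidean_space \<Rightarrow> ennreal"
  assumes g[measurable]: "g \<in> borel_measurable borel"
  shows "(\<integral>\<^sup>+z\<in>ball 0 1. g z \<partial>lborel) =
    (\<integral>\<^sup>+s\<in>{0<..<1}. ennreal (DIM('a) * s ^ (DIM('a) - 1)) * (\<integral>\<^sup>+w\<in>ball 0 1. g (s *\<^sub>R sgn w) \<partial>lborel) \<partial>lborel)"
proof -
  define N where "N = DIM('a)"
  have N: "N \<ge> 1" unfolding N_def by (simp add: Suc_leI)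
  have ae: "AE w in lborel. w \<noteq> (0::'a)" by (rule AE_lborel_singleton)
  have [measurable]: "ball (0::'a) 1 \<in> sets borel" by simp
  have [measurable]: "(sgn :: 'a \<Rightarrow> 'a) \<in> borel_measurable borel"
    unfolding sgn_div_norm by measurable
  have "(\<integral>\<^sup>+s\<in>{0<..<1}. ennreal (N * s ^ (N - 1)) * (\<integral>\<^sup>+w\<in>ball 0 1. g (s *\<^sub>R sgn w) \<partial>lborel) \<partial>lborel)
     = (\<integral>\<^sup>+s. \<integral>\<^sup>+w. indicator {0<..<1} s * ennreal (N * s ^ (N - 1)) * (g (s *\<^sub>R sgn w) * indicator (ball 0 1) w) \<partial>lborel \<partial>(lborel::real measure))"
  proof (rule nn_integral_cong)
    fix s :: real
    have [measurable]: "(\<lambda>w::'a. g (s *\<^sub>R sgn w) * indicator (ball 0 1) w) \<in> borel_measurable lborel" by measurable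
    show "ennreal (N * s ^ (N - 1)) * (\<integral>\<^sup>+w\<in>ball 0 1. g (s *\<^sub>R sgn w) \<partial>lborel) * indicator {0<..<1} s
      = (\<integral>\<^sup>+w. indicator {0<..<1} s * ennreal (N * s ^ (N - 1)) * (g (s *\<^sub>R sgn w) * indicator (ball 0 1) w) \<partial>lborel)"
      by (subst nn_integral_cmult) (auto simp: mult_ac)
  qed
  also have "\<dots> = (\<integral>\<^sup>+w. \<integral>\<^sup>+s. indicator {0<..<1} s * ennreal (N * s ^ (N - 1)) * (g (s *\<^sub>R sgn w) * indicator (ball 0 1) w) \<partial>(lborel::real measure) \<partial>lborel)"
    by (rule lborel_pair.Fubini') measurable
  also have "\<dots> = (\<integral>\<^sup>+w. \<integral>\<^sup>+t. indicator {0<..<1} (t * norm w) * ennreal (N * (t * norm w) ^ (N - 1)) * (g (t *\<^sub>R w) * indicator (ball 0 1) w) * ennreal (norm w) \<partial>(lborel::real measure) \<partial>lborel)"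
  proof (rule nn_integral_cong_AE, use ae in eventually_elim)
    fix w :: 'a assume w: "w \<noteq> 0"
    have "(\<integral>\<^sup>+s. indicator {0<..<1} s * ennreal (N * s ^ (N - 1)) * (g (s *\<^sub>R sgn w) * indicator (ball 0 1) w) \<partial>lborel)
      = ennreal (norm w) * (\<integral>\<^sup>+t. indicator {0<..<1} (norm w * t) * ennreal (N * (norm w * t) ^ (N - 1)) * (g ((norm w * t) *\<^sub>R sgn w) * indicator (ball 0 1) w) \<partial>lborel)"
      using w by (subst nn_integral_real_affine[where c = "norm w" and t = 0]) auto
    also have "\<dots> = (\<integral>\<^sup>+t. indicator {0<..<1} (t * norm w) * ennreal (N * (t * norm w) ^ (N - 1)) * (g (t *\<^sub>R w) * indicator (ball 0 1) w) * ennreal (norm w) \<partial>lborel)"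
      using w by (subst nn_integral_cmult[symmetric]) (auto simp: mult_ac sgn_div_norm)
    finally show "(\<integral>\<^sup>+s. indicator {0<..<1} s * ennreal (N * s ^ (N - 1)) * (g (s *\<^sub>R sgn w) * indicator (ball 0 1) w) \<partial>lborel) = 
      (\<integral>\<^sup>+t. indicator {0<..<1} (t * norm w) * ennreal (N * (t * norm w) ^ (N - 1)) * (g (t *\<^sub>R w) * indicator (ball 0 1) w) * ennreal (norm w) \<partial>lborel)" .
  qed
  also have "\<dots> = (\<integral>\<^sup>+t. \<integral>\<^sup>+w. indicator {0<..<1} (t * norm w) * ennreal (N * (t * norm w) ^ (N - 1)) * (g (t *\<^sub>R w) * indicator (ball 0 1) w) * ennreal (norm w) \<partial>lborel \<partial>(lborel::real measure))"
    by (rule lborel_pair.Fubini'[symmetric]) measurable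
  also have "\<dots> = (\<integral>\<^sup>+t. \<integral>\<^sup>+z. indicator (ball 0 1) z * g z * (ennreal (norm z ^ N) * (ennreal (N * t powr (- real N - 1)) * (if norm z < t then 1 else 0))) \<partial>lborel \<partial>(lborel::real measure))"
  proof (rule nn_integral_cong)
    fix t :: real
    show "(\<integral>\<^sup>+w. indicator {0<..<1} (t * norm w) * ennreal (N * (t * norm w) ^ (N - 1)) * (g (t *\<^sub>R w) * indicator (ball 0 1) w) * ennreal (norm w) \<partial>lborel)
       = (\<integral>\<^sup>+z. indicator (ball 0 1) z * g z * (ennreal (norm z ^ N) * (ennreal (N * t powr (- real N - 1)) * (if norm z < t then 1 else 0))) \<partial>lborel)"
    proof (cases "t > 0")
      case False
      have "\<not> norm z < t" for z :: 'a
        using False order.strict_trans1[OF norm_ge_zero[of z], of t] by auto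
      moreover have "indicator {0<..<1} (t * norm w) = (0::ennreal)" for w :: 'a
        using False by (simp add: indicator_def zero_less_mult_iff)
      ultimately show ?thesis by simp
    next
      case True
      have "(\<integral>\<^sup>+z. indicator (ball 0 1) z * g z * (ennreal (norm z ^ N) * (ennreal (N * t powr (- real N - 1)) * (if norm z < t then 1 else 0))) \<partial>lborel)
        = ennreal (t ^ N) * (\<integral>\<^sup>+w. indicator (ball 0 1) (t *\<^sub>R w) * g (t *\<^sub>R w) * (ennreal (norm (t *\<^sub>R w) ^ N) * (ennreal (N * t powr (- real N - 1)) * (if norm (t *\<^sub>R w) < t then 1 else 0))) \<partial>lborel)"
        (is "nn_integral _ ?h = _ * nn_integral _ ?k")
      proof -
        have h: "?h \<in> borel_measurable borel" by measurable
        show ?thesis using nn_integral_lborel_scale[OF h, of t] True by (simp only: N_def abs_of_pos less_imp_neq[symmetric] simp_thms)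
      qed
      also have "\<dots> = (\<integral>\<^sup>+w. indicator {0<..<1} (t * norm w) * ennreal (N * (t * norm w) ^ (N - 1)) * (g (t *\<^sub>R w) * indicator (ball 0 1) w) * ennreal (norm w) \<partial>lborel)"
      proof (subst nn_integral_cmult[symmetric], measurable, rule nn_integral_cong_AE, use ae in eventually_elim)
        fix w :: 'a assume w: "w \<noteq> 0"
        have tp: "t powr (- real N - 1) = 1 / t ^ (N + 1)"
          using True by (simp add: powr_diff powr_minus powr_realpow divide_simps)
        have p: "t ^ N = t * t ^ (N - 1)" "norm w ^ N = norm w * norm w ^ (N - 1)"
          using N by (auto simp: power_eq_if)
        have "ennreal (t ^ N) * (ennreal (norm (t *\<^sub>R w) ^ N) * ennreal (N * t powr (- real N - 1)))
          = ennreal (t ^ N * (norm (t *\<^sub>R w) ^ N * (N * t powr (- real N - 1))))"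
          using True by (simp add: ennreal_mult)
        also have "t ^ N * (norm (t *\<^sub>R w) ^ N * (N * t powr (- real N - 1))) = (N * (t * norm w) ^ (N - 1)) * norm w"
          using True unfolding tp by (simp add: power_mult_distrib p field_simps)
        finally have e: "ennreal (t ^ N) * (ennreal (norm (t *\<^sub>R w) ^ N) * ennreal (N * t powr (- real N - 1))) = ennreal (N * (t * norm w) ^ (N - 1)) * ennreal (norm w)"
          using True by (simp add: ennreal_mult)
        have i: "(if norm (t *\<^sub>R w) < t then 1 else 0) = (indicator (ball 0 1) w :: ennreal)"
          "indicator {0<..<1} (t * norm w) = (indicator (ball 0 1) (t *\<^sub>R w) :: ennreal)"
          using True w by (auto simp: indicator_def)
        show "ennreal (t ^ N) * (indicator (ball 0 1) (t *\<^sub>R w) * g (t *\<^sub>R w) * (ennreal (norm (t *\<^sub>R w) ^ N) * (ennreal (N * t powr (- real N - 1)) * (if norm (t *\<^sub>R w) < t then 1 else 0))))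
          = indicator {0<..<1} (t * norm w) * ennreal (N * (t * norm w) ^ (N - 1)) * (g (t *\<^sub>R w) * indicator (ball 0 1) w) * ennreal (norm w)"
          unfolding i using arg_cong[OF e, of "\<lambda>x. x * (indicator (ball 0 1) (t *\<^sub>R w) * g (t *\<^sub>R w) * indicator (ball 0 1) w)"]
          by (simp only: mult_ac)
      qed
      finally show ?thesis by simp
    qed
  qed
  also have "\<dots> = (\<integral>\<^sup>+z. \<integral>\<^sup>+t. indicator (ball 0 1) z * g z * (ennreal (norm z ^ N) * (ennreal (N * t powr (- real N - 1)) * (if norm z < t then 1 else 0))) \<partial>(lborel::real measure) \<partial>lborel)"
    by (rule lborel_pair.Fubini') measurable
  also have "\<dots> = (\<integral>\<^sup>+z. indicator (ball 0 1) z * g z \<partial>lborel)"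
  proof (rule nn_integral_cong_AE, use ae in eventually_elim)
    fix z :: 'a assume z: "z \<noteq> 0"
    have "(\<integral>\<^sup>+t. indicator (ball 0 1) z * g z * (ennreal (norm z ^ N) * (ennreal (N * t powr (- real N - 1)) * (if norm z < t then 1 else 0))) \<partial>lborel)
      = indicator (ball 0 1) z * g z * (ennreal (norm z ^ N) * (\<integral>\<^sup>+t\<in>{norm z<..}. ennreal (N * t powr (- real N - 1)) \<partial>lborel))"
      by (subst nn_integral_cmult[symmetric], measurable)+ (intro nn_integral_cong, auto simp: indicator_def)
    also have "\<dots> = indicator (ball 0 1) z * g z * ennreal (norm z ^ N * norm z powr (- real N))"
      using nn_integral_inverse_power[of "norm z" N] z N by (simp add: ennreal_mult)
    also have "norm z ^ N * norm z powr (- real N) = 1"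
      using z by (simp add: powr_minus powr_realpow)
    finally show "(\<integral>\<^sup>+t. indicator (ball 0 1) z * g z * (ennreal (norm z ^ N) * (ennreal (N * t powr (- real N - 1)) * (if norm z < t then 1 else 0))) \<partial>lborel)
      = indicator (ball 0 1) z * g z" by simp
  qed
  finally show ?thesis unfolding N_def by (simp add: mult.commute)
qed

section \<open>Geometry of the complex ball\<close>

lemma norm_vector_scale: "norm (c *s (z :: complex ^ 'n)) = cmod c * norm z"
  by (simp add: norm_vec_def norm_mult L2_set_right_distrib)

lemma cinner_add_left: "cinner (x + y) z = cinner x z + cinner y z"
  by (simp add: cinner_def algebra_simps sum.distrib)

lemma cinner_diff_left: "cinner (x - y) z = cinner x z - cinner y z"
  by (simp add: cinner_def algebra_simps sum_subtractf)

lemma cinner_scale_left: "cinner (c *s x) z = c * cinner x z"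
  by (simp add: cinner_def sum_distrib_left mult_ac)

lemma cinner_commute: "cinner y x = cnj (cinner x y)"
  by (simp add: cinner_def mult_ac)

lemma cinner_add_right: "cinner z (x + y) = cinner z x + cinner z y"
  by (simp add: cinner_def algebra_simps sum.distrib)

lemma cinner_diff_right: "cinner z (x - y) = cinner z x - cinner z y"
  by (simp add: cinner_def algebra_simps sum_subtractf)

lemma cinner_scale_right: "cinner z (c *s x) = cnj c * cinner z x"
  by (simp add: cinner_def sum_distrib_left mult_ac)

lemma cinner_zero [simp]: "cinner 0 z = 0" "cinner z 0 = 0"
  by (simp_all add: cinner_def)

lemma Re_cinner: "Re (cinner x y) = x \<bullet> y"
  by (simp add: cinner_def inner_vec_def inner_complex_def)

lemma cinner_self: "cinner x x = of_real ((norm x)\<^sup>2)"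
proof (rule complex_eqI)
  show "Re (cinner x x) = Re (of_real ((norm x)\<^sup>2))"
    by (simp add: Re_cinner dot_square_norm)
  show "Im (cinner x x) = Im (of_real ((norm x)\<^sup>2))"
    by (simp add: cinner_def)
qed

text \<open>A unimodular factor c makes the inner product real and nonnegative, where it coincides
  with the real inner product.\<close>

lemma cinner_Cauchy_Schwarz: "cmod (cinner x y) \<le> norm x * norm y"
proof (cases "cinner x y = 0")
  case False
  define c where "c = cnj (sgn (cinner x y))"
  have c: "cmod c = 1" using False by (simp add: c_def norm_sgn)
  have "cinner x y * cnj (cinner x y) = of_real (cmod (cinner x y)) * of_real (cmod (cinner x y))"
    by (simp add: complex_norm_square[symmetric] power2_eq_square[symmetric])
  then have "c * cinner x y = of_real (cmod (cinner x y))"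
    using False by (simp add: c_def sgn_eq field_simps)
  then have "cmod (cinner x y) = Re (cinner (c *s x) y)"
    by (simp add: cinner_scale_left)
  also have "\<dots> \<le> norm (c *s x) * norm y"
    unfolding Re_cinner by (rule norm_cauchy_schwarz)
  finally show ?thesis by (simp add: norm_vector_scale c)
qed simp

lemma norm_sq_lincomb:
  "(norm (c *s x + d *s y))\<^sup>2
    = (cmod c)\<^sup>2 * (norm x)\<^sup>2 + 2 * Re (c * cnj d * cinner x y) + (cmod d)\<^sup>2 * (norm y)\<^sup>2"
proof -
  have "complex_of_real ((norm (c *s x + d *s y))\<^sup>2) = cinner (c *s x + d *s y) (c *s x + d *s y)"
    by (simp add: cinner_self)
  also have "\<dots> = (c * cnj c) * cinner x x + (c * cnj d * cinner x y + cnj (c * cnj d * cinner x y))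
     + (d * cnj d) * cinner y y"
    by (simp add: cinner_add_left cinner_add_right cinner_scale_left cinner_scale_right
        cinner_commute[of y x] algebra_simps)
  also have "\<dots> = of_real ((cmod c)\<^sup>2 * (norm x)\<^sup>2 + 2 * Re (c * cnj d * cinner x y) + (cmod d)\<^sup>2 * (norm y)\<^sup>2)"
    by (simp only: complex_add_cnj complex_norm_square[symmetric] cinner_self of_real_add of_real_mult)
  finally show ?thesis by (simp only: of_real_eq_iff)
qed

text \<open>Comparable to the distance to the sphere within a factor 2 (\<open>bgap_bounds\<close>),
  but polynomial in the coordinates, which keeps the identities below exact.\<close>

definition bgap :: "complex ^ 'n \<Rightarrow> real" where
  "bgap a = 1 - (norm a)\<^sup>2"

text \<open>A quasi-distance with constant 5 (\<open>kdist_triangle\<close>), except that it does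
  not vanish on the diagonal: its value at (a, a) is the gap of a.\<close>

definition kdist :: "complex ^ 'n \<Rightarrow> complex ^ 'n \<Rightarrow> real" where
  "kdist a z = cmod (1 - cinner z a)"

lemma kdist_commute: "kdist a z = kdist z a"
  unfolding kdist_def by (metis cinner_commute complex_cnj_diff complex_cnj_one complex_mod_cnj)

lemma bgap_pos: "a \<in> unit_ball \<Longrightarrow> 0 < bgap a"
  by (simp add: bgap_def abs_square_less_1)

lemma bgap_le_1: "bgap a \<le> 1" by (simp add: bgap_def)

lemma bgap_bounds:
  assumes "a \<in> unit_ball"
  shows "1 - norm a \<le> bgap a" "bgap a \<le> 2 * (1 - norm a)"
proof -
  have "bgap a = (1 - norm a) * (1 + norm a)" by (simp add: bgap_def algebra_simps power2_eq_square)
  moreover have "(1 - norm a) * 1 \<le> (1 - norm a) * (1 + norm a)"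
    by (rule mult_left_mono) (use assms in auto)
  moreover have "(1 - norm a) * (1 + norm a) \<le> (1 - norm a) * 2"
    by (rule mult_left_mono) (use assms in auto)
  ultimately show "1 - norm a \<le> bgap a" "bgap a \<le> 2 * (1 - norm a)" by auto
qed

lemma kdist_ge:
  assumes "a \<in> unit_ball" "z \<in> unit_ball"
  shows "1 - norm a * norm z \<le> kdist a z" "1 - norm a \<le> kdist a z" "bgap a \<le> 2 * kdist a z"
    "0 < kdist a z"
proof -
  have "1 - cmod (cinner z a) \<le> kdist a z"
    unfolding kdist_def using norm_triangle_ineq2[of 1 "cinner z a"] by simp
  moreover have "cmod (cinner z a) \<le> norm a * norm z"
    using cinner_Cauchy_Schwarz[of z a] by (simp add: mult.commute)
  ultimately show 1: "1 - norm a * norm z \<le> kdist a z" by simp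
  have "norm a * norm z \<le> norm a * 1" using assms by (intro mult_left_mono) auto
  with 1 show 2: "1 - norm a \<le> kdist a z" by simp
  show "bgap a \<le> 2 * kdist a z" using order_trans[OF bgap_bounds(2)[OF assms(1)] mult_left_mono[OF 2]] by simp
  show "0 < kdist a z" using 2 assms by simp
qed

lemma kdist_le_2:
  assumes "a \<in> unit_ball" "z \<in> unit_ball"
  shows "kdist a z \<le> 2"
proof -
  have "cmod (cinner z a) \<le> norm z * norm a" by (rule cinner_Cauchy_Schwarz)
  also have "\<dots> \<le> 1 * 1" using assms by (intro mult_mono) auto
  finally show ?thesis unfolding kdist_def using norm_triangle_ineq4[of 1 "cinner z a"] by simp
qed

lemma norm_sq_remove_component:
  assumes "norm b \<le> 1"
  shows "(norm (a - cinner a b *s b))\<^sup>2 \<le> (norm a)\<^sup>2 - (cmod (cinner a b))\<^sup>2"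
proof -
  define l where "l = cinner a b"
  have "(norm (a - l *s b))\<^sup>2 = (norm (1 *s a + (- l) *s b))\<^sup>2" by (simp)
  also have "\<dots> = (norm a)\<^sup>2 - 2 * Re (cnj l * l) + (cmod l)\<^sup>2 * (norm b)\<^sup>2"
    unfolding norm_sq_lincomb by (simp add: l_def)
  also have "Re (cnj l * l) = (cmod l)\<^sup>2"
    by (simp add: cmod_power2) (simp add: power2_eq_square)
  also have "(cmod l)\<^sup>2 * (norm b)\<^sup>2 \<le> (cmod l)\<^sup>2 * 1"
    using assms by (intro mult_left_mono) (auto simp: power_le_one)
  finally show ?thesis by (simp add: l_def)
qed

text \<open>If 1 - <a,b> is small then a is almost parallel to b: the transversal part is only of
  the order of the square root of \<open>kdist b a\<close>.\<close>

lemma norm_sq_remove_component_kdist: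
  assumes "a \<in> unit_ball" "b \<in> unit_ball"
  shows "(norm (a - cinner a b *s b))\<^sup>2 \<le> 2 * kdist b a"
proof -
  have "(norm (a - cinner a b *s b))\<^sup>2 \<le> (norm a)\<^sup>2 - (cmod (cinner a b))\<^sup>2"
    using assms by (intro norm_sq_remove_component) auto
  also have "(norm a)\<^sup>2 \<le> 1" using assms by (simp add: abs_square_le_1)
  finally have 1: "(norm (a - cinner a b *s b))\<^sup>2 \<le> 1 - (cmod (cinner a b))\<^sup>2" by simp
  have "1 - kdist b a \<le> cmod (cinner a b)"
    unfolding kdist_def using norm_triangle_ineq2[of 1 "1 - cinner a b"] by simp
  show ?thesis
  proof (cases "kdist b a \<le> 1")
    case True
    with \<open>1 - kdist b a \<le> cmod (cinner a b)\<close> have "(1 - kdist b a)\<^sup>2 \<le> (cmod (cinner a b))\<^sup>2"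
      by (intro power_mono) auto
    moreover have "1 - 2 * kdist b a \<le> (1 - kdist b a)\<^sup>2" by (simp add: power2_eq_square algebra_simps)
    ultimately show ?thesis using 1 by linarith
  next
    case False
    then show ?thesis using 1 zero_le_power2[of "cmod (cinner a b)"] by linarith
  qed
qed

text \<open>Remove from a and c their components along b. With x = 1 - <a,b> and y = 1 - <b,c>, what
  is left of 1 - <a,c> is x + y - x y, a term bounded by the gap of b and hence by 2|x|, and the
  inner product of two remainders, at most |x| + |y| by the previous lemma. Together this is at most
  5|x| + 3|y|.\<close>

lemma kdist_triangle:
  assumes "a \<in> unit_ball" "b \<in> unit_ball" "c \<in> unit_ball"
  shows "kdist a c \<le> 5 * (kdist a b + kdist b c)"
proof -
  define x where "x = 1 - cinner a b"
  define y where "y = 1 - cinner b c"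
  define a' where "a' = a - cinner a b *s b"
  define c' where "c' = c - cinner c b *s b"
  have xy: "cmod x = kdist a b" "cmod y = kdist b c"
    by (simp_all add: x_def y_def kdist_commute[of a b] kdist_commute[of b c]) (simp_all add: kdist_def)
  have ab: "cinner a b = 1 - x" "cinner b c = 1 - y" "cnj (cinner c b) = 1 - y"
    by (simp_all add: x_def y_def cinner_commute[of b c])
  have e: "1 - cinner a c = x + y - x * y - (1 - x) * (1 - y) * of_real (bgap b) - cinner a' c'"
    unfolding a'_def c'_def cinner_diff_left cinner_diff_right cinner_scale_left cinner_scale_right
      cinner_self ab by (simp add: bgap_def algebra_simps)
  have "cmod (cinner a' c') \<le> norm a' * norm c'" by (rule cinner_Cauchy_Schwarz)
  also have "\<dots> \<le> ((norm a')\<^sup>2 + (norm c')\<^sup>2) / 2" using sum_squares_bound[of "norm a'" "norm c'"] by simp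
  also have "\<dots> \<le> (2 * cmod x + 2 * cmod y) / 2"
    using norm_sq_remove_component_kdist[OF assms(1,2)] norm_sq_remove_component_kdist[OF assms(3,2)]
    by (simp add: a'_def c'_def xy kdist_commute)
  finally have 1: "cmod (cinner a' c') \<le> cmod x + cmod y" by simp
  have le2: "cmod x \<le> 2" "cmod y \<le> 2" unfolding xy using kdist_le_2 assms by auto
  have "cmod x * cmod y \<le> cmod x + cmod y"
  proof -
    have "cmod x * cmod y \<le> cmod x * 2" "cmod x * cmod y \<le> 2 * cmod y"
      using le2 by (auto intro!: mult_left_mono mult_right_mono)
    then show ?thesis by linarith
  qed
  then have 2: "cmod (x * y) \<le> cmod x + cmod y" by (simp add: norm_mult)
  have "norm a * norm b \<le> 1" "norm b * norm c \<le> 1"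
    using assms by (auto intro!: mult_le_one)
  then have "cmod (1 - x) \<le> 1" "cmod (1 - y) \<le> 1"
    unfolding ab(1,2)[symmetric] using cinner_Cauchy_Schwarz[of a b] cinner_Cauchy_Schwarz[of b c]
    by linarith+
  then have "cmod ((1 - x) * (1 - y) * of_real (bgap b)) \<le> 1 * 1 * bgap b"
    unfolding norm_mult using bgap_pos[OF assms(2)] by (intro mult_mono) auto
  also have "\<dots> \<le> 2 * cmod x" unfolding xy using kdist_ge(3)[OF assms(2,1)] by (simp add: kdist_commute)
  finally have 3: "cmod ((1 - x) * (1 - y) * of_real (bgap b)) \<le> 2 * cmod x" .
  have "kdist a c = cmod (1 - cinner a c)" by (simp add: kdist_commute[of a c]) (simp add: kdist_def)
  also have "\<dots> \<le> cmod x + cmod y + cmod (x * y) + cmod ((1 - x) * (1 - y) * of_real (bgap b)) + cmod (cinner a' c')"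
    unfolding e by (intro norm_triangle_le_diff norm_triangle_le add_mono order_refl)
  also have "\<dots> \<le> 5 * (cmod x + cmod y)" using 1 2 3 norm_ge_zero[of x] norm_ge_zero[of y] by (smt (verit))
  finally show ?thesis by (simp add: xy)
qed

text \<open>A symmetric substitute for a ball in the invariant metric, A measuring its size. It is
  reflexive only for A >= 1, as \<open>kdist a a\<close> equals \<open>bgap a\<close>.\<close>

definition near :: "real \<Rightarrow> complex ^ 'n \<Rightarrow> complex ^ 'n \<Rightarrow> bool" where
  "near A a z \<longleftrightarrow> kdist a z \<le> A * bgap a \<and> kdist a z \<le> A * bgap z"

lemma near_commute: "near A a z \<longleftrightarrow> near A z a"
  by (auto simp: near_def kdist_commute)

lemma near_bgap:
  assumes "near A a z" "a \<in> unit_ball" "z \<in> unit_ball"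
  shows "bgap z \<le> 2 * A * bgap a" "bgap a \<le> 2 * A * bgap z"
  using assms kdist_ge(3)[of a z] kdist_ge(3)[of z a] by (auto simp: near_def kdist_commute[of z a])

lemma near_pos:
  assumes "near A a z" "a \<in> unit_ball" "z \<in> unit_ball"
  shows "0 < A"
proof -
  have "0 < A * bgap a" using assms kdist_ge(4)[of a z] by (auto simp: near_def)
  then show ?thesis using bgap_pos[OF assms(2)] by (simp add: zero_less_mult_iff)
qed

lemma near_mono:
  assumes "near A a z" "A \<le> B" "a \<in> unit_ball" "z \<in> unit_ball"
  shows "near B a z"
  using assms bgap_pos[of a] bgap_pos[of z] unfolding near_def
  by (meson less_imp_le mult_right_mono order_trans)

text \<open>The gaps at a, b and c are comparable, so each of the two distances can be charged to
  the gap at either end: directly, or through b at the cost of a further factor 2A or 2B. The factor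
  5 is that of the quasi-triangle inequality.\<close>

lemma near_trans:
  assumes "near A a b" "near B b c" and in_ball: "a \<in> unit_ball" "b \<in> unit_ball" "c \<in> unit_ball"
  shows "near (5 * A + 5 * B + 10 * A * B) a c"
proof -
  have pos: "0 < A" "0 < B" using near_pos assms by blast+
  have g: "0 < bgap a" "0 < bgap c" using bgap_pos in_ball by auto
  have ba: "bgap b \<le> 2 * A * bgap a" "bgap b \<le> 2 * B * bgap c"
    using near_bgap[OF assms(1)] near_bgap[OF assms(2)] in_ball by auto
  have t: "kdist a c \<le> 5 * (kdist a b + kdist b c)" by (rule kdist_triangle) fact+
  have "kdist b c \<le> B * bgap b" using assms(2) by (simp add: near_def)
  also have "\<dots> \<le> B * (2 * A * bgap a)" using pos ba by (intro mult_left_mono) auto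
  finally have 1: "kdist b c \<le> 2 * A * B * bgap a" by (simp add: mult_ac)
  have "kdist a b \<le> A * bgap b" using assms(1) by (simp add: near_def)
  also have "\<dots> \<le> A * (2 * B * bgap c)" using pos ba by (intro mult_left_mono) auto
  finally have 2: "kdist a b \<le> 2 * A * B * bgap c" by (simp add: mult_ac)
  have 3: "kdist a b \<le> A * bgap a" "kdist b c \<le> B * bgap c" using assms by (auto simp: near_def)
  have "kdist a c \<le> 5 * A * bgap a + 10 * A * B * bgap a" using t 1 3 by (simp add: algebra_simps)
  moreover have "0 \<le> 5 * B * bgap a" "0 \<le> 5 * A * bgap c" using pos g by auto
  moreover have "kdist a c \<le> 5 * B * bgap c + 10 * A * B * bgap c" using t 2 3 by (simp add: algebra_simps)
  ultimately show ?thesis unfolding near_def by (simp add: algebra_simps)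
qed

text \<open>The constants are chosen so that this region consists of points near
  its centre; it is invariant under rotations \<open>a + h \<mapsto> a + e\<^sup>i\<^sup>t h\<close>.\<close>
definition hood :: "complex ^ 'n \<Rightarrow> (complex ^ 'n) set" where
  "hood a = {z. cmod (cinner (z - a) a) < bgap a / 8 \<and> (norm (z - a))\<^sup>2 < bgap a / 64}"

lemma bgap_shift: "bgap (a + h) = bgap a - 2 * Re (cinner h a) - (norm h)\<^sup>2"
  using norm_sq_lincomb[of 1 h 1 a] by (simp add: bgap_def add.commute)

lemma kdist_shift: "kdist a (a + h) = cmod (of_real (bgap a) - cinner h a)"
  by (simp add: kdist_def cinner_add_left cinner_self bgap_def diff_diff_eq)

lemma hood_near:
  assumes a: "a \<in> unit_ball" and z: "z \<in> hood a"
  shows "z \<in> unit_ball" "near 2 a z"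
proof -
  define h where "h = z - a"
  have zh: "z = a + h" by (simp add: h_def)
  have h: "cmod (cinner h a) < bgap a / 8" "(norm h)\<^sup>2 < bgap a / 64"
    using z by (auto simp: hood_def h_def)
  have g: "0 < bgap a" using a by (rule bgap_pos)
  \<comment> \<open>By \<open>bgap_shift\<close> the gap drops by at most 2/8 + 1/64 of itself. With
    the bound 9/8 for \<open>kdist a z\<close> below, the ratio is 9/5, within the 2 of
    \<open>near 2\<close>.\<close>
  have bz: "bgap z \<ge> 5 / 8 * bgap a"
    unfolding zh bgap_shift using h abs_Re_le_cmod[of "cinner h a"] g by linarith
  then have "(norm z)\<^sup>2 < 1" using g by (simp add: bgap_def[of z])
  then show "z \<in> unit_ball" by (simp add: abs_square_less_1)
  have "kdist a z \<le> cmod (of_real (bgap a)) + cmod (cinner h a)"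
    unfolding zh kdist_shift by (rule norm_triangle_ineq4)
  also have "\<dots> < 9 / 8 * bgap a" using h g by simp
  finally show "near 2 a z" unfolding near_def using bz g by linarith
qed

lemma self_in_hood: "a \<in> unit_ball \<Longrightarrow> a \<in> hood a"
  using bgap_pos[of a] by (simp add: hood_def)

lemma open_hood: "open (hood a)"
proof -
  have "continuous_on UNIV (\<lambda>z. cmod (cinner (z - a) a))"
    unfolding cinner_def by (intro continuous_intros)
  then show ?thesis
    unfolding hood_def by (intro open_Collect_conj open_Collect_less) (auto intro!: continuous_intros)
qed

text \<open>The classical identity 1 - |\<phi>(z)|^2 = (1 - |a|^2)(1 - |z|^2) / |1 - <z,a>|^2 for
  \<phi> the automorphism \<open>ball_aut a\<close>, cleared of its denominator. Since the
  projection of z is m a for a scalar m, the numerator of the automorphism is a combination of a and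
  z, whose norm \<open>norm_sq_lincomb\<close> expands.\<close>

lemma pseudo_hyp_sq:
  assumes "a \<in> unit_ball" "z \<in> unit_ball"
  shows "(pseudo_hyp a z)\<^sup>2 * (kdist a z)\<^sup>2 = (kdist a z)\<^sup>2 - bgap a * bgap z"
proof (cases "a = 0")
  case True
  then show ?thesis by (simp add: pseudo_hyp_def ball_aut_def kdist_def bgap_def)
next
  case False
  define w where "w = cinner z a"
  define t where "t = (norm a)\<^sup>2"
  define s where "s = sqrt (1 - t)"
  define m where "m = w / of_real t"
  have t: "0 < t" "t < 1" using False assms by (auto simp: t_def abs_square_less_1)
  have s: "s\<^sup>2 = 1 - t" using t by (simp add: s_def)
  have w: "w = m * of_real t" using t by (simp add: m_def)
  have wa: "cinner a z = cnj m * of_real t" using w w_def by (metis cinner_commute complex_cnj_mult complex_cnj_complex_of_real)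
  define V where "V = a - m *s a - of_real s *s (z - m *s a)"
  have "ball_aut a z = (1 / (1 - w)) *s V"
    using False by (simp add: ball_aut_def Let_def V_def s_def m_def w_def t_def cinner_self)
  then have "pseudo_hyp a z = norm V / kdist a z"
    by (simp add: pseudo_hyp_def norm_vector_scale norm_divide kdist_def w_def)
  moreover have "0 < kdist a z" by (rule kdist_ge(4)) fact+
  ultimately have 1: "(pseudo_hyp a z)\<^sup>2 * (kdist a z)\<^sup>2 = (norm V)\<^sup>2"
    by (simp add: power_divide)
  have V: "V = (1 - m + of_real s * m) *s a + (- of_real s) *s z"
    by (simp add: V_def vec_eq_iff algebra_simps)
  have "(norm V)\<^sup>2 = (cmod (1 - m + of_real s * m))\<^sup>2 * t
      - 2 * s * Re ((1 - m + of_real s * m) * cnj m) * t + s\<^sup>2 * (norm z)\<^sup>2"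
    unfolding V norm_sq_lincomb wa by (simp add: t_def algebra_simps)
  also have "\<dots> = t * (1 - 2 * Re m + (cmod m)\<^sup>2) - s\<^sup>2 * t * (cmod m)\<^sup>2 + s\<^sup>2 * (norm z)\<^sup>2"
    unfolding cmod_power2 by (simp add: algebra_simps power2_eq_square)
  also have "\<dots> = t - 2 * t * Re m + t\<^sup>2 * (cmod m)\<^sup>2 + (1 - t) * (norm z)\<^sup>2"
    unfolding s by (simp add: algebra_simps power2_eq_square)
  also have "\<dots> = (kdist a z)\<^sup>2 - bgap a * bgap z"
    unfolding kdist_def w_def[symmetric] w bgap_def t_def[symmetric] cmod_power2
    by (simp add: algebra_simps power2_eq_square)
  finally show ?thesis using 1 by simp
qed

lemma pseudo_hyp_eq:
  assumes "a \<in> unit_ball" "z \<in> unit_ball"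
  shows "pseudo_hyp a z = sqrt (1 - bgap a * bgap z / (kdist a z)\<^sup>2)"
proof -
  have "0 < kdist a z" by (rule kdist_ge(4)) fact+
  then have "(pseudo_hyp a z)\<^sup>2 = 1 - bgap a * bgap z / (kdist a z)\<^sup>2"
    using pseudo_hyp_sq[OF assms] by (simp add: field_simps)
  moreover have "0 \<le> pseudo_hyp a z" by (simp add: pseudo_hyp_def)
  ultimately show ?thesis by (metis real_sqrt_unique)
qed

lemma pseudo_hyp_commute:
  assumes "a \<in> unit_ball" "z \<in> unit_ball"
  shows "pseudo_hyp a z = pseudo_hyp z a"
  using assms by (simp add: pseudo_hyp_eq kdist_commute mult.commute)

lemma pseudo_hyp_nonneg: "0 \<le> pseudo_hyp a z"
  by (simp add: pseudo_hyp_def)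

text \<open>The displacement is of size \<rho> times the gap in the direction of a and of size
  \<rho> times the root of the gap overall, which are the proportions of \<open>hood a\<close>. The
  assumption \<rho> <= 1/2 allows the term |<h,a>| <= kdist/2 to be absorbed, so that
  \<open>kdist a z\<close> is at most twice the gap of a.\<close>

lemma pseudo_hyp_small:
  assumes "a \<in> unit_ball" "z \<in> unit_ball" and small: "pseudo_hyp a z \<le> 1/2"
  shows "cmod (cinner (z - a) a) \<le> 2 * pseudo_hyp a z * bgap a"
    and "(norm (z - a))\<^sup>2 \<le> (2 * pseudo_hyp a z)\<^sup>2 * bgap a"
proof -
  define h where "h = z - a"
  define r where "r = pseudo_hyp a z"
  have zh: "z = a + h" by (simp add: h_def)
  have g: "0 < bgap a" using assms by (simp add: bgap_pos)
  have r: "0 \<le> r" "r \<le> 1/2" using small by (auto simp: r_def pseudo_hyp_nonneg)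
  have "r\<^sup>2 * (kdist a z)\<^sup>2 = (kdist a z)\<^sup>2 - bgap a * bgap z"
    unfolding r_def by (rule pseudo_hyp_sq) fact+
  also have "\<dots> = (cmod (cinner h a))\<^sup>2 + bgap a * (norm h)\<^sup>2"
    unfolding zh kdist_shift bgap_shift cmod_power2 by (simp add: algebra_simps power2_eq_square)
  finally have e: "(r * kdist a z)\<^sup>2 = (cmod (cinner h a))\<^sup>2 + bgap a * (norm h)\<^sup>2"
    by (simp add: power_mult_distrib)
  have k: "0 < kdist a z" by (rule kdist_ge(4)) fact+
  have "(cmod (cinner h a))\<^sup>2 \<le> (r * kdist a z)\<^sup>2" using e g by simp
  then have 1: "cmod (cinner h a) \<le> r * kdist a z"
    by (rule power2_le_imp_le) (use r k in simp)
  have "kdist a z = cmod (of_real (bgap a) - cinner h a)" by (simp only: zh kdist_shift)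
  also have "\<dots> \<le> cmod (of_real (bgap a)) + cmod (cinner h a)" by (rule norm_triangle_ineq4)
  also have "cmod (of_real (bgap a)) = bgap a" using g by simp
  also have "cmod (cinner h a) \<le> 1/2 * kdist a z"
    by (rule order_trans[OF 1]) (use r k in \<open>auto intro!: mult_right_mono\<close>)
  finally have kb: "kdist a z \<le> 2 * bgap a" by simp
  have rk: "r * kdist a z \<le> 2 * r * bgap a" using mult_left_mono[OF kb r(1)] by simp
  then show "cmod (cinner (z - a) a) \<le> 2 * pseudo_hyp a z * bgap a"
    using 1 by (simp add: h_def r_def)
  have "bgap a * (norm h)\<^sup>2 \<le> (r * kdist a z)\<^sup>2" using e by simp
  also have "\<dots> \<le> (2 * r * bgap a)\<^sup>2" using rk r k by (intro power_mono) auto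
  also have "\<dots> = bgap a * ((2 * r)\<^sup>2 * bgap a)" by (simp add: power2_eq_square)
  finally show "(norm (z - a))\<^sup>2 \<le> (2 * pseudo_hyp a z)\<^sup>2 * bgap a"
    using g unfolding h_def r_def by (simp only: mult_le_cancel_left_pos)
qed

section \<open>Volumes of caps and neighbourhoods\<close>

lemma DIM_complex_vec: "DIM(complex ^ 'n) = 2 * CARD('n)"
  by (simp add: DIM_cart)

lemma continuous_on_vector_scale [continuous_intros]:
  fixes f :: "'a::topological_space \<Rightarrow> complex" and g :: "'a \<Rightarrow> complex ^ 'n"
  assumes "continuous_on S f" "continuous_on S g"
  shows "continuous_on S (\<lambda>x. f x *s g x)"
  unfolding vector_scalar_mult_def using assms by (intro continuous_intros)

lemma continuous_on_cinner [continuous_intros]: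
  fixes f g :: "'a::topological_space \<Rightarrow> complex ^ 'n"
  assumes "continuous_on S f" "continuous_on S g"
  shows "continuous_on S (\<lambda>x. cinner (f x) (g x))"
  unfolding cinner_def using assms by (intro continuous_intros)

lemma borel_measurable_vector_scale [measurable (raw)]:
  fixes f :: "'a \<Rightarrow> complex" and g :: "'a \<Rightarrow> complex ^ 'n"
  assumes [measurable]: "f \<in> borel_measurable M" "g \<in> borel_measurable M"
  shows "(\<lambda>x. f x *s g x) \<in> borel_measurable M"
proof -
  have "(\<lambda>x. fst x *s (snd x :: complex ^ 'n)) \<in> borel_measurable borel"
    by (intro borel_measurable_continuous_onI continuous_intros)
  then have "(\<lambda>x. fst (f x, g x) *s snd (f x, g x)) \<in> borel_measurable M"
    by (rule measurable_compose[rotated]) measurable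
  then show ?thesis by simp
qed

lemma borel_measurable_cinner [measurable (raw)]:
  fixes f g :: "'a \<Rightarrow> complex ^ 'n"
  assumes [measurable]: "f \<in> borel_measurable M" "g \<in> borel_measurable M"
  shows "(\<lambda>x. cinner (f x) (g x)) \<in> borel_measurable M"
proof -
  have "(\<lambda>x. cinner (fst x) (snd x :: complex ^ 'n)) \<in> borel_measurable borel"
    by (intro borel_measurable_continuous_onI continuous_intros)
  then have "(\<lambda>x. cinner (fst (f x, g x)) (snd (f x, g x))) \<in> borel_measurable M"
    by (rule measurable_compose[rotated]) measurable
  then show ?thesis by simp
qed

lemma borel_measurable_kdist [measurable (raw)]:
  fixes f g :: "'a \<Rightarrow> complex ^ 'n"
  assumes [measurable]: "f \<in> borel_measurable M" "g \<in> borel_measurable M"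
  shows "(\<lambda>x. kdist (f x) (g x)) \<in> borel_measurable M"
  unfolding kdist_def by measurable

lemma borel_measurable_bgap [measurable (raw)]:
  fixes f :: "'a \<Rightarrow> complex ^ 'n"
  assumes [measurable]: "f \<in> borel_measurable M"
  shows "(\<lambda>x. bgap (f x)) \<in> borel_measurable M"
  unfolding bgap_def by measurable

lemma hood_borel [measurable]: "hood a \<in> sets borel"
  using open_hood by (rule borel_open)

lemma unit_ball_borel [measurable]: "(unit_ball :: (complex ^ 'n) set) \<in> sets borel"
  by simp

lemma emeasure_ball_complex_vec:
  "r \<ge> 0 \<Longrightarrow> emeasure lborel (ball (c :: complex ^ 'n) r) = ennreal (unit_ball_vol (real (2 * CARD('n))) * r ^ (2 * CARD('n)))"
  "r \<ge> 0 \<Longrightarrow> emeasure lborel (cball (c :: complex ^ 'n) r) = ennreal (unit_ball_vol (real (2 * CARD('n))) * r ^ (2 * CARD('n)))"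
  by (simp_all only: emeasure_ball emeasure_cball DIM_complex_vec)

lemma nn_integral_indicator_times:
  "A \<in> sets M \<Longrightarrow> (\<integral>\<^sup>+x. indicator A x * c \<partial>M) = emeasure M A * c"
  by (subst nn_integral_multc) auto

lemma nn_integral_times_indicator:
  "A \<in> sets M \<Longrightarrow> (\<integral>\<^sup>+x. c * indicator A x \<partial>M) = c * emeasure M A"
  by (subst nn_integral_cmult) auto

lemma unit_ball_vol_2_neq_0: "unit_ball_vol 2 \<noteq> 0"
  using unit_ball_vol_pos[of 2] by linarith

text \<open>Both volume bounds compare the set with its translates by \<open>\<lambda> e\<close> via Tonelli in \<open>(\<lambda>, w)\<close>;
  this replaces a unitary change of coordinates.\<close>
lemma emeasure_kdist_cap_le:
  fixes e :: "complex ^ 'n"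
  assumes e: "norm e = 1" and T: "0 < T"
  shows "emeasure lborel {w \<in> unit_ball. cmod (1 - cinner w e) \<le> T}
     \<le> ennreal (unit_ball_vol (real (2 * CARD('n))) * 9 ^ CARD('n) * T ^ (CARD('n) + 1))"
proof -
  define S where "S = {w \<in> unit_ball. cmod (1 - cinner w e) \<le> T}"
  define V where "V = unit_ball_vol (real (2 * CARD('n)))"
  have V: "0 < V" by (simp add: V_def)
  have S[measurable]: "S \<in> sets borel" unfolding S_def by measurable
  show ?thesis
  proof (cases "T \<le> 1")
    case False
    have "emeasure lborel S \<le> emeasure lborel (ball (0 :: complex ^ 'n) 1)"
      by (intro emeasure_mono) (auto simp: S_def)
    also have "\<dots> = ennreal V" by (subst emeasure_ball_complex_vec) (auto simp: V_def)
    also have "\<dots> \<le> ennreal (V * 9 ^ CARD('n) * T ^ (CARD('n) + 1))"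
    proof (rule ennreal_leI)
      have "1 * 1 \<le> (9::real) ^ CARD('n) * T ^ (CARD('n) + 1)"
        using False by (intro mult_mono one_le_power) auto
      then show "V \<le> V * 9 ^ CARD('n) * T ^ (CARD('n) + 1)"
        using V mult_left_mono[of 1 "9 ^ CARD('n) * T ^ (CARD('n) + 1)" V] by (simp add: mult.assoc)
    qed
    finally show ?thesis by (simp add: S_def V_def)
  next
    case True
    \<comment> \<open>For |w| <= 1 the square of |w - e| is at most 2 Re (1 - <w,e>), so the cap
      lies in a ball of radius of order sqrt T.\<close>
    have near_e: "norm (w - e) \<le> 2 * sqrt T" if "w \<in> S" for w
    proof -
      have w: "norm w < 1" "cmod (1 - cinner w e) \<le> T" using that by (auto simp: S_def)
      have "(norm (w - e))\<^sup>2 = (norm w)\<^sup>2 - 2 * Re (cinner w e) + 1"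
        using norm_sq_lincomb[of 1 w "-1" e] e by simp
      also have "\<dots> \<le> 2 * Re (1 - cinner w e)" using w by (simp add: abs_square_le_1)
      also have "\<dots> \<le> 2 * T" using complex_Re_le_cmod[of "1 - cinner w e"] w by linarith
      also have "\<dots> \<le> (2 * sqrt T)\<^sup>2" using T by (simp add: power_mult_distrib)
      finally show ?thesis by (rule power2_le_imp_le) (use T in simp)
    qed
    let ?f = "\<lambda>(l::complex) (w::complex^'n). indicator (ball 0 (sqrt T)) l * indicator S (- (l *s e) + w) :: ennreal"
    have ballm: "ball (0::complex) (sqrt T) \<in> sets borel" by simp
    note ballm[measurable]
    have "ennreal (unit_ball_vol 2 * T) * emeasure lborel S = emeasure lborel (ball (0::complex) (sqrt T)) * emeasure lborel S"
      using T by (simp add: emeasure_ball)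
    also have "\<dots> = (\<integral>\<^sup>+l. indicator (ball (0::complex) (sqrt T)) l * emeasure lborel S \<partial>lborel)"
      by (subst nn_integral_indicator_times) auto
    also have "\<dots> = (\<integral>\<^sup>+l. \<integral>\<^sup>+w. ?f l w \<partial>lborel \<partial>lborel)"
    proof (rule nn_integral_cong)
      fix l :: complex
      show "indicator (ball 0 (sqrt T)) l * emeasure lborel S = (\<integral>\<^sup>+w. ?f l w \<partial>lborel)"
        using nn_integral_lborel_translate[of "indicator S" "- (l *s e)"] by (subst nn_integral_cmult) auto
    qed
    also have "\<dots> = (\<integral>\<^sup>+w. \<integral>\<^sup>+l. ?f l w \<partial>lborel \<partial>lborel)"
      by (rule lborel_pair.Fubini'[symmetric]) measurable
    \<comment> \<open>For fixed w the admissible shifts fill only a disc of radius T, while l ranges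
      over a disc of radius sqrt T. This ratio of areas is the extra factor T over the volume of a
      ball of radius 3 sqrt T.\<close>
    also have "\<dots> \<le> (\<integral>\<^sup>+w. indicator (cball e (3 * sqrt T)) w * ennreal (unit_ball_vol 2 * T\<^sup>2) \<partial>lborel)"
    proof (rule nn_integral_mono)
      fix w :: "complex ^ 'n"
      have "?f l w \<le> indicator (cball e (3 * sqrt T)) w * indicator (cball (cinner w e - 1) T) l" for l
      proof (cases "l \<in> ball 0 (sqrt T) \<and> - (l *s e) + w \<in> S")
        case True
        have "norm (w - e) = norm ((- (l *s e) + w - e) + l *s e)" by simp
        also have "\<dots> \<le> norm (- (l *s e) + w - e) + norm (l *s e)" by (rule norm_triangle_ineq)
        also have "\<dots> \<le> 2 * sqrt T + sqrt T"
          using near_e[of "- (l *s e) + w"] True e by (intro add_mono) (auto simp: norm_vector_scale)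
        finally have "w \<in> cball e (3 * sqrt T)" by (simp add: dist_norm norm_minus_commute)
        moreover have "l \<in> cball (cinner w e - 1) T"
        proof -
          have "cmod (1 - cinner (- (l *s e) + w) e) \<le> T" using True by (simp add: S_def)
          also have "1 - cinner (- (l *s e) + w) e = l - (cinner w e - 1)"
            using cinner_diff_left[of w "l *s e" e] e by (simp add: cinner_scale_left cinner_self)
          finally show ?thesis by (simp add: dist_norm norm_minus_commute)
        qed
        ultimately show ?thesis by (simp add: indicator_def)
      qed (auto simp: indicator_def)
      then have "(\<integral>\<^sup>+l. ?f l w \<partial>lborel) \<le> (\<integral>\<^sup>+l. indicator (cball e (3 * sqrt T)) w * indicator (cball (cinner w e - 1) T) l \<partial>lborel)"
        by (rule nn_integral_mono)
      also have "\<dots> = indicator (cball e (3 * sqrt T)) w * ennreal (unit_ball_vol 2 * T\<^sup>2)"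
        using T by (subst nn_integral_times_indicator) (auto simp: emeasure_cball)
      finally show "(\<integral>\<^sup>+l. ?f l w \<partial>lborel) \<le> indicator (cball e (3 * sqrt T)) w * ennreal (unit_ball_vol 2 * T\<^sup>2)" .
    qed
    also have "\<dots> = emeasure lborel (cball e (3 * sqrt T)) * ennreal (unit_ball_vol 2 * T\<^sup>2)"
      by (subst nn_integral_indicator_times) auto
    also have "emeasure lborel (cball e (3 * sqrt T)) = ennreal (V * (9 ^ CARD('n) * T ^ CARD('n)))"
    proof -
      have "(3 * sqrt T) ^ (2 * CARD('n)) = 9 ^ CARD('n) * T ^ CARD('n)"
        using T by (simp add: power_mult power_mult_distrib)
      then show ?thesis using T by (subst emeasure_ball_complex_vec) (auto simp: V_def)
    qed
    also have "ennreal (V * (9 ^ CARD('n) * T ^ CARD('n))) * ennreal (unit_ball_vol 2 * T\<^sup>2)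
      = ennreal (unit_ball_vol 2 * T) * ennreal (V * 9 ^ CARD('n) * T ^ (CARD('n) + 1))"
      using T V by (simp add: ennreal_mult[symmetric] power2_eq_square mult_ac)
    finally have "ennreal (unit_ball_vol 2 * T) * emeasure lborel S
      \<le> ennreal (unit_ball_vol 2 * T) * ennreal (V * 9 ^ CARD('n) * T ^ (CARD('n) + 1))" .
    then show ?thesis
      using T by (subst (asm) ennreal_mult_le_mult_iff) (auto simp: S_def V_def unit_ball_vol_2_neq_0)
  qed
qed

lemma emeasure_hood_ge:
  fixes a :: "complex ^ 'n"
  assumes a: "a \<in> unit_ball"
  shows "ennreal (unit_ball_vol (real (2 * CARD('n))) / (4 * 256 ^ CARD('n)) * bgap a ^ (CARD('n) + 1))
    \<le> emeasure lborel (hood a)"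
proof -
  define d where "d = bgap a"
  define V where "V = unit_ball_vol (real (2 * CARD('n)))"
  have V: "0 < V" by (simp add: V_def)
  have d: "0 < d" "d \<le> 1" using bgap_pos[OF a] bgap_le_1[of a] by (auto simp: d_def)
  have d_sqrt: "d \<le> sqrt d" using d by (intro real_le_rsqrt) (simp add: power2_eq_square mult_left_le)
  let ?f = "\<lambda>(l::complex) (h::complex^'n). indicator (ball 0 (sqrt d / 8)) l * indicator (hood a) (a - l *s a + h) :: ennreal"
  have ballm: "ball (0::complex) r \<in> sets borel" for r by simp
  note ballm[measurable]
  have "emeasure lborel (ball (0::complex^'n) (sqrt d / 16)) * ennreal (unit_ball_vol 2 * (d / 16)\<^sup>2)
    = (\<integral>\<^sup>+h. indicator (ball 0 (sqrt d / 16)) h * ennreal (unit_ball_vol 2 * (d / 16)\<^sup>2) \<partial>(lborel::(complex^'n) measure))"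
    by (subst nn_integral_indicator_times) auto
  also have "\<dots> \<le> (\<integral>\<^sup>+h. \<integral>\<^sup>+l. ?f l h \<partial>lborel \<partial>lborel)"
  proof (rule nn_integral_mono)
    fix h :: "complex ^ 'n"
    show "indicator (ball 0 (sqrt d / 16)) h * ennreal (unit_ball_vol 2 * (d / 16)\<^sup>2) \<le> (\<integral>\<^sup>+l. ?f l h \<partial>lborel)"
    proof (cases "h \<in> ball 0 (sqrt d / 16)")
      case True
      then have h: "norm h < sqrt d / 16" by simp
      define c where "c = cinner h a"
      have ch: "cmod c \<le> norm h"
      proof -
        have "cmod c \<le> norm h * norm a" unfolding c_def by (rule cinner_Cauchy_Schwarz)
        also have "\<dots> \<le> norm h * 1" using a by (intro mult_left_mono) auto
        finally show ?thesis by simp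
      qed
      \<comment> \<open>Subtracting c a with c = <h,a> leaves the component c d along a, at most
        d/16 in modulus, and an error d/16 in l is harmless. So for each h a disc of area of order
        d^2 of shifts leads into the neighbourhood.\<close>
      have "indicator (ball c (d / 16)) l \<le> ?f l h" for l
      proof (cases "l \<in> ball c (d / 16)")
        case True
        then have l: "cmod (l - c) < d / 16" by (simp add: dist_norm norm_minus_commute)
        have "cmod l \<le> cmod c + cmod (l - c)" using norm_triangle_ineq[of c "l - c"] by simp
        also have "\<dots> < sqrt d / 8" using ch h l d_sqrt by linarith
        finally have 1: "l \<in> ball 0 (sqrt d / 8)" by simp
        have e1: "cinner (h - l *s a) a = c * of_real d - (l - c) * of_real ((norm a)\<^sup>2)"
          by (simp add: cinner_diff_left cinner_scale_left cinner_self c_def d_def bgap_def algebra_simps)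
        have "cmod (cinner (h - l *s a) a) \<le> cmod (c * of_real d) + cmod ((l - c) * of_real ((norm a)\<^sup>2))"
          unfolding e1 by (rule norm_triangle_ineq4)
        also have "cmod (c * of_real d) = cmod c * d" using d by (simp add: norm_mult)
        also have "cmod c * d \<le> 1 / 16 * d"
        proof (rule mult_right_mono)
          have "sqrt d \<le> 1" using d by simp
          then show "cmod c \<le> 1 / 16" using ch h by linarith
        qed (use d in simp)
        also have "cmod ((l - c) * of_real ((norm a)\<^sup>2)) \<le> cmod (l - c) * 1"
          unfolding norm_mult using a by (intro mult_left_mono) (auto simp: norm_power power_le_one)
        finally have 2: "cmod (cinner (h - l *s a) a) < d / 8" using l by simp
        have "norm (h - l *s a) = norm ((h - c *s a) - (l - c) *s a)" by (simp add: vec_eq_iff algebra_simps)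
        also have "\<dots> \<le> norm (h - c *s a) + norm ((l - c) *s a)" by (rule norm_triangle_ineq4)
        also have "norm (h - c *s a) \<le> norm h"
        proof (rule power2_le_imp_le)
          show "(norm (h - c *s a))\<^sup>2 \<le> (norm h)\<^sup>2"
            using norm_sq_remove_component[of a h] a by (simp add: c_def order_trans)
        qed simp
        also have "norm ((l - c) *s a) \<le> cmod (l - c) * 1"
          unfolding norm_vector_scale using a by (intro mult_left_mono) auto
        finally have "norm (h - l *s a) < sqrt d / 8" using h l d_sqrt by linarith
        then have "(norm (h - l *s a))\<^sup>2 < (sqrt d / 8)\<^sup>2" by (intro power_strict_mono) auto
        then have 3: "(norm (h - l *s a))\<^sup>2 < d / 64" using d by (simp add: power_divide)
        have "a - l *s a + h \<in> hood a"
          using 2 3 by (simp add: hood_def d_def algebra_simps)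
        with 1 show ?thesis by (simp add: indicator_def)
      qed simp
      then have "(\<integral>\<^sup>+l. indicator (ball c (d / 16)) l \<partial>lborel) \<le> (\<integral>\<^sup>+l. ?f l h \<partial>lborel)"
        by (rule nn_integral_mono)
      then show ?thesis using True d by (simp add: emeasure_ball)
    qed simp
  qed
  also have "\<dots> = (\<integral>\<^sup>+l. \<integral>\<^sup>+h. ?f l h \<partial>lborel \<partial>lborel)"
    by (rule lborel_pair.Fubini') measurable
  also have "\<dots> = (\<integral>\<^sup>+l. indicator (ball (0::complex) (sqrt d / 8)) l * emeasure lborel (hood a) \<partial>lborel)"
  proof (rule nn_integral_cong)
    fix l :: complex
    show "(\<integral>\<^sup>+h. ?f l h \<partial>lborel) = indicator (ball 0 (sqrt d / 8)) l * emeasure lborel (hood a)"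
      using nn_integral_lborel_translate[of "indicator (hood a)" "a - l *s a"] by (subst nn_integral_cmult) auto
  qed
  also have "\<dots> = emeasure lborel (ball (0::complex) (sqrt d / 8)) * emeasure lborel (hood a)"
    by (subst nn_integral_indicator_times) auto
  also have "emeasure lborel (ball (0::complex) (sqrt d / 8)) = ennreal (unit_ball_vol 2 * (d / 64))"
    using d by (simp add: emeasure_ball power_divide)
  also have "emeasure lborel (ball (0::complex^'n) (sqrt d / 16)) = ennreal (V * (d ^ CARD('n) / 256 ^ CARD('n)))"
  proof -
    have "(sqrt d / 16) ^ (2 * CARD('n)) = d ^ CARD('n) / 256 ^ CARD('n)"
      using d by (simp add: power_mult power_divide)
    then show ?thesis using d by (subst emeasure_ball_complex_vec) (auto simp: V_def)
  qed
  also have "ennreal (V * (d ^ CARD('n) / 256 ^ CARD('n))) * ennreal (unit_ball_vol 2 * (d / 16)\<^sup>2)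
     = ennreal (unit_ball_vol 2 * (d / 64)) * ennreal (V / (4 * 256 ^ CARD('n)) * d ^ (CARD('n) + 1))"
    using d V by (simp add: ennreal_mult[symmetric] power2_eq_square field_simps)
  finally show ?thesis
    using d by (subst (asm) ennreal_mult_le_mult_iff) (auto simp: d_def V_def unit_ball_vol_2_neq_0)
qed

section \<open>Holomorphic functions on the ball\<close>

lemma scaleR_vector_scale: "r *\<^sub>R (x :: complex ^ 'n) = of_real r *s x"
  by (simp add: vec_eq_iff complex_eq_iff)

lemma holo_on_continuous: "holo_on U f \<Longrightarrow> continuous_on U f"
  unfolding holo_on_def
  by (metis continuous_at_imp_continuous_on has_derivative_continuous)

text \<open>Complex linearity of the derivative makes slices along complex lines holomorphic; this
  is the channel through which one-variable theory enters.\<close>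

lemma holo_on_line:
  fixes f :: "complex ^ 'n \<Rightarrow> complex"
  assumes "holo_on U f" "\<And>l. l \<in> S \<Longrightarrow> a + l *s h \<in> U"
  shows "(\<lambda>l. f (a + l *s h)) holomorphic_on S"
proof -
  have "(\<lambda>l. f (a + l *s h)) field_differentiable at l" if "l \<in> S" for l
  proof -
    have "\<exists>L. (f has_derivative L) (at (a + l *s h)) \<and> (\<forall>c x. L (c *s x) = c * L x)"
      using assms(1) assms(2)[OF that] unfolding holo_on_def by (rule bspec)
    then obtain L where L: "(f has_derivative L) (at (a + l *s h))" "\<And>c x. L (c *s x) = c * L x"
      by blast
    have "bounded_linear (\<lambda>l::complex. l *s h)"
    proof (rule bounded_linear_intro[where K = "norm h"])
      show "norm (x *s h) \<le> norm x * norm h" for x by (simp add: norm_vector_scale)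
    qed (simp_all add: vec_eq_iff algebra_simps)
    then have "((\<lambda>l. a + l *s h) has_derivative (\<lambda>t. t *s h)) (at l)"
      by (auto intro!: derivative_eq_intros bounded_linear_imp_has_derivative)
    from has_derivative_compose[OF this L(1)]
    have "((\<lambda>l. f (a + l *s h)) has_derivative (\<lambda>t. L h * t)) (at l)"
      by (simp add: L(2) mult.commute)
    then show ?thesis
      unfolding field_differentiable_def has_field_derivative_def by blast
  qed
  then show ?thesis
    unfolding holomorphic_on_def by (blast intro: field_differentiable_at_within)
qed

lemma holo_on_diff:
  assumes "holo_on U f" "holo_on U g"
  shows "holo_on U (\<lambda>z. f z - g z)"
  unfolding holo_on_def
proof
  fix z assume "z \<in> U"
  then obtain L M where "(f has_derivative L) (at z)" "\<forall>c x. L (c *s x) = c * L x"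
    "(g has_derivative M) (at z)" "\<forall>c x. M (c *s x) = c * M x"
    using assms unfolding holo_on_def by meson
  then show "\<exists>L. ((\<lambda>z. f z - g z) has_derivative L) (at z) \<and> (\<forall>c x. L (c *s x) = c * L x)"
    by (intro exI[of _ "\<lambda>x. L x - M x"]) (auto intro!: derivative_intros simp: algebra_simps)
qed

lemma holo_on_sum:
  assumes "finite I" "\<And>i. i \<in> I \<Longrightarrow> holo_on U (f i)"
  shows "holo_on U (\<lambda>z. \<Sum>i\<in>I. f i z)"
  unfolding holo_on_def
proof
  fix z assume "z \<in> U"
  then have "\<forall>i\<in>I. \<exists>L. (f i has_derivative L) (at z) \<and> (\<forall>c x. L (c *s x) = c * L x)"
    using assms(2) unfolding holo_on_def by meson
  then obtain L where "\<And>i. i \<in> I \<Longrightarrow> (f i has_derivative L i) (at z)"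
     "\<And>i c x. i \<in> I \<Longrightarrow> L i (c *s x) = c * L i x" by metis
  then show "\<exists>L. ((\<lambda>z. \<Sum>i\<in>I. f i z) has_derivative L) (at z) \<and> (\<forall>c x. L (c *s x) = c * L x)"
    by (intro exI[of _ "\<lambda>x. \<Sum>i\<in>I. L i x"]) (auto intro!: derivative_intros simp: sum_distrib_left)
qed

lemma holo_on_compose_field:
  assumes "holo_on U f" "\<And>z. z \<in> U \<Longrightarrow> g field_differentiable at (f z)"
  shows "holo_on U (\<lambda>z. g (f z))"
  unfolding holo_on_def
proof
  fix z assume z: "z \<in> U"
  then obtain L where L: "(f has_derivative L) (at z)" "\<And>c x. L (c *s x) = c * L x"
    using assms(1) unfolding holo_on_def by meson
  obtain D where "(g has_derivative (\<lambda>t. D * t)) (at (f z))"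
    using assms(2)[OF z] unfolding field_differentiable_def has_field_derivative_def by blast
  from has_derivative_compose[OF L(1) this]
  show "\<exists>L. ((\<lambda>z. g (f z)) has_derivative L) (at z) \<and> (\<forall>c x. L (c *s x) = c * L x)"
    by (intro exI[of _ "\<lambda>x. D * L x"]) (simp add: L(2))
qed

lemma holo_on_cinner: "holo_on U (\<lambda>z. cinner z a)"
  unfolding holo_on_def
proof
  fix z assume "z \<in> U"
  have "bounded_linear (\<lambda>z. cinner z a)"
  proof (rule bounded_linear_intro[where K = "norm a"])
    show "norm (cinner x a) \<le> norm x * norm a" for x by (rule cinner_Cauchy_Schwarz)
    show "cinner (r *\<^sub>R x) a = r *\<^sub>R cinner x a" for r x
      by (simp only: scaleR_vector_scale cinner_scale_left scaleR_conv_of_real)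
  qed (simp add: cinner_add_left)
  then show "\<exists>L. ((\<lambda>z. cinner z a) has_derivative L) (at z) \<and> (\<forall>c x. L (c *s x) = c * L x)"
    by (intro exI[of _ "\<lambda>z. cinner z a"]) (auto intro: bounded_linear_imp_has_derivative simp: cinner_scale_left)
qed

text \<open>Normalized so that it is of size one near a, with constants depending on M; a large M
  buys decay away from a.\<close>

definition ball_kernel :: "nat \<Rightarrow> complex ^ 'n \<Rightarrow> complex ^ 'n \<Rightarrow> complex" where
  "ball_kernel M a z = (of_real (1 - norm a) / (1 - cinner z a)) ^ M"

lemma cinner_neq_1:
  assumes "a \<in> unit_ball" "z \<in> unit_ball"
  shows "cinner z a \<noteq> 1"
  using kdist_ge(4)[OF assms] by (auto simp: kdist_def)

lemma holo_on_ball_kernel: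
  assumes "a \<in> unit_ball"
  shows "holo_on unit_ball (\<lambda>z. c * ball_kernel M a z)"
  unfolding ball_kernel_def
  by (rule holo_on_compose_field[OF holo_on_cinner[where a = a], where g = "\<lambda>w. c * (of_real (1 - norm a) / (1 - w)) ^ M"])
     (use cinner_neq_1[OF assms] in \<open>auto intro!: derivative_intros\<close>)

lemma norm_ball_kernel:
  assumes "a \<in> unit_ball"
  shows "cmod (ball_kernel M a z) = ((1 - norm a) / kdist a z) ^ M"
proof -
  have "cmod (of_real (1 - norm a)) = 1 - norm a" using assms by (simp only: norm_of_real) simp
  then show ?thesis by (simp only: ball_kernel_def norm_power norm_divide kdist_def)
qed

text \<open>The cutoff makes the function Borel on the whole space: \<open>holo_on\<close>
  constrains no value outside the ball.\<close>

definition ball_pow :: "real \<Rightarrow> (complex ^ 'n \<Rightarrow> complex) \<Rightarrow> complex ^ 'n \<Rightarrow> ennreal" where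
  "ball_pow p f z = ennreal (cmod (f z) powr p) * indicator unit_ball z"

lemma borel_measurable_ball_pow [measurable]:
  assumes "holo_on unit_ball f"
  shows "ball_pow p f \<in> borel_measurable borel"
proof -
  have "(\<lambda>z. indicator unit_ball z *\<^sub>R f z) \<in> borel_measurable borel"
    using holo_on_continuous[OF assms] by (intro borel_measurable_continuous_on_indicator) auto
  then have "(\<lambda>z. ennreal (cmod (indicator unit_ball z *\<^sub>R f z) powr p) * indicator unit_ball z) \<in> borel_measurable borel"
    by measurable
  moreover have "(\<lambda>z. ennreal (cmod (indicator unit_ball z *\<^sub>R f z) powr p) * indicator unit_ball z) = ball_pow p f"
    by (auto simp: ball_pow_def indicator_def)
  ultimately show ?thesis by simp
qed

lemma nn_integral_rotate:
  fixes f :: "complex ^ 'n \<Rightarrow> ennreal"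
  assumes [measurable]: "f \<in> borel_measurable borel" and c: "cmod c = 1"
  shows "(\<integral>\<^sup>+z. f (c *s z) \<partial>lborel) = (\<integral>\<^sup>+z. f z \<partial>lborel)"
proof -
  have "linear (\<lambda>z :: complex ^ 'n. c *s z)"
    by (rule linearI) (simp_all add: vec_eq_iff algebra_simps)
  then have "distr lborel borel (\<lambda>z :: complex ^ 'n. c *s z) = lborel"
    by (rule distr_lborel_linear_isometry) (simp add: norm_vector_scale c)
  then have "(\<integral>\<^sup>+z. f z \<partial>lborel) = (\<integral>\<^sup>+z. f z \<partial>distr lborel borel (\<lambda>z :: complex ^ 'n. c *s z))" by simp
  also have "\<dots> = (\<integral>\<^sup>+z. f (c *s z) \<partial>lborel)" by (subst nn_integral_distr) auto
  finally show ?thesis by simp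
qed

lemma nn_integral_rotate_about:
  fixes f :: "complex ^ 'n \<Rightarrow> ennreal"
  assumes [measurable]: "f \<in> borel_measurable borel" and c: "cmod c = 1"
  shows "(\<integral>\<^sup>+z. f (a + c *s (z - a)) \<partial>lborel) = (\<integral>\<^sup>+z. f z \<partial>lborel)"
proof -
  have "(\<integral>\<^sup>+z. f (a + c *s (z - a)) \<partial>lborel) = (\<integral>\<^sup>+z. f (a + c *s z) \<partial>lborel)"
    using nn_integral_lborel_translate[of "\<lambda>z. f (a + c *s z)" "- a"] by simp
  also have "\<dots> = (\<integral>\<^sup>+z. f (a + z) \<partial>lborel)"
    using c by (intro nn_integral_rotate) auto
  finally show ?thesis by (simp add: nn_integral_lborel_translate)
qed

lemma nn_integral_const_2pi: "(\<integral>\<^sup>+t\<in>{0..2*pi}. c \<partial>lborel) = ennreal (2 * pi) * c"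
  by (subst nn_integral_times_indicator) (auto simp: mult.commute)

lemma ennreal_2pi_cancel: "ennreal (2 * pi) * x \<le> ennreal (2 * pi) * y \<Longrightarrow> x \<le> y"
  by (subst (asm) ennreal_mult_le_mult_iff) auto

text \<open>The neighbourhood is invariant under rotations about a, so its integral may be averaged
  over the circles a + e^(it) (z - a). On each circle the value at the centre is compared with the
  mean, radius 0 against radius 1.\<close>

lemma hood_submean:
  fixes f :: "complex ^ 'n \<Rightarrow> complex"
  assumes f: "holo_on unit_ball f" and a: "a \<in> unit_ball" and p: "0 < p"
  shows "ennreal (cmod (f a) powr p) * emeasure lborel (hood a) \<le> (\<integral>\<^sup>+z\<in>hood a. ball_pow p f z \<partial>lborel)"
proof (rule ennreal_2pi_cancel)
  define F where "F z = ball_pow p f z * indicator (hood a) z" for z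
  have F[measurable]: "F \<in> borel_measurable borel"
    unfolding F_def using borel_measurable_ball_pow[OF f] by measurable
  have circ: "ennreal (2 * pi) * ennreal (cmod (f a) powr p) \<le> (\<integral>\<^sup>+t\<in>{0..2*pi}. F (a + cis t *s (z - a)) \<partial>lborel)"
    if z: "z \<in> hood a" for z
  proof -
    define h where "h = z - a"
    have h: "cmod (cinner h a) < bgap a / 8" "(norm h)\<^sup>2 < bgap a / 64"
      using z by (auto simp: hood_def h_def)
    \<comment> \<open>The inequalities defining the neighbourhood are strict, so the slice through z
      remains in it up to some radius R > 1; the unit circle then lies inside an open disc of
      holomorphy.\<close>
    have "((\<lambda>R::real. R * cmod (cinner h a)) \<longlongrightarrow> 1 * cmod (cinner h a)) (at_right 1)"
         "((\<lambda>R::real. R\<^sup>2 * (norm h)\<^sup>2) \<longlongrightarrow> 1\<^sup>2 * (norm h)\<^sup>2) (at_right 1)"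
      by (intro tendsto_intros)+
    then have "eventually (\<lambda>R. R * cmod (cinner h a) < bgap a / 8) (at_right 1)"
       "eventually (\<lambda>R. R\<^sup>2 * (norm h)\<^sup>2 < bgap a / 64) (at_right 1)"
      using h by (simp_all only: mult_1 one_power2) (erule order_tendstoD(2), assumption)+
    then have "eventually (\<lambda>R. R * cmod (cinner h a) < bgap a / 8 \<and> R\<^sup>2 * (norm h)\<^sup>2 < bgap a / 64 \<and> 1 < R) (at_right 1)"
      using eventually_at_right_less[of "1::real"] by eventually_elim auto
    from eventually_happens'[OF trivial_limit_at_right_real this]
    obtain R :: real where R: "R * cmod (cinner h a) < bgap a / 8" "R\<^sup>2 * (norm h)\<^sup>2 < bgap a / 64" "1 < R"
      by blast
    have inh: "a + l *s h \<in> hood a" if "l \<in> ball 0 R" for l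
    proof -
      have "cmod l * cmod (cinner h a) \<le> R * cmod (cinner h a)" "(cmod l)\<^sup>2 * (norm h)\<^sup>2 \<le> R\<^sup>2 * (norm h)\<^sup>2"
        using that by (auto intro!: mult_right_mono power_mono)
      then show ?thesis
        using R by (auto simp: hood_def cinner_scale_left norm_mult norm_vector_scale power_mult_distrib)
    qed
    have hol: "(\<lambda>l. f (a + l *s h)) holomorphic_on ball 0 R"
      by (rule holo_on_line[OF f]) (use inh hood_near(1)[OF a] in blast)
    have "(\<integral>\<^sup>+t\<in>{0..2*pi}. ennreal (cmod (f (a + (of_real 0 * cis t) *s h)) powr p) \<partial>lborel)
      \<le> (\<integral>\<^sup>+t\<in>{0..2*pi}. ennreal (cmod (f (a + (of_real 1 * cis t) *s h)) powr p) \<partial>lborel)"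
      by (rule nn_integral_circle_mono[OF hol p]) (use R in auto)
    also have "\<dots> = (\<integral>\<^sup>+t\<in>{0..2*pi}. F (a + cis t *s h) \<partial>lborel)"
    proof -
      have i: "a + cis t *s h \<in> hood a" for t by (rule inh) (use R in simp)
      show ?thesis using i hood_near(1)[OF a i] by (simp add: F_def ball_pow_def)
    qed
    finally show ?thesis by (simp add: nn_integral_const_2pi h_def)
  qed
  have "ennreal (2 * pi) * (ennreal (cmod (f a) powr p) * emeasure lborel (hood a))
    = (\<integral>\<^sup>+z. ennreal (2 * pi) * ennreal (cmod (f a) powr p) * indicator (hood a) z \<partial>lborel)"
    by (subst nn_integral_times_indicator) (auto simp: mult.assoc)
  also have "\<dots> \<le> (\<integral>\<^sup>+z. \<integral>\<^sup>+t. F (a + cis t *s (z - a)) * indicator {0..2*pi} t \<partial>lborel \<partial>lborel)"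
    using circ by (intro nn_integral_mono) (simp add: indicator_def)
  also have "\<dots> = (\<integral>\<^sup>+t. \<integral>\<^sup>+z. F (a + cis t *s (z - a)) * indicator {0..2*pi} t \<partial>lborel \<partial>lborel)"
  proof (rule lborel_pair.Fubini')
    have [measurable]: "cis \<in> borel_measurable borel" by (intro borel_measurable_continuous_onI continuous_intros)
    show "(\<lambda>(t, z). F (a + cis t *s (z - a)) * indicator {0..2 * pi} t) \<in> borel_measurable (lborel \<Otimes>\<^sub>M lborel)"
      by measurable
  qed
  also have "\<dots> = (\<integral>\<^sup>+t. (\<integral>\<^sup>+z. F z \<partial>lborel) * indicator {0..2*pi} t \<partial>lborel)"
  proof (rule nn_integral_cong)
    fix t :: real
    show "(\<integral>\<^sup>+z. F (a + cis t *s (z - a)) * indicator {0..2*pi} t \<partial>lborel) = (\<integral>\<^sup>+z. F z \<partial>lborel) * indicator {0..2*pi} t"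
      using nn_integral_rotate_about[OF F, of "cis t" a] by (subst nn_integral_multc) auto
  qed
  also have "\<dots> = ennreal (2 * pi) * (\<integral>\<^sup>+z. F z \<partial>lborel)" by (rule nn_integral_const_2pi)
  finally show "ennreal (2 * pi) * (ennreal (cmod (f a) powr p) * emeasure lborel (hood a))
    \<le> ennreal (2 * pi) * (\<integral>\<^sup>+z\<in>hood a. ball_pow p f z \<partial>lborel)" by (simp add: F_def)
qed

text \<open>Up to the volume of the ball, the mean of |f|^p over the sphere of radius s. Writing
  points of the sphere as \<open>sgn w\<close> with w in the ball avoids a surface measure; w = 0 is
  a null set.\<close>

definition sphere_mean :: "real \<Rightarrow> (complex ^ 'n \<Rightarrow> complex) \<Rightarrow> real \<Rightarrow> ennreal" where
  "sphere_mean p f s = (\<integral>\<^sup>+w\<in>unit_ball. ball_pow p f (s *\<^sub>R sgn w) \<partial>lborel)"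

text \<open>Averaging over the rotations w -> e^(it) w first expresses both sides through circular
  means of slices of f through the origin, which are monotone in the radius.\<close>

lemma sphere_mean_mono:
  fixes f :: "complex ^ 'n \<Rightarrow> complex"
  assumes f: "holo_on unit_ball f" and p: "0 < p" and s: "0 \<le> s" "s \<le> s'" "s' < 1"
  shows "sphere_mean p f s \<le> sphere_mean p f s'"
proof (rule ennreal_2pi_cancel)
  note [measurable] = borel_measurable_ball_pow[OF f]
  have [measurable]: "cis \<in> borel_measurable borel" by (intro borel_measurable_continuous_onI continuous_intros)
  have sgn_rot: "c *s (x *\<^sub>R sgn w) = x *\<^sub>R sgn (c *s w)" if "cmod c = 1" for c x and w :: "complex ^ 'n"
    using that by (simp add: sgn_div_norm norm_vector_scale scaleR_vector_scale mult.commute mult.left_commute)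
  have avg: "ennreal (2 * pi) * sphere_mean p f x = (\<integral>\<^sup>+w. \<integral>\<^sup>+t. ball_pow p f (cis t *s (x *\<^sub>R sgn w)) * indicator unit_ball w * indicator {0..2*pi} t \<partial>lborel \<partial>lborel)"
    (is "_ = ?R") for x
  proof -
    have "?R = (\<integral>\<^sup>+t. \<integral>\<^sup>+w. ball_pow p f (cis t *s (x *\<^sub>R sgn w)) * indicator unit_ball w * indicator {0..2*pi} t \<partial>lborel \<partial>lborel)"
      by (rule lborel_pair.Fubini') measurable
    also have "\<dots> = (\<integral>\<^sup>+t. sphere_mean p f x * indicator {0..2*pi} t \<partial>lborel)"
    proof (rule nn_integral_cong)
      fix t :: real
      have "(\<integral>\<^sup>+w. ball_pow p f (cis t *s (x *\<^sub>R sgn w)) * indicator unit_ball w \<partial>lborel)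
         = (\<integral>\<^sup>+w. (\<lambda>w. ball_pow p f (x *\<^sub>R sgn w) * indicator unit_ball w) (cis t *s w) \<partial>lborel)"
        by (intro nn_integral_cong) (simp add: sgn_rot indicator_def norm_vector_scale)
      also have "\<dots> = sphere_mean p f x"
        unfolding sphere_mean_def by (rule nn_integral_rotate) auto
      finally show "(\<integral>\<^sup>+w. ball_pow p f (cis t *s (x *\<^sub>R sgn w)) * indicator unit_ball w * indicator {0..2*pi} t \<partial>lborel)
         = sphere_mean p f x * indicator {0..2*pi} t"
        by (subst nn_integral_multc) auto
    qed
    finally show ?thesis by (simp add: nn_integral_const_2pi)
  qed
  have "(\<integral>\<^sup>+t. ball_pow p f (cis t *s (s *\<^sub>R sgn w)) * indicator unit_ball w * indicator {0..2*pi} t \<partial>lborel)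
    \<le> (\<integral>\<^sup>+t. ball_pow p f (cis t *s (s' *\<^sub>R sgn w)) * indicator unit_ball w * indicator {0..2*pi} t \<partial>lborel)" for w :: "complex ^ 'n"
  proof -
    have nsgn: "norm (sgn w) \<le> 1" by (simp add: norm_sgn)
    have inb: "l *s sgn w \<in> unit_ball" if "cmod l < 1" for l
      using mult_left_mono[OF nsgn, of "cmod l"] that by (simp add: norm_vector_scale)
    have hol: "(\<lambda>l. f (0 + l *s sgn w)) holomorphic_on ball 0 1"
      by (rule holo_on_line[OF f]) (use inb in auto)
    have eq: "ball_pow p f (cis t *s (x *\<^sub>R sgn w)) = ennreal (cmod (f (0 + (of_real x * cis t) *s sgn w)) powr p)"
      if "0 \<le> x" "x < 1" for x t
    proof -
      have e: "cis t *s (x *\<^sub>R sgn w) = (of_real x * cis t) *s sgn w"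
        by (simp add: scaleR_vector_scale mult.commute)
      have "(of_real x * cis t) *s sgn w \<in> unit_ball" by (rule inb) (use that in \<open>simp add: norm_mult\<close>)
      then show ?thesis unfolding ball_pow_def e by simp
    qed
    have "(\<integral>\<^sup>+t\<in>{0..2*pi}. ennreal (cmod (f (0 + (of_real s * cis t) *s sgn w)) powr p) \<partial>lborel)
      \<le> (\<integral>\<^sup>+t\<in>{0..2*pi}. ennreal (cmod (f (0 + (of_real s' * cis t) *s sgn w)) powr p) \<partial>lborel)"
      by (rule nn_integral_circle_mono[OF hol p]) (use s in auto)
    then show ?thesis
      using s by (cases "w \<in> unit_ball") (simp_all add: eq)
  qed
  then show "ennreal (2 * pi) * sphere_mean p f s \<le> ennreal (2 * pi) * sphere_mean p f s'"
    unfolding avg by (rule nn_integral_mono)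
qed

lemma nn_integral_ball_polar_radial:
  fixes f :: "complex ^ 'n \<Rightarrow> complex" and w :: "real \<Rightarrow> ennreal"
  assumes f: "holo_on unit_ball f" and [measurable]: "w \<in> borel_measurable borel"
  shows "(\<integral>\<^sup>+z. ball_pow p f z * w (norm z) \<partial>lborel) =
    (\<integral>\<^sup>+s\<in>{0<..<1}. ennreal (2 * CARD('n) * s ^ (2 * CARD('n) - 1)) * (w s * sphere_mean p f s) \<partial>lborel)"
proof -
  note [measurable] = borel_measurable_ball_pow[OF f]
  have "(\<integral>\<^sup>+z. ball_pow p f z * w (norm z) \<partial>lborel) = (\<integral>\<^sup>+z\<in>unit_ball. ball_pow p f z * w (norm z) \<partial>lborel)"
    by (intro nn_integral_cong) (simp add: ball_pow_def indicator_def)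
  also have "\<dots> = (\<integral>\<^sup>+s\<in>{0<..<1}. ennreal (DIM(complex ^ 'n) * s ^ (DIM(complex ^ 'n) - 1)) * (\<integral>\<^sup>+x\<in>unit_ball. ball_pow p f (s *\<^sub>R sgn x) * w (norm (s *\<^sub>R sgn x)) \<partial>lborel) \<partial>lborel)"
    by (rule nn_integral_ball_polar) measurable
  also have "\<dots> = (\<integral>\<^sup>+s\<in>{0<..<1}. ennreal (2 * CARD('n) * s ^ (2 * CARD('n) - 1)) * (w s * sphere_mean p f s) \<partial>lborel)"
  proof (rule nn_integral_cong)
    fix s :: real
    have "(\<integral>\<^sup>+x\<in>unit_ball. ball_pow p f (s *\<^sub>R sgn x) * w (norm (s *\<^sub>R sgn x)) \<partial>lborel) = w s * sphere_mean p f s"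
      if "0 < s"
    proof -
      have "(\<integral>\<^sup>+x\<in>unit_ball. ball_pow p f (s *\<^sub>R sgn x) * w (norm (s *\<^sub>R sgn x)) \<partial>lborel)
         = (\<integral>\<^sup>+x. w s * (ball_pow p f (s *\<^sub>R sgn x) * indicator unit_ball x) \<partial>lborel)"
      proof (rule nn_integral_cong_AE)
        have "AE x in lborel. x \<noteq> (0 :: complex ^ 'n)" by (rule AE_lborel_singleton)
        then show "AE x in lborel. ball_pow p f (s *\<^sub>R sgn x) * w (norm (s *\<^sub>R sgn x)) * indicator unit_ball x = w s * (ball_pow p f (s *\<^sub>R sgn x) * indicator unit_ball x)"
          by eventually_elim (use that in \<open>simp add: norm_sgn mult_ac\<close>)
      qed
      also have "\<dots> = w s * sphere_mean p f s"
        unfolding sphere_mean_def by (rule nn_integral_cmult) measurable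
      finally show ?thesis .
    qed
    then show "ennreal (DIM(complex ^ 'n) * s ^ (DIM(complex ^ 'n) - 1)) * (\<integral>\<^sup>+x\<in>unit_ball. ball_pow p f (s *\<^sub>R sgn x) * w (norm (s *\<^sub>R sgn x)) \<partial>lborel) * indicator {0<..<1} s
      = ennreal (2 * CARD('n) * s ^ (2 * CARD('n) - 1)) * (w s * sphere_mean p f s) * indicator {0<..<1} s"
      by (auto simp: indicator_def mult.commute[of _ "2::nat"] mult.commute[of _ "2::real"])
  qed
  finally show ?thesis .
qed

section \<open>Integrals of kernels against radial weights\<close>

text \<open>The form in which all dyadic decompositions below are made: at each point a single term
  of the series already dominates the integrand.\<close>

lemma nn_integral_le_shells:
  assumes "\<And>k. S k \<in> sets M"
    and "\<And>x. x \<in> space M \<Longrightarrow> h x \<noteq> 0 \<Longrightarrow> \<exists>k::nat. x \<in> S k \<and> h x \<le> A k"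
  shows "(\<integral>\<^sup>+x. h x \<partial>M) \<le> (\<Sum>k. A k * emeasure M (S k))"
proof -
  have "(\<integral>\<^sup>+x. h x \<partial>M) \<le> (\<integral>\<^sup>+x. (\<Sum>k. A k * indicator (S k) x) \<partial>M)"
  proof (rule nn_integral_mono)
    fix x assume x: "x \<in> space M"
    show "h x \<le> (\<Sum>k. A k * indicator (S k) x)"
    proof (cases "h x = 0")
      case False
      then obtain k where k: "x \<in> S k" "h x \<le> A k" using assms(2)[OF x] by blast
      then have "h x \<le> A k * indicator (S k) x" by simp
      also have "\<dots> = sum (\<lambda>k. A k * indicator (S k) x) {k}" by (simp only: sum.insert sum.empty finite.emptyI empty_iff not_False_eq_True add_0_right)
      also have "\<dots> \<le> (\<Sum>k. A k * indicator (S k) x)" by (rule sum_le_suminf) auto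
      finally show ?thesis .
    qed simp
  qed
  also have "\<dots> = (\<Sum>k. A k * emeasure M (S k))"
    using assms(1) by (subst nn_integral_suminf) (auto simp: nn_integral_times_indicator)
  finally show ?thesis .
qed

lemma ex_power_interval:
  fixes b y :: real
  assumes "1 < b" "1 \<le> y"
  shows "\<exists>k::nat. b ^ k \<le> y \<and> y < b ^ Suc k"
proof -
  obtain n where n: "y < b ^ n" using real_arch_pow[OF assms(1)] by blast
  define m where "m = (LEAST n. y < b ^ n)"
  have m: "y < b ^ m" unfolding m_def using n by (rule LeastI)
  have "m \<noteq> 0" using m assms(2) by (intro notI) simp
  then obtain k where k: "m = Suc k" using not0_implies_Suc by blast
  have "\<not> y < b ^ k" using not_less_Least[of k "\<lambda>n. y < b ^ n"] k by (simp add: m_def)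
  then show ?thesis using m k by (auto simp: not_less)
qed

lemma suminf_geometric_ennreal:
  assumes "0 \<le> c" "0 \<le> x" "x < 1"
  shows "(\<Sum>k. ennreal (c * x ^ k)) = ennreal (c / (1 - x))"
proof -
  have "(\<lambda>k. c * x ^ k) sums (c * (1 / (1 - x)))"
    using geometric_sums[of x] assms by (intro sums_mult) auto
  then show ?thesis
    using assms by (intro suminf_ennreal_eq) (auto)
qed

text \<open>Dyadic decomposition in 1 - s >= d. Iterated doubling bounds the tail at distance 2^k d
  by C^k times the tail at d, so the terms form a geometric series of ratio C / 2^\<gamma> <
  1.\<close>

lemma radial_integral_inner:
  fixes \<nu> :: "real measure"
  assumes sets: "sets \<nu> = sets borel" and C: "1 \<le> C" "C < 2 powr \<gamma>" and d: "0 < d"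
    and dbl: "\<And>x. 0 < x \<Longrightarrow> emeasure \<nu> {1 - 2 * x..} \<le> ennreal C * emeasure \<nu> {1 - x..}"
  shows "(\<integral>\<^sup>+s\<in>{..1 - d}. ennreal ((1 - s) powr (- \<gamma>)) \<partial>\<nu>)
    \<le> ennreal (C / (1 - C / 2 powr \<gamma>) * d powr (- \<gamma>)) * emeasure \<nu> {1 - d..}"
proof -
  have \<gamma>: "0 < \<gamma>"
  proof (rule ccontr)
    assume "\<not> 0 < \<gamma>"
    then have "2 powr \<gamma> \<le> 2 powr 0" by (intro powr_mono) auto
    then show False using C by simp
  qed
  have pow: "emeasure \<nu> {1 - 2 ^ k * d..} \<le> ennreal (C ^ k) * emeasure \<nu> {1 - d..}" for k
  proof (induction k)
    case (Suc k)
    have "emeasure \<nu> {1 - 2 ^ Suc k * d..} \<le> ennreal C * emeasure \<nu> {1 - 2 ^ k * d..}"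
      using dbl[of "2 ^ k * d"] d by (simp add: mult.assoc)
    also have "\<dots> \<le> ennreal C * (ennreal (C ^ k) * emeasure \<nu> {1 - d..})"
      by (intro mult_left_mono Suc) simp
    finally show ?case using C by (simp add: ennreal_mult mult.assoc)
  qed simp
  have "(\<integral>\<^sup>+s\<in>{..1 - d}. ennreal ((1 - s) powr (- \<gamma>)) \<partial>\<nu>)
    \<le> (\<Sum>k. ennreal ((2 ^ k * d) powr (- \<gamma>)) * emeasure \<nu> {1 - 2 ^ Suc k * d..})"
  proof (rule nn_integral_le_shells)
    fix s assume "ennreal ((1 - s) powr (- \<gamma>)) * indicator {..1 - d} s \<noteq> 0"
    then have s: "s \<le> 1 - d" by (auto simp: indicator_def split: if_splits)
    then obtain k where k: "2 ^ k \<le> (1 - s) / d" "(1 - s) / d < 2 ^ Suc k"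
      using ex_power_interval[of 2 "(1 - s) / d"] d by (auto simp: field_simps)
    have "2 ^ k * d \<le> 1 - s" "1 - s < 2 ^ Suc k * d" using k d by (auto simp: field_simps)
    then show "\<exists>k. s \<in> {1 - 2 ^ Suc k * d..} \<and> ennreal ((1 - s) powr (- \<gamma>)) * indicator {..1 - d} s \<le> ennreal ((2 ^ k * d) powr (- \<gamma>))"
      using s d \<gamma> by (intro exI[of _ k]) (auto intro!: ennreal_leI powr_mono2')
  qed (simp add: sets)
  also have "\<dots> \<le> (\<Sum>k. ennreal (C * d powr (- \<gamma>) * (C / 2 powr \<gamma>) ^ k) * emeasure \<nu> {1 - d..})"
  proof (rule suminf_le)
    fix k
    have "ennreal ((2 ^ k * d) powr (- \<gamma>)) * emeasure \<nu> {1 - 2 ^ Suc k * d..}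
      \<le> ennreal ((2 ^ k * d) powr (- \<gamma>)) * (ennreal (C ^ Suc k) * emeasure \<nu> {1 - d..})"
      by (intro mult_left_mono pow) simp
    also have "\<dots> = ennreal ((2 ^ k * d) powr (- \<gamma>) * C ^ Suc k) * emeasure \<nu> {1 - d..}"
      using C by (simp add: ennreal_mult mult.assoc)
    also have "(2 ^ k * d) powr (- \<gamma>) * C ^ Suc k = C * d powr (- \<gamma>) * (C / 2 powr \<gamma>) ^ k"
    proof -
      have "(2 ^ k) powr (- \<gamma>) = (1 / 2 powr \<gamma>) ^ k"
        by (simp add: powr_minus_divide powr_realpow[symmetric] powr_powr mult.commute power_one_over powr_power)
      then show ?thesis using d by (simp add: powr_mult power_divide)
    qed
    finally show "ennreal ((2 ^ k * d) powr (- \<gamma>)) * emeasure \<nu> {1 - 2 ^ Suc k * d..}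
      \<le> ennreal (C * d powr (- \<gamma>) * (C / 2 powr \<gamma>) ^ k) * emeasure \<nu> {1 - d..}" .
  qed auto
  also have "\<dots> = (\<Sum>k. ennreal (C * d powr (- \<gamma>) * (C / 2 powr \<gamma>) ^ k)) * emeasure \<nu> {1 - d..}"
    by simp
  also have "(\<Sum>k. ennreal (C * d powr (- \<gamma>) * (C / 2 powr \<gamma>) ^ k)) = ennreal (C * d powr (- \<gamma>) / (1 - C / 2 powr \<gamma>))"
    using C by (intro suminf_geometric_ennreal) auto
  finally show ?thesis by (simp add: mult.commute mult.left_commute)
qed

text \<open>Decomposition of 1 - s <= d in powers of K. By the lower condition the tail at distance
  d / K^k has shrunk by C^k, which beats the growth K^(k \<tau>) of the singular factor exactly when
  K^\<tau> < C. The singular factor itself comes from the Schur test for p > 1.\<close>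

lemma radial_integral_outer:
  fixes \<nu> :: "real measure"
  assumes sets: "sets \<nu> = sets borel" and K: "1 < K" "K powr \<tau> < C" "0 \<le> \<tau>" and d: "0 < d" "d \<le> 1"
    and chk: "\<And>x. 0 < x \<Longrightarrow> x \<le> 1 \<Longrightarrow> ennreal C * emeasure \<nu> {1 - x / K..} \<le> emeasure \<nu> {1 - x..}"
  shows "(\<integral>\<^sup>+s\<in>{1 - d..<1}. ennreal ((1 - s) powr (- \<tau>)) \<partial>\<nu>)
    \<le> ennreal (K powr \<tau> / (1 - K powr \<tau> / C) * d powr (- \<tau>)) * emeasure \<nu> {1 - d..}"
proof -
  have C: "0 < C" using K(2) powr_ge_zero[of K \<tau>] by linarith
  have pow: "emeasure \<nu> {1 - d / K ^ k..} \<le> ennreal ((1 / C) ^ k) * emeasure \<nu> {1 - d..}" for k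
  proof (induction k)
    case (Suc k)
    have "d \<le> K ^ k" by (rule order_trans[OF d(2)]) (use K in \<open>simp add: one_le_power\<close>)
    then have "d / K ^ k \<le> 1" using K by simp
    then have "ennreal C * emeasure \<nu> {1 - d / K ^ Suc k..} \<le> emeasure \<nu> {1 - d / K ^ k..}"
      using chk[of "d / K ^ k"] d K by (simp add: mult.commute)
    then have "ennreal (1 / C) * (ennreal C * emeasure \<nu> {1 - d / K ^ Suc k..}) \<le> ennreal (1 / C) * emeasure \<nu> {1 - d / K ^ k..}"
      by (rule mult_left_mono) simp
    also have "\<dots> \<le> ennreal (1 / C) * (ennreal ((1 / C) ^ k) * emeasure \<nu> {1 - d..})"
      by (intro mult_left_mono Suc) simp
    finally show ?case using C by (simp add: ennreal_mult[symmetric] mult.assoc[symmetric])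
  qed simp
  have "(\<integral>\<^sup>+s\<in>{1 - d..<1}. ennreal ((1 - s) powr (- \<tau>)) \<partial>\<nu>)
    \<le> (\<Sum>k. ennreal ((d / K ^ Suc k) powr (- \<tau>)) * emeasure \<nu> {1 - d / K ^ k..})"
  proof (rule nn_integral_le_shells)
    fix s assume "ennreal ((1 - s) powr (- \<tau>)) * indicator {1 - d..<1} s \<noteq> 0"
    then have s: "1 - d \<le> s" "s < 1" by (auto simp: indicator_def split: if_splits)
    then obtain k where k: "K ^ k \<le> d / (1 - s)" "d / (1 - s) < K ^ Suc k"
      using ex_power_interval[of K "d / (1 - s)"] d K by (auto simp: field_simps)
    have Kp: "0 < K ^ k" "0 < K ^ Suc k" using K by auto
    have 1: "1 - s \<le> d / K ^ k" using k(1) s Kp(1) by (simp add: pos_le_divide_eq mult.commute)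
    have 2: "d / K ^ Suc k \<le> 1 - s" 
    proof -
      have "d < K ^ Suc k * (1 - s)" using k(2) s by (simp only: pos_divide_less_eq diff_gt_0_iff_gt)
      then show ?thesis using Kp(2) by (simp only: pos_divide_le_eq mult.commute less_imp_le)
    qed
    have "(1 - s) powr (- \<tau>) \<le> (d / K ^ Suc k) powr (- \<tau>)"
      using K(3) 2 d Kp by (intro powr_mono2') auto
    then show "\<exists>k. s \<in> {1 - d / K ^ k..} \<and> ennreal ((1 - s) powr (- \<tau>)) * indicator {1 - d..<1} s \<le> ennreal ((d / K ^ Suc k) powr (- \<tau>))"
      using s 1 by (intro exI[of _ k]) (auto intro!: ennreal_leI)
  qed (simp add: sets)
  also have "\<dots> \<le> (\<Sum>k. ennreal (K powr \<tau> * d powr (- \<tau>) * (K powr \<tau> / C) ^ k) * emeasure \<nu> {1 - d..})"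
  proof (rule suminf_le)
    fix k
    have "ennreal ((d / K ^ Suc k) powr (- \<tau>)) * emeasure \<nu> {1 - d / K ^ k..}
      \<le> ennreal ((d / K ^ Suc k) powr (- \<tau>)) * (ennreal ((1 / C) ^ k) * emeasure \<nu> {1 - d..})"
      by (intro mult_left_mono pow) simp
    also have "\<dots> = ennreal ((d / K ^ Suc k) powr (- \<tau>) * (1 / C) ^ k) * emeasure \<nu> {1 - d..}"
      using C by (simp add: ennreal_mult mult.assoc)
    also have "(d / K ^ Suc k) powr (- \<tau>) * (1 / C) ^ k = K powr \<tau> * d powr (- \<tau>) * (K powr \<tau> / C) ^ k"
    proof -
      have "(d / K ^ Suc k) powr (- \<tau>) = d powr (- \<tau>) * (K powr \<tau>) ^ Suc k"
        using d K by (simp add: powr_divide powr_minus_divide powr_mult powr_power powr_realpow[symmetric] powr_powr mult.commute)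
      then show ?thesis by (simp add: power_divide)
    qed
    finally show "ennreal ((d / K ^ Suc k) powr (- \<tau>)) * emeasure \<nu> {1 - d / K ^ k..}
      \<le> ennreal (K powr \<tau> * d powr (- \<tau>) * (K powr \<tau> / C) ^ k) * emeasure \<nu> {1 - d..}" .
  qed auto
  also have "\<dots> = (\<Sum>k. ennreal (K powr \<tau> * d powr (- \<tau>) * (K powr \<tau> / C) ^ k)) * emeasure \<nu> {1 - d..}"
    by simp
  also have "(\<Sum>k. ennreal (K powr \<tau> * d powr (- \<tau>) * (K powr \<tau> / C) ^ k)) = ennreal (K powr \<tau> * d powr (- \<tau>) / (1 - K powr \<tau> / C))"
    using C K by (intro suminf_geometric_ennreal) auto
  finally show ?thesis by (simp add: mult.commute mult.left_commute)
qed

text \<open>Split at s = x. To the left 1 - s x >= 1 - s, so both powers merge into one; to the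
  right 1 - s x >= 1 - x, so the second power is a constant.\<close>

lemma radial_integral:
  fixes \<nu> :: "real measure"
  assumes sets: "sets \<nu> = sets borel" and C: "1 \<le> C" "C < 2 powr (\<gamma> + \<tau>)" "0 \<le> \<gamma>"
    and K: "1 < K" "K powr \<tau> < C'" "0 \<le> \<tau>"
    and dbl: "\<And>x. 0 < x \<Longrightarrow> emeasure \<nu> {1 - 2 * x..} \<le> ennreal C * emeasure \<nu> {1 - x..}"
    and chk: "\<And>x. 0 < x \<Longrightarrow> x \<le> 1 \<Longrightarrow> ennreal C' * emeasure \<nu> {1 - x / K..} \<le> emeasure \<nu> {1 - x..}"
  shows "\<exists>B>0. \<forall>x. 0 \<le> x \<longrightarrow> x < 1 \<longrightarrow>
    (\<integral>\<^sup>+s\<in>{0..<1}. ennreal ((1 - s) powr (- \<tau>) * (1 - s * x) powr (- \<gamma>)) \<partial>\<nu>)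
      \<le> ennreal (B * (1 - x) powr (- \<gamma> - \<tau>)) * emeasure \<nu> {x..}"
proof -
  define B1 where "B1 = C / (1 - C / 2 powr (\<gamma> + \<tau>))"
  define B2 where "B2 = K powr \<tau> / (1 - K powr \<tau> / C')"
  have C': "0 < C'" using K(2) powr_ge_zero[of K \<tau>] by linarith
  have B: "0 < B1" "0 < B2" using C K C' by (auto simp: B1_def B2_def)
  show ?thesis
  proof (intro exI[of _ "B1 + B2"] conjI allI impI)
    fix x :: real assume x: "0 \<le> x" "x < 1"
    define d where "d = 1 - x"
    have d: "0 < d" "d \<le> 1" using x by (auto simp: d_def)
    have "(\<integral>\<^sup>+s\<in>{0..<1}. ennreal ((1 - s) powr (- \<tau>) * (1 - s * x) powr (- \<gamma>)) \<partial>\<nu>)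
      \<le> (\<integral>\<^sup>+s. ennreal ((1 - s) powr (- (\<gamma> + \<tau>))) * indicator {..1 - d} s
            + ennreal (d powr (- \<gamma>)) * (ennreal ((1 - s) powr (- \<tau>)) * indicator {1 - d..<1} s) \<partial>\<nu>)"
    proof (rule nn_integral_mono)
      fix s :: real
      consider "s \<in> {0..<1}" "s \<le> x" | "s \<in> {0..<1}" "s > x" | "s \<notin> {0..<1}" by linarith
      then show "ennreal ((1 - s) powr (- \<tau>) * (1 - s * x) powr (- \<gamma>)) * indicator {0..<1} s
        \<le> ennreal ((1 - s) powr (- (\<gamma> + \<tau>))) * indicator {..1 - d} s
            + ennreal (d powr (- \<gamma>)) * (ennreal ((1 - s) powr (- \<tau>)) * indicator {1 - d..<1} s)"
      proof cases
        case 1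
        have "1 - s \<le> 1 - s * x" using 1 x by (simp add: mult_left_le)
        then have "(1 - s * x) powr (- \<gamma>) \<le> (1 - s) powr (- \<gamma>)"
          using 1 C(3) by (intro powr_mono2') auto
        then have "(1 - s) powr (- \<tau>) * (1 - s * x) powr (- \<gamma>) \<le> (1 - s) powr (- \<tau>) * (1 - s) powr (- \<gamma>)"
          by (intro mult_left_mono) auto
        also have "\<dots> = (1 - s) powr (- (\<gamma> + \<tau>))" by (simp add: powr_add[symmetric] add.commute)
        finally show ?thesis using 1
          by (intro order_trans[OF _ add_increasing2[OF zero_le order_refl]]) (auto simp: d_def intro!: ennreal_leI)
      next
        case 2
        have "x * s \<le> x * 1" using 2 x by (intro mult_left_mono) auto
        then have "d \<le> 1 - s * x" by (simp add: d_def mult.commute)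
        then have "(1 - s * x) powr (- \<gamma>) \<le> d powr (- \<gamma>)"
          using d C(3) by (intro powr_mono2') auto
        then have "(1 - s) powr (- \<tau>) * (1 - s * x) powr (- \<gamma>) \<le> d powr (- \<gamma>) * (1 - s) powr (- \<tau>)"
          by (subst mult.commute) (intro mult_right_mono, auto)
        then have "ennreal ((1 - s) powr (- \<tau>) * (1 - s * x) powr (- \<gamma>)) \<le> ennreal (d powr (- \<gamma>)) * ennreal ((1 - s) powr (- \<tau>))"
          by (simp add: ennreal_mult[symmetric] ennreal_leI)
        then show ?thesis using 2
          by (intro order_trans[OF _ add_increasing[OF zero_le order_refl]]) (auto simp: d_def)
      qed auto
    qed
    also have "\<dots> = (\<integral>\<^sup>+s\<in>{..1 - d}. ennreal ((1 - s) powr (- (\<gamma> + \<tau>))) \<partial>\<nu>)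
        + ennreal (d powr (- \<gamma>)) * (\<integral>\<^sup>+s\<in>{1 - d..<1}. ennreal ((1 - s) powr (- \<tau>)) \<partial>\<nu>)"
    proof -
      have [measurable]: "(\<lambda>s. ennreal ((1 - s) powr (- t))) \<in> borel_measurable \<nu>" for t
        unfolding measurable_cong_sets[OF sets refl] by measurable
      have [measurable]: "{..1 - d} \<in> sets \<nu>" "{1 - d..<1} \<in> sets \<nu>" by (simp_all add: sets)
      show ?thesis by (subst nn_integral_add, measurable)+ (subst nn_integral_cmult, measurable)
    qed
    also have "\<dots> \<le> ennreal (B1 * d powr (- (\<gamma> + \<tau>))) * emeasure \<nu> {1 - d..}
        + ennreal (d powr (- \<gamma>)) * (ennreal (B2 * d powr (- \<tau>)) * emeasure \<nu> {1 - d..})"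
      unfolding B1_def B2_def
      by (intro add_mono mult_left_mono radial_integral_inner radial_integral_outer sets C K d dbl chk) auto
    also have "\<dots> = ennreal (B1 * d powr (- (\<gamma> + \<tau>)) + d powr (- \<gamma>) * (B2 * d powr (- \<tau>))) * emeasure \<nu> {1 - d..}"
      using B by (simp add: ennreal_mult[symmetric] mult.assoc[symmetric] ennreal_plus distrib_right)
    also have "B1 * d powr (- (\<gamma> + \<tau>)) + d powr (- \<gamma>) * (B2 * d powr (- \<tau>)) = (B1 + B2) * d powr (- \<gamma> - \<tau>)"
      by (simp add: powr_diff powr_minus powr_add field_simps add_divide_distrib)
    finally show "(\<integral>\<^sup>+s\<in>{0..<1}. ennreal ((1 - s) powr (- \<tau>) * (1 - s * x) powr (- \<gamma>)) \<partial>\<nu>)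
      \<le> ennreal ((B1 + B2) * (1 - x) powr (- \<gamma> - \<tau>)) * emeasure \<nu> {x..}" by (simp add: d_def)
  qed (use B in simp)
qed

text \<open>The set is the cone over a spherical cap. The layer of points s sgn w with 1 - T < s < 1
  lies in a solid cap of size 3 T, of volume of order T^(n+1); dividing by the thickness T leaves
  T^n.\<close>

lemma emeasure_sphere_cap_le:
  "\<exists>B>0. \<forall>(b :: complex ^ 'n) T. norm b < 1 \<longrightarrow> 1 - norm b \<le> T \<longrightarrow>
    emeasure lborel {w \<in> unit_ball. cmod (1 - cinner (sgn w) b) \<le> T} \<le> ennreal (B * T ^ CARD('n))"
proof -
  define V where "V = unit_ball_vol (real (2 * CARD('n)))"
  define B where "B = V * 9 ^ CARD('n) * 3 ^ (CARD('n) + 1) * 2 ^ (2 * CARD('n))"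
  have V: "0 < V" by (simp add: V_def)
  have VB: "V * 2 ^ CARD('n) \<le> B"
  proof -
    have "2 ^ CARD('n) * 1 \<le> (9 ^ CARD('n) * 3 ^ (CARD('n) + 1)) * (2 ^ (2 * CARD('n)) :: real)"
    proof (rule mult_mono)
      have "(2::real) ^ CARD('n) * 1 \<le> 9 ^ CARD('n) * 3 ^ (CARD('n) + 1)"
        by (intro mult_mono power_mono one_le_power) auto
      then show "(2::real) ^ CARD('n) \<le> 9 ^ CARD('n) * 3 ^ (CARD('n) + 1)" by simp
    qed auto
    then show ?thesis using V unfolding B_def by (simp add: mult.assoc)
  qed
  have B0: "0 < B" using V by (simp add: B_def)
  have "emeasure lborel {w \<in> unit_ball. cmod (1 - cinner (sgn w) b) \<le> T} \<le> ennreal (B * T ^ CARD('n))"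
    if b: "norm b < 1" and bT: "1 - norm b \<le> T" for b :: "complex ^ 'n" and T
  proof (cases "T \<le> 1/2")
    case False
    have "emeasure lborel {w \<in> unit_ball. cmod (1 - cinner (sgn w) b) \<le> T} \<le> emeasure lborel (ball (0 :: complex ^ 'n) 1)"
      by (intro emeasure_mono) auto
    also have "\<dots> = ennreal V" by (subst emeasure_ball_complex_vec) (auto simp: V_def)
    also have "\<dots> \<le> ennreal (B * T ^ CARD('n))"
    proof (rule ennreal_leI)
      have "V * 1 \<le> V * (2 ^ CARD('n) * T ^ CARD('n))"
        unfolding power_mult_distrib[symmetric] using V False by (intro mult_left_mono one_le_power) auto
      also have "\<dots> \<le> B * T ^ CARD('n)"
        using VB False mult_right_mono[OF VB, of "T ^ CARD('n)"] by (simp add: mult.assoc)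
      finally show "V \<le> B * T ^ CARD('n)" by simp
    qed
    finally show ?thesis .
  next
    case True
    have T: "0 < T" using b bT by simp
    have b0: "b \<noteq> 0" using bT True by auto
    define e where "e = sgn b"
    have e: "norm e = 1" using b0 by (simp add: e_def norm_sgn)
    have be: "b - e = of_real (norm b - 1) *s e"
      using b0 by (simp add: e_def sgn_div_norm scaleR_vector_scale vec_eq_iff field_simps)
    define S where "S = {w \<in> unit_ball. cmod (1 - cinner (sgn w) b) \<le> T}"
    define P where "P = {w \<in> unit_ball. cmod (1 - cinner w e) \<le> 3 * T}"
    have [measurable]: "S \<in> sets borel" "P \<in> sets borel" unfolding S_def P_def by measurable
    have SP: "s *\<^sub>R sgn w \<in> P" if w: "w \<in> S" and s: "1 - T < s" "s < 1" for w s
    proof -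
      have nw: "norm (sgn w) \<le> 1" by (simp add: norm_sgn)
      have s0: "0 \<le> s" using s True by simp
      have ce: "cmod (cinner (sgn w) e) \<le> 1"
        using cinner_Cauchy_Schwarz[of "sgn w" e] nw e by simp
      \<comment> \<open>Each of the three terms is at most T: by the choice of w, by 1 - |b| <= T,
        and by 1 - s < T. This is the origin of the 3 in \<open>P\<close>.\<close>
      have eq: "1 - cinner (s *\<^sub>R sgn w) e = (1 - cinner (sgn w) b) + cinner (sgn w) (b - e) + of_real (1 - s) * cinner (sgn w) e"
        by (simp add: scaleR_vector_scale cinner_scale_left cinner_diff_right algebra_simps)
      have "cmod (1 - cinner (s *\<^sub>R sgn w) e) \<le> cmod (1 - cinner (sgn w) b) + cmod (cinner (sgn w) (b - e)) + cmod (of_real (1 - s) * cinner (sgn w) e)"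
        unfolding eq by (intro order_trans[OF norm_triangle_ineq] add_mono order_refl norm_triangle_ineq)
      also have "cmod (cinner (sgn w) (b - e)) = (1 - norm b) * cmod (cinner (sgn w) e)"
        unfolding be cinner_scale_right norm_mult complex_mod_cnj norm_of_real using b by simp
      also have "\<dots> \<le> (1 - norm b) * 1" using b ce by (intro mult_left_mono) auto
      also have "cmod (of_real (1 - s) * cinner (sgn w) e) = (1 - s) * cmod (cinner (sgn w) e)"
        unfolding norm_mult norm_of_real using s by simp
      also have "\<dots> \<le> (1 - s) * 1" using s ce by (intro mult_left_mono) auto
      finally have "cmod (1 - cinner (s *\<^sub>R sgn w) e) \<le> 3 * T" using w bT s by (simp add: S_def)
      moreover have "norm (s *\<^sub>R sgn w) < 1"
        using mult_left_mono[OF nw s0] s s0 by simp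
      ultimately show ?thesis by (simp add: P_def)
    qed
    \<comment> \<open>A lower bound for the polar density 2n s^(2n-1) on the layer, where T <= 1/2
      forces s > 1/2.\<close>
    define c where "c = (1/2 :: real) ^ (2 * CARD('n))"
    have "ennreal (c * T) * emeasure lborel S = (\<integral>\<^sup>+s. ennreal c * emeasure lborel S * indicator {1 - T<..<1} s \<partial>lborel)"
      using T by (subst nn_integral_times_indicator) (auto simp: ennreal_mult c_def mult_ac)
    also have "\<dots> \<le> (\<integral>\<^sup>+s\<in>{0<..<1}. ennreal (DIM(complex ^ 'n) * s ^ (DIM(complex ^ 'n) - 1)) * (\<integral>\<^sup>+w\<in>unit_ball. indicator P (s *\<^sub>R sgn w) \<partial>lborel) \<partial>lborel)"
    proof (rule nn_integral_mono)
      fix s :: real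
      show "ennreal c * emeasure lborel S * indicator {1 - T<..<1} s \<le> ennreal (DIM(complex ^ 'n) * s ^ (DIM(complex ^ 'n) - 1)) * (\<integral>\<^sup>+w\<in>unit_ball. indicator P (s *\<^sub>R sgn w) \<partial>lborel) * indicator {0<..<1} s"
      proof (cases "s \<in> {1 - T<..<1}")
        case s: True
        have "c \<le> DIM(complex ^ 'n) * s ^ (DIM(complex ^ 'n) - 1)"
        proof -
          have "c \<le> (1/2) ^ (2 * CARD('n) - 1)" unfolding c_def by (rule power_decreasing) auto
          also have "\<dots> \<le> 1 * s ^ (2 * CARD('n) - 1)" unfolding mult_1 using s True by (intro power_mono) auto
          also have "1 * s ^ (2 * CARD('n) - 1) \<le> real (2 * CARD('n)) * s ^ (2 * CARD('n) - 1)"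
          proof (rule mult_right_mono)
            have "1 \<le> 2 * CARD('n)" using zero_less_card_finite[where 'a = 'n] by linarith
            then show "1 \<le> real (2 * CARD('n))" by (metis of_nat_1 of_nat_le_iff)
          qed (use s True in auto)
          finally show ?thesis by (simp only: DIM_complex_vec)
        qed
        moreover have "emeasure lborel S \<le> (\<integral>\<^sup>+w\<in>unit_ball. indicator P (s *\<^sub>R sgn w) \<partial>lborel)"
        proof -
          have "emeasure lborel S = (\<integral>\<^sup>+w. indicator S w \<partial>lborel)" by simp
          also have "\<dots> \<le> (\<integral>\<^sup>+w\<in>unit_ball. indicator P (s *\<^sub>R sgn w) \<partial>lborel)"
            using SP s by (intro nn_integral_mono) (auto simp: indicator_def S_def)
          finally show ?thesis .
        qed
        ultimately show ?thesis using s True by (auto intro!: mult_mono ennreal_leI)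
      qed simp
    qed
    also have "\<dots> = (\<integral>\<^sup>+z\<in>unit_ball. indicator P z \<partial>lborel)"
      by (rule nn_integral_ball_polar[symmetric]) measurable
    also have "\<dots> \<le> (\<integral>\<^sup>+z. indicator P z \<partial>lborel)"
      by (intro nn_integral_mono) (auto simp: indicator_def)
    also have "\<dots> = emeasure lborel P" by simp
    also have "\<dots> \<le> ennreal (V * 9 ^ CARD('n) * (3 * T) ^ (CARD('n) + 1))"
      unfolding P_def V_def using T e by (intro emeasure_kdist_cap_le) auto
    also have "V * 9 ^ CARD('n) * (3 * T) ^ (CARD('n) + 1) = (c * T) * (B * T ^ CARD('n))"
      unfolding B_def c_def by (simp add: power_mult_distrib power_divide)
    also have "ennreal ((c * T) * (B * T ^ CARD('n))) = ennreal (c * T) * ennreal (B * T ^ CARD('n))"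
      using T B0 by (intro ennreal_mult) (auto simp: c_def)
    finally show ?thesis
      using T by (subst (asm) ennreal_mult_le_mult_iff) (auto simp: c_def S_def)
  qed
  with B0 show ?thesis by blast
qed

text \<open>On the k-th dyadic shell the kernel is at most (2^k d)^(-M) with d = 1 - |b|, and the
  cap has measure of order (2^k d)^n. For M > n the terms decay geometrically and the innermost
  shell decides.\<close>

lemma sphere_integral_kernel:
  fixes M :: real
  assumes M: "real CARD('n) < M"
  shows "\<exists>B>0. \<forall>b :: complex ^ 'n. norm b < 1 \<longrightarrow>
    (\<integral>\<^sup>+w\<in>unit_ball. ennreal (cmod (1 - cinner (sgn w) b) powr (- M)) \<partial>lborel) \<le> ennreal (B * (1 - norm b) powr (CARD('n) - M))"
proof -
  obtain B where B: "0 < B" and cap0: "\<forall>(b :: complex ^ 'n) T. norm b < 1 \<longrightarrow> 1 - norm b \<le> T \<longrightarrow>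
    emeasure lborel {w \<in> unit_ball. cmod (1 - cinner (sgn w) b) \<le> T} \<le> ennreal (B * T ^ CARD('n))"
    using emeasure_sphere_cap_le by blast
  note cap = cap0[rule_format]
  define x where "x = 2 powr (CARD('n) - M)"
  have x: "0 < x" "x < 1" using M powr_less_mono[of "CARD('n) - M" 0 2] by (auto simp: x_def)
  define C where "C = B * 2 ^ CARD('n) / (1 - x)"
  have "(\<integral>\<^sup>+w\<in>unit_ball. ennreal (cmod (1 - cinner (sgn w) b) powr (- M)) \<partial>lborel) \<le> ennreal (C * (1 - norm b) powr (CARD('n) - M))"
    if b: "norm b < 1" for b :: "complex ^ 'n"
  proof -
    define d where "d = 1 - norm b"
    have d: "0 < d" using b by (simp add: d_def)
    have hd: "d \<le> cmod (1 - cinner (sgn w) b)" for w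
    proof -
      have "cmod (cinner (sgn w) b) \<le> norm (sgn w) * norm b" by (rule cinner_Cauchy_Schwarz)
      also have "\<dots> \<le> norm b" by (simp add: norm_sgn)
      finally show ?thesis using norm_triangle_ineq2[of 1 "cinner (sgn w) b"] by (simp add: d_def)
    qed
    have "(\<integral>\<^sup>+w\<in>unit_ball. ennreal (cmod (1 - cinner (sgn w) b) powr (- M)) \<partial>lborel)
      \<le> (\<Sum>k. ennreal ((2 ^ k * d) powr (- M)) * emeasure lborel {w \<in> unit_ball. cmod (1 - cinner (sgn w) b) \<le> 2 ^ Suc k * d})"
    proof (rule nn_integral_le_shells)
      show "{w \<in> unit_ball. cmod (1 - cinner (sgn w) b) \<le> 2 ^ Suc k * d} \<in> sets lborel" for k
        by measurable
      fix w assume "ennreal (cmod (1 - cinner (sgn w) b) powr (- M)) * indicator unit_ball w \<noteq> 0"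
      then have w: "w \<in> unit_ball" by (auto simp: indicator_def split: if_splits)
      obtain k where k: "2 ^ k \<le> cmod (1 - cinner (sgn w) b) / d" "cmod (1 - cinner (sgn w) b) / d < 2 ^ Suc k"
        using ex_power_interval[of 2 "cmod (1 - cinner (sgn w) b) / d"] d hd[of w] by (auto simp: field_simps)
      have "2 ^ k * d \<le> cmod (1 - cinner (sgn w) b)" "cmod (1 - cinner (sgn w) b) < 2 ^ Suc k * d"
        using k d by (auto simp: field_simps)
      moreover from this(1) have "cmod (1 - cinner (sgn w) b) powr (- M) \<le> (2 ^ k * d) powr (- M)"
        using M d by (intro powr_mono2') auto
      ultimately show "\<exists>k. w \<in> {w \<in> unit_ball. cmod (1 - cinner (sgn w) b) \<le> 2 ^ Suc k * d} \<and>
         ennreal (cmod (1 - cinner (sgn w) b) powr (- M)) * indicator unit_ball w \<le> ennreal ((2 ^ k * d) powr (- M))"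
        using w by (intro exI[of _ k]) (auto intro!: ennreal_leI)
    qed
    also have "\<dots> \<le> (\<Sum>k. ennreal (B * 2 ^ CARD('n) * d powr (CARD('n) - M) * x ^ k))"
    proof (rule suminf_le)
      fix k
      have "d * 1 \<le> d * 2 ^ Suc k" using d by (intro mult_left_mono) (auto simp del: power_Suc intro: one_le_power)
      then have "1 - norm b \<le> 2 ^ Suc k * d" by (simp add: d_def mult.commute)
      then have "ennreal ((2 ^ k * d) powr (- M)) * emeasure lborel {w \<in> unit_ball. cmod (1 - cinner (sgn w) b) \<le> 2 ^ Suc k * d}
        \<le> ennreal ((2 ^ k * d) powr (- M)) * ennreal (B * (2 ^ Suc k * d) ^ CARD('n))"
        by (intro mult_left_mono cap b) auto
      also have "\<dots> = ennreal ((2 ^ k * d) powr (- M) * (B * (2 ^ Suc k * d) ^ CARD('n)))"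
        using B d by (simp add: ennreal_mult)
      also have "(2 ^ k * d) powr (- M) * (B * (2 ^ Suc k * d) ^ CARD('n)) = B * 2 ^ CARD('n) * d powr (CARD('n) - M) * x ^ k"
      proof -
        have "(2 ^ k * d) powr (- M) * (2 ^ Suc k * d) ^ CARD('n) = 2 ^ CARD('n) * ((2 ^ k * d) powr (- M) * (2 ^ k * d) powr CARD('n))"
          using d by (simp add: powr_realpow power_mult_distrib)
        also have "(2 ^ k * d) powr (- M) * (2 ^ k * d) powr CARD('n) = (2 ^ k * d) powr (CARD('n) - M)"
          by (simp add: powr_add[symmetric])
        also have "\<dots> = (2 ^ k) powr (CARD('n) - M) * d powr (CARD('n) - M)" using d by (simp add: powr_mult)
        also have "(2 ^ k) powr (CARD('n) - M) = x ^ k"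
          by (simp add: x_def powr_power powr_realpow[symmetric] powr_powr mult.commute)
        finally show ?thesis by (simp add: mult_ac)
      qed
      finally show "ennreal ((2 ^ k * d) powr (- M)) * emeasure lborel {w \<in> unit_ball. cmod (1 - cinner (sgn w) b) \<le> 2 ^ Suc k * d}
        \<le> ennreal (B * 2 ^ CARD('n) * d powr (CARD('n) - M) * x ^ k)" .
    qed auto
    also have "\<dots> = ennreal (B * 2 ^ CARD('n) * d powr (CARD('n) - M) / (1 - x))"
      using x B by (intro suminf_geometric_ennreal) auto
    finally show ?thesis by (simp add: C_def d_def)
  qed
  moreover have "0 < C" using B x by (simp add: C_def)
  ultimately show ?thesis by blast
qed

definition radial_measure :: "(real \<Rightarrow> ennreal) \<Rightarrow> real measure" where
  "radial_measure w = density lborel (\<lambda>s. w s * indicator {0..<1} s)"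

text \<open>For z = s w with |w| = 1 the kernel at z is |1 - <w, s a>|, so the spherical integral
  contributes the power n - M of 1 - s|a|; \<open>radial_integral\<close> with \<gamma> = M - n does
  the rest.\<close>

lemma ball_integral_kernel:
  fixes w :: "real \<Rightarrow> ennreal" and M :: real
  assumes w[measurable]: "w \<in> borel_measurable borel"
    and M: "real CARD('n) < M"
    and C: "1 \<le> C" "C < 2 powr (M - CARD('n) + \<tau>)"
    and K: "1 < K" "K powr \<tau> < C'" "0 \<le> \<tau>"
    and dbl: "\<And>x. 0 < x \<Longrightarrow> emeasure (radial_measure w) {1 - 2 * x..} \<le> ennreal C * emeasure (radial_measure w) {1 - x..}"
    and chk: "\<And>x. 0 < x \<Longrightarrow> x \<le> 1 \<Longrightarrow> ennreal C' * emeasure (radial_measure w) {1 - x / K..} \<le> emeasure (radial_measure w) {1 - x..}"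
  shows "\<exists>B>0. \<forall>a :: complex ^ 'n. norm a < 1 \<longrightarrow>
    (\<integral>\<^sup>+z\<in>unit_ball. ennreal (kdist a z powr (- M) * (1 - norm z) powr (- \<tau>)) * w (norm z) \<partial>lborel)
      \<le> ennreal (B * (1 - norm a) powr (CARD('n) - M - \<tau>)) * emeasure (radial_measure w) {norm a..}"
proof -
  obtain B1 where B1: "0 < B1" and sph0: "\<forall>b :: complex ^ 'n. norm b < 1 \<longrightarrow>
    (\<integral>\<^sup>+w\<in>unit_ball. ennreal (cmod (1 - cinner (sgn w) b) powr (- M)) \<partial>lborel) \<le> ennreal (B1 * (1 - norm b) powr (CARD('n) - M))"
    using sphere_integral_kernel[OF M] by blast
  note sph = sph0[rule_format]
  have "\<exists>B>0. \<forall>x. 0 \<le> x \<longrightarrow> x < 1 \<longrightarrow>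
    (\<integral>\<^sup>+s\<in>{0..<1}. ennreal ((1 - s) powr (- \<tau>) * (1 - s * x) powr (- (M - CARD('n)))) \<partial>radial_measure w)
      \<le> ennreal (B * (1 - x) powr (- (M - CARD('n)) - \<tau>)) * emeasure (radial_measure w) {x..}"
  proof (rule radial_integral)
    show "sets (radial_measure w) = sets borel" by (simp add: radial_measure_def)
  qed (use C K M dbl chk in auto)
  then obtain B2 where B2: "0 < B2" and rad0: "\<forall>x. 0 \<le> x \<longrightarrow> x < 1 \<longrightarrow>
    (\<integral>\<^sup>+s\<in>{0..<1}. ennreal ((1 - s) powr (- \<tau>) * (1 - s * x) powr (- (M - CARD('n)))) \<partial>radial_measure w)
      \<le> ennreal (B2 * (1 - x) powr (- (M - CARD('n)) - \<tau>)) * emeasure (radial_measure w) {x..}"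
    by blast
  note rad = rad0[rule_format]
  define N where "N = real (2 * CARD('n))"
  have "(\<integral>\<^sup>+z\<in>unit_ball. ennreal (kdist a z powr (- M) * (1 - norm z) powr (- \<tau>)) * w (norm z) \<partial>lborel)
      \<le> ennreal (N * B1 * B2 * (1 - norm a) powr (CARD('n) - M - \<tau>)) * emeasure (radial_measure w) {norm a..}"
    if a: "norm a < 1" for a :: "complex ^ 'n"
  proof -
    have "(\<integral>\<^sup>+z\<in>unit_ball. ennreal (kdist a z powr (- M) * (1 - norm z) powr (- \<tau>)) * w (norm z) \<partial>lborel)
      = (\<integral>\<^sup>+s\<in>{0<..<1}. ennreal (DIM(complex ^ 'n) * s ^ (DIM(complex ^ 'n) - 1)) *
          (\<integral>\<^sup>+x\<in>unit_ball. ennreal (kdist a (s *\<^sub>R sgn x) powr (- M) * (1 - norm (s *\<^sub>R sgn x)) powr (- \<tau>)) * w (norm (s *\<^sub>R sgn x)) \<partial>lborel) \<partial>lborel)"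
      by (rule nn_integral_ball_polar) measurable
    also have "\<dots> \<le> (\<integral>\<^sup>+s. ennreal (N * B1) * (w s * indicator {0..<1} s * (ennreal ((1 - s) powr (- \<tau>) * (1 - s * norm a) powr (- (M - CARD('n)))) * indicator {0..<1} s)) \<partial>lborel)"
    proof (rule nn_integral_mono)
      fix s :: real
      show "ennreal (DIM(complex ^ 'n) * s ^ (DIM(complex ^ 'n) - 1)) *
          (\<integral>\<^sup>+x\<in>unit_ball. ennreal (kdist a (s *\<^sub>R sgn x) powr (- M) * (1 - norm (s *\<^sub>R sgn x)) powr (- \<tau>)) * w (norm (s *\<^sub>R sgn x)) \<partial>lborel) * indicator {0<..<1} s
        \<le> ennreal (N * B1) * (w s * indicator {0..<1} s * (ennreal ((1 - s) powr (- \<tau>) * (1 - s * norm a) powr (- (M - CARD('n)))) * indicator {0..<1} s))"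
      proof (cases "s \<in> {0<..<1}")
        case s: True
        have sa: "norm (s *\<^sub>R a) < 1" using s a mult_strict_mono[of s 1 "norm a" 1] by simp
        have kd: "kdist a (s *\<^sub>R sgn x) = cmod (1 - cinner (sgn x) (s *\<^sub>R a))" for x
          by (simp add: kdist_def scaleR_vector_scale cinner_scale_left cinner_scale_right)
        have "(\<integral>\<^sup>+x\<in>unit_ball. ennreal (kdist a (s *\<^sub>R sgn x) powr (- M) * (1 - norm (s *\<^sub>R sgn x)) powr (- \<tau>)) * w (norm (s *\<^sub>R sgn x)) \<partial>lborel)
          = (\<integral>\<^sup>+x. (ennreal ((1 - s) powr (- \<tau>)) * w s) * (ennreal (cmod (1 - cinner (sgn x) (s *\<^sub>R a)) powr (- M)) * indicator unit_ball x) \<partial>lborel)"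
        proof (rule nn_integral_cong_AE)
          have "AE x in lborel. x \<noteq> (0 :: complex ^ 'n)" by (rule AE_lborel_singleton)
          then show "AE x in lborel. ennreal (kdist a (s *\<^sub>R sgn x) powr (- M) * (1 - norm (s *\<^sub>R sgn x)) powr (- \<tau>)) * w (norm (s *\<^sub>R sgn x)) * indicator unit_ball x
            = (ennreal ((1 - s) powr (- \<tau>)) * w s) * (ennreal (cmod (1 - cinner (sgn x) (s *\<^sub>R a)) powr (- M)) * indicator unit_ball x)"
            by eventually_elim (use s in \<open>simp add: kd norm_sgn ennreal_mult mult_ac\<close>)
        qed
        also have "\<dots> = (ennreal ((1 - s) powr (- \<tau>)) * w s) * (\<integral>\<^sup>+x\<in>unit_ball. ennreal (cmod (1 - cinner (sgn x) (s *\<^sub>R a)) powr (- M)) \<partial>lborel)"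
          by (rule nn_integral_cmult) measurable
        also have "\<dots> \<le> (ennreal ((1 - s) powr (- \<tau>)) * w s) * ennreal (B1 * (1 - norm (s *\<^sub>R a)) powr (CARD('n) - M))"
          by (intro mult_left_mono sph sa) simp
        also have "norm (s *\<^sub>R a) = s * norm a" using s by simp
        finally have 1: "(\<integral>\<^sup>+x\<in>unit_ball. ennreal (kdist a (s *\<^sub>R sgn x) powr (- M) * (1 - norm (s *\<^sub>R sgn x)) powr (- \<tau>)) * w (norm (s *\<^sub>R sgn x)) \<partial>lborel)
          \<le> (ennreal ((1 - s) powr (- \<tau>)) * w s) * ennreal (B1 * (1 - s * norm a) powr (CARD('n) - M))" .
        have "DIM(complex ^ 'n) * s ^ (DIM(complex ^ 'n) - 1) \<le> N * 1"
          unfolding N_def DIM_complex_vec using s by (intro mult_left_mono power_le_one) auto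
        then have "ennreal (DIM(complex ^ 'n) * s ^ (DIM(complex ^ 'n) - 1)) *
          (\<integral>\<^sup>+x\<in>unit_ball. ennreal (kdist a (s *\<^sub>R sgn x) powr (- M) * (1 - norm (s *\<^sub>R sgn x)) powr (- \<tau>)) * w (norm (s *\<^sub>R sgn x)) \<partial>lborel)
           \<le> ennreal N * ((ennreal ((1 - s) powr (- \<tau>)) * w s) * ennreal (B1 * (1 - s * norm a) powr (CARD('n) - M)))"
          by (intro mult_mono 1 ennreal_leI) auto
        also have "\<dots> = ennreal (N * B1) * (w s * ennreal ((1 - s) powr (- \<tau>) * (1 - s * norm a) powr (- (M - CARD('n)))))"
          using B1 by (simp add: N_def ennreal_mult mult_ac)
        finally show ?thesis using s by simp
      qed simp
    qed
    also have "\<dots> = ennreal (N * B1) * (\<integral>\<^sup>+s\<in>{0..<1}. ennreal ((1 - s) powr (- \<tau>) * (1 - s * norm a) powr (- (M - CARD('n)))) \<partial>radial_measure w)"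
      unfolding radial_measure_def by (subst nn_integral_density, measurable) (subst nn_integral_cmult, measurable)
    also have "\<dots> \<le> ennreal (N * B1) * (ennreal (B2 * (1 - norm a) powr (- (M - CARD('n)) - \<tau>)) * emeasure (radial_measure w) {norm a..})"
      by (intro mult_left_mono rad a) auto
    also have "\<dots> = ennreal (N * B1 * B2 * (1 - norm a) powr (CARD('n) - M - \<tau>)) * emeasure (radial_measure w) {norm a..}"
      using B1 B2 by (simp add: N_def ennreal_mult mult_ac)
    finally show ?thesis .
  qed
  moreover have "0 < N * B1 * B2" using B1 B2 by (simp add: N_def)
  ultimately show ?thesis by blast
qed

section \<open>Khinchine's inequality\<close>

text \<open>A is the set of indices carrying the sign +, so that an expectation over random signs is
  a finite sum over \<open>Pow J\<close> divided by 2 ^ card J.\<close>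

definition signed_sum :: "'i set \<Rightarrow> ('i \<Rightarrow> complex) \<Rightarrow> 'i set \<Rightarrow> complex" where
  "signed_sum J x A = (\<Sum>j\<in>J. (if j \<in> A then 1 else -1) * x j)"

lemma sum_Pow_insert:
  assumes "finite J" "i \<notin> J"
  shows "(\<Sum>A\<in>Pow (insert i J). F A) = (\<Sum>A\<in>Pow J. F A + F (insert i A))"
proof -
  have "(\<Sum>A\<in>Pow (insert i J). F A) = (\<Sum>A\<in>Pow J. F A) + (\<Sum>A\<in>insert i ` Pow J. F A)"
    unfolding Pow_insert using assms by (intro sum.union_disjoint) auto
  also have "(\<Sum>A\<in>insert i ` Pow J. F A) = (\<Sum>A\<in>Pow J. F (insert i A))"
    using assms by (subst sum.reindex) (auto simp: inj_on_def)
  finally show ?thesis by (simp add: sum.distrib)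
qed

lemma signed_sum_insert:
  assumes "finite J" "i \<notin> J" "A \<in> Pow J"
  shows "signed_sum (insert i J) x A = signed_sum J x A - x i"
    and "signed_sum (insert i J) x (insert i A) = signed_sum J x A + x i"
proof -
  have "i \<notin> A" using assms by auto
  then show "signed_sum (insert i J) x A = signed_sum J x A - x i"
    using assms by (simp add: signed_sum_def)
  have "(\<Sum>j\<in>J. (if j \<in> insert i A then 1 else -1) * x j) = (\<Sum>j\<in>J. (if j \<in> A then 1 else -1) * x j)"
    using assms by (intro sum.cong) auto
  then show "signed_sum (insert i J) x (insert i A) = signed_sum J x A + x i"
    using assms by (simp add: signed_sum_def)
qed

lemma cmod_add_diff_sq: "(cmod (z - w))\<^sup>2 + (cmod (z + w))\<^sup>2 = 2 * (cmod z)\<^sup>2 + 2 * (cmod w)\<^sup>2"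
  unfolding cmod_power2 by (simp add: algebra_simps power2_eq_square)

lemma cmod_add_diff_pow4:
  "(cmod (z - w)) ^ 4 + (cmod (z + w)) ^ 4 \<le> 2 * ((cmod z) ^ 4 + 6 * (cmod z)\<^sup>2 * (cmod w)\<^sup>2 + (cmod w) ^ 4)"
proof -
  define r where "r = Re (z * cnj w)"
  have p4: "x ^ 4 = (x\<^sup>2)\<^sup>2" for x :: real by simp
  have 1: "(cmod (z - w))\<^sup>2 = (cmod z)\<^sup>2 + (cmod w)\<^sup>2 - 2 * r" "(cmod (z + w))\<^sup>2 = (cmod z)\<^sup>2 + (cmod w)\<^sup>2 + 2 * r"
    unfolding cmod_power2 r_def by (simp_all add: algebra_simps power2_eq_square)
  have "\<bar>r\<bar> \<le> cmod z * cmod w" unfolding r_def using abs_Re_le_cmod[of "z * cnj w"] by (simp add: norm_mult)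
  then have "r\<^sup>2 \<le> (cmod z * cmod w)\<^sup>2" by (metis abs_ge_zero power2_abs power_mono)
  then have "r\<^sup>2 \<le> (cmod z)\<^sup>2 * (cmod w)\<^sup>2" by (simp add: power_mult_distrib)
  then show ?thesis unfolding p4 1 by (simp add: power2_eq_square algebra_simps)
qed

text \<open>A new index replaces S by S - x and S + x. The parallelogram law gives the second
  moment. For the fourth, the recursion produces 3 m^2 + 6 m |x|^2 + |x|^4, which is below 3 (m +
  |x|^2)^2.\<close>

lemma signed_sum_moments:
  assumes "finite J"
  shows "(\<Sum>A\<in>Pow J. (cmod (signed_sum J x A))\<^sup>2) = 2 ^ card J * (\<Sum>j\<in>J. (cmod (x j))\<^sup>2)"
    and "(\<Sum>A\<in>Pow J. (cmod (signed_sum J x A)) ^ 4) \<le> 2 ^ card J * (3 * (\<Sum>j\<in>J. (cmod (x j))\<^sup>2)\<^sup>2)"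
  using assms
proof (induction J rule: finite_induct)
  case empty
  { case 1 show ?case by (simp add: signed_sum_def) }
  { case 2 show ?case by (simp add: signed_sum_def) }
next
  case (insert i J)
  let ?s = "\<Sum>j\<in>J. (cmod (x j))\<^sup>2"
  { case 1
    have "(\<Sum>A\<in>Pow (insert i J). (cmod (signed_sum (insert i J) x A))\<^sup>2)
      = (\<Sum>A\<in>Pow J. 2 * (cmod (signed_sum J x A))\<^sup>2 + 2 * (cmod (x i))\<^sup>2)"
      unfolding sum_Pow_insert[OF insert.hyps]
      by (intro sum.cong refl) (simp only: signed_sum_insert[OF insert.hyps] cmod_add_diff_sq)
    also have "\<dots> = 2 * (2 ^ card J * ?s) + 2 ^ card J * (2 * (cmod (x i))\<^sup>2)"
      using insert.hyps by (simp add: sum.distrib sum_distrib_left[symmetric] insert.IH(1) card_Pow)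
    also have "\<dots> = 2 ^ card (insert i J) * (\<Sum>j\<in>insert i J. (cmod (x j))\<^sup>2)"
      using insert.hyps by (simp add: algebra_simps)
    finally show ?case . }
  { case 2
    have "(\<Sum>A\<in>Pow (insert i J). (cmod (signed_sum (insert i J) x A)) ^ 4)
      \<le> (\<Sum>A\<in>Pow J. 2 * ((cmod (signed_sum J x A)) ^ 4 + 6 * (cmod (signed_sum J x A))\<^sup>2 * (cmod (x i))\<^sup>2 + (cmod (x i)) ^ 4))"
      unfolding sum_Pow_insert[OF insert.hyps]
      by (intro sum_mono) (simp only: signed_sum_insert[OF insert.hyps] cmod_add_diff_pow4)
    also have "\<dots> = 2 * (\<Sum>A\<in>Pow J. (cmod (signed_sum J x A)) ^ 4) + 12 * (cmod (x i))\<^sup>2 * (\<Sum>A\<in>Pow J. (cmod (signed_sum J x A))\<^sup>2)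
        + 2 ^ card J * (2 * (cmod (x i)) ^ 4)"
      using insert.hyps by (simp add: sum.distrib sum_distrib_left card_Pow algebra_simps)
    also have "\<dots> \<le> 2 * (2 ^ card J * (3 * ?s\<^sup>2)) + 12 * (cmod (x i))\<^sup>2 * (2 ^ card J * ?s) + 2 ^ card J * (2 * (cmod (x i)) ^ 4)"
      using insert.IH by simp
    also have "\<dots> \<le> 2 ^ card (insert i J) * (3 * (\<Sum>j\<in>insert i J. (cmod (x j))\<^sup>2)\<^sup>2)"
    proof -
      have "(cmod (x i)) ^ 4 = ((cmod (x i))\<^sup>2)\<^sup>2" by simp
      then have "2 ^ card (insert i J) * (3 * (\<Sum>j\<in>insert i J. (cmod (x j))\<^sup>2)\<^sup>2)
        - (2 * (2 ^ card J * (3 * ?s\<^sup>2)) + 12 * (cmod (x i))\<^sup>2 * (2 ^ card J * ?s) + 2 ^ card J * (2 * (cmod (x i)) ^ 4))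
        = 2 ^ card J * (4 * ((cmod (x i))\<^sup>2)\<^sup>2)"
        using insert.hyps by (simp add: power2_eq_square algebra_simps)
      moreover have "0 \<le> 2 ^ card J * (4 * ((cmod (x i))\<^sup>2)\<^sup>2)" by simp
      ultimately show ?thesis by linarith
    qed
    finally show ?case . }
qed

text \<open>With \<open>t = |S|\<^sup>2/m\<close>, \<open>m = \<Sum>|x\<^sub>j|\<^sup>2\<close>, the Paley-Zygmund argument is
  the pointwise bound \<open>t - t\<^sup>2/6 - 1/4 \<le> (5/4) 1{t \<ge> 1/4}\<close> averaged over the signs.\<close>
lemma Khinchine_lower:
  assumes J: "finite J" and q: "0 < q"
  shows "(\<Sum>j\<in>J. (cmod (x j))\<^sup>2) powr (q / 2)
    \<le> 5 * 4 powr (q / 2) * ((\<Sum>A\<in>Pow J. cmod (signed_sum J x A) powr q) / 2 ^ card J)"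
proof -
  define m where "m = (\<Sum>j\<in>J. (cmod (x j))\<^sup>2)"
  have m0: "0 \<le> m" unfolding m_def by (intro sum_nonneg) auto
  show ?thesis
  proof (cases "m = 0")
    case True
    have "0 \<le> (\<Sum>A\<in>Pow J. cmod (signed_sum J x A) powr q)" by (intro sum_nonneg) auto
    then show ?thesis using True unfolding m_def[symmetric] by simp
  next
    case False
    with m0 have m: "0 < m" by simp
    let ?S = "\<lambda>A. cmod (signed_sum J x A)"
    have pt: "(m / 4) powr (q / 2) * (4 / 5 * (?S A ^ 2 / m - ?S A ^ 4 / (6 * m\<^sup>2) - 1 / 4)) \<le> ?S A powr q" for A
    proof -
      define t where "t = ?S A ^ 2 / m"
      have t0: "0 \<le> t" using m by (simp add: t_def)
      have t4: "?S A ^ 4 / (6 * m\<^sup>2) = t\<^sup>2 / 6"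
      proof -
        have "?S A ^ 4 = (?S A ^ 2)\<^sup>2" by simp
        then show ?thesis by (simp add: t_def power_divide)
      qed
      have St: "?S A powr q = (t * m) powr (q / 2)"
      proof -
        have "t * m = ?S A powr 2" using m by (simp add: t_def powr_numeral)
        then show ?thesis by (simp only: powr_powr) simp
      qed
      show ?thesis
      proof (cases "t \<le> 1 / 4")
        case True
        have "t - t\<^sup>2 / 6 - 1 / 4 \<le> 0" using True zero_le_power2[of t] by linarith
        then have "(m / 4) powr (q / 2) * (4 / 5 * (t - t\<^sup>2 / 6 - 1 / 4)) \<le> 0"
          by (intro mult_nonneg_nonpos) auto
        also have "\<dots> \<le> ?S A powr q" by simp
        finally show ?thesis unfolding t4 t_def[symmetric] .
      next
        case False
        \<comment> \<open>The parabola t - t^2/6 has its maximum 3/2 at t = 3, so the bracket is at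
          most 5/4.\<close>
        have "0 \<le> (t - 3)\<^sup>2" by simp
        then have "4 / 5 * (t - t\<^sup>2 / 6 - 1 / 4) \<le> 1" by (simp add: power2_eq_square algebra_simps)
        then have "(m / 4) powr (q / 2) * (4 / 5 * (t - t\<^sup>2 / 6 - 1 / 4)) \<le> (m / 4) powr (q / 2) * 1"
          by (intro mult_left_mono) auto
        also have "\<dots> \<le> (t * m) powr (q / 2)"
          using False m q by (simp) (intro powr_mono2, auto)
        finally show ?thesis unfolding t4 t_def[symmetric] St .
      qed
    qed
    \<comment> \<open>Averaged over the signs, the second-moment term is 1 and the fourth-moment
      term at most 1/2. There remains 1 - 1/2 - 1/4 = 1/4, and 4/5 of it is the 1/5 of the
      statement.\<close>
    have "(m / 4) powr (q / 2) * (4 / 5 * (2 ^ card J - 2 ^ card J / 2 - 2 ^ card J / 4))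
      \<le> (m / 4) powr (q / 2) * (4 / 5 * ((\<Sum>A\<in>Pow J. ?S A ^ 2) / m - (\<Sum>A\<in>Pow J. ?S A ^ 4) / (6 * m\<^sup>2) - 2 ^ card J / 4))"
    proof (intro mult_left_mono diff_right_mono diff_mono)
      show "2 ^ card J \<le> (\<Sum>A\<in>Pow J. ?S A ^ 2) / m"
        unfolding signed_sum_moments(1)[OF J] m_def[symmetric] using m by simp
      have "(\<Sum>A\<in>Pow J. ?S A ^ 4) / (6 * m\<^sup>2) \<le> (2 ^ card J * (3 * m\<^sup>2)) / (6 * m\<^sup>2)"
        using signed_sum_moments(2)[OF J, of x] m unfolding m_def[symmetric] by (intro divide_right_mono) auto
      then show "(\<Sum>A\<in>Pow J. ?S A ^ 4) / (6 * m\<^sup>2) \<le> 2 ^ card J / 2"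
        using m by simp
    qed auto
    also have "\<dots> = (m / 4) powr (q / 2) * (4 / 5 * (\<Sum>A\<in>Pow J. ?S A ^ 2 / m - ?S A ^ 4 / (6 * m\<^sup>2) - 1 / 4))"
      using J by (simp only: sum_subtractf sum_divide_distrib[symmetric] sum_constant card_Pow) simp
    also have "\<dots> = (\<Sum>A\<in>Pow J. (m / 4) powr (q / 2) * (4 / 5 * (?S A ^ 2 / m - ?S A ^ 4 / (6 * m\<^sup>2) - 1 / 4)))"
      by (simp only: sum_distrib_left)
    also have "\<dots> \<le> (\<Sum>A\<in>Pow J. ?S A powr q)" by (intro sum_mono pt)
    finally have "(m / 4) powr (q / 2) * (2 ^ card J / 5) \<le> (\<Sum>A\<in>Pow J. ?S A powr q)" by simp
    moreover have "(m / 4) powr (q / 2) = m powr (q / 2) / 4 powr (q / 2)" using m by (simp add: powr_divide)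
    ultimately show ?thesis unfolding m_def[symmetric] by (simp add: field_simps)
  qed
qed

section \<open>Weights with two-sided doubling\<close>

lemma emeasure_radial_measure:
  assumes [measurable]: "w \<in> borel_measurable borel"
  shows "emeasure (radial_measure w) {x..} = (\<integral>\<^sup>+s\<in>{max 0 x..<1}. w s \<partial>lborel)"
proof -
  have "emeasure (radial_measure w) {x..} = (\<integral>\<^sup>+s. w s * indicator {0..<1} s * indicator {x..} s \<partial>lborel)"
    unfolding radial_measure_def by (subst emeasure_density) auto
  also have "\<dots> = (\<integral>\<^sup>+s\<in>{max 0 x..<1}. w s \<partial>lborel)"
    by (intro nn_integral_cong) (auto simp: indicator_def)
  finally show ?thesis .
qed

lemma nn_integral_power_reflect:
  "(\<integral>\<^sup>+s\<in>{max 0 (1 - x)..<1}. ennreal ((1 - s) powr c) \<partial>lborel)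
    = (\<integral>\<^sup>+u\<in>{0<..min 1 x}. ennreal (u powr c) \<partial>lborel)"
proof -
  have "(\<integral>\<^sup>+u\<in>{0<..min 1 x}. ennreal (u powr c) \<partial>lborel)
    = (\<integral>\<^sup>+s. ennreal ((1 + (- 1) * s) powr c) * indicator {0<..min 1 x} (1 + (- 1) * s) \<partial>lborel)"
    using nn_integral_real_affine[of "\<lambda>u. ennreal (u powr c) * indicator {0<..min 1 x} u" "-1" 1] by simp
  also have "\<dots> = (\<integral>\<^sup>+s\<in>{max 0 (1 - x)..<1}. ennreal ((1 - s) powr c) \<partial>lborel)"
    by (intro nn_integral_cong) (auto simp: indicator_def)
  finally show ?thesis by simp
qed

lemma nn_integral_power_scale:
  "(\<integral>\<^sup>+u\<in>{0<..2 * x}. ennreal (u powr c) \<partial>lborel)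
    = ennreal (2 powr (c + 1)) * (\<integral>\<^sup>+u\<in>{0<..x}. ennreal (u powr c) \<partial>lborel)"
proof -
  have "(\<integral>\<^sup>+u\<in>{0<..2 * x}. ennreal (u powr c) \<partial>lborel)
    = 2 * (\<integral>\<^sup>+v. ennreal ((2 * v) powr c) * indicator {0<..2 * x} (2 * v) \<partial>lborel)"
    using nn_integral_real_affine[of "\<lambda>u. ennreal (u powr c) * indicator {0<..2 * x} u" 2 0] by simp
  also have "(\<integral>\<^sup>+v. ennreal ((2 * v) powr c) * indicator {0<..2 * x} (2 * v) \<partial>lborel)
    = (\<integral>\<^sup>+v. ennreal (2 powr c) * (ennreal (v powr c) * indicator {0<..x} v) \<partial>lborel)"
    by (intro nn_integral_cong) (auto simp: indicator_def powr_mult ennreal_mult)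
  also have "\<dots> = ennreal (2 powr c) * (\<integral>\<^sup>+u\<in>{0<..x}. ennreal (u powr c) \<partial>lborel)"
    by (rule nn_integral_cmult) measurable
  also have "2 * (ennreal (2 powr c) * (\<integral>\<^sup>+u\<in>{0<..x}. ennreal (u powr c) \<partial>lborel))
     = ennreal (2 powr (c + 1)) * (\<integral>\<^sup>+u\<in>{0<..x}. ennreal (u powr c) \<partial>lborel)"
    by (simp add: powr_add ennreal_mult mult_ac)
  finally show ?thesis .
qed

text \<open>The weight (1 - |z|)^c with c = M - t - n - 1 >= 0, without singular factor. Its tail is
  homogeneous of degree c + 1 for small arguments, so 2^(c+1) serves as constant in both doubling
  conditions. The result drives the kernel sums over a lattice.\<close>

lemma ball_integral_kernel_power:
  fixes M t :: real
  assumes t: "0 < t" and M: "real CARD('n) + 1 + t \<le> M"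
  shows "\<exists>B>0. \<forall>a :: complex ^ 'n. norm a < 1 \<longrightarrow>
    (\<integral>\<^sup>+z\<in>unit_ball. ennreal (kdist a z powr (- M) * (1 - norm z) powr (M - t - CARD('n) - 1)) \<partial>lborel)
      \<le> ennreal (B * (1 - norm a) powr (- t))"
proof -
  define c where "c = M - t - CARD('n) - 1"
  have c: "0 \<le> c" using M by (simp add: c_def)
  define w where "w s = ennreal ((1 - s) powr c)" for s :: real
  have w[measurable]: "w \<in> borel_measurable borel" unfolding w_def by measurable
  define G where "G x = (\<integral>\<^sup>+u\<in>{0<..x}. ennreal (u powr c) \<partial>lborel)" for x
  have em: "emeasure (radial_measure w) {1 - x..} = G (min 1 x)" for x
    unfolding emeasure_radial_measure[OF w] w_def G_def by (rule nn_integral_power_reflect)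
  have Gmono: "G x \<le> G y" if "x \<le> y" for x y
    unfolding G_def using that by (intro nn_integral_mono) (auto simp: indicator_def)
  have G2: "G (2 * x) = ennreal (2 powr (c + 1)) * G x" for x
    unfolding G_def by (rule nn_integral_power_scale)
  have Gle: "G x \<le> ennreal (x powr (c + 1))" if "0 < x" for x
  proof -
    have "G x \<le> (\<integral>\<^sup>+u. ennreal (x powr c) * indicator {0<..x} u \<partial>lborel)"
      unfolding G_def using c by (intro nn_integral_mono) (auto simp: indicator_def intro!: ennreal_leI powr_mono2)
    also have "\<dots> = ennreal (x powr c * x)"
      using that by (subst nn_integral_times_indicator) (auto simp: ennreal_mult)
    also have "x powr c * x = x powr (c + 1)" using that by (simp add: powr_add)
    finally show ?thesis .
  qed
  have "\<exists>B>0. \<forall>a :: complex ^ 'n. norm a < 1 \<longrightarrow>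
    (\<integral>\<^sup>+z\<in>unit_ball. ennreal (kdist a z powr (- M) * (1 - norm z) powr (- 0)) * w (norm z) \<partial>lborel)
      \<le> ennreal (B * (1 - norm a) powr (CARD('n) - M - 0)) * emeasure (radial_measure w) {norm a..}"
  proof (rule ball_integral_kernel[where C = "2 powr (c + 1)" and K = 2 and C' = "2 powr (c + 1)"])
    show "1 \<le> 2 powr (c + 1)" using c by (simp add: ge_one_powr_ge_zero)
    show "2 powr (c + 1) < 2 powr (M - CARD('n) + 0)" using t by (simp add: c_def)
    show "2 powr (0::real) < 2 powr (c + 1)" using c by (intro powr_less_mono) auto
    show "emeasure (radial_measure w) {1 - 2 * x..} \<le> ennreal (2 powr (c + 1)) * emeasure (radial_measure w) {1 - x..}" if "0 < x" for x
    proof -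
      have "emeasure (radial_measure w) {1 - 2 * x..} \<le> G (2 * min 1 x)"
        unfolding em by (rule Gmono) (use that in auto)
      then show ?thesis by (simp add: em G2)
    qed
    show "ennreal (2 powr (c + 1)) * emeasure (radial_measure w) {1 - x / 2..} \<le> emeasure (radial_measure w) {1 - x..}" if "0 < x" "x \<le> 1" for x
    proof -
      have m: "min 1 (x / 2) = x / 2" "min 1 x = x" using that by auto
      show ?thesis unfolding em m G2[symmetric] by simp
    qed
  qed (use w M t in auto)
  then obtain B where B: "0 < B" "\<forall>a :: complex ^ 'n. norm a < 1 \<longrightarrow>
    (\<integral>\<^sup>+z\<in>unit_ball. ennreal (kdist a z powr (- M) * (1 - norm z) powr (- 0)) * w (norm z) \<partial>lborel)
      \<le> ennreal (B * (1 - norm a) powr (CARD('n) - M - 0)) * emeasure (radial_measure w) {norm a..}" by blast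
  have "(\<integral>\<^sup>+z\<in>unit_ball. ennreal (kdist a z powr (- M) * (1 - norm z) powr c) \<partial>lborel)
      \<le> ennreal (B * (1 - norm a) powr (- t))" if a: "norm a < 1" for a :: "complex ^ 'n"
  proof -
    have "(\<integral>\<^sup>+z\<in>unit_ball. ennreal (kdist a z powr (- M) * (1 - norm z) powr c) \<partial>lborel)
      = (\<integral>\<^sup>+z\<in>unit_ball. ennreal (kdist a z powr (- M) * (1 - norm z) powr (- 0)) * w (norm z) \<partial>lborel)"
      by (intro nn_integral_cong) (auto simp: w_def indicator_def ennreal_mult[symmetric])
    also have "\<dots> \<le> ennreal (B * (1 - norm a) powr (CARD('n) - M)) * emeasure (radial_measure w) {norm a..}"
      using B(2) a by simp
    also have "emeasure (radial_measure w) {norm a..} \<le> ennreal ((1 - norm a) powr (c + 1))"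
    proof -
      have "emeasure (radial_measure w) {1 - (1 - norm a)..} = G (1 - norm a)" unfolding em by (simp add: min_def)
      then show ?thesis using Gle[of "1 - norm a"] a by simp
    qed
    also have "ennreal (B * (1 - norm a) powr (CARD('n) - M)) * ennreal ((1 - norm a) powr (c + 1))
      = ennreal (B * ((1 - norm a) powr (CARD('n) - M) * (1 - norm a) powr (c + 1)))"
      using B(1) by (simp add: ennreal_mult mult.assoc)
    also have "(1 - norm a) powr (CARD('n) - M) * (1 - norm a) powr (c + 1) = (1 - norm a) powr (- t)"
      by (simp add: powr_add[symmetric] c_def)
    finally show ?thesis by (simp add: mult_left_mono)
  qed
  with B(1) show ?thesis unfolding c_def by blast
qed

lemma unit_ball_volume:
  "emeasure lborel (unit_ball :: (complex ^ 'n) set) \<noteq> 0" "emeasure lborel (unit_ball :: (complex ^ 'n) set) \<noteq> \<infinity>"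
proof -
  have "0 < unit_ball_vol (real (2 * CARD('n)))" by simp
  then show "emeasure lborel (unit_ball :: (complex ^ 'n) set) \<noteq> 0" 
    by (subst emeasure_ball_complex_vec) (auto simp del: unit_ball_vol_pos)
  show "emeasure lborel (unit_ball :: (complex ^ 'n) set) \<noteq> \<infinity>" by (subst emeasure_ball_complex_vec) auto
qed

lemma nn_integral_dV:
  fixes F :: "complex ^ 'n \<Rightarrow> ennreal"
  assumes [measurable]: "(\<lambda>z. F z * indicator unit_ball z) \<in> borel_measurable borel"
  shows "(\<integral>\<^sup>+z. F z \<partial>dV) = (\<integral>\<^sup>+z\<in>unit_ball. F z \<partial>lborel) / emeasure lborel (unit_ball :: (complex ^ 'n) set)"
proof -
  have "(\<integral>\<^sup>+z. F z \<partial>dV) = (\<integral>\<^sup>+z. F z * indicator unit_ball z \<partial>dV)"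
    unfolding dV_def by (intro nn_integral_cong_AE AE_uniform_measureI) auto
  also have "\<dots> = (\<integral>\<^sup>+z. F z * indicator unit_ball z * indicator unit_ball z \<partial>lborel) / emeasure lborel (unit_ball :: (complex ^ 'n) set)"
    unfolding dV_def by (rule nn_integral_uniform_measure) auto
  also have "(\<integral>\<^sup>+z. F z * indicator unit_ball z * indicator unit_ball z \<partial>lborel) = (\<integral>\<^sup>+z\<in>unit_ball. F z \<partial>lborel)"
    by (intro nn_integral_cong) (auto simp: indicator_def)
  finally show ?thesis .
qed

section \<open>Weights in the doubling class: tails, regularization, kernel integrals\<close>

locale D_weight =
  fixes T :: "'n::finite itself" and \<omega> :: "real \<Rightarrow> real"
  assumes D_class: "D_class T \<omega>"
begin

lemma weight_measurable [measurable]: "\<omega> \<in> borel_measurable borel"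
  and weight_pos: "0 \<le> s \<Longrightarrow> s < 1 \<Longrightarrow> 0 < \<omega> s"
  and weight_integrable: "(\<integral>\<^sup>+z. ennreal (\<omega> (norm z)) \<partial>(dV :: (complex ^ 'n) measure)) < \<infinity>"
  using D_class unfolding D_class_def D_hat_def radial_weight_def by auto

definition wmeas :: "real measure" where
  "wmeas = radial_measure (\<lambda>s. ennreal (\<omega> s))"

lemma emeasure_wmeas: "emeasure wmeas {x..} = omega_hat \<omega> (max 0 x)"
  unfolding wmeas_def by (subst emeasure_radial_measure) (auto simp: omega_hat_def)

text \<open>Integrates over \<open>lborel\<close>, where translations and polar coordinates are at
  hand; it differs from \<open>Ap_norm_p\<close> by the volume of the ball
  (\<open>Ap_norm_p_eq\<close>).\<close>

definition wnorm :: "real \<Rightarrow> (complex ^ 'n \<Rightarrow> complex) \<Rightarrow> ennreal" where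
  "wnorm p f = (\<integral>\<^sup>+z. ball_pow p f z * ennreal (\<omega> (norm z)) \<partial>lborel)"

lemma Ap_norm_p_eq:
  assumes f: "holo_on unit_ball f"
  shows "Ap_norm_p p \<omega> f = wnorm p f / emeasure lborel (unit_ball :: (complex ^ 'n) set)"
proof -
  have eq: "ennreal (cmod (f z) powr p * \<omega> (norm z)) * indicator unit_ball z = ball_pow p f z * ennreal (\<omega> (norm z))" for z :: "complex ^ 'n"
    by (simp add: ball_pow_def indicator_def ennreal_mult')
  have "(\<lambda>z. ennreal (cmod (f z) powr p * \<omega> (norm z)) * indicator unit_ball z) \<in> borel_measurable borel"
    unfolding eq using borel_measurable_ball_pow[OF f] by measurable
  then show ?thesis unfolding Ap_norm_p_def wnorm_def by (subst nn_integral_dV) (simp_all only: eq)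
qed

text \<open>Integrability over the ball carries the polar density s^(2n-1), which degenerates at 0,
  so at first only tails away from 0 are finite. The upper doubling condition at r = 0 later extends
  this to the full tail.\<close>

lemma omega_hat_half_finite: "omega_hat \<omega> (1/2) < \<infinity>"
proof -
  have h1: "holo_on unit_ball (\<lambda>z :: complex ^ 'n. 1)"
    unfolding holo_on_def by (intro ballI exI[of _ "\<lambda>_. 0"]) auto
  have "(\<integral>\<^sup>+z\<in>unit_ball. ennreal (\<omega> (norm z)) \<partial>(lborel :: (complex ^ 'n) measure)) / emeasure lborel (unit_ball :: (complex ^ 'n) set) < \<infinity>"
    using weight_integrable by (subst (asm) nn_integral_dV) auto
  then have "(\<integral>\<^sup>+z\<in>unit_ball. ennreal (\<omega> (norm z)) \<partial>(lborel :: (complex ^ 'n) measure)) < \<infinity>"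
    using unit_ball_volume(2)[where 'n = 'n] by (auto simp: ennreal_top_divide less_top[symmetric] intro!: ccontr[of "_ < _"])
  then have fin: "(\<integral>\<^sup>+z. ball_pow 1 (\<lambda>z :: complex ^ 'n. 1) z * ennreal (\<omega> (norm z)) \<partial>lborel) < \<infinity>"
    by (simp add: ball_pow_def mult.commute)
  define V where "V = emeasure lborel (unit_ball :: (complex ^ 'n) set)"
  have sm: "sphere_mean 1 (\<lambda>z :: complex ^ 'n. 1) s = V" if "0 \<le> s" "s < 1" for s
  proof -
    have "s *\<^sub>R sgn w \<in> unit_ball" for w :: "complex ^ 'n" using that by (simp add: norm_sgn)
    then show ?thesis unfolding sphere_mean_def ball_pow_def by (simp add: V_def)
  qed
  define c where "c = (1/2 :: real) ^ (2 * CARD('n))"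
  have "ennreal c * V * omega_hat \<omega> (1/2) = (\<integral>\<^sup>+s. ennreal c * V * (ennreal (\<omega> s) * indicator {1/2..<1} s) \<partial>lborel)"
    unfolding omega_hat_def by (rule nn_integral_cmult[symmetric]) measurable
  also have "\<dots> \<le> (\<integral>\<^sup>+s\<in>{0<..<1}. ennreal (2 * CARD('n) * s ^ (2 * CARD('n) - 1)) * (ennreal (\<omega> s) * sphere_mean 1 (\<lambda>z :: complex ^ 'n. 1) s) \<partial>lborel)"
  proof (rule nn_integral_mono)
    fix s :: real
    show "ennreal c * V * (ennreal (\<omega> s) * indicator {1/2..<1} s) \<le> ennreal (2 * CARD('n) * s ^ (2 * CARD('n) - 1)) * (ennreal (\<omega> s) * sphere_mean 1 (\<lambda>z :: complex ^ 'n. 1) s) * indicator {0<..<1} s"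
    proof (cases "s \<in> {1/2..<1}")
      case s: True
      have "c \<le> 1 * (1/2) ^ (2 * CARD('n) - 1)" unfolding c_def mult_1 by (rule power_decreasing) auto
      also have "\<dots> \<le> (2 * CARD('n)) * s ^ (2 * CARD('n) - 1)"
      proof (intro mult_mono power_mono)
        have "1 \<le> 2 * CARD('n)" using zero_less_card_finite[where 'a = 'n] by linarith
        then show "1 \<le> real (2 * CARD('n))" by (metis of_nat_1 of_nat_le_iff)
      qed (use s in auto)
      finally have "ennreal c * (V * ennreal (\<omega> s)) \<le> ennreal (2 * CARD('n) * s ^ (2 * CARD('n) - 1)) * (V * ennreal (\<omega> s))"
        by (intro mult_right_mono ennreal_leI) auto
      then show ?thesis using s by (simp add: sm mult_ac)
    qed simp
  qed
  also have "\<dots> = (\<integral>\<^sup>+z. ball_pow 1 (\<lambda>z :: complex ^ 'n. 1) z * ennreal (\<omega> (norm z)) \<partial>lborel)"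
    by (rule nn_integral_ball_polar_radial[OF h1, symmetric]) measurable
  finally have "ennreal c * V * omega_hat \<omega> (1/2) < \<infinity>" using fin by (rule le_less_trans)
  moreover have "ennreal c * V \<noteq> 0" using unit_ball_volume(1)[where 'n = 'n] by (simp add: V_def c_def)
  ultimately show ?thesis by (auto simp: ennreal_mult_less_top ennreal_mult_eq_top_iff less_top)
qed

lemma omega_hat_antimono: "0 \<le> x \<Longrightarrow> x \<le> y \<Longrightarrow> omega_hat \<omega> y \<le> omega_hat \<omega> x"
  unfolding omega_hat_def by (intro nn_integral_mono) (auto simp: indicator_def)

lemma wmeas_antimono: "x \<le> y \<Longrightarrow> emeasure wmeas {y..} \<le> emeasure wmeas {x..}"
  unfolding emeasure_wmeas by (intro omega_hat_antimono) auto

text \<open>Extends the condition to every x > 0. For x > 1/2 the left tail is the full one, and the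
  condition at r = 0 with monotonicity is enough.\<close>

lemma wmeas_doubling: "\<exists>C\<ge>1. \<forall>x>0. emeasure wmeas {1 - 2 * x..} \<le> ennreal C * emeasure wmeas {1 - x..}"
proof -
  obtain C where C: "1 \<le> C" "\<And>r. r \<in> {0..<1} \<Longrightarrow> omega_hat \<omega> r \<le> ennreal C * omega_hat \<omega> ((1 + r) / 2)"
    using D_class unfolding D_class_def D_hat_def by blast
  have "emeasure wmeas {1 - 2 * x..} \<le> ennreal C * emeasure wmeas {1 - x..}" if x: "0 < x" for x
  proof (cases "x \<le> 1/2")
    case True
    have e: "max 0 (1 - 2 * x) = 1 - 2 * x" "max 0 (1 - x) = (1 + (1 - 2 * x)) / 2" using True x by auto
    show ?thesis unfolding emeasure_wmeas e by (rule C(2)) (use True x in auto)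
  next
    case False
    have "emeasure wmeas {1 - 2 * x..} = omega_hat \<omega> 0" using False by (simp add: emeasure_wmeas)
    also have "\<dots> \<le> ennreal C * omega_hat \<omega> (1/2)" using C(2)[of 0] by simp
    also have "\<dots> \<le> ennreal C * emeasure wmeas {1 - x..}"
      unfolding emeasure_wmeas using False by (intro mult_left_mono omega_hat_antimono) (auto simp: max_def)
    finally show ?thesis .
  qed
  with C(1) show ?thesis by blast
qed

lemma wmeas_check: "\<exists>C>1. \<exists>K>1. \<forall>x. 0 < x \<longrightarrow> x \<le> 1 \<longrightarrow> ennreal C * emeasure wmeas {1 - x / K..} \<le> emeasure wmeas {1 - x..}"
proof -
  obtain C K where C: "1 < C" "1 < K" "\<And>r. r \<in> {0..<1} \<Longrightarrow> omega_hat \<omega> r \<ge> ennreal C * omega_hat \<omega> (1 - (1 - r) / K)"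
    using D_class unfolding D_class_def D_check_def by blast
  have "ennreal C * emeasure wmeas {1 - x / K..} \<le> emeasure wmeas {1 - x..}" if "0 < x" "x \<le> 1" for x
  proof -
    have "x / K \<le> 1" using that C by (simp add: field_simps)
    then have m: "max 0 (1 - x / K) = 1 - (1 - (1 - x)) / K" "max 0 (1 - x) = 1 - x" using that by auto
    show ?thesis unfolding emeasure_wmeas m by (rule C(3)) (use that in auto)
  qed
  with C(1,2) show ?thesis by blast
qed

lemma wmeas_finite: "emeasure wmeas {x..} < \<infinity>"
proof -
  obtain C where C: "\<And>x. 0 < x \<Longrightarrow> emeasure wmeas {1 - 2 * x..} \<le> ennreal C * emeasure wmeas {1 - x..}"
    using wmeas_doubling by blast
  have "emeasure wmeas {x..} \<le> emeasure wmeas {0..}"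
    unfolding emeasure_wmeas by (intro omega_hat_antimono) auto
  also have "\<dots> \<le> ennreal C * emeasure wmeas {1/2..}" using C[of "1/2"] by simp
  also have "\<dots> < \<infinity>" using omega_hat_half_finite by (simp add: emeasure_wmeas ennreal_mult_less_top max_def)
  finally show ?thesis .
qed

lemma wmeas_pos: "x < 1 \<Longrightarrow> 0 < emeasure wmeas {x..}"
proof (rule ccontr)
  assume x: "x < 1" and "\<not> 0 < emeasure wmeas {x..}"
  then have "(\<integral>\<^sup>+s. ennreal (\<omega> s) * indicator {max 0 x..<1} s \<partial>lborel) = 0"
    by (simp add: emeasure_wmeas omega_hat_def)
  then have "AE s in lborel. ennreal (\<omega> s) * indicator {max 0 x..<1} s = 0"
    by (subst (asm) nn_integral_0_iff_AE) auto
  then have "AE s in lborel. s \<notin> {max 0 x..<1}"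
    by eventually_elim (use weight_pos in \<open>force simp: indicator_def\<close>)
  then have "(\<integral>\<^sup>+s. indicator {max 0 x..<1} s \<partial>lborel) = (\<integral>\<^sup>+s. 0 \<partial>(lborel :: real measure))"
    by (intro nn_integral_cong_AE) (auto simp: indicator_def elim: eventually_mono)
  then have "emeasure lborel {max 0 x..<1} = 0" by simp
  then show False using x by auto
qed

text \<open>The real-valued tail of \<omega>, equal to its value at 0 for negative
  arguments.\<close>

definition tl :: "real \<Rightarrow> real" where
  "tl x = enn2real (emeasure wmeas {x..})"

lemma ennreal_tl: "ennreal (tl x) = emeasure wmeas {x..}"
  using wmeas_finite[of x] by (simp add: tl_def less_top)

lemma tl_pos: "x < 1 \<Longrightarrow> 0 < tl x"
  using wmeas_pos[of x] wmeas_finite[of x] by (simp add: tl_def enn2real_positive_iff)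

lemma tl_nonneg: "0 \<le> tl x" by (simp add: tl_def)

lemma tl_antimono: "x \<le> y \<Longrightarrow> tl y \<le> tl x"
  using wmeas_antimono[of x y] by (simp add: ennreal_tl[symmetric] tl_nonneg)

lemma borel_measurable_tl [measurable]: "tl \<in> borel_measurable borel"
proof -
  have "(\<lambda>x. - tl x) \<in> borel_measurable borel"
    by (rule borel_measurable_mono) (auto simp: mono_def tl_antimono)
  then show ?thesis by simp
qed

text \<open>For near points the distances to the sphere differ by a factor of at most 4A, which
  doubling covers in k steps once 2^k > 4A.\<close>

lemma tl_near: "\<exists>B>0. \<forall>a z :: complex ^ 'n. norm a < 1 \<longrightarrow> norm z < 1 \<longrightarrow> near A a z \<longrightarrow> tl (norm a) \<le> B * tl (norm z)"
proof -
  obtain C where C: "1 \<le> C" "\<And>x. 0 < x \<Longrightarrow> emeasure wmeas {1 - 2 * x..} \<le> ennreal C * emeasure wmeas {1 - x..}"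
    using wmeas_doubling by blast
  have C1: "tl (1 - 2 * x) \<le> C * tl (1 - x)" if "0 < x" for x
    using C(2)[OF that] C(1) by (simp add: ennreal_tl[symmetric] ennreal_mult[symmetric] tl_nonneg)
  have Ck: "tl (1 - 2 ^ k * x) \<le> C ^ k * tl (1 - x)" if "0 < x" for x k
  proof (induction k)
    case (Suc k)
    have "tl (1 - 2 ^ Suc k * x) \<le> C * tl (1 - 2 ^ k * x)" using C1[of "2 ^ k * x"] that by (simp add: mult.assoc)
    also have "\<dots> \<le> C * (C ^ k * tl (1 - x))" using C(1) Suc by (intro mult_left_mono) auto
    finally show ?case by simp
  qed simp
  obtain k where k: "4 * A < 2 ^ k" using real_arch_pow[of 2 "4 * A"] by auto
  have "tl (norm a) \<le> C ^ k * tl (norm z)" if a: "norm a < 1" and z: "norm z < 1" and n: "near A a z" for a z :: "complex ^ 'n"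
  proof -
    have A: "0 < A" using near_pos[OF n] a z by simp
    have "1 - norm a \<le> bgap a" using bgap_bounds a by simp
    also have "\<dots> \<le> 2 * A * bgap z" using near_bgap[OF n] a z by simp
    also have "\<dots> \<le> 2 * A * (2 * (1 - norm z))" using bgap_bounds[of z] z A by (intro mult_left_mono) auto
    also have "\<dots> = 4 * A * (1 - norm z)" by simp
    also have "\<dots> \<le> 2 ^ k * (1 - norm z)" using k z by (intro mult_right_mono) auto
    finally have "1 - 2 ^ k * (1 - norm z) \<le> norm a" by simp
    then have "tl (norm a) \<le> tl (1 - 2 ^ k * (1 - norm z))" by (rule tl_antimono)
    also have "\<dots> \<le> C ^ k * tl (1 - (1 - norm z))" using z by (intro Ck) simp
    finally show ?thesis by simp
  qed
  then show ?thesis using C(1) by (intro exI[of _ "C ^ k"]) auto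
qed

text \<open>Here membership in the lower class lets the irregular weight be replaced by the regular one
  \<open>tl(|z|)/(1-|z|)\<close>: the mass \<open>tl(s)\<close> is comparable to that of \<open>\<omega>\<close> on \<open>[s, 1 - (1-s)/K)\<close>,
  and the spherical means of \<open>|f|\<^sup>p\<close> are increasing.\<close>
lemma regular_norm_le:
  "\<exists>B>0. \<forall>p>0. \<forall>f :: complex ^ 'n \<Rightarrow> complex. holo_on unit_ball f \<longrightarrow>
    (\<integral>\<^sup>+z. ball_pow p f z * ennreal (tl (norm z) / (1 - norm z)) \<partial>lborel) \<le> ennreal B * wnorm p f"
proof -
  obtain C K where C: "1 < C" "1 < K" and chk: "\<And>x. 0 < x \<Longrightarrow> x \<le> 1 \<Longrightarrow> ennreal C * emeasure wmeas {1 - x / K..} \<le> emeasure wmeas {1 - x..}"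
    using wmeas_check by blast
  define B where "B = C / (C - 1) * (K - 1)"
  define up where "up s = 1 - (1 - s) / K" for s :: real
  \<comment> \<open>As \<open>C * tl (up s)\<close> is at most \<open>tl s\<close>, at least the
    fraction 1 - 1/C of the tail mass sits on [s, up s).\<close>
  have tl_le: "ennreal (tl s) \<le> ennreal (C / (C - 1)) * (\<integral>\<^sup>+t\<in>{s..<up s}. ennreal (\<omega> t) \<partial>lborel)" if s: "0 < s" "s < 1" for s
  proof -
    have su: "s \<le> up s" "up s < 1" "0 \<le> up s"
    proof -
      have "(1 - s) / K \<le> 1 - s" using s C mult_left_mono[of 1 K "1 - s"] by (simp add: pos_divide_le_eq)
      then show "s \<le> up s" by (simp add: up_def)
      then show "0 \<le> up s" using s by simp
      show "up s < 1" using s C by (simp add: up_def)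
    qed
    define I where "I = (\<integral>\<^sup>+t\<in>{s..<up s}. ennreal (\<omega> t) \<partial>lborel)"
    have "ennreal (tl s) = (\<integral>\<^sup>+t\<in>{s..<1}. ennreal (\<omega> t) \<partial>lborel)"
      using s by (simp add: ennreal_tl emeasure_wmeas omega_hat_def)
    also have "\<dots> = (\<integral>\<^sup>+t. ennreal (\<omega> t) * indicator {s..<up s} t + ennreal (\<omega> t) * indicator {up s..<1} t \<partial>lborel)"
      using su by (intro nn_integral_cong) (auto simp: indicator_def)
    also have "\<dots> = I + ennreal (tl (up s))"
      using su by (subst nn_integral_add) (auto simp: I_def ennreal_tl emeasure_wmeas omega_hat_def)
    finally have e: "ennreal (tl s) = I + ennreal (tl (up s))" .
    then have "I \<le> ennreal (tl s)" by simp
    then have Ifin: "I < top" using ennreal_less_top le_less_trans by blast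
    then obtain i where i: "I = ennreal i" "0 \<le> i" by (cases I rule: ennreal_cases) auto
    have e': "tl s = i + tl (up s)"
      using e unfolding i(1) by (simp add: i(2) tl_nonneg flip: ennreal_plus)
    have "C * tl (up s) \<le> tl s"
      using chk[of "1 - s"] s C unfolding up_def by (simp add: ennreal_tl[symmetric] ennreal_mult[symmetric] tl_nonneg)
    then have "(C - 1) * tl s \<le> C * i" using e' by (simp add: algebra_simps)
    then have "tl s \<le> C / (C - 1) * i" using C by (simp add: field_simps)
    then show ?thesis unfolding I_def[symmetric] i(1) using C i(2) by (simp add: ennreal_mult[symmetric])
  qed
  have "(\<integral>\<^sup>+z. ball_pow p f z * ennreal (tl (norm z) / (1 - norm z)) \<partial>lborel) \<le> ennreal B * wnorm p f"
    if p: "0 < p" and f: "holo_on unit_ball f" for p and f :: "complex ^ 'n \<Rightarrow> complex"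
  proof -
    note [measurable] = borel_measurable_ball_pow[OF f]
    define A where "A s = ennreal (2 * CARD('n) * s ^ (2 * CARD('n) - 1)) * sphere_mean p f s" for s :: real
    have [measurable]: "sphere_mean p f \<in> borel_measurable borel" unfolding sphere_mean_def by measurable
    have [measurable]: "A \<in> borel_measurable borel" unfolding A_def by measurable
    have Amono: "A s \<le> A t" if "0 < s" "s \<le> t" "t < 1" for s t
      unfolding A_def using that sphere_mean_mono[OF f p, of s t]
      by (intro mult_mono ennreal_leI mult_left_mono power_mono) auto
    have "(\<integral>\<^sup>+z. ball_pow p f z * ennreal (tl (norm z) / (1 - norm z)) \<partial>lborel)
      = (\<integral>\<^sup>+s\<in>{0<..<1}. ennreal (2 * CARD('n) * s ^ (2 * CARD('n) - 1)) * (ennreal (tl s / (1 - s)) * sphere_mean p f s) \<partial>lborel)"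
      by (rule nn_integral_ball_polar_radial[OF f]) measurable
    also have "\<dots> \<le> (\<integral>\<^sup>+s. \<integral>\<^sup>+t. ennreal (C / (C - 1)) * (ennreal (\<omega> t) * (if 0 < s \<and> s < 1 \<and> s \<le> t \<and> t < up s then A s * ennreal (1 / (1 - s)) else 0)) \<partial>lborel \<partial>lborel)"
    proof (rule nn_integral_mono)
      fix s :: real
      show "ennreal (2 * CARD('n) * s ^ (2 * CARD('n) - 1)) * (ennreal (tl s / (1 - s)) * sphere_mean p f s) * indicator {0<..<1} s
        \<le> (\<integral>\<^sup>+t. ennreal (C / (C - 1)) * (ennreal (\<omega> t) * (if 0 < s \<and> s < 1 \<and> s \<le> t \<and> t < up s then A s * ennreal (1 / (1 - s)) else 0)) \<partial>lborel)"
      proof (cases "s \<in> {0<..<1}")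
        case True
        then have s: "0 < s" "s < 1" by auto
        have "ennreal (2 * CARD('n) * s ^ (2 * CARD('n) - 1)) * (ennreal (tl s / (1 - s)) * sphere_mean p f s) = A s * ennreal (1 / (1 - s)) * ennreal (tl s)"
        proof -
          have "ennreal (tl s / (1 - s)) = ennreal (1 / (1 - s)) * ennreal (tl s)"
            using s by (simp add: ennreal_mult[symmetric] tl_nonneg)
          then show ?thesis by (simp only: A_def mult_ac)
        qed
        also have "\<dots> \<le> A s * ennreal (1 / (1 - s)) * (ennreal (C / (C - 1)) * (\<integral>\<^sup>+t\<in>{s..<up s}. ennreal (\<omega> t) \<partial>lborel))"
          by (intro mult_left_mono tl_le s) simp
        also have "\<dots> = (\<integral>\<^sup>+t. A s * ennreal (1 / (1 - s)) * (ennreal (C / (C - 1)) * (ennreal (\<omega> t) * indicator {s..<up s} t)) \<partial>lborel)"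
          by (subst nn_integral_cmult[symmetric], measurable)+
        also have "\<dots> = (\<integral>\<^sup>+t. ennreal (C / (C - 1)) * (ennreal (\<omega> t) * (if 0 < s \<and> s < 1 \<and> s \<le> t \<and> t < up s then A s * ennreal (1 / (1 - s)) else 0)) \<partial>lborel)"
          using s by (intro nn_integral_cong) (auto simp: indicator_def mult_ac)
        finally show ?thesis using True by simp
      qed simp
    qed
    also have "\<dots> = (\<integral>\<^sup>+t. \<integral>\<^sup>+s. ennreal (C / (C - 1)) * (ennreal (\<omega> t) * (if 0 < s \<and> s < 1 \<and> s \<le> t \<and> t < up s then A s * ennreal (1 / (1 - s)) else 0)) \<partial>lborel \<partial>lborel)"
      unfolding up_def by (rule lborel_pair.Fubini') measurable
    \<comment> \<open>For fixed t the admissible s lie in an interval of length (K - 1)(1 - t),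
      while 1/(1 - s) <= 1/(1 - t) and \<open>A s\<close> is at most \<open>A t\<close>; the powers
      of 1 - t cancel.\<close>
    also have "\<dots> \<le> (\<integral>\<^sup>+t. ennreal B * (ennreal (2 * CARD('n) * t ^ (2 * CARD('n) - 1)) * (ennreal (\<omega> t) * sphere_mean p f t) * indicator {0<..<1} t) \<partial>lborel)"
    proof (rule nn_integral_mono)
      fix t :: real
      show "(\<integral>\<^sup>+s. ennreal (C / (C - 1)) * (ennreal (\<omega> t) * (if 0 < s \<and> s < 1 \<and> s \<le> t \<and> t < up s then A s * ennreal (1 / (1 - s)) else 0)) \<partial>lborel)
         \<le> ennreal B * (ennreal (2 * CARD('n) * t ^ (2 * CARD('n) - 1)) * (ennreal (\<omega> t) * sphere_mean p f t) * indicator {0<..<1} t)"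
      proof (cases "0 < t \<and> t < 1")
        case True
        then have t: "0 < t" "t < 1" by auto
        have "(\<integral>\<^sup>+s. ennreal (C / (C - 1)) * (ennreal (\<omega> t) * (if 0 < s \<and> s < 1 \<and> s \<le> t \<and> t < up s then A s * ennreal (1 / (1 - s)) else 0)) \<partial>lborel)
          \<le> (\<integral>\<^sup>+s. ennreal (C / (C - 1)) * (ennreal (\<omega> t) * (A t * ennreal (1 / (1 - t)))) * indicator {1 - K * (1 - t)..t} s \<partial>lborel)"
        proof (rule nn_integral_mono)
          fix s :: real
          show "ennreal (C / (C - 1)) * (ennreal (\<omega> t) * (if 0 < s \<and> s < 1 \<and> s \<le> t \<and> t < up s then A s * ennreal (1 / (1 - s)) else 0))
            \<le> ennreal (C / (C - 1)) * (ennreal (\<omega> t) * (A t * ennreal (1 / (1 - t)))) * indicator {1 - K * (1 - t)..t} s"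
          proof (cases "0 < s \<and> s < 1 \<and> s \<le> t \<and> t < up s")
            case True
            have "(1 - s) / K < 1 - t" using True by (simp add: up_def)
            then have "1 - K * (1 - t) \<le> s" using C by (simp add: field_simps)
            moreover have "A s * ennreal (1 / (1 - s)) \<le> A t * ennreal (1 / (1 - t))"
              using True t by (intro mult_mono Amono ennreal_leI) (auto simp: field_simps)
            ultimately show ?thesis using True by (auto intro!: mult_left_mono)
          qed (simp only: if_False mult_zero_right zero_le)
        qed
        also have "\<dots> = ennreal (C / (C - 1)) * (ennreal (\<omega> t) * (A t * ennreal (1 / (1 - t)))) * ennreal ((K - 1) * (1 - t))"
        proof -
          have "1 * (1 - t) \<le> K * (1 - t)" using C t by (intro mult_right_mono) auto
          then show ?thesis by (subst nn_integral_times_indicator) (auto simp: algebra_simps)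
        qed
        also have "\<dots> = (ennreal (C / (C - 1)) * (ennreal (1 / (1 - t)) * ennreal ((K - 1) * (1 - t)))) * (ennreal (\<omega> t) * A t)"
          by (simp only: mult_ac)
        also have "ennreal (C / (C - 1)) * (ennreal (1 / (1 - t)) * ennreal ((K - 1) * (1 - t))) = ennreal B"
          using C t by (simp add: ennreal_mult[symmetric] B_def)
        finally show ?thesis using t by (simp add: A_def mult_ac)
      next
        case False
        have "t < 1" if "s < 1" "t < up s" for s
        proof -
          have "0 < (1 - s) / K" using that C by simp
          then show ?thesis using that by (simp add: up_def)
        qed
        then have "(if 0 < s \<and> s < 1 \<and> s \<le> t \<and> t < up s then A s * ennreal (1 / (1 - s)) else 0) = 0" for s
          using False by auto
        then show ?thesis by simp
      qed
    qed
    also have "\<dots> = ennreal B * (\<integral>\<^sup>+t\<in>{0<..<1}. ennreal (2 * CARD('n) * t ^ (2 * CARD('n) - 1)) * (ennreal (\<omega> t) * sphere_mean p f t) \<partial>lborel)"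
      by (rule nn_integral_cmult) measurable
    also have "\<dots> = ennreal B * wnorm p f"
      unfolding wnorm_def by (subst nn_integral_ball_polar_radial[OF f]) auto
    finally show ?thesis .
  qed
  moreover have "0 < B" using C by (simp add: B_def)
  ultimately show ?thesis by blast
qed

text \<open>The thresholds translate the hypotheses of \<open>ball_integral_kernel\<close>: C < 2^(M
  - n + \<tau>) holds once M > n + log 2 C, and K^\<tau> < C' once \<tau> < log K C'. Halving the
  latter logarithm leaves room for \<tau> = \<open>\<tau>0\<close>.\<close>

lemma kernel_weight_integral:
  "\<exists>M0 \<tau>0 :: real. 0 < \<tau>0 \<and> (\<forall>(M::real) (\<tau>::real). M0 < M \<longrightarrow> 0 \<le> \<tau> \<longrightarrow> \<tau> \<le> \<tau>0 \<longrightarrow>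
    (\<exists>B>0. \<forall>a :: complex ^ 'n. norm a < 1 \<longrightarrow>
    (\<integral>\<^sup>+z\<in>unit_ball. ennreal (kdist a z powr (- M) * (1 - norm z) powr (- \<tau>)) * ennreal (\<omega> (norm z)) \<partial>lborel)
      \<le> ennreal (B * (1 - norm a) powr (CARD('n) - M - \<tau>) * tl (norm a))))"
proof -
  obtain C where C: "1 \<le> C" "\<And>x. 0 < x \<Longrightarrow> emeasure wmeas {1 - 2 * x..} \<le> ennreal C * emeasure wmeas {1 - x..}"
    using wmeas_doubling by blast
  obtain C' K where C': "1 < C'" "1 < K" and chk: "\<And>x. 0 < x \<Longrightarrow> x \<le> 1 \<Longrightarrow> ennreal C' * emeasure wmeas {1 - x / K..} \<le> emeasure wmeas {1 - x..}"
    using wmeas_check by blast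
  define \<tau>0 where "\<tau>0 = log K C' / 2"
  have \<tau>0: "0 < \<tau>0" "\<tau>0 < log K C'" using C' by (auto simp: \<tau>0_def)
  define M0 where "M0 = CARD('n) + log 2 C"
  have main: "\<exists>B>0. \<forall>a :: complex ^ 'n. norm a < 1 \<longrightarrow>
    (\<integral>\<^sup>+z\<in>unit_ball. ennreal (kdist a z powr (- M) * (1 - norm z) powr (- \<tau>)) * ennreal (\<omega> (norm z)) \<partial>lborel)
      \<le> ennreal (B * (1 - norm a) powr (CARD('n) - M - \<tau>) * tl (norm a))"
    if M: "M0 < M" and \<tau>: "0 \<le> \<tau>" "\<tau> \<le> \<tau>0" for M \<tau> :: real
  proof -
    have "\<exists>B>0. \<forall>a :: complex ^ 'n. norm a < 1 \<longrightarrow>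
      (\<integral>\<^sup>+z\<in>unit_ball. ennreal (kdist a z powr (- M) * (1 - norm z) powr (- \<tau>)) * ennreal (\<omega> (norm z)) \<partial>lborel)
      \<le> ennreal (B * (1 - norm a) powr (CARD('n) - M - \<tau>)) * emeasure (radial_measure (\<lambda>s. ennreal (\<omega> s))) {norm a..}"
    proof (rule ball_integral_kernel[where C = C and K = K and C' = C'])
      have "0 \<le> log 2 C" using C(1) by simp
      then show "real CARD('n) < M" using M by (simp add: M0_def)
      have "C = 2 powr (log 2 C)" using C(1) by simp
      also have "\<dots> < 2 powr (M - CARD('n) + \<tau>)" using M \<tau> by (intro powr_less_mono) (auto simp: M0_def)
      finally show "C < 2 powr (M - CARD('n) + \<tau>)" .
      have "K powr \<tau> < K powr (log K C')" using \<tau> \<tau>0 C' by (intro powr_less_mono) auto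
      then show "K powr \<tau> < C'" using C' by simp
    qed (use C C' chk \<tau> in \<open>auto simp: wmeas_def[symmetric]\<close>)
    then obtain B where B: "0 < B" "\<forall>a :: complex ^ 'n. norm a < 1 \<longrightarrow>
      (\<integral>\<^sup>+z\<in>unit_ball. ennreal (kdist a z powr (- M) * (1 - norm z) powr (- \<tau>)) * ennreal (\<omega> (norm z)) \<partial>lborel)
      \<le> ennreal (B * (1 - norm a) powr (CARD('n) - M - \<tau>)) * emeasure (radial_measure (\<lambda>s. ennreal (\<omega> s))) {norm a..}"
      by blast
    show ?thesis
      using B by (intro exI[of _ B]) (simp add: wmeas_def[symmetric] ennreal_tl[symmetric] ennreal_mult[symmetric] tl_nonneg)
  qed
  show ?thesis by (intro exI[of _ M0] exI[of _ \<tau>0] conjI allI impI main \<tau>0(1))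
qed

end

section \<open>Lattices and sums of kernels\<close>

text \<open>The tangent to x^p at 1, from the weighted arithmetic-geometric inequality for x^p and 1
  with weights 1/p and 1 - 1/p.\<close>

lemma powr_tangent_le:
  fixes x p :: real
  assumes "0 \<le> x" "1 \<le> p"
  shows "1 + p * (x - 1) \<le> x powr p"
proof (cases "x = 0")
  case False
  with assms have x: "0 < x" by simp
  have "(x powr p) powr (1 / p) * 1 powr (1 - 1 / p) \<le> (1 / p) * x powr p + (1 - 1 / p) * 1"
    using assms x by (intro Youngs_inequality_0) auto
  moreover have "(x powr p) powr (1 / p) = x" using assms x by (simp add: powr_powr)
  ultimately have "x \<le> (1 / p) * x powr p + (1 - 1 / p)" by simp
  then have "p * x \<le> p * ((1 / p) * x powr p + (1 - 1 / p))" using assms by (intro mult_left_mono) auto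
  also have "\<dots> = x powr p + p - 1" using assms by (simp add: field_simps)
  finally show ?thesis by (simp add: algebra_simps)
qed (use assms in simp)

text \<open>Jensen's inequality for unnormalized weights: sum the tangent inequalities taken at the
  weighted mean m = S / L, where the linear terms cancel.\<close>

lemma weighted_power_mean:
  fixes lam y :: "'i \<Rightarrow> real"
  assumes p: "1 \<le> p" and lam: "\<And>j. j \<in> J \<Longrightarrow> 0 \<le> lam j" and y: "\<And>j. j \<in> J \<Longrightarrow> 0 \<le> y j"
  shows "(\<Sum>j\<in>J. lam j * y j) powr p \<le> (\<Sum>j\<in>J. lam j) powr (p - 1) * (\<Sum>j\<in>J. lam j * y j powr p)"
proof -
  define L where "L = (\<Sum>j\<in>J. lam j)"
  define S where "S = (\<Sum>j\<in>J. lam j * y j)"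
  have L0: "0 \<le> L" and S0: "0 \<le> S" unfolding L_def S_def using lam y by (auto intro!: sum_nonneg)
  show ?thesis
  proof (cases "S = 0")
    case True
    have "0 \<le> (\<Sum>j\<in>J. lam j) powr (p - 1) * (\<Sum>j\<in>J. lam j * y j powr p)"
      using lam by (intro mult_nonneg_nonneg sum_nonneg) auto
    then show ?thesis using True p unfolding S_def[symmetric] by simp
  next
    case False
    then have S: "0 < S" using S0 by simp
    have L: "0 < L"
    proof (rule ccontr)
      assume "\<not> 0 < L"
      then have "L = 0" using L0 by simp
      have fin: "finite J" using False unfolding S_def by (meson sum.infinite)
      have "\<forall>j\<in>J. lam j = 0" using \<open>L = 0\<close> lam unfolding L_def by (subst (asm) sum_nonneg_eq_0_iff[OF fin]) auto
      then show False using False by (simp add: S_def)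
    qed
    define m where "m = S / L"
    have m: "0 < m" using S L by (simp add: m_def)
    have tan: "m powr p * (1 + p * (y j / m - 1)) \<le> y j powr p" if "j \<in> J" for j
    proof -
      have "m powr p * (1 + p * (y j / m - 1)) \<le> m powr p * (y j / m) powr p"
        using powr_tangent_le[of "y j / m" p] y[OF that] m p by (intro mult_left_mono) auto
      also have "\<dots> = y j powr p" using m y[OF that] by (simp add: powr_divide)
      finally show ?thesis .
    qed
    have "(\<Sum>j\<in>J. lam j * (m powr p * (1 + p * (y j / m - 1)))) \<le> (\<Sum>j\<in>J. lam j * y j powr p)"
      using tan lam by (intro sum_mono mult_left_mono) auto
    also have "(\<Sum>j\<in>J. lam j * (m powr p * (1 + p * (y j / m - 1)))) = m powr p * ((1 - p) * L + p / m * S)"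
      unfolding L_def S_def by (simp add: sum_distrib_left sum.distrib[symmetric] algebra_simps)
    also have "\<dots> = m powr p * L" using m S L by (simp add: m_def field_simps)
    finally have "m powr p * L \<le> (\<Sum>j\<in>J. lam j * y j powr p)" .
    then have "L powr (p - 1) * (m powr p * L) \<le> L powr (p - 1) * (\<Sum>j\<in>J. lam j * y j powr p)"
      by (intro mult_left_mono) auto
    moreover have "L powr (p - 1) * (m powr p * L) = S powr p"
    proof -
      have "L powr (p - 1) * L = L powr p" using L by (simp add: powr_diff)
      then have "L powr (p - 1) * (m powr p * L) = m powr p * L powr p" by (metis mult.assoc mult.commute)
      then show ?thesis using L S by (simp add: m_def powr_divide)
    qed
    ultimately show ?thesis unfolding L_def S_def by simp
  qed
qed

lemma powr_add_subadditive:
  fixes x y p :: real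
  assumes "0 \<le> x" "0 \<le> y" "0 < p" "p \<le> 1"
  shows "(x + y) powr p \<le> x powr p + y powr p"
proof (cases "x + y = 0")
  case False
  then have s: "0 < x + y" using assms by simp
  have le: "t \<le> t powr p" if "0 \<le> t" "t \<le> 1" for t :: real
    using powr_mono'[of p 1 t] that assms by (cases "t = 0") auto
  have "(x + y) powr p * 1 = (x + y) powr p * (x / (x + y) + y / (x + y))"
    using s by (simp add: add_divide_distrib[symmetric])
  also have "\<dots> \<le> (x + y) powr p * ((x / (x + y)) powr p + (y / (x + y)) powr p)"
    using assms s by (intro mult_left_mono add_mono le) auto
  also have "\<dots> = x powr p + y powr p" using s assms by (simp add: powr_divide distrib_left)
  finally show ?thesis by simp
qed (use assms in auto)

lemma powr_sum_subadditive:
  fixes x :: "'i \<Rightarrow> real"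
  assumes "finite J" "\<And>j. j \<in> J \<Longrightarrow> 0 \<le> x j" "0 < p" "p \<le> 1"
  shows "(\<Sum>j\<in>J. x j) powr p \<le> (\<Sum>j\<in>J. x j powr p)"
  using assms
proof (induction J rule: finite_induct)
  case (insert i J)
  have "(\<Sum>j\<in>insert i J. x j) powr p = (x i + (\<Sum>j\<in>J. x j)) powr p" using insert by simp
  also have "\<dots> \<le> x i powr p + (\<Sum>j\<in>J. x j) powr p"
    using insert by (intro powr_add_subadditive sum_nonneg) auto
  also have "\<dots> \<le> x i powr p + (\<Sum>j\<in>J. x j powr p)" using insert by (intro add_left_mono insert.IH) auto
  finally show ?case using insert by simp
qed simp

text \<open>The 60 is 5*2 + 5*2 + 10*2*2, what \<open>near_trans\<close> yields when two
  neighbourhoods meet, each consisting of points \<open>near 2\<close> its centre.\<close>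

definition lattice :: "(nat \<Rightarrow> complex ^ 'n) \<Rightarrow> bool" where
  "lattice a \<longleftrightarrow> (\<forall>j. a j \<in> unit_ball) \<and> disjoint_family (\<lambda>j. hood (a j)) \<and>
     (\<forall>z\<in>unit_ball. \<exists>j. near 60 (a j) z)"

lemma near_self: "a \<in> unit_ball \<Longrightarrow> near 2 a a"
  using hood_near(2)[OF _ self_in_hood] by blast

text \<open>A maximal set of centres with disjoint neighbourhoods. Maximality makes every point near
  a centre, disjointness of nonempty open sets makes the set countable, and the boundary makes it
  infinite, so it can be indexed by the naturals without repetition.\<close>

lemma lattice_exists: "\<exists>a :: nat \<Rightarrow> complex ^ 'n. lattice a"
proof -
  define \<F> where "\<F> = {L :: (complex ^ 'n) set. L \<subseteq> unit_ball \<and> (\<forall>x\<in>L. \<forall>y\<in>L. x \<noteq> y \<longrightarrow> hood x \<inter> hood y = {})}"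
  have "\<exists>L\<in>\<F>. \<forall>X\<in>\<F>. L \<subseteq> X \<longrightarrow> X = L"
  proof (rule subset_Zorn')
    fix C assume C: "subset.chain \<F> C"
    then have CF: "C \<subseteq> \<F>" and lin: "\<And>X Y. X \<in> C \<Longrightarrow> Y \<in> C \<Longrightarrow> X \<subseteq> Y \<or> Y \<subseteq> X"
      by (auto simp: subset_chain_def)
    show "\<Union>C \<in> \<F>"
      unfolding \<F>_def
    proof (intro CollectI conjI ballI impI)
      show "\<Union>C \<subseteq> unit_ball" using CF unfolding \<F>_def by blast
      fix x y assume "x \<in> \<Union>C" "y \<in> \<Union>C" "x \<noteq> y"
      then obtain X Y where XY: "X \<in> C" "Y \<in> C" "x \<in> X" "y \<in> Y" by blast
      obtain Z where "Z \<in> C" "x \<in> Z" "y \<in> Z" using lin[OF XY(1,2)] XY by blast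
      then show "hood x \<inter> hood y = {}" using CF \<open>x \<noteq> y\<close> unfolding \<F>_def by blast
    qed
  qed
  then obtain L where L: "L \<in> \<F>" and max: "\<And>X. X \<in> \<F> \<Longrightarrow> L \<subseteq> X \<Longrightarrow> X = L" by blast
  have Lb: "L \<subseteq> unit_ball" and disj: "\<And>x y. x \<in> L \<Longrightarrow> y \<in> L \<Longrightarrow> x \<noteq> y \<Longrightarrow> hood x \<inter> hood y = {}"
    using L unfolding \<F>_def by auto
  have cover: "\<exists>b\<in>L. near 60 b z" if z: "z \<in> unit_ball" for z
  proof (cases "z \<in> L")
    case True
    have "near 60 z z" by (rule near_mono[OF near_self[OF z]]) (use z in auto)
    then show ?thesis using True by blast
  next
    case False
    have "insert z L \<notin> \<F>" using max[of "insert z L"] False by blast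
    then obtain b where b: "b \<in> L" "hood z \<inter> hood b \<noteq> {}"
      using z Lb disj unfolding \<F>_def by blast
    then obtain w where w: "w \<in> hood z" "w \<in> hood b" by blast
    have bb: "b \<in> unit_ball" using b Lb by blast
    have "near (5 * 2 + 5 * 2 + 10 * 2 * 2) b z"
      using near_trans[of 2 b w 2 z] hood_near[OF bb w(2)] hood_near[OF z w(1)] bb z by (simp add: near_commute)
    then show ?thesis using b(1) by (intro bexI[of _ b]) auto
  qed
  have hne: "hood x \<noteq> {}" if "x \<in> L" for x using self_in_hood[of x] that Lb by blast
  have inj: "inj_on hood L"
  proof (rule inj_onI)
    fix x y assume xy: "x \<in> L" "y \<in> L" "hood x = hood y"
    show "x = y"
    proof (rule ccontr)
      assume "x \<noteq> y"
      then have "hood x \<inter> hood y = {}" using disj xy by blast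
      then show False using xy(3) hne[OF xy(1)] by simp
    qed
  qed
  have "countable (hood ` L)"
  proof (rule countable_disjoint_open_subsets)
    show "open S" if "S \<in> hood ` L" for S using that open_hood by auto
    show "pairwise disjnt (hood ` L)"
      using disj unfolding pairwise_def disjnt_def by blast
  qed
  then have cL: "countable L" using inj by (rule countable_image_inj_on)
  have "infinite L"
  proof
    assume fin: "finite L"
    have ne: "L \<noteq> {}" using cover[of 0] by auto
    define m where "m = Min (bgap ` L)"
    have "m \<in> bgap ` L" unfolding m_def using fin ne by (intro Min_in) auto
    then have m0: "0 < m" "m \<le> 1" using Lb bgap_pos bgap_le_1 by (blast, blast)
    obtain i :: 'n where True by blast
    \<comment> \<open>A point of gap m/240 could only be near a centre of gap at most 120 m/240 =
      m/2, below the least gap m.\<close>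
    define z where "z = sqrt (1 - m / 240) *\<^sub>R (axis i 1 :: complex ^ 'n)"
    have nz: "(norm z)\<^sup>2 = 1 - m / 240" using m0 by (simp add: z_def norm_axis_1)
    then have bz: "bgap z = m / 240" by (simp add: bgap_def)
    have zb: "z \<in> unit_ball" 
    proof -
      have "(norm z)\<^sup>2 < 1" using nz m0 by simp
      then show ?thesis by (simp add: abs_square_less_1)
    qed
    obtain b where b: "b \<in> L" "near 60 b z" using cover[OF zb] by blast
    have "m \<le> bgap b" unfolding m_def using fin b by (intro Min_le) auto
    also have "\<dots> \<le> 2 * 60 * bgap z" using near_bgap(2)[OF b(2)] b(1) Lb zb by blast
    finally show False using bz m0 by simp
  qed
  then have bij: "bij_betw (from_nat_into L) UNIV L" using cL by (intro bij_betw_from_nat_into)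
  have "lattice (from_nat_into L)"
    unfolding lattice_def
  proof (intro conjI allI ballI)
    fix j show "from_nat_into L j \<in> unit_ball" using bij Lb by (metis bij_betwE iso_tuple_UNIV_I subsetD)
  next
    show "disjoint_family (\<lambda>j. hood (from_nat_into L j))"
      unfolding disjoint_family_on_def using bij disj
      by (metis bij_betwE bij_betw_imp_inj_on injD iso_tuple_UNIV_I)
  next
    fix z :: "complex ^ 'n" assume "z \<in> unit_ball"
    then obtain b where "b \<in> L" "near 60 b z" using cover by blast
    then show "\<exists>j. near 60 (from_nat_into L j) z" using bij by (metis bij_betw_imp_surj_on imageE)
  qed
  then show ?thesis by blast
qed

text \<open>Kernel and gap are essentially constant on each neighbourhood, so a term is dominated by
  an integral over \<open>hood (a j)\<close> in which z has become the pole. Disjointness adds these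
  up to one integral over the ball. This is the row bound for the Schur test.\<close>

lemma lattice_kernel_sum:
  fixes a :: "nat \<Rightarrow> complex ^ 'n" and t :: real and M :: nat
  assumes lat: "lattice a" and t: "0 < t" and M: "real CARD('n) + 1 + t \<le> real M"
  shows "\<exists>B>0. \<forall>J z. finite J \<longrightarrow> z \<in> unit_ball \<longrightarrow>
    (\<Sum>j\<in>J. cmod (ball_kernel M (a j) z) * (1 - norm (a j)) powr (- t)) \<le> B * (1 - norm z) powr (- t)"
proof -
  define e where "e = real M - t - CARD('n) - 1"
  have e: "0 \<le> e" using M by (simp add: e_def)
  obtain B where B: "0 < B" "\<forall>z :: complex ^ 'n. norm z < 1 \<longrightarrow>
    (\<integral>\<^sup>+w\<in>unit_ball. ennreal (kdist z w powr (- real M) * (1 - norm w) powr (real M - t - CARD('n) - 1)) \<partial>lborel)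
      \<le> ennreal (B * (1 - norm z) powr (- t))"
    using ball_integral_kernel_power[OF t M] by blast
  define V where "V = unit_ball_vol (real (2 * CARD('n))) / (4 * 256 ^ CARD('n))"
  have V: "0 < V" by (simp add: V_def)
  \<comment> \<open>On \<open>hood (a j)\<close> the quasi-triangle inequality gives kdist z w <= 5
    (k + 4 k) with k = \<open>kdist (a j) z\<close>, and 1 - |a j| is at most 8 (1 - |w|). Division
    by V comes from the volume of the neighbourhood.\<close>
  define K where "K = 25 powr M * 8 powr e / V"
  have K: "0 < K" using V by (simp add: K_def)
  have ab: "a j \<in> unit_ball" for j using lat by (simp add: lattice_def)
  have main: "(\<Sum>j\<in>J. cmod (ball_kernel M (a j) z) * (1 - norm (a j)) powr (- t)) \<le> K * B * (1 - norm z) powr (- t)"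
    if J: "finite J" and z: "z \<in> unit_ball" for J z
  proof -
    define F where "F w = ennreal (kdist z w powr (- real M) * (1 - norm w) powr e)" for w
    have [measurable]: "F \<in> borel_measurable borel" unfolding F_def by measurable
    have single: "ennreal (cmod (ball_kernel M (a j) z) * (1 - norm (a j)) powr (- t)) \<le> ennreal K * (\<integral>\<^sup>+w\<in>hood (a j). F w \<partial>lborel)" for j
    proof -
      define d where "d = 1 - norm (a j)"
      define k where "k = kdist (a j) z"
      have d: "0 < d" using ab[of j] by (simp add: d_def)
      have k: "0 < k" unfolding k_def by (rule kdist_ge(4)) (use ab z in auto)
      have lw: "k powr (- real M) * d powr e \<le> 25 powr M * 8 powr e * (kdist z w powr (- real M) * (1 - norm w) powr e)" if w: "w \<in> hood (a j)" for w
      proof -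
        note nw = hood_near[OF ab w]
        have w1: "norm w < 1" using nw by simp
        have "kdist z w \<le> 5 * (kdist z (a j) + kdist (a j) w)" by (rule kdist_triangle) (use ab z nw in auto)
        also have "kdist (a j) w \<le> 2 * bgap (a j)" using nw(2) by (simp add: near_def)
        also have "bgap (a j) \<le> 2 * k" unfolding k_def by (rule kdist_ge(3)) (use ab z in auto)
        finally have 1: "kdist z w \<le> 25 * k" by (simp add: k_def kdist_commute)
        have zw: "0 < kdist z w" by (rule kdist_ge(4)) (use z nw in auto)
        have "(25 * k) powr (- real M) \<le> kdist z w powr (- real M)" using 1 zw by (intro powr_mono2') auto
        then have "25 powr M * (25 * k) powr (- real M) \<le> 25 powr M * kdist z w powr (- real M)"
          by (intro mult_left_mono) auto
        then have 2: "k powr (- real M) \<le> 25 powr M * kdist z w powr (- real M)"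
          using k by (simp add: powr_mult powr_minus field_simps)
        have "d \<le> bgap (a j)" using bgap_bounds[OF ab] by (simp add: d_def)
        also have "\<dots> \<le> 2 * 2 * bgap w" using near_bgap(2)[OF nw(2) ab nw(1)] by simp
        also have "\<dots> \<le> 8 * (1 - norm w)" using bgap_bounds(2)[OF nw(1)] by simp
        finally have "d powr e \<le> (8 * (1 - norm w)) powr e" using d e by (intro powr_mono2) auto
        then have 3: "d powr e \<le> 8 powr e * (1 - norm w) powr e" using w1 by (subst (asm) powr_mult) auto
        show ?thesis using mult_mono[OF 2 3] by (simp add: mult_ac)
      qed
      have "ennreal (k powr (- real M) * d powr e) * ennreal (V * d ^ (CARD('n) + 1)) \<le> ennreal (k powr (- real M) * d powr e) * emeasure lborel (hood (a j))"
      proof (rule mult_left_mono)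
        have "V * d ^ (CARD('n) + 1) \<le> V * bgap (a j) ^ (CARD('n) + 1)"
          using V d bgap_bounds[OF ab[of j]] by (intro mult_left_mono power_mono) (auto simp: d_def)
        then have "ennreal (V * d ^ (CARD('n) + 1)) \<le> ennreal (V * bgap (a j) ^ (CARD('n) + 1))" by (rule ennreal_leI)
        also have "\<dots> \<le> emeasure lborel (hood (a j))" unfolding V_def by (rule emeasure_hood_ge[OF ab])
        finally show "ennreal (V * d ^ (CARD('n) + 1)) \<le> emeasure lborel (hood (a j))" .
      qed simp
      also have "\<dots> = (\<integral>\<^sup>+w. ennreal (k powr (- real M) * d powr e) * indicator (hood (a j)) w \<partial>lborel)"
        by (subst nn_integral_times_indicator) auto
      also have "\<dots> \<le> (\<integral>\<^sup>+w. ennreal (25 powr M * 8 powr e) * (F w * indicator (hood (a j)) w) \<partial>lborel)"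
        using lw by (intro nn_integral_mono) (auto simp: indicator_def F_def ennreal_mult[symmetric] intro!: ennreal_leI)
      also have "\<dots> = ennreal (25 powr M * 8 powr e) * (\<integral>\<^sup>+w\<in>hood (a j). F w \<partial>lborel)"
        by (rule nn_integral_cmult) measurable
      finally have "ennreal (k powr (- real M) * d powr e) * ennreal (V * d ^ (CARD('n) + 1)) \<le> ennreal (25 powr M * 8 powr e) * (\<integral>\<^sup>+w\<in>hood (a j). F w \<partial>lborel)" .
      then have "ennreal (1 / V) * (ennreal (k powr (- real M) * d powr e) * ennreal (V * d ^ (CARD('n) + 1))) \<le> ennreal (1 / V) * (ennreal (25 powr M * 8 powr e) * (\<integral>\<^sup>+w\<in>hood (a j). F w \<partial>lborel))"
        by (intro mult_left_mono) auto
      also have "\<dots> = ennreal K * (\<integral>\<^sup>+w\<in>hood (a j). F w \<partial>lborel)"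
        using V by (simp add: mult.assoc[symmetric] ennreal_mult[symmetric] K_def)
      also have "ennreal (1 / V) * (ennreal (k powr (- real M) * d powr e) * ennreal (V * d ^ (CARD('n) + 1)))
        = ennreal (1 / V * ((k powr (- real M) * d powr e) * (V * d ^ (CARD('n) + 1))))"
        using V d by (simp add: ennreal_mult[symmetric])
      also have "1 / V * ((k powr (- real M) * d powr e) * (V * d ^ (CARD('n) + 1))) = cmod (ball_kernel M (a j) z) * d powr (- t)"
      proof -
        have "d powr e * d ^ (CARD('n) + 1) = d powr e * d powr (CARD('n) + 1)" using d by (subst powr_realpow[symmetric]) auto
        also have "\<dots> = d powr (real M + - t)" by (simp add: powr_add[symmetric] e_def)
        also have "\<dots> = d powr M * d powr (- t)" by (rule powr_add)
        finally have dd: "d powr e * d ^ (CARD('n) + 1) = d powr M * d powr (- t)" .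
        have "cmod (ball_kernel M (a j) z) = (d / k) ^ M" using norm_ball_kernel[OF ab] by (simp add: d_def k_def)
        also have "\<dots> = (d / k) powr M" using d k by (simp add: powr_realpow)
        also have "\<dots> = d powr M * k powr (- real M)" using d k by (simp add: powr_divide powr_minus_divide)
        finally show ?thesis using dd V by (simp add: mult_ac)
      qed
      finally show ?thesis by (simp add: d_def)
    qed
    have "ennreal (\<Sum>j\<in>J. cmod (ball_kernel M (a j) z) * (1 - norm (a j)) powr (- t))
      = (\<Sum>j\<in>J. ennreal (cmod (ball_kernel M (a j) z) * (1 - norm (a j)) powr (- t)))"
      by (simp add: sum_ennreal)
    also have "\<dots> \<le> (\<Sum>j\<in>J. ennreal K * (\<integral>\<^sup>+w\<in>hood (a j). F w \<partial>lborel))" by (intro sum_mono single)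
    also have "\<dots> = ennreal K * (\<integral>\<^sup>+w. (\<Sum>j\<in>J. F w * indicator (hood (a j)) w) \<partial>lborel)"
      by (subst nn_integral_sum) (auto simp: sum_distrib_left)
    also have "\<dots> \<le> ennreal K * (\<integral>\<^sup>+w\<in>unit_ball. F w \<partial>lborel)"
    proof (intro mult_left_mono nn_integral_mono)
      fix w
      have "disjoint_family_on (\<lambda>j. hood (a j)) J" using lat unfolding lattice_def disjoint_family_on_def by auto
      then have "(\<Sum>j\<in>J. F w * indicator (hood (a j)) w) = F w * indicator (\<Union>j\<in>J. hood (a j)) w"
        using J by (subst indicator_UN_disjoint) (auto simp: sum_distrib_left)
      also have "\<dots> \<le> F w * indicator unit_ball w"
        using hood_near(1)[OF ab] by (intro mult_left_mono) (auto simp: indicator_def)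
      finally show "(\<Sum>j\<in>J. F w * indicator (hood (a j)) w) \<le> F w * indicator unit_ball w" .
    qed simp
    also have "\<dots> \<le> ennreal K * ennreal (B * (1 - norm z) powr (- t))"
      using B(2) z unfolding F_def e_def by (intro mult_left_mono) auto
    also have "\<dots> = ennreal (K * B * (1 - norm z) powr (- t))" using K B(1) by (simp add: ennreal_mult[symmetric] mult.assoc)
    finally show ?thesis using K B(1) by (subst (asm) ennreal_le_iff) auto
  qed
  then show ?thesis using K B(1) by (intro exI[of _ "K * B"]) auto
qed

lemma holo_measurable_ball_space:
  fixes f :: "complex ^ 'n \<Rightarrow> complex"
  assumes "holo_on unit_ball f" "sets \<nu> = sets ball_space"
  shows "f \<in> borel_measurable \<nu>"
proof -
  have "f \<in> borel_measurable (ball_space :: (complex ^ 'n) measure)"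
    unfolding ball_space_def using holo_on_continuous[OF assms(1)] by (rule borel_measurable_continuous_on_restrict)
  then show ?thesis by (simp add: measurable_cong_sets[OF assms(2) refl])
qed

lemma space_ball_space: "sets \<nu> = sets ball_space \<Longrightarrow> space \<nu> = unit_ball"
  by (subst sets_eq_imp_space_eq[of \<nu> ball_space]) (simp_all add: ball_space_def space_restrict_space)

section \<open>Norms of kernel sums and the discrete Carleson inequality\<close>

context D_weight
begin

text \<open>Stands for the \<omega>-mass of a cell, the \<open>W\<^sub>j\<close> of the overview:
  tail mass times the measure of order (1 - |a|)^n of the cap below it.\<close>

definition cellw :: "complex ^ 'n \<Rightarrow> real" where
  "cellw a = tl (norm a) * (1 - norm a) ^ CARD('n)"

lemma cellw_pos: "a \<in> unit_ball \<Longrightarrow> 0 < cellw a"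
  unfolding cellw_def by (intro mult_pos_pos tl_pos zero_less_power) auto

definition ksum :: "(nat \<Rightarrow> complex ^ 'n) \<Rightarrow> nat \<Rightarrow> nat set \<Rightarrow> (nat \<Rightarrow> real) \<Rightarrow> nat set \<Rightarrow> complex ^ 'n \<Rightarrow> complex" where
  "ksum a M J c A z = signed_sum J (\<lambda>j. of_real (c j) * ball_kernel M (a j) z) A"

lemma holo_on_ksum:
  assumes "lattice a" "finite J"
  shows "holo_on unit_ball (ksum a M J c A)"
proof -
  have "holo_on unit_ball (\<lambda>z. \<Sum>j\<in>J. ((if j \<in> A then 1 else -1) * of_real (c j)) * ball_kernel M (a j) z)"
    using assms by (intro holo_on_sum holo_on_ball_kernel) (auto simp: lattice_def)
  then show ?thesis unfolding ksum_def[abs_def] signed_sum_def by (simp add: mult.assoc)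
qed

lemma cmod_ksum_le:
  assumes "\<And>j. j \<in> J \<Longrightarrow> 0 \<le> c j"
  shows "cmod (ksum a M J c A z) \<le> (\<Sum>j\<in>J. c j * cmod (ball_kernel M (a j) z))"
  unfolding ksum_def signed_sum_def
proof (rule order_trans[OF norm_sum sum_mono])
  fix j assume "j \<in> J"
  then show "cmod ((if j \<in> A then 1 else -1) * (of_real (c j) * ball_kernel M (a j) z)) \<le> c j * cmod (ball_kernel M (a j) z)"
    using assms by (simp add: norm_mult)
qed

lemma norm_ball_kernel_powr:
  assumes "b \<in> unit_ball" "z \<in> unit_ball"
  shows "cmod (ball_kernel M b z) powr p = (1 - norm b) powr (M * p) * kdist b z powr (- (M * p))"
proof -
  have d: "0 < 1 - norm b" "0 < kdist b z" using assms kdist_ge(4)[OF assms] by auto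
  have "cmod (ball_kernel M b z) = ((1 - norm b) / kdist b z) powr M"
    using norm_ball_kernel[OF assms(1)] d by (simp add: powr_realpow)
  then show ?thesis using d by (simp add: powr_powr powr_divide powr_minus_divide)
qed

text \<open>For \<open>p \<le> 1\<close> the $p$-th power is subadditive; for \<open>p > 1\<close> this is a Schur test with the
  weights $(1-|a_j|)^{-t}$, and \<open>t\<close> has to be small because of the lower doubling condition.\<close>
lemma wnorm_ksum_le:
  assumes lat: "lattice a" and p: "0 < p"
  shows "\<exists>M B. 0 < B \<and> (\<forall>J c A. finite J \<longrightarrow> (\<forall>j\<in>J. 0 \<le> c j) \<longrightarrow>
    wnorm p (ksum a M J c A) \<le> ennreal (B * (\<Sum>j\<in>J. c j powr p * cellw (a j))))"
proof -
  have ab: "a j \<in> unit_ball" for j using lat by (simp add: lattice_def)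
  obtain M0 \<tau>0 :: real where \<tau>0: "0 < \<tau>0" and kw0: "\<forall>(M::real) (\<tau>::real). M0 < M \<longrightarrow> 0 \<le> \<tau> \<longrightarrow> \<tau> \<le> \<tau>0 \<longrightarrow>
    (\<exists>B>0. \<forall>a :: complex ^ 'n. norm a < 1 \<longrightarrow>
    (\<integral>\<^sup>+z\<in>unit_ball. ennreal (kdist a z powr (- M) * (1 - norm z) powr (- \<tau>)) * ennreal (\<omega> (norm z)) \<partial>lborel)
      \<le> ennreal (B * (1 - norm a) powr (CARD('n) - M - \<tau>) * tl (norm a)))"
    using kernel_weight_integral by (elim exE conjE) (rule that)
  note kw = kw0[rule_format]
  \<comment> \<open>The computation shared by both ranges of p: given a termwise majorant, the
    kernel estimate integrates it, and the powers of 1 - |a j| combine to exponent n, leaving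
    \<open>cellw\<close>.\<close>
  have int_le: "(\<integral>\<^sup>+z. G z * ennreal (\<omega> (norm z)) * indicator unit_ball z \<partial>lborel) \<le> ennreal (B * (\<Sum>j\<in>J. c j powr p * cellw (a j)))"
    if J: "finite J"
      and B: "0 < B" "\<And>a :: complex ^ 'n. norm a < 1 \<Longrightarrow>
    (\<integral>\<^sup>+z\<in>unit_ball. ennreal (kdist a z powr (- s) * (1 - norm z) powr (- \<tau>)) * ennreal (\<omega> (norm z)) \<partial>lborel)
      \<le> ennreal (B * (1 - norm a) powr (CARD('n) - s - \<tau>) * tl (norm a))"
      and G: "\<And>z. z \<in> unit_ball \<Longrightarrow> G z \<le> (\<Sum>j\<in>J. ennreal (c j powr p * (1 - norm (a j)) powr (s + \<tau>)) * ennreal (kdist (a j) z powr (- s) * (1 - norm z) powr (- \<tau>)))"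
    for G :: "complex ^ 'n \<Rightarrow> ennreal" and J :: "nat set" and c and s \<tau> B :: real
  proof -
    have "(\<integral>\<^sup>+z. G z * ennreal (\<omega> (norm z)) * indicator unit_ball z \<partial>lborel)
      \<le> (\<integral>\<^sup>+z. (\<Sum>j\<in>J. ennreal (c j powr p * (1 - norm (a j)) powr (s + \<tau>)) * (ennreal (kdist (a j) z powr (- s) * (1 - norm z) powr (- \<tau>)) * ennreal (\<omega> (norm z)) * indicator unit_ball z)) \<partial>lborel)"
    proof (rule nn_integral_mono)
      fix z
      show "G z * ennreal (\<omega> (norm z)) * indicator unit_ball z \<le> (\<Sum>j\<in>J. ennreal (c j powr p * (1 - norm (a j)) powr (s + \<tau>)) * (ennreal (kdist (a j) z powr (- s) * (1 - norm z) powr (- \<tau>)) * ennreal (\<omega> (norm z)) * indicator unit_ball z))"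
        using mult_right_mono[OF G[of z], of "ennreal (\<omega> (norm z))"]
        by (cases "z \<in> unit_ball") (simp_all add: sum_distrib_right mult.assoc)
    qed
    also have "\<dots> = (\<Sum>j\<in>J. ennreal (c j powr p * (1 - norm (a j)) powr (s + \<tau>)) * (\<integral>\<^sup>+z\<in>unit_ball. ennreal (kdist (a j) z powr (- s) * (1 - norm z) powr (- \<tau>)) * ennreal (\<omega> (norm z)) \<partial>lborel))"
      by (subst nn_integral_sum, measurable) (intro sum.cong refl nn_integral_cmult, measurable)
    also have "\<dots> \<le> (\<Sum>j\<in>J. ennreal (c j powr p * (1 - norm (a j)) powr (s + \<tau>)) * ennreal (B * (1 - norm (a j)) powr (CARD('n) - s - \<tau>) * tl (norm (a j))))"
      using ab by (intro sum_mono mult_left_mono B(2)) auto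
    also have "\<dots> = (\<Sum>j\<in>J. ennreal (B * (c j powr p * cellw (a j))))"
    proof (rule sum.cong[OF refl])
      fix j
      have d: "0 < 1 - norm (a j)" using ab[of j] by simp
      have "(1 - norm (a j)) powr (s + \<tau>) * (1 - norm (a j)) powr (CARD('n) - s - \<tau>) = (1 - norm (a j)) powr real CARD('n)"
        by (simp add: powr_add[symmetric])
      also have "\<dots> = (1 - norm (a j)) ^ CARD('n)" using d by (rule powr_realpow)
      finally have e: "(1 - norm (a j)) powr (s + \<tau>) * (1 - norm (a j)) powr (CARD('n) - s - \<tau>) = (1 - norm (a j)) ^ CARD('n)" .
      have "ennreal (c j powr p * (1 - norm (a j)) powr (s + \<tau>)) * ennreal (B * (1 - norm (a j)) powr (CARD('n) - s - \<tau>) * tl (norm (a j)))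
        = ennreal (B * (c j powr p * (tl (norm (a j)) * ((1 - norm (a j)) powr (s + \<tau>) * (1 - norm (a j)) powr (CARD('n) - s - \<tau>)))))"
        using B(1) by (simp add: ennreal_mult[symmetric] tl_nonneg mult_ac)
      then show "ennreal (c j powr p * (1 - norm (a j)) powr (s + \<tau>)) * ennreal (B * (1 - norm (a j)) powr (CARD('n) - s - \<tau>) * tl (norm (a j))) = ennreal (B * (c j powr p * cellw (a j)))"
        unfolding e cellw_def .
    qed
    also have "\<dots> = ennreal (B * (\<Sum>j\<in>J. c j powr p * cellw (a j)))"
      using B(1) less_imp_le[OF cellw_pos[OF ab]] by (subst sum_ennreal) (auto simp: sum_distrib_left)
    finally show ?thesis .
  qed
  have wn: "wnorm p f = (\<integral>\<^sup>+z. ennreal (cmod (f z) powr p) * ennreal (\<omega> (norm z)) * indicator unit_ball z \<partial>lborel)" for f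
    unfolding wnorm_def ball_pow_def by (simp add: mult_ac)
  show ?thesis
  proof (cases "p \<le> 1")
    case True
    obtain M :: nat where M: "M0 / p < M" using reals_Archimedean2 by blast
    have Mp: "M0 < M * p" using M p by (simp add: field_simps)
    obtain B where B: "0 < B" "\<forall>a :: complex ^ 'n. norm a < 1 \<longrightarrow>
      (\<integral>\<^sup>+z\<in>unit_ball. ennreal (kdist a z powr (- (M * p)) * (1 - norm z) powr (- 0)) * ennreal (\<omega> (norm z)) \<partial>lborel)
        \<le> ennreal (B * (1 - norm a) powr (CARD('n) - M * p - 0) * tl (norm a))"
      using kw[OF Mp order_refl less_imp_le[OF \<tau>0]] by (elim exE conjE) (rule that)
    have "wnorm p (ksum a M J c A) \<le> ennreal (B * (\<Sum>j\<in>J. c j powr p * cellw (a j)))"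
      if J: "finite J" and c: "\<forall>j\<in>J. 0 \<le> c j" for J c A
      unfolding wn
    proof (rule int_le[OF J B(1) B(2)[rule_format]])
      fix z :: "complex ^ 'n" assume z: "z \<in> unit_ball"
      have "cmod (ksum a M J c A z) powr p \<le> (\<Sum>j\<in>J. c j * cmod (ball_kernel M (a j) z)) powr p"
        using p c by (intro powr_mono2 cmod_ksum_le) auto
      also have "\<dots> \<le> (\<Sum>j\<in>J. (c j * cmod (ball_kernel M (a j) z)) powr p)"
        using J c p True by (intro powr_sum_subadditive) auto
      also have "\<dots> = (\<Sum>j\<in>J. (c j powr p * (1 - norm (a j)) powr (M * p + 0)) * (kdist (a j) z powr (- (M * p)) * (1 - norm z) powr (- 0)))"
        using c z ab by (intro sum.cong refl) (simp add: powr_mult norm_ball_kernel_powr)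
      finally have "ennreal (cmod (ksum a M J c A z) powr p) \<le> ennreal (\<Sum>j\<in>J. (c j powr p * (1 - norm (a j)) powr (M * p + 0)) * (kdist (a j) z powr (- (M * p)) * (1 - norm z) powr (- 0)))"
        by (rule ennreal_leI)
      also have "\<dots> = (\<Sum>j\<in>J. ennreal (c j powr p * (1 - norm (a j)) powr (M * p + 0)) * ennreal (kdist (a j) z powr (- (M * p)) * (1 - norm z) powr (- 0)))"
        by (subst sum_ennreal[symmetric]) (auto simp: ennreal_mult)
      finally show "ennreal (cmod (ksum a M J c A z) powr p) \<le> (\<Sum>j\<in>J. ennreal (c j powr p * (1 - norm (a j)) powr (M * p + 0)) * ennreal (kdist (a j) z powr (- (M * p)) * (1 - norm z) powr (- 0)))" .
    qed
    then show ?thesis using B(1) by blast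
  next
    case False
    \<comment> \<open>The Schur weight raised to p - 1 produces the singular factor with exponent
      \<tau> = t (p - 1); this choice makes it the largest admissible one.\<close>
    define t where "t = \<tau>0 / (p - 1)"
    define \<tau> where "\<tau> = t * (p - 1)"
    have t: "0 < t" and \<tau>r: "0 \<le> \<tau>" "\<tau> \<le> \<tau>0" using \<tau>0 False by (auto simp: t_def \<tau>_def)
    obtain M :: nat where M: "max M0 (real CARD('n) + 1 + t) < M" using reals_Archimedean2 by blast
    have M1: "M0 < M" "real CARD('n) + 1 + t \<le> M" using M by auto
    obtain B1 where B1: "0 < B1" "\<forall>J z. finite J \<longrightarrow> z \<in> unit_ball \<longrightarrow>
      (\<Sum>j\<in>J. cmod (ball_kernel M (a j) z) * (1 - norm (a j)) powr (- t)) \<le> B1 * (1 - norm z) powr (- t)"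
      using lattice_kernel_sum[OF lat t M1(2)] by blast
    obtain B where B: "0 < B" "\<forall>a :: complex ^ 'n. norm a < 1 \<longrightarrow>
      (\<integral>\<^sup>+z\<in>unit_ball. ennreal (kdist a z powr (- real M) * (1 - norm z) powr (- \<tau>)) * ennreal (\<omega> (norm z)) \<partial>lborel)
        \<le> ennreal (B * (1 - norm a) powr (CARD('n) - real M - \<tau>) * tl (norm a))"
      using kw[OF M1(1) \<tau>r] by (elim exE conjE) (rule that)
    define E where "E = B1 powr (p - 1)"
    have E: "0 < E" using B1 by (simp add: E_def)
    have "wnorm p (ksum a M J c A) \<le> ennreal (E * B * (\<Sum>j\<in>J. c j powr p * cellw (a j)))"
      if J: "finite J" and c: "\<forall>j\<in>J. 0 \<le> c j" for J c A
    proof -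
      \<comment> \<open>The constant E is absorbed into the coefficients so that
        \<open>int_le\<close> applies unchanged.\<close>
      define c' where "c' j = E powr (1 / p) * c j" for j
      have c'p: "c' j powr p = E * c j powr p" if "j \<in> J" for j
        using c that E p by (simp add: c'_def powr_mult powr_powr)
      have "wnorm p (ksum a M J c A) \<le> ennreal (B * (\<Sum>j\<in>J. c' j powr p * cellw (a j)))"
        unfolding wn
      proof (rule int_le[OF J B(1) B(2)[rule_format]])
        fix z :: "complex ^ 'n" assume z: "z \<in> unit_ball"
        define l where "l j = cmod (ball_kernel M (a j) z) * (1 - norm (a j)) powr (- t)" for j
        define y where "y j = c j * (1 - norm (a j)) powr t" for j
        have d: "0 < 1 - norm (a j)" for j using ab[of j] by simp
        have ly: "l j * y j = c j * cmod (ball_kernel M (a j) z)" for j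
          using d[of j] by (simp add: l_def y_def powr_minus)
        have "cmod (ksum a M J c A z) powr p \<le> (\<Sum>j\<in>J. c j * cmod (ball_kernel M (a j) z)) powr p"
          using p c by (intro powr_mono2 cmod_ksum_le) auto
        also have "\<dots> = (\<Sum>j\<in>J. l j * y j) powr p" by (simp only: ly)
        also have "\<dots> \<le> (\<Sum>j\<in>J. l j) powr (p - 1) * (\<Sum>j\<in>J. l j * y j powr p)"
          using False c by (intro weighted_power_mean) (auto simp: l_def y_def)
        also have "\<dots> \<le> (B1 * (1 - norm z) powr (- t)) powr (p - 1) * (\<Sum>j\<in>J. l j * y j powr p)"
        proof (intro mult_right_mono powr_mono2)
          show "(\<Sum>j\<in>J. l j) \<le> B1 * (1 - norm z) powr (- t)"
            unfolding l_def using B1(2) J z by blast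
        qed (use False c in \<open>auto simp: l_def y_def intro!: sum_nonneg\<close>)
        also have "(B1 * (1 - norm z) powr (- t)) powr (p - 1) = E * (1 - norm z) powr (- \<tau>)"
          using B1 by (simp add: powr_mult powr_powr E_def \<tau>_def)
        also have "E * (1 - norm z) powr (- \<tau>) * (\<Sum>j\<in>J. l j * y j powr p)
          = (\<Sum>j\<in>J. (c' j powr p * (1 - norm (a j)) powr (M + \<tau>)) * (kdist (a j) z powr (- real M) * (1 - norm z) powr (- \<tau>)))"
          unfolding sum_distrib_left
        proof (rule sum.cong[OF refl])
          fix j assume j: "j \<in> J"
          have k: "cmod (ball_kernel M (a j) z) = (1 - norm (a j)) powr M * kdist (a j) z powr (- real M)"
            using norm_ball_kernel_powr[OF ab z, of M j 1] by simp
          have "(1 - norm (a j)) powr M * ((1 - norm (a j)) powr (- t) * ((1 - norm (a j)) powr t) powr p) = (1 - norm (a j)) powr (M + \<tau>)"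
            by (simp add: powr_powr powr_add[symmetric] \<tau>_def algebra_simps)
          then have "l j * y j powr p = c j powr p * ((1 - norm (a j)) powr (M + \<tau>) * kdist (a j) z powr (- real M))"
            unfolding l_def y_def k using c j by (simp add: powr_mult mult_ac)
          then show "E * (1 - norm z) powr (- \<tau>) * (l j * y j powr p) = (c' j powr p * (1 - norm (a j)) powr (M + \<tau>)) * (kdist (a j) z powr (- real M) * (1 - norm z) powr (- \<tau>))"
            unfolding c'p[OF j] by (simp add: mult_ac)
        qed
        finally have "ennreal (cmod (ksum a M J c A z) powr p) \<le> ennreal (\<Sum>j\<in>J. (c' j powr p * (1 - norm (a j)) powr (M + \<tau>)) * (kdist (a j) z powr (- real M) * (1 - norm z) powr (- \<tau>)))"
          by (rule ennreal_leI)
        also have "\<dots> = (\<Sum>j\<in>J. ennreal (c' j powr p * (1 - norm (a j)) powr (M + \<tau>)) * ennreal (kdist (a j) z powr (- real M) * (1 - norm z) powr (- \<tau>)))"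
          by (subst sum_ennreal[symmetric]) (auto simp: ennreal_mult)
        finally show "ennreal (cmod (ksum a M J c A z) powr p) \<le> (\<Sum>j\<in>J. ennreal (c' j powr p * (1 - norm (a j)) powr (M + \<tau>)) * ennreal (kdist (a j) z powr (- real M) * (1 - norm z) powr (- \<tau>)))" .
      qed
      also have "B * (\<Sum>j\<in>J. c' j powr p * cellw (a j)) = E * B * (\<Sum>j\<in>J. c j powr p * cellw (a j))"
        by (simp add: sum_distrib_left c'p mult_ac)
      finally show ?thesis .
    qed
    then show ?thesis using B(1) E by (intro exI[of _ M] exI[of _ "E * B"]) auto
  qed
qed

text \<open>The signs are averaged before anything is compared on cells: the mean of |F|^q dominates
  the power q/2 of the square function, and on \<open>Q i\<close> its i-th term alone suffices,
  because the kernel is bounded below there.\<close>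

lemma carleson_discrete:
  assumes lat: "lattice a" and pq: "0 < q" "0 < p" and car: "carleson q p \<omega> \<nu>"
    and sets: "sets \<nu> = sets ball_space"
    and Q: "\<And>j. Q j \<in> sets \<nu>" "disjoint_family Q" "\<And>j z. z \<in> Q j \<Longrightarrow> near 60 (a j) z"
  shows "\<exists>C>0. \<forall>J c. finite J \<longrightarrow> (\<forall>j\<in>J. 0 \<le> c j) \<longrightarrow>
    (\<Sum>j\<in>J. ennreal (c j powr q) * emeasure \<nu> (Q j)) \<le> ennreal (C * (\<Sum>j\<in>J. c j powr p * cellw (a j)) powr (q / p))"
proof -
  have ab: "a j \<in> unit_ball" for j using lat by (simp add: lattice_def)
  define V where "V = measure lborel (unit_ball :: (complex ^ 'n) set)"
  have eV: "emeasure lborel (unit_ball :: (complex ^ 'n) set) = ennreal V"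
    unfolding V_def using unit_ball_volume(2)[where 'n = 'n] by (intro emeasure_eq_ennreal_measure) auto
  have V: "0 < V" using unit_ball_volume(1)[where 'n = 'n] eV by (cases "V > 0") (auto simp: ennreal_neg not_less)
  obtain C0 where C0: "\<And>f. f \<in> Bergman p \<omega> \<Longrightarrow> (\<integral>\<^sup>+z. ennreal (cmod (f z) powr q) \<partial>\<nu>) \<le> ennreal (C0 * (enn2real (Ap_norm_p p \<omega> f)) powr (q / p))"
    using car unfolding carleson_def by blast
  obtain M B where B: "0 < B" and wk: "\<And>J c A. finite J \<Longrightarrow> (\<forall>j\<in>J. 0 \<le> c j) \<Longrightarrow>
    wnorm p (ksum a M J c A) \<le> ennreal (B * (\<Sum>j\<in>J. c j powr p * cellw (a j)))"
    using wnorm_ksum_le[OF lat pq(2)] by blast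
  \<comment> \<open>The constant in \<open>carleson\<close> carries no sign condition; the maximum
    makes it positive.\<close>
  define C1 where "C1 = max C0 1"
  define C2 where "C2 = C1 * (B / V) powr (q / p)"
  \<comment> \<open>The first factors are Khinchine's constant. On \<open>Q j\<close> one has kdist
    <= 60 bgap <= 120 (1 - |a j|), so the kernel is at least 120^(-M) there.\<close>
  define C3 where "C3 = 5 * 4 powr (q / 2) * 120 powr (M * q)"
  have C: "0 < C1" "0 < C2" "0 < C3" using B V by (auto simp: C1_def C2_def C3_def)
  have "(\<Sum>j\<in>J. ennreal (c j powr q) * emeasure \<nu> (Q j)) \<le> ennreal (C3 * C2 * (\<Sum>j\<in>J. c j powr p * cellw (a j)) powr (q / p))"
    if J: "finite J" and c: "\<forall>j\<in>J. 0 \<le> c j" for J c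
  proof -
    define S where "S = (\<Sum>j\<in>J. c j powr p * cellw (a j))"
    have S0: "0 \<le> S" unfolding S_def using less_imp_le[OF cellw_pos[OF ab]] by (intro sum_nonneg) auto
    define F where "F A = ksum a M J c A" for A
    have hF: "holo_on unit_ball (F A)" for A unfolding F_def by (rule holo_on_ksum[OF lat J])
    have [measurable]: "F A \<in> borel_measurable \<nu>" for A by (rule holo_measurable_ball_space[OF hF sets])
    have bound: "(\<integral>\<^sup>+z. ennreal (cmod (F A z) powr q) \<partial>\<nu>) \<le> ennreal (C2 * S powr (q / p))" for A
    proof -
      have "Ap_norm_p p \<omega> (F A) = wnorm p (F A) / ennreal V" by (simp add: Ap_norm_p_eq[OF hF] eV)
      also have "\<dots> \<le> ennreal (B * S) / ennreal V"
        unfolding F_def S_def by (intro divide_right_mono_ennreal wk J c)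
      also have "\<dots> = ennreal (B / V * S)" using V B S0 by (simp add: divide_ennreal)
      finally have le: "Ap_norm_p p \<omega> (F A) \<le> ennreal (B / V * S)" .
      then have "F A \<in> Bergman p \<omega>"
        using hF le_less_trans[OF le ennreal_less_top] by (simp add: Bergman_def)
      then have "(\<integral>\<^sup>+z. ennreal (cmod (F A z) powr q) \<partial>\<nu>) \<le> ennreal (C0 * (enn2real (Ap_norm_p p \<omega> (F A))) powr (q / p))"
        by (rule C0)
      also have "\<dots> \<le> ennreal (C1 * (B / V * S) powr (q / p))"
      proof (rule ennreal_leI)
        have "enn2real (Ap_norm_p p \<omega> (F A)) \<le> B / V * S"
          using le B V S0 by (intro enn2real_leI) auto
        then have "enn2real (Ap_norm_p p \<omega> (F A)) powr (q / p) \<le> (B / V * S) powr (q / p)"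
          using pq by (intro powr_mono2) auto
        then have "C1 * enn2real (Ap_norm_p p \<omega> (F A)) powr (q / p) \<le> C1 * (B / V * S) powr (q / p)"
          using C(1) by (intro mult_left_mono) auto
        moreover have "C0 * enn2real (Ap_norm_p p \<omega> (F A)) powr (q / p) \<le> C1 * enn2real (Ap_norm_p p \<omega> (F A)) powr (q / p)"
          by (intro mult_right_mono) (auto simp: C1_def)
        ultimately show "C0 * enn2real (Ap_norm_p p \<omega> (F A)) powr (q / p) \<le> C1 * (B / V * S) powr (q / p)" by linarith
      qed
      also have "C1 * (B / V * S) powr (q / p) = C2 * S powr (q / p)"
        using B V S0 by (subst powr_mult) (auto simp: C2_def)
      finally show ?thesis .
    qed
    define av where "av z = (\<Sum>A\<in>Pow J. cmod (F A z) powr q) / 2 ^ card J" for z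
    have pt: "(\<Sum>j\<in>J. c j powr q * indicator (Q j) z) \<le> C3 * av z" for z
    proof (cases "\<exists>i\<in>J. z \<in> Q i")
      case False
      have "0 \<le> C3 * av z" unfolding av_def using C by (intro mult_nonneg_nonneg divide_nonneg_nonneg sum_nonneg) auto
      moreover have "(\<Sum>j\<in>J. c j powr q * indicator (Q j) z) = 0"
        using False by (intro sum.neutral) auto
      ultimately show ?thesis by simp
    next
      case True
      then obtain i where i: "i \<in> J" "z \<in> Q i" by blast
      have z: "z \<in> unit_ball" using sets.sets_into_space[OF Q(1)] i(2) space_ball_space[OF sets] by blast
      have uniq: "z \<notin> Q j" if "j \<noteq> i" for j using Q(2) i(2) that by (auto simp: disjoint_family_on_def)
      have "(\<Sum>j\<in>J. c j powr q * indicator (Q j) z) = (\<Sum>j\<in>J. if j = i then c j powr q else 0)"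
        using uniq i by (intro sum.cong) (auto simp: indicator_def)
      also have "\<dots> = c i powr q" using J i by simp
      also have "\<dots> \<le> 120 powr (M * q) * (c i * cmod (ball_kernel M (a i) z)) powr q"
      proof -
        have "kdist (a i) z \<le> 60 * bgap (a i)" using Q(3)[OF i(2)] by (simp add: near_def)
        also have "\<dots> \<le> 120 * (1 - norm (a i))" using bgap_bounds(2)[OF ab[of i]] by simp
        finally have "1 / 120 \<le> (1 - norm (a i)) / kdist (a i) z" using kdist_ge(4)[OF ab z, of i] by (simp add: field_simps)
        then have "(1 / 120) ^ M \<le> cmod (ball_kernel M (a i) z)"
          unfolding norm_ball_kernel[OF ab] by (intro power_mono) auto
        then have "((1 / 120) ^ M) powr q \<le> cmod (ball_kernel M (a i) z) powr q" using pq by (intro powr_mono2) auto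
        moreover have "((1 / 120) ^ M) powr q = 1 / 120 powr (M * q)"
          by (simp add: powr_realpow[symmetric] powr_powr powr_divide power_one_over)
        ultimately have "1 / 120 powr (M * q) \<le> cmod (ball_kernel M (a i) z) powr q" by (simp only:)
        then have "1 \<le> 120 powr (M * q) * cmod (ball_kernel M (a i) z) powr q" by (simp add: pos_divide_le_eq mult.commute)
        then have "c i powr q * 1 \<le> c i powr q * (120 powr (M * q) * cmod (ball_kernel M (a i) z) powr q)"
          by (intro mult_left_mono) auto
        then show ?thesis using c i by (simp add: powr_mult mult_ac)
      qed
      also have "(c i * cmod (ball_kernel M (a i) z)) powr q = ((cmod (of_real (c i) * ball_kernel M (a i) z))\<^sup>2) powr (q / 2)"
        using c i by (simp add: norm_mult powr_power[symmetric] powr_powr flip: powr_numeral)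
      also have "120 powr (M * q) * \<dots> \<le> 120 powr (M * q) * (\<Sum>j\<in>J. (cmod (of_real (c j) * ball_kernel M (a j) z))\<^sup>2) powr (q / 2)"
        using J i pq by (intro mult_left_mono powr_mono2 member_le_sum) auto
      also have "\<dots> \<le> 120 powr (M * q) * (5 * 4 powr (q / 2) * av z)"
        unfolding av_def F_def ksum_def by (intro mult_left_mono Khinchine_lower J pq) auto
      finally show ?thesis by (simp add: C3_def mult_ac)
    qed
    have "(\<Sum>j\<in>J. ennreal (c j powr q) * emeasure \<nu> (Q j)) = (\<integral>\<^sup>+z. (\<Sum>j\<in>J. ennreal (c j powr q) * indicator (Q j) z) \<partial>\<nu>)"
      using Q(1) by (subst nn_integral_sum) (auto simp: nn_integral_times_indicator)
    also have "\<dots> \<le> (\<integral>\<^sup>+z. ennreal (C3 / 2 ^ card J) * (\<Sum>A\<in>Pow J. ennreal (cmod (F A z) powr q)) \<partial>\<nu>)"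
    proof (rule nn_integral_mono)
      fix z
      have "(\<Sum>j\<in>J. ennreal (c j powr q) * indicator (Q j) z) = (\<Sum>j\<in>J. ennreal (c j powr q * indicator (Q j) z))"
        by (intro sum.cong) (auto simp: indicator_def)
      also have "\<dots> = ennreal (\<Sum>j\<in>J. c j powr q * indicator (Q j) z)" by (intro sum_ennreal) auto
      also have "\<dots> \<le> ennreal (C3 * av z)" by (rule ennreal_leI[OF pt])
      also have "\<dots> = ennreal (C3 / 2 ^ card J) * (\<Sum>A\<in>Pow J. ennreal (cmod (F A z) powr q))"
        unfolding av_def using C by (subst sum_ennreal) (auto simp: ennreal_mult[symmetric] sum_nonneg)
      finally show "(\<Sum>j\<in>J. ennreal (c j powr q) * indicator (Q j) z) \<le> ennreal (C3 / 2 ^ card J) * (\<Sum>A\<in>Pow J. ennreal (cmod (F A z) powr q))" .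
    qed
    also have "\<dots> = ennreal (C3 / 2 ^ card J) * (\<Sum>A\<in>Pow J. (\<integral>\<^sup>+z. ennreal (cmod (F A z) powr q) \<partial>\<nu>))"
      by (subst nn_integral_cmult, measurable) (subst nn_integral_sum, auto)
    also have "\<dots> \<le> ennreal (C3 / 2 ^ card J) * (\<Sum>A\<in>Pow J. ennreal (C2 * S powr (q / p)))"
      by (intro mult_left_mono sum_mono bound) auto
    also have "(\<Sum>A\<in>Pow J. ennreal (C2 * S powr (q / p))) = ennreal (2 ^ card J * (C2 * S powr (q / p)))"
      using J C by (subst sum_ennreal) (auto simp: card_Pow)
    also have "ennreal (C3 / 2 ^ card J) * ennreal (2 ^ card J * (C2 * S powr (q / p))) = ennreal (C3 * C2 * S powr (q / p))"
      using C by (subst ennreal_mult[symmetric]) auto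
    finally show ?thesis by (simp add: S_def)
  qed
  then show ?thesis using C by (intro exI[of _ "C3 * C2"]) auto
qed

end

section \<open>Local masses\<close>

lemma near_set_borel [measurable]: "{z. near A b z} \<in> sets borel"
  unfolding near_def by measurable

text \<open>Volume count. The neighbourhoods of the centres near z are disjoint, each has volume at
  least of order g^(n+1) with g the gap of z, and all of them lie in one cap of volume of the same
  order.\<close>

lemma lattice_overlap:
  fixes a :: "nat \<Rightarrow> complex ^ 'n"
  assumes lat: "lattice a" and A: "0 < A"
  shows "\<exists>N>0. \<forall>z J. z \<in> unit_ball \<longrightarrow> finite J \<longrightarrow> (\<forall>j\<in>J. near A (a j) z) \<longrightarrow> real (card J) \<le> N"
proof -
  define V where "V = unit_ball_vol (real (2 * CARD('n)))"
  have V: "0 < V" by (simp add: V_def)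
  define V1 where "V1 = V / (4 * 256 ^ CARD('n))"
  define A3 where "A3 = 5 * A + 5 * 2 + 10 * A * 2"
  have A3: "0 < A3" using A by (simp add: A3_def)
  define N where "N = (V * 9 ^ CARD('n) * (A3 + 2) ^ (CARD('n) + 1)) / (V1 / (2 * A) ^ (CARD('n) + 1))"
  have V1: "0 < V1" using V by (simp add: V1_def)
  have N: "0 < N" using V V1 A A3 by (simp add: N_def)
  have ab: "a j \<in> unit_ball" for j using lat by (simp add: lattice_def)
  have "real (card J) \<le> N" if z: "z \<in> unit_ball" and J: "finite J" and nr: "\<forall>j\<in>J. near A (a j) z" for z J
  proof -
    define g where "g = bgap z"
    have g: "0 < g" using z by (simp add: g_def bgap_pos)
    obtain i :: 'n where True by blast
    define e where "e = (if z = 0 then axis i 1 else sgn z)"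
    have e: "norm e = 1" by (simp add: e_def norm_sgn)
    define P where "P = {w \<in> unit_ball. cmod (1 - cinner w e) \<le> (A3 + 2) * g}"
    have sub: "hood (a j) \<subseteq> P" if j: "j \<in> J" for j
    proof
      fix w assume w: "w \<in> hood (a j)"
      note nw = hood_near[OF ab w]
      have "near A z (a j)" using nr j by (simp add: near_commute)
      from near_trans[OF this nw(2) z ab nw(1)] have k: "kdist z w \<le> A3 * g" by (simp add: near_def A3_def g_def)
      \<comment> \<open>Replacing z by the boundary point e costs 1 - |z| <= g. At z = 0 the
        direction e is arbitrary, g = 1, and the trivial bound 2 is 2 g.\<close>
      have "cmod (1 - cinner w e) \<le> kdist z w + 2 * g"
      proof (cases "z = 0")
        case True
        have "cmod (1 - cinner w e) \<le> cmod 1 + cmod (cinner w e)" by (rule norm_triangle_ineq4)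
        also have "cmod (cinner w e) \<le> norm w * norm e" by (rule cinner_Cauchy_Schwarz)
        also have "\<dots> \<le> 1" using nw(1) e by simp
        finally have "cmod (1 - cinner w e) \<le> 2" by simp
        moreover have "g = 1" using True by (simp add: g_def bgap_def)
        moreover have "0 \<le> kdist z w" by (simp add: kdist_def)
        ultimately show ?thesis by simp
      next
        case False
        have ze: "z = of_real (norm z) *s e" using False by (simp add: e_def sgn_div_norm scaleR_vector_scale)
        have "1 - cinner w e = (1 - cinner w z) - of_real (1 - norm z) * cinner w e"
          by (subst ze) (simp add: cinner_scale_right algebra_simps)
        then have "cmod (1 - cinner w e) \<le> cmod (1 - cinner w z) + cmod (of_real (1 - norm z) * cinner w e)"
          using norm_triangle_ineq4 by metis
        also have "cmod (of_real (1 - norm z) * cinner w e) = (1 - norm z) * cmod (cinner w e)"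
          unfolding norm_mult norm_of_real using z by simp
        also have "\<dots> \<le> (1 - norm z) * 1"
        proof (rule mult_left_mono)
          have "cmod (cinner w e) \<le> norm w * norm e" by (rule cinner_Cauchy_Schwarz)
          then show "cmod (cinner w e) \<le> 1" using nw(1) e by simp
        qed (use z in simp)
        also have "1 - norm z \<le> g" using bgap_bounds(1)[OF z] by (simp add: g_def)
        finally show ?thesis using g by (simp add: kdist_def)
      qed
      then have "cmod (1 - cinner w e) \<le> (A3 + 2) * g" using k by (simp add: algebra_simps)
      then show "w \<in> P" using nw(1) by (simp add: P_def)
    qed
    have vol: "ennreal (V1 * (g / (2 * A)) ^ (CARD('n) + 1)) \<le> emeasure lborel (hood (a j))" if j: "j \<in> J" for j
    proof -
      have "g \<le> 2 * A * bgap (a j)" using near_bgap(1)[of A "a j" z] nr j ab z by (simp add: g_def)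
      then have "g / (2 * A) \<le> bgap (a j)" using A by (simp add: field_simps)
      then have "V1 * (g / (2 * A)) ^ (CARD('n) + 1) \<le> V1 * bgap (a j) ^ (CARD('n) + 1)"
        using V1 A g by (intro mult_left_mono power_mono) auto
      then have "ennreal (V1 * (g / (2 * A)) ^ (CARD('n) + 1)) \<le> ennreal (V1 * bgap (a j) ^ (CARD('n) + 1))"
        by (rule ennreal_leI)
      also have "\<dots> \<le> emeasure lborel (hood (a j))" unfolding V1_def V_def by (rule emeasure_hood_ge[OF ab])
      finally show ?thesis .
    qed
    have "ennreal (card J * (V1 * (g / (2 * A)) ^ (CARD('n) + 1))) = (\<Sum>j\<in>J. ennreal (V1 * (g / (2 * A)) ^ (CARD('n) + 1)))"
      using V1 g A by (subst sum_ennreal) auto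
    also have "\<dots> \<le> (\<Sum>j\<in>J. emeasure lborel (hood (a j)))" by (intro sum_mono vol)
    also have "\<dots> = emeasure lborel (\<Union>j\<in>J. hood (a j))"
    proof (rule sum_emeasure)
      show "disjoint_family_on (\<lambda>j. hood (a j)) J" using lat unfolding lattice_def disjoint_family_on_def by auto
    qed (use J in auto)
    also have "\<dots> \<le> emeasure lborel P"
    proof (rule emeasure_mono)
      show "(\<Union>j\<in>J. hood (a j)) \<subseteq> P" using sub by blast
      show "P \<in> sets lborel" unfolding P_def by measurable
    qed
    also have "\<dots> \<le> ennreal (V * 9 ^ CARD('n) * ((A3 + 2) * g) ^ (CARD('n) + 1))"
      unfolding P_def V_def using A3 g by (intro emeasure_kdist_cap_le e) auto
    finally have "card J * (V1 * (g / (2 * A)) ^ (CARD('n) + 1)) \<le> V * 9 ^ CARD('n) * ((A3 + 2) * g) ^ (CARD('n) + 1)"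
      using V A3 g by (subst (asm) ennreal_le_iff) auto
    then have "(card J * (V1 / (2 * A) ^ (CARD('n) + 1))) * g ^ (CARD('n) + 1) \<le> (V * 9 ^ CARD('n) * (A3 + 2) ^ (CARD('n) + 1)) * g ^ (CARD('n) + 1)"
      by (simp only: power_mult_distrib power_divide times_divide_eq_right times_divide_eq_left mult.assoc)
    then have "card J * (V1 / (2 * A) ^ (CARD('n) + 1)) \<le> V * 9 ^ CARD('n) * (A3 + 2) ^ (CARD('n) + 1)"
      using g by (subst (asm) mult_le_cancel_right_pos) auto
    then show ?thesis unfolding N_def using V1 A by (subst pos_le_divide_eq) auto
  qed
  with N show ?thesis by blast
qed

text \<open>Cauchy's estimate for the slice g(l) = f(b + l h): discs of radius R/2 about points of
  the closed unit disc stay inside radius R because 1 + R/2 < R, so |g'| <= 2 S / R between 0 and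
  1.\<close>

lemma holo_difference_bound:
  fixes f :: "complex ^ 'n \<Rightarrow> complex"
  assumes f: "holo_on unit_ball f" and R: "2 < R"
    and S: "\<And>l. cmod l < R \<Longrightarrow> b + l *s h \<in> unit_ball \<and> cmod (f (b + l *s h)) \<le> S"
  shows "cmod (f (b + h) - f b) \<le> 2 / R * S"
proof -
  define g where "g l = f (b + l *s h)" for l
  have hol: "g holomorphic_on ball 0 R"
    unfolding g_def by (rule holo_on_line[OF f]) (use S in auto)
  have der: "norm (deriv g l) \<le> S / (R / 2)" if l: "l \<in> cball 0 1" for l
  proof (rule field_le_epsilon)
    fix \<epsilon> :: real assume \<epsilon>: "0 < \<epsilon>"
    show "norm (deriv g l) \<le> S / (R / 2) + \<epsilon>"
    proof -
      have sub: "cball l (R / 2) \<subseteq> ball 0 R"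
      proof
        fix x assume x: "x \<in> cball l (R / 2)"
        have "norm x \<le> norm l + norm (x - l)" using norm_triangle_ineq[of l "x - l"] by simp
        also have "\<dots> \<le> 1 + R / 2" using l x by (intro add_mono) (auto simp: dist_norm norm_minus_commute)
        finally show "x \<in> ball 0 R" using R by simp
      qed
      have "norm ((deriv ^^ 1) g l) \<le> fact 1 * S / (R / 2) ^ 1"
      proof (rule Cauchy_inequality)
        show "g holomorphic_on ball l (R / 2)" by (rule holomorphic_on_subset[OF hol]) (use sub in auto)
        show "continuous_on (cball l (R / 2)) g"
          by (rule continuous_on_subset[OF holomorphic_on_imp_continuous_on[OF hol] sub])
        fix x assume "norm (l - x) = R / 2"
        then have "x \<in> cball l (R / 2)" by (simp add: dist_norm)
        then have "norm x < R" using sub by auto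
        then show "norm (g x) \<le> S" using S by (simp add: g_def)
      qed (use R in simp)
      then show ?thesis using \<epsilon> by simp
    qed
  qed
  have "norm (g 1 - g 0) \<le> S / (R / 2) * norm (1 - 0 :: complex)"
  proof (rule field_differentiable_bound[of "cball 0 1" g "deriv g"])
    show "(g has_field_derivative deriv g z) (at z within cball 0 1)" if "z \<in> cball 0 1" for z
      by (rule has_field_derivative_at_within[OF holomorphic_derivI[OF hol open_ball]]) (use that R in auto)
  qed (use der in auto)
  then show ?thesis by (simp add: g_def mult.commute)
qed

text \<open>With h = a - b, the points b + l h stay in \<open>hood b\<close> as long as |l| < 1/(16
  \<rho>), by \<open>pseudo_hyp_small\<close> and the constants 1/8 and 1/64 of the neighbourhood.
  The difference bound with R = 1/(16 \<rho>) then gives 2 * 16 \<rho>; \<rho> < 1/64 ensures R >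
  2.\<close>

lemma hood_Schwarz:
  fixes f :: "complex ^ 'n \<Rightarrow> complex"
  assumes f: "holo_on unit_ball f" and ab: "a \<in> unit_ball" "b \<in> unit_ball"
    and small: "pseudo_hyp b a < 1/64" and S: "\<And>w. w \<in> hood b \<Longrightarrow> cmod (f w) \<le> S"
  shows "cmod (f a - f b) \<le> 32 * pseudo_hyp b a * S"
proof -
  define \<rho> where "\<rho> = pseudo_hyp b a"
  define h where "h = a - b"
  have g: "0 < bgap b" using ab by (simp add: bgap_pos)
  have h: "cmod (cinner h b) \<le> 2 * \<rho> * bgap b" "(norm h)\<^sup>2 \<le> (2 * \<rho>)\<^sup>2 * bgap b"
    using pseudo_hyp_small[OF ab(2,1)] small by (auto simp: \<rho>_def h_def)
  have \<rho>0: "0 \<le> \<rho>" by (simp add: \<rho>_def pseudo_hyp_nonneg)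
  show ?thesis
  proof (cases "\<rho> = 0")
    case True
    then have "h = 0" using h(2) by simp
    then show ?thesis using True by (simp add: h_def \<rho>_def)
  next
    case False
    then have \<rho>: "0 < \<rho>" using \<rho>0 by simp
    have "cmod (f (b + h) - f b) \<le> 2 / (1 / (16 * \<rho>)) * S"
    proof (rule holo_difference_bound[OF f])
      show "2 < 1 / (16 * \<rho>)" using \<rho> small by (simp add: \<rho>_def[symmetric] field_simps)
      fix l :: complex assume l: "cmod l < 1 / (16 * \<rho>)"
      then have l\<rho>: "cmod l * (2 * \<rho>) < 1 / 8" using \<rho> by (simp add: field_simps)
      have "cmod (cinner (l *s h) b) \<le> cmod l * (2 * \<rho> * bgap b)"
        unfolding cinner_scale_left norm_mult by (intro mult_left_mono h) auto
      also have "\<dots> = (cmod l * (2 * \<rho>)) * bgap b" by simp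
      also have "\<dots> < 1 / 8 * bgap b" using l\<rho> g by (intro mult_strict_right_mono) auto
      finally have 1: "cmod (cinner (l *s h) b) < bgap b / 8" by simp
      have "(norm (l *s h))\<^sup>2 \<le> (cmod l)\<^sup>2 * ((2 * \<rho>)\<^sup>2 * bgap b)"
        unfolding norm_vector_scale power_mult_distrib[of "cmod l" "norm h"] by (intro mult_left_mono h) auto
      also have "\<dots> = (cmod l * (2 * \<rho>))\<^sup>2 * bgap b" by (simp add: power_mult_distrib)
      also have "\<dots> < (1 / 8)\<^sup>2 * bgap b" using l\<rho> g \<rho>0 by (intro mult_strict_right_mono power_strict_mono) auto
      finally have "(norm (l *s h))\<^sup>2 < bgap b / 64" by (simp add: power2_eq_square)
      with 1 have "b + l *s h \<in> hood b" by (simp add: hood_def)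
      then show "b + l *s h \<in> unit_ball \<and> cmod (f (b + l *s h)) \<le> S"
        using S hood_near(1)[OF ab(2)] by blast
    qed
    then show ?thesis by (simp add: h_def \<rho>_def mult_ac)
  qed
qed

text \<open>Two applications of \<open>near_trans\<close>: from a centre b to a point z of its cell
  (60), from z to a point w of \<open>hood z\<close> (2), from w to a point of \<open>hood w\<close>
  (2).\<close>

definition near_const :: real where
  "near_const = 5 * (5 * 60 + 5 * 2 + 10 * 60 * 2) + 5 * 2 + 10 * (5 * 60 + 5 * 2 + 10 * 60 * 2) * 2"

definition local_mass :: "real \<Rightarrow> (complex ^ 'n \<Rightarrow> complex) \<Rightarrow> complex ^ 'n \<Rightarrow> ennreal" where
  "local_mass p f b = (\<integral>\<^sup>+z\<in>{z. near near_const b z}. ball_pow p f z \<partial>lborel)"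

text \<open>The submean inequality at w over \<open>hood w\<close>, a set which stays in the region
  of integration and whose volume is at least of order (1 - |b|)^(n+1).\<close>

lemma hood_sup_le_local_mass:
  "\<exists>K>0. \<forall>p (f :: complex ^ 'n \<Rightarrow> complex) b z w. 0 < p \<longrightarrow> holo_on unit_ball f \<longrightarrow> b \<in> unit_ball \<longrightarrow> z \<in> unit_ball \<longrightarrow>
    near 60 b z \<longrightarrow> w \<in> hood z \<longrightarrow>
    ennreal (cmod (f w) powr p) \<le> ennreal (K / (1 - norm b) ^ (CARD('n) + 1)) * local_mass p f b"
proof -
  define A1 :: real where "A1 = 5 * 60 + 5 * 2 + 10 * 60 * 2"
  define V where "V = unit_ball_vol (real (2 * CARD('n))) / (4 * 256 ^ CARD('n))"
  have V: "0 < V" by (simp add: V_def)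
  define K where "K = (2 * A1) ^ (CARD('n) + 1) / V"
  have K: "0 < K" using V by (simp add: K_def A1_def)
  have "ennreal (cmod (f w) powr p) \<le> ennreal (K / (1 - norm b) ^ (CARD('n) + 1)) * local_mass p f b"
    if p: "0 < p" and f: "holo_on unit_ball f" and b: "b \<in> unit_ball" and z: "z \<in> unit_ball"
      and bz: "near 60 b z" and wz: "w \<in> hood z" for p and f :: "complex ^ 'n \<Rightarrow> complex" and b z w
  proof -
    define d where "d = 1 - norm b"
    have d: "0 < d" using b by (simp add: d_def)
    note nw = hood_near[OF z wz]
    have bw: "near A1 b w" unfolding A1_def by (rule near_trans[OF bz nw(2) b z nw(1)])
    have sub: "hood w \<subseteq> {z. near near_const b z}"
    proof
      fix x assume x: "x \<in> hood w"
      note nx = hood_near[OF nw(1) x]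
      show "x \<in> {z. near near_const b z}"
        using near_trans[OF bw nx(2) b nw(1) nx(1)] by (simp add: near_const_def A1_def)
    qed
    have "d \<le> 2 * A1 * bgap w" using bgap_bounds(1)[OF b] near_bgap(2)[OF bw b nw(1)] by (simp add: d_def)
    then have "d / (2 * A1) \<le> bgap w" by (simp add: A1_def field_simps)
    then have "V * (d / (2 * A1)) ^ (CARD('n) + 1) \<le> V * bgap w ^ (CARD('n) + 1)"
      using V d by (intro mult_left_mono power_mono) (auto simp: A1_def)
    then have "ennreal (V * (d / (2 * A1)) ^ (CARD('n) + 1)) \<le> ennreal (V * bgap w ^ (CARD('n) + 1))" by (rule ennreal_leI)
    also have "\<dots> \<le> emeasure lborel (hood w)" unfolding V_def by (rule emeasure_hood_ge[OF nw(1)])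
    finally have vol: "ennreal (V * (d / (2 * A1)) ^ (CARD('n) + 1)) \<le> emeasure lborel (hood w)" .
    have "ennreal (cmod (f w) powr p) * ennreal (V * (d / (2 * A1)) ^ (CARD('n) + 1)) \<le> ennreal (cmod (f w) powr p) * emeasure lborel (hood w)"
      by (intro mult_left_mono vol) simp
    also have "\<dots> \<le> (\<integral>\<^sup>+z\<in>hood w. ball_pow p f z \<partial>lborel)" by (rule hood_submean[OF f nw(1) p])
    also have "\<dots> \<le> local_mass p f b"
      unfolding local_mass_def using sub by (intro nn_integral_mono) (auto simp: indicator_def)
    finally have "ennreal (K / d ^ (CARD('n) + 1)) * (ennreal (cmod (f w) powr p) * ennreal (V * (d / (2 * A1)) ^ (CARD('n) + 1))) \<le> ennreal (K / d ^ (CARD('n) + 1)) * local_mass p f b"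
      by (intro mult_left_mono) auto
    moreover have "ennreal (K / d ^ (CARD('n) + 1)) * (ennreal (cmod (f w) powr p) * ennreal (V * (d / (2 * A1)) ^ (CARD('n) + 1))) = ennreal (cmod (f w) powr p)"
    proof -
      have "K / d ^ (CARD('n) + 1) * (V * (d / (2 * A1)) ^ (CARD('n) + 1)) = 1"
        using V d by (simp add: K_def power_divide A1_def)
      then have "ennreal (K / d ^ (CARD('n) + 1)) * ennreal (V * (d / (2 * A1)) ^ (CARD('n) + 1)) = 1"
        using K V d by (subst ennreal_mult[symmetric]) (auto simp: A1_def)
      then show ?thesis by (metis mult.left_commute mult.right_neutral)
    qed
    ultimately show ?thesis by (simp add: d_def)
  qed
  then show ?thesis using K by (intro exI[of _ K]) blast
qed

section \<open>Summing local masses over the lattice\<close>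

context D_weight
begin

text \<open>The regions overlap boundedly often and tl(|z|)/(1 - |z|) is essentially constant on
  each, so the sum is controlled by the integral against this regular weight, which
  \<open>regular_norm_le\<close> returns to \<omega>.\<close>

lemma lattice_local_mass_sum:
  assumes lat: "lattice (a :: nat \<Rightarrow> complex ^ 'n)"
  shows "\<exists>N>0. \<forall>p f. 0 < p \<longrightarrow> holo_on unit_ball f \<longrightarrow>
    (\<Sum>j. ennreal (tl (norm (a j)) / (1 - norm (a j))) * local_mass p f (a j)) \<le> ennreal N * wnorm p f"
proof -
  have ab: "a j \<in> unit_ball" for j using lat by (simp add: lattice_def)
  have A: "0 < near_const" by (simp add: near_const_def)
  obtain N where N: "0 < N" "\<forall>z J. z \<in> unit_ball \<longrightarrow> finite J \<longrightarrow> (\<forall>j\<in>J. near near_const (a j) z) \<longrightarrow> real (card J) \<le> N"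
    using lattice_overlap[OF lat A] by (elim exE conjE) (rule that)
  obtain B1 where B1: "0 < B1" "\<forall>a z :: complex ^ 'n. norm a < 1 \<longrightarrow> norm z < 1 \<longrightarrow> near near_const a z \<longrightarrow> tl (norm a) \<le> B1 * tl (norm z)"
    using tl_near[of near_const] by (elim exE conjE) (rule that)
  obtain B2 where B2: "0 < B2" "\<forall>p>0. \<forall>f :: complex ^ 'n \<Rightarrow> complex. holo_on unit_ball f \<longrightarrow>
    (\<integral>\<^sup>+z. ball_pow p f z * ennreal (tl (norm z) / (1 - norm z)) \<partial>lborel) \<le> ennreal B2 * wnorm p f"
    using regular_norm_le by (elim exE conjE) (rule that)
  define E where "E = B1 * (4 * near_const)"
  have E: "0 < E" using B1 A by (simp add: E_def)
  have ind: "(\<Sum>j. indicator {z. near near_const (a j) z} z) \<le> ennreal N" if z: "z \<in> unit_ball" for z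
  proof (rule suminf_le_const)
    fix n
    define J where "J = {j. j < n \<and> near near_const (a j) z}"
    have "(\<Sum>j<n. indicator {z. near near_const (a j) z} z :: ennreal) = (\<Sum>j\<in>J. 1)"
      unfolding J_def by (intro sum.mono_neutral_cong_right) (auto simp: indicator_def)
    also have "\<dots> = ennreal (real (card J))" by (simp add: ennreal_of_nat_eq_real_of_nat)
    also have "\<dots> \<le> ennreal N" using N(2) z by (intro ennreal_leI) (auto simp: J_def)
    finally show "(\<Sum>j<n. indicator {z. near near_const (a j) z} z) \<le> ennreal N" .
  qed simp
  have "(\<Sum>j. ennreal (tl (norm (a j)) / (1 - norm (a j))) * local_mass p f (a j)) \<le> ennreal (E * N * B2) * wnorm p f"
    if p: "0 < p" and f: "holo_on unit_ball f" for p f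
  proof -
    note [measurable] = borel_measurable_ball_pow[OF f]
    define G where "G z = ball_pow p f z * ennreal (tl (norm z) / (1 - norm z))" for z
    have G[measurable]: "G \<in> borel_measurable borel" unfolding G_def by measurable
    have single: "ennreal (tl (norm (a j)) / (1 - norm (a j))) * local_mass p f (a j) \<le> ennreal E * (\<integral>\<^sup>+z\<in>{z. near near_const (a j) z}. G z \<partial>lborel)" for j
    proof -
      have "ennreal (tl (norm (a j)) / (1 - norm (a j))) * local_mass p f (a j)
        = (\<integral>\<^sup>+z. ennreal (tl (norm (a j)) / (1 - norm (a j))) * (ball_pow p f z * indicator {z. near near_const (a j) z} z) \<partial>lborel)"
        unfolding local_mass_def by (rule nn_integral_cmult[symmetric]) measurable
      also have "\<dots> \<le> (\<integral>\<^sup>+z. ennreal E * (G z * indicator {z. near near_const (a j) z} z) \<partial>lborel)"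
      proof (rule nn_integral_mono)
        fix z
        show "ennreal (tl (norm (a j)) / (1 - norm (a j))) * (ball_pow p f z * indicator {z. near near_const (a j) z} z) \<le> ennreal E * (G z * indicator {z. near near_const (a j) z} z)"
        proof (cases "z \<in> unit_ball \<and> near near_const (a j) z")
          case True
          then have z: "z \<in> unit_ball" and nz: "near near_const (a j) z" by auto
          have d: "0 < 1 - norm (a j)" "0 < 1 - norm z" using ab[of j] z by auto
          have t: "tl (norm (a j)) \<le> B1 * tl (norm z)" using B1(2) ab[of j] z nz by simp
          have "1 - norm z \<le> bgap z" using bgap_bounds(1)[OF z] .
          also have "\<dots> \<le> 2 * near_const * bgap (a j)" using near_bgap(1)[OF nz ab z] .
          also have "\<dots> \<le> 2 * near_const * (2 * (1 - norm (a j)))" using bgap_bounds(2)[OF ab[of j]] A by (intro mult_left_mono) auto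
          finally have "1 - norm z \<le> 4 * near_const * (1 - norm (a j))" by (simp add: algebra_simps)
          then have i: "1 / (1 - norm (a j)) \<le> 4 * near_const / (1 - norm z)" using d by (simp add: field_simps)
          have "tl (norm (a j)) / (1 - norm (a j)) = tl (norm (a j)) * (1 / (1 - norm (a j)))" by simp
          also have "\<dots> \<le> (B1 * tl (norm z)) * (4 * near_const / (1 - norm z))"
            using d B1(1) tl_nonneg by (intro mult_mono t i) auto
          also have "\<dots> = E * (tl (norm z) / (1 - norm z))" by (simp add: E_def)
          finally have "ennreal (tl (norm (a j)) / (1 - norm (a j))) \<le> ennreal (E * (tl (norm z) / (1 - norm z)))" by (rule ennreal_leI)
          also have "\<dots> = ennreal E * ennreal (tl (norm z) / (1 - norm z))" using E d tl_nonneg by (intro ennreal_mult) auto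
          finally have "ball_pow p f z * ennreal (tl (norm (a j)) / (1 - norm (a j))) \<le> ball_pow p f z * (ennreal E * ennreal (tl (norm z) / (1 - norm z)))"
            by (intro mult_left_mono) auto
          then show ?thesis using True by (simp add: G_def mult_ac)
        next
          case False
          then show ?thesis by (auto simp: ball_pow_def indicator_def)
        qed
      qed
      also have "\<dots> = ennreal E * (\<integral>\<^sup>+z\<in>{z. near near_const (a j) z}. G z \<partial>lborel)" by (rule nn_integral_cmult) measurable
      finally show ?thesis .
    qed
    have "(\<Sum>j. ennreal (tl (norm (a j)) / (1 - norm (a j))) * local_mass p f (a j)) \<le> (\<Sum>j. ennreal E * (\<integral>\<^sup>+z\<in>{z. near near_const (a j) z}. G z \<partial>lborel))"
      by (intro suminf_le single) auto
    also have "\<dots> = ennreal E * (\<integral>\<^sup>+z. (\<Sum>j. G z * indicator {z. near near_const (a j) z} z) \<partial>lborel)"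
      by (subst nn_integral_suminf) auto
    also have "\<dots> \<le> ennreal E * (\<integral>\<^sup>+z. ennreal N * G z \<partial>lborel)"
    proof (intro mult_left_mono nn_integral_mono)
      fix z
      show "(\<Sum>j. G z * indicator {z. near near_const (a j) z} z) \<le> ennreal N * G z"
      proof (cases "z \<in> unit_ball")
        case True
        have "(\<Sum>j. G z * indicator {z. near near_const (a j) z} z) = G z * (\<Sum>j. indicator {z. near near_const (a j) z} z)"
          by simp
        also have "\<dots> \<le> G z * ennreal N" using ind[OF True] by (intro mult_left_mono) auto
        finally show ?thesis by (simp add: mult.commute)
      qed (simp add: G_def ball_pow_def)
    qed simp
    also have "\<dots> = ennreal E * (ennreal N * (\<integral>\<^sup>+z. G z \<partial>lborel))" by (subst nn_integral_cmult) auto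
    also have "\<dots> \<le> ennreal E * (ennreal N * (ennreal B2 * wnorm p f))"
      unfolding G_def using B2(2) p f by (intro mult_left_mono) auto
    also have "\<dots> = ennreal (E * N * B2) * wnorm p f" using E N(1) B2(1) by (simp add: ennreal_mult mult.assoc)
    finally show ?thesis .
  qed
  moreover have "0 < E * N * B2" using E N(1) B2(1) by simp
  ultimately show ?thesis by blast
qed

end

section \<open>Summability from the Carleson condition; normal families\<close>

context D_weight
begin

text \<open>Choosing \<open>c\<^sub>j = (\<nu>(Q\<^sub>j)/W\<^sub>j)\<^bsup>1/(p-q)\<^esup>\<close> in the discrete inequality makes both sides sums of the same
  terms \<open>t\<^sub>j\<close>; since \<open>q < p\<close> this bounds \<open>\<Sum>t\<^sub>j\<close>, and Young's inequality absorbs \<open>\<nu>(Q\<^sub>j)\<close>.\<close>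
lemma carleson_Young:
  assumes lat: "lattice a" and pq: "0 < q" "q < p" and car: "carleson q p \<omega> \<nu>"
    and sets: "sets \<nu> = sets ball_space"
    and Q: "\<And>j. Q j \<in> sets \<nu>" "disjoint_family Q" "\<forall>j. \<forall>z\<in>Q j. near 60 (a j) z"
  shows "(\<forall>j. emeasure \<nu> (Q j) < \<infinity>) \<and> (\<exists>t :: nat \<Rightarrow> real. (\<forall>j. 0 \<le> t j) \<and> summable t \<and>
    (\<forall>\<eta>>0. \<exists>C\<ge>0. \<forall>j x. 0 \<le> x \<longrightarrow>
      ennreal (x powr (q / p)) * emeasure \<nu> (Q j) \<le> ennreal (\<eta> * (x * cellw (a j)) + C * t j)))"
proof -
  have p: "0 < p" using pq by simp
  have ab: "a j \<in> unit_ball" for j using lat by (simp add: lattice_def)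
  obtain C where C: "0 < C" and disc: "\<And>J c. finite J \<Longrightarrow> (\<forall>j\<in>J. 0 \<le> c j) \<Longrightarrow>
    (\<Sum>j\<in>J. ennreal (c j powr q) * emeasure \<nu> (Q j)) \<le> ennreal (C * (\<Sum>j\<in>J. c j powr p * cellw (a j)) powr (q / p))"
    using carleson_discrete[OF lat pq(1) p car sets Q(1,2) Q(3)[rule_format]] by blast
  \<comment> \<open>One cell with coefficient 1 tests finiteness, which allows the measures of cells
    to be handled as reals.\<close>
  have fin: "emeasure \<nu> (Q j) < \<infinity>" for j
    using disc[of "{j}" "\<lambda>_. 1"] by (simp add: le_less_trans[OF _ ennreal_less_top])
  define \<beta> where "\<beta> j = enn2real (emeasure \<nu> (Q j))" for j
  define W where "W j = cellw (a j)" for j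
  have e\<beta>: "emeasure \<nu> (Q j) = ennreal (\<beta> j)" for j using fin[of j] by (simp add: \<beta>_def less_top)
  have \<beta>: "0 \<le> \<beta> j" for j by (simp add: \<beta>_def)
  have W: "0 < W j" for j unfolding W_def by (rule cellw_pos[OF ab])
  define t where "t j = (\<beta> j / W j) powr (p / (p - q)) * W j" for j
  have t0: "0 \<le> t j" for j using W[of j] by (simp add: t_def)
  define \<theta> where "\<theta> = q / p"
  have \<theta>: "0 < \<theta>" "\<theta> < 1" using pq by (auto simp: \<theta>_def)
  have sum_bound: "(\<Sum>j\<in>J. t j) \<le> C powr (1 / (1 - \<theta>))" if J: "finite J" for J
  proof -
    define c where "c j = (\<beta> j / W j) powr (1 / (p - q))" for j
    have e0: "q / (p - q) + 1 = p / (p - q)" using pq by (simp add: field_simps)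
    have c1: "c j powr q * \<beta> j = t j" for j
    proof (cases "\<beta> j = 0")
      case False
      then have b: "0 < \<beta> j / W j" using \<beta>[of j] W[of j] by simp
      have "c j powr q * \<beta> j = (\<beta> j / W j) powr (q / (p - q)) * ((\<beta> j / W j) powr 1 * W j)"
        using b W[of j] \<beta>[of j] by (simp add: c_def powr_powr)
      also have "\<dots> = (\<beta> j / W j) powr (q / (p - q) + 1) * W j" by (simp only: powr_add mult.assoc)
      finally show ?thesis unfolding e0 t_def .
    qed (use pq in \<open>simp add: t_def\<close>)
    have c2: "c j powr p * W j = t j" for j by (simp add: c_def t_def powr_powr)
    define s where "s = (\<Sum>j\<in>J. t j)"
    have s0: "0 \<le> s" unfolding s_def by (intro sum_nonneg t0)
    have "ennreal s = (\<Sum>j\<in>J. ennreal (c j powr q) * emeasure \<nu> (Q j))"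
      unfolding s_def e\<beta> by (simp add: ennreal_mult[symmetric] \<beta> c1 sum_ennreal t0)
    also have "\<dots> \<le> ennreal (C * (\<Sum>j\<in>J. c j powr p * cellw (a j)) powr (q / p))"
      by (rule disc[OF J]) (simp add: c_def)
    also have "(\<Sum>j\<in>J. c j powr p * cellw (a j)) = s" by (simp add: s_def c2 flip: W_def)
    \<comment> \<open>Here s is a finite real, so s^\<theta> may be cancelled; the resulting bound
      is independent of J.\<close>
    finally have le: "s \<le> C * s powr \<theta>" using C by (simp add: \<theta>_def)
    show ?thesis
    proof (cases "s = 0")
      case False
      then have s: "0 < s" using s0 by simp
      have "s powr (1 - \<theta>) * s powr \<theta> = s" using s by (simp flip: powr_add)
      then have "s powr (1 - \<theta>) * s powr \<theta> \<le> C * s powr \<theta>" using le by simp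
      then have "s powr (1 - \<theta>) \<le> C" using s by simp
      then have "(s powr (1 - \<theta>)) powr (1 / (1 - \<theta>)) \<le> C powr (1 / (1 - \<theta>))"
        using \<theta> by (intro powr_mono2) auto
      then show ?thesis using s \<theta> by (simp add: powr_powr s_def)
    qed (simp add: s_def[symmetric])
  qed
  have "summable t"
    by (rule summableI_nonneg_bounded[where x = "C powr (1 / (1 - \<theta>))"]) (use t0 sum_bound in auto)
  moreover have "\<exists>C\<ge>0. \<forall>j x. 0 \<le> x \<longrightarrow>
      ennreal (x powr (q / p)) * emeasure \<nu> (Q j) \<le> ennreal (\<eta> * (x * cellw (a j)) + C * t j)" if \<eta>: "0 < \<eta>" for \<eta>
  proof (intro exI[of _ "\<eta> powr (- \<theta> / (1 - \<theta>))"] conjI allI impI)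
    fix j and x :: real assume x: "0 \<le> x"
    \<comment> \<open>Chosen so that \<eta>^\<theta> E^(1 - \<theta>) = 1.\<close>
    define E where "E = \<eta> powr (- \<theta> / (1 - \<theta>))"
    have E: "0 < E" using \<eta> by (simp add: E_def)
    have "x powr \<theta> * \<beta> j \<le> \<eta> * (x * W j) + E * t j"
    proof (cases "x = 0 \<or> \<beta> j = 0")
      case True
      then have "x powr \<theta> * \<beta> j = 0" by auto
      also have "0 \<le> \<eta> * (x * W j) + E * t j" using \<eta> x W[of j] E t0[of j] by (intro add_nonneg_nonneg mult_nonneg_nonneg) auto
      finally show ?thesis .
    next
      case False
      then have x: "0 < x" and b: "0 < \<beta> j" using x \<beta>[of j] by auto
      have t: "0 < t j" using b W[of j] by (simp add: t_def)
      have pp: "p / (p - q) * (1 - \<theta>) = 1" using pq by (simp add: \<theta>_def field_simps)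
      have "t j powr (1 - \<theta>) = ((\<beta> j / W j) powr (p / (p - q))) powr (1 - \<theta>) * W j powr (1 - \<theta>)"
        using W[of j] by (simp add: t_def powr_mult)
      also have "\<dots> = \<beta> j / W j * W j powr (1 - \<theta>)" 
      proof -
        have "((\<beta> j / W j) powr (p / (p - q))) powr (1 - \<theta>) = \<beta> j / W j" unfolding powr_powr pp using b W[of j] by simp
        then show ?thesis by (simp only:)
      qed
      also have "\<dots> = \<beta> j / W j powr \<theta>" using W[of j] by (simp add: powr_diff)
      \<comment> \<open>The purpose of the exponent in \<open>t\<close>: the measure of the cell
        becomes a geometric mean of \<open>t j\<close> and \<open>W j\<close> with weights 1 -
        \<theta> and \<theta>, the shape required by Young's inequality.\<close>
      finally have tb: "\<beta> j = t j powr (1 - \<theta>) * W j powr \<theta>" using W[of j] by simp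
      have Ep: "E powr (1 - \<theta>) = \<eta> powr (- \<theta>)" using \<theta> by (simp add: E_def powr_powr)
      have "x powr \<theta> * \<beta> j = (\<eta> * (x * W j)) powr \<theta> * (E * t j) powr (1 - \<theta>)"
      proof -
        have "(\<eta> * (x * W j)) powr \<theta> * (E * t j) powr (1 - \<theta>) = (\<eta> powr \<theta> * \<eta> powr (- \<theta>)) * (x powr \<theta> * (t j powr (1 - \<theta>) * W j powr \<theta>))"
          using \<eta> x W[of j] E t by (simp add: powr_mult Ep mult_ac)
        also have "\<eta> powr \<theta> * \<eta> powr (- \<theta>) = 1" using \<eta> by (simp flip: powr_add)
        finally show ?thesis by (simp add: tb)
      qed
      also have "\<dots> \<le> \<theta> * (\<eta> * (x * W j)) + (1 - \<theta>) * (E * t j)"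
        using \<theta> \<eta> x W[of j] E t by (intro Youngs_inequality_0) auto
      also have "\<dots> \<le> 1 * (\<eta> * (x * W j)) + 1 * (E * t j)"
        using \<theta> \<eta> x W[of j] E t by (intro add_mono mult_right_mono) auto
      finally show ?thesis by simp
    qed
    then show "ennreal (x powr (q / p)) * emeasure \<nu> (Q j) \<le> ennreal (\<eta> * (x * cellw (a j)) + \<eta> powr (- \<theta> / (1 - \<theta>)) * t j)"
      unfolding e\<beta> using \<beta>[of j] by (subst ennreal_mult[symmetric]) (auto intro!: ennreal_leI simp: W_def E_def \<theta>_def)
  qed simp
  ultimately show ?thesis using fin t0 by blast
qed

text \<open>The submean inequality is combined with the regular weight, which is bounded below on
  compact subsets of the ball; \<omega> itself need not be.\<close>

lemma locally_bounded:
  assumes p: "0 < p" and R: "R < 1" "0 \<le> R" and M: "0 \<le> M"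
  shows "\<exists>B. \<forall>f. holo_on unit_ball f \<longrightarrow> wnorm p f \<le> ennreal M \<longrightarrow> (\<forall>z :: complex ^ 'n. norm z \<le> R \<longrightarrow> cmod (f z) \<le> B)"
proof -
  obtain B2 where B2: "0 < B2" "\<forall>p>0. \<forall>f :: complex ^ 'n \<Rightarrow> complex. holo_on unit_ball f \<longrightarrow>
    (\<integral>\<^sup>+z. ball_pow p f z * ennreal (tl (norm z) / (1 - norm z)) \<partial>lborel) \<le> ennreal B2 * wnorm p f"
    using regular_norm_le by (elim exE conjE) (rule that)
  define V where "V = unit_ball_vol (real (2 * CARD('n))) / (4 * 256 ^ CARD('n)) * (1 - R) ^ (CARD('n) + 1)"
  have V: "0 < V" using R by (simp add: V_def)
  \<comment> \<open>Points of \<open>hood z\<close> have gap at least a quarter of that of z, hence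
    at least (1 - R)/4, and therefore norm at most R'.\<close>
  define R' where "R' = sqrt (1 - (1 - R) / 4)"
  have R': "R' < 1" using R by (simp add: R'_def)
  have tR: "0 < tl R'" by (rule tl_pos[OF R'])
  define X where "X = B2 * M / (tl R' * V)"
  have X: "0 \<le> X" using B2(1) M tR V by (simp add: X_def)
  have "cmod (f z) \<le> X powr (1 / p)" if f: "holo_on unit_ball f" and w: "wnorm p f \<le> ennreal M" and z: "norm z \<le> R" for f and z :: "complex ^ 'n"
  proof -
    note [measurable] = borel_measurable_ball_pow[OF f]
    have zb: "z \<in> unit_ball" using z R by simp
    have bz: "1 - R \<le> bgap z" using bgap_bounds(1)[OF zb] z by simp
    have "ennreal (cmod (f z) powr p) * ennreal V \<le> ennreal (cmod (f z) powr p) * emeasure lborel (hood z)"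
    proof (rule mult_left_mono)
      have "V \<le> unit_ball_vol (real (2 * CARD('n))) / (4 * 256 ^ CARD('n)) * bgap z ^ (CARD('n) + 1)"
        unfolding V_def using bz R by (intro mult_left_mono power_mono) auto
      then have "ennreal V \<le> ennreal (unit_ball_vol (real (2 * CARD('n))) / (4 * 256 ^ CARD('n)) * bgap z ^ (CARD('n) + 1))" by (rule ennreal_leI)
      also have "\<dots> \<le> emeasure lborel (hood z)" by (rule emeasure_hood_ge[OF zb])
      finally show "ennreal V \<le> emeasure lborel (hood z)" .
    qed simp
    also have "\<dots> \<le> (\<integral>\<^sup>+w\<in>hood z. ball_pow p f w \<partial>lborel)" by (rule hood_submean[OF f zb p])
    finally have 1: "ennreal (cmod (f z) powr p) * ennreal V \<le> (\<integral>\<^sup>+w\<in>hood z. ball_pow p f w \<partial>lborel)" .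
    have "ennreal (tl R') * (\<integral>\<^sup>+w\<in>hood z. ball_pow p f w \<partial>lborel) = (\<integral>\<^sup>+w. ennreal (tl R') * (ball_pow p f w * indicator (hood z) w) \<partial>lborel)"
      by (rule nn_integral_cmult[symmetric]) measurable
    also have "\<dots> \<le> (\<integral>\<^sup>+w. ball_pow p f w * ennreal (tl (norm w) / (1 - norm w)) \<partial>lborel)"
    proof (rule nn_integral_mono)
      fix w
      show "ennreal (tl R') * (ball_pow p f w * indicator (hood z) w) \<le> ball_pow p f w * ennreal (tl (norm w) / (1 - norm w))"
      proof (cases "w \<in> hood z")
        case True
        note nw = hood_near[OF zb True]
        have "1 - R \<le> 2 * 2 * bgap w" using bz near_bgap(2)[OF nw(2) zb nw(1)] by simp
        then have "(norm w)\<^sup>2 \<le> 1 - (1 - R) / 4" unfolding bgap_def by (simp add: field_simps)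
        then have "norm w \<le> R'" unfolding R'_def by (rule real_le_rsqrt)
        then have "tl R' \<le> tl (norm w)" by (rule tl_antimono)
        also have "\<dots> \<le> tl (norm w) / (1 - norm w)"
          using nw(1) tl_nonneg[of "norm w"] by (simp add: le_divide_eq mult_left_le)
        finally have "ennreal (tl R') \<le> ennreal (tl (norm w) / (1 - norm w))" by (rule ennreal_leI)
        then have "ball_pow p f w * ennreal (tl R') \<le> ball_pow p f w * ennreal (tl (norm w) / (1 - norm w))" by (intro mult_left_mono) auto
        then show ?thesis using True by (simp add: mult.commute)
      qed simp
    qed
    also have "\<dots> \<le> ennreal B2 * wnorm p f" using B2(2) p f by simp
    also have "\<dots> \<le> ennreal B2 * ennreal M" by (intro mult_left_mono w) simp
    finally have 2: "ennreal (tl R') * (\<integral>\<^sup>+w\<in>hood z. ball_pow p f w \<partial>lborel) \<le> ennreal B2 * ennreal M" .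
    have "ennreal (tl R') * (ennreal (cmod (f z) powr p) * ennreal V) \<le> ennreal B2 * ennreal M"
      by (rule order_trans[OF mult_left_mono[OF 1] 2]) simp
    then have "tl R' * (cmod (f z) powr p * V) \<le> B2 * M"
      using tR V B2(1) M by (simp add: ennreal_mult[symmetric])
    then have "cmod (f z) powr p \<le> X" using tR V by (simp add: X_def pos_le_divide_eq mult_ac)
    then have "(cmod (f z) powr p) powr (1 / p) \<le> X powr (1 / p)" using p by (intro powr_mono2) auto
    then show ?thesis using p by (simp add: powr_powr)
  qed
  then show ?thesis by blast
qed

text \<open>Local bounds and Cauchy's estimate give equicontinuity, Arzela-Ascoli a subsequence on
  each ball of an exhaustion, and a diagonal choice one subsequence for all. The result is stated as
  a Cauchy property because the compactness proof works with differences of two members.\<close>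

lemma locally_uniformly_Cauchy_subsequence:
  fixes fs :: "nat \<Rightarrow> complex ^ 'n \<Rightarrow> complex"
  assumes p: "0 < p" and fs: "\<And>k. holo_on unit_ball (fs k)" and M: "0 \<le> M" "\<And>k. wnorm p (fs k) \<le> ennreal M"
  shows "\<exists>s :: nat \<Rightarrow> nat. strict_mono s \<and> (\<forall>R<1. \<forall>e>0. \<exists>N. \<forall>m n x. N \<le> m \<and> N \<le> n \<and> norm x \<le> R \<longrightarrow> cmod (fs (s m) x - fs (s n) x) < e)"
proof -
  define R where "R i = 1 - 1 / (real i + 2)" for i :: nat
  have R: "0 \<le> R i" "R i < 1" for i by (auto simp: R_def field_simps)
  define P where "P i r \<longleftrightarrow> (\<forall>e>0. \<exists>N. \<forall>m n x. N \<le> m \<and> N \<le> n \<and> norm x \<le> R i \<longrightarrow> cmod (fs (r m) x - fs (r n) x) < e)"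
    for i and r :: "nat \<Rightarrow> nat"
  have sub: "\<exists>k. strict_mono (k :: nat \<Rightarrow> nat) \<and> P i (r \<circ> k)" for i r
  proof -
    define R1 where "R1 = (1 + R i) / 2"
    have R1: "R i < R1" "R1 < 1" using R[of i] by (auto simp: R1_def)
    obtain B where B: "\<And>f z. holo_on unit_ball f \<Longrightarrow> wnorm p f \<le> ennreal M \<Longrightarrow> norm (z :: complex ^ 'n) \<le> R1 \<Longrightarrow> cmod (f z) \<le> B"
      using locally_bounded[OF p R1(2) _ M(1)] R[of i] R1 by (metis order.trans less_imp_le)
    have Bf: "cmod (fs k z) \<le> B" if "norm z \<le> R1" for k z using B[OF fs M(2) that] .
    have B0: "0 \<le> B" using R[of i] R1 by (intro order_trans[OF norm_ge_zero Bf[of 0 0]]) simp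
    \<comment> \<open>For |l| < (1 - R i) / (2 |h|) the point x + l h remains in the ball of radius
      R1, halfway between R i and 1, where the functions are bounded by B.\<close>
    have lip: "cmod (fs k x - fs k y) \<le> 4 * B / (1 - R i) * norm (x - y)" if x: "norm x \<le> R i" and xy: "norm (x - y) < (1 - R i) / 4" for k x y
    proof (cases "x = y")
      case False
      define h where "h = y - x"
      have h: "0 < norm h" "norm h < (1 - R i) / 4" using False xy by (auto simp: h_def norm_minus_commute)
      have "cmod (fs k (x + h) - fs k x) \<le> 2 / ((1 - R i) / (2 * norm h)) * B"
      proof (rule holo_difference_bound[OF fs])
        show "2 < (1 - R i) / (2 * norm h)" using h by (simp add: field_simps)
        fix l :: complex assume l: "cmod l < (1 - R i) / (2 * norm h)"
        have "norm (x + l *s h) \<le> norm x + cmod l * norm h" using norm_triangle_ineq[of x "l *s h"] by (simp add: norm_vector_scale)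
        also have "cmod l * norm h \<le> (1 - R i) / 2" using l h by (simp add: field_simps)
        finally have "norm (x + l *s h) \<le> R1" using x by (simp add: R1_def field_simps)
        then show "x + l *s h \<in> unit_ball \<and> cmod (fs k (x + l *s h)) \<le> B" using Bf R1 by auto
      qed
      then show ?thesis by (simp add: h_def norm_minus_commute mult_ac)
    qed simp
    obtain g k where k: "strict_mono (k :: nat \<Rightarrow> nat)" and
      conv: "\<And>e. 0 < e \<Longrightarrow> \<exists>N. \<forall>n x. n \<ge> N \<and> x \<in> cball 0 (R i) \<longrightarrow> norm (fs (r (k n)) x - g x) < e"
    proof (rule Arzela_Ascoli[of "cball 0 (R i)" "\<lambda>n. fs (r n)" B])
      show "compact (cball (0 :: complex ^ 'n) (R i))" by simp
      show "norm (fs (r n) x) \<le> B" if "x \<in> cball 0 (R i)" for n x using that R1 by (intro Bf) auto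
      show "\<exists>d. 0 < d \<and> (\<forall>n y. y \<in> cball 0 (R i) \<and> norm (x - y) < d \<longrightarrow> norm (fs (r n) x - fs (r n) y) < e)"
        if x: "x \<in> cball 0 (R i)" and e: "0 < e" for x e
      proof (intro exI[of _ "min ((1 - R i) / 4) (e * (1 - R i) / (4 * B + 1))"] conjI allI impI)
        show "0 < min ((1 - R i) / 4) (e * (1 - R i) / (4 * B + 1))" using R[of i] e B0 by simp
        fix n y assume y: "y \<in> cball 0 (R i) \<and> norm (x - y) < min ((1 - R i) / 4) (e * (1 - R i) / (4 * B + 1))"
        have "norm (fs (r n) x - fs (r n) y) \<le> 4 * B / (1 - R i) * norm (x - y)" using x y by (intro lip) auto
        also have "\<dots> \<le> (4 * B + 1) / (1 - R i) * norm (x - y)"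
          using R[of i] by (intro mult_right_mono divide_right_mono) auto
        also have "\<dots> < (4 * B + 1) / (1 - R i) * (e * (1 - R i) / (4 * B + 1))"
          using y R[of i] B0 by (intro mult_strict_left_mono divide_pos_pos) auto
        also have "\<dots> = e" using R[of i] B0 by simp
        finally show "norm (fs (r n) x - fs (r n) y) < e" .
      qed
    qed (blast intro: that)
    have "P i (r \<circ> k)"
      unfolding P_def
    proof (intro allI impI)
      fix e :: real assume e: "0 < e"
      then obtain N where N: "\<And>n x. n \<ge> N \<Longrightarrow> norm x \<le> R i \<Longrightarrow> norm (fs (r (k n)) x - g x) < e / 2"
        using conv[of "e / 2"] by auto
      show "\<exists>N. \<forall>m n x. N \<le> m \<and> N \<le> n \<and> norm x \<le> R i \<longrightarrow> cmod (fs ((r \<circ> k) m) x - fs ((r \<circ> k) n) x) < e"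
      proof (intro exI[of _ N] allI impI)
        fix m n and x :: "complex ^ 'n" assume "N \<le> m \<and> N \<le> n \<and> norm x \<le> R i"
        then have "norm (fs (r (k m)) x - g x) < e / 2" "norm (fs (r (k n)) x - g x) < e / 2" using N by auto
        then show "cmod (fs ((r \<circ> k) m) x - fs ((r \<circ> k) n) x) < e"
          using norm_triangle_ineq4[of "fs (r (k m)) x - g x" "fs (r (k n)) x - g x"] by simp
      qed
    qed
    with k show ?thesis by blast
  qed
  obtain k where k: "strict_mono (k :: nat \<Rightarrow> nat)" "\<And>i. P i (id \<circ> k)"
  proof (rule subsequence_diagonalization_lemma[of P id])
    show "\<exists>k :: nat \<Rightarrow> nat. strict_mono k \<and> P i (r \<circ> k)" for i r by (rule sub)
    show "P i (r \<circ> k2)" if P1: "P i (r \<circ> k1)" and k12: "\<And>j. N \<le> j \<Longrightarrow> \<exists>j'\<ge>j. k2 j = k1 j'" for i N and r k1 k2 :: "nat \<Rightarrow> nat"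
      unfolding P_def
    proof (intro allI impI)
      fix e :: real assume "0 < e"
      then obtain N0 where N0: "\<forall>m n x. N0 \<le> m \<and> N0 \<le> n \<and> norm x \<le> R i \<longrightarrow> cmod (fs ((r \<circ> k1) m) x - fs ((r \<circ> k1) n) x) < e"
        using P1 unfolding P_def by blast
      show "\<exists>N. \<forall>m n x. N \<le> m \<and> N \<le> n \<and> norm x \<le> R i \<longrightarrow> cmod (fs ((r \<circ> k2) m) x - fs ((r \<circ> k2) n) x) < e"
      proof (intro exI[of _ "max N N0"] allI impI)
        fix m n and x :: "complex ^ 'n" assume h: "max N N0 \<le> m \<and> max N N0 \<le> n \<and> norm x \<le> R i"
        obtain m' n' where "m' \<ge> m" "k2 m = k1 m'" "n' \<ge> n" "k2 n = k1 n'" using k12[of m] k12[of n] h by auto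
        then show "cmod (fs ((r \<circ> k2) m) x - fs ((r \<circ> k2) n) x) < e" using N0[rule_format, of m' n' x] h by simp
      qed
    qed
  qed (blast intro: that)
  have main: "\<exists>N. \<forall>m n x. N \<le> m \<and> N \<le> n \<and> norm x \<le> \<rho> \<longrightarrow> cmod (fs (k m) x - fs (k n) x) < e" if \<rho>: "\<rho> < 1" and e: "0 < e" for \<rho> e
  proof -
    obtain i :: nat where i: "1 / (1 - \<rho>) < real i" using reals_Archimedean2 by blast
    have "1 < (1 - \<rho>) * real i" using i \<rho> by (simp add: field_simps)
    also have "\<dots> \<le> (1 - \<rho>) * (real i + 2)" using \<rho> by (intro mult_left_mono) auto
    finally have "1 / (real i + 2) \<le> 1 - \<rho>" by (simp add: pos_divide_le_eq)
    then have "\<rho> \<le> R i" by (simp add: R_def)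
    then show ?thesis using k(2)[of i, unfolded P_def, rule_format, OF e] by (simp add: o_def) (meson order_trans)
  qed
  show ?thesis by (intro exI[of _ k] conjI allI impI k(1) main)
qed

end

section \<open>The difference operator\<close>

lemma emeasure_measure_add:
  assumes "sets N = sets M" "A \<in> sets M"
  shows "emeasure (measure_add M N) A = emeasure M A + emeasure N A"
proof (rule emeasure_measure_of[OF measure_add_def])
  show "countably_additive (sets (measure_add M N)) (\<lambda>A. emeasure M A + emeasure N A)"
  proof (rule countably_additiveI)
    fix B :: "nat \<Rightarrow> _" assume B: "range B \<subseteq> sets (measure_add M N)" "disjoint_family B" "(\<Union>i. B i) \<in> sets (measure_add M N)"
    have BM: "range B \<subseteq> sets M" "range B \<subseteq> sets N"
      using B(1) assms(1) by (auto simp: measure_add_def)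
    show "(\<Sum>i. emeasure M (B i) + emeasure N (B i)) = emeasure M (\<Union>i. B i) + emeasure N (\<Union>i. B i)"
      by (subst suminf_add[symmetric]) (simp_all add: suminf_emeasure[OF BM(1) B(2)] suminf_emeasure[OF BM(2) B(2)])
  qed
qed (use assms in \<open>auto simp: measure_add_def positive_def sets.space_closed sets.sigma_sets_eq\<close>)

lemma sets_measure_add: "sets (measure_add M N) = sets M"
  by (simp add: measure_add_def)

lemma nn_integral_measure_add:
  assumes sets: "sets N = sets M" and g: "g \<in> borel_measurable M"
  shows "(\<integral>\<^sup>+x. g x \<partial>measure_add M N) = (\<integral>\<^sup>+x. g x \<partial>M) + (\<integral>\<^sup>+x. g x \<partial>N)"
proof -
  have sA: "sets (measure_add M N) = sets M" by (rule sets_measure_add)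
  have m: "h \<in> borel_measurable (measure_add M N) \<longleftrightarrow> h \<in> borel_measurable M"
    "h \<in> borel_measurable N \<longleftrightarrow> h \<in> borel_measurable M" for h :: "'a \<Rightarrow> ennreal"
    by (simp_all add: measurable_cong_sets[OF sA refl] measurable_cong_sets[OF sets refl])
  have sp: "space (measure_add M N) = space M" "space N = space M"
    using sets_eq_imp_space_eq[OF sA] sets_eq_imp_space_eq[OF sets] by auto
  show ?thesis
    using g
  proof (induction rule: borel_measurable_induct)
    case (cong f g)
    have "(\<integral>\<^sup>+x. f x \<partial>K) = (\<integral>\<^sup>+x. g x \<partial>K)" if "space K = space M" for K
      by (rule nn_integral_cong) (use cong(3) that in simp)
    then show ?case using cong(4) sp by simp
  next
    case (set A)
    then show ?case using emeasure_measure_add[OF sets set] by (simp add: sA sets)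
  next
    case (mult u c)
    then show ?case by (simp add: nn_integral_cmult m distrib_left)
  next
    case (add u v)
    then show ?case by (simp add: nn_integral_add m add_ac)
  next
    case (seq U)
    have "(\<integral>\<^sup>+x. (SUP i. U i x) \<partial>K) = (SUP i. \<integral>\<^sup>+x. U i x \<partial>K)" if "\<And>i. U i \<in> borel_measurable K" for K
      using seq that by (intro nn_integral_monotone_convergence_SUP) auto
    note mc = this
    have inc: "incseq (\<lambda>i. \<integral>\<^sup>+x. U i x \<partial>K)" for K
      using seq(3) by (auto simp: incseq_def le_fun_def intro!: nn_integral_mono)
    have "(SUP i. (\<integral>\<^sup>+x. U i x \<partial>M) + (\<integral>\<^sup>+x. U i x \<partial>N)) = (SUP i. \<integral>\<^sup>+x. U i x \<partial>M) + (SUP i. \<integral>\<^sup>+x. U i x \<partial>N)"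
      by (rule ennreal_SUP_add[OF inc inc])
    then show ?case using seq by (simp add: mc m SUP_apply[abs_def] image_comp)
  qed
qed

text \<open>Split at \<open>r0\<close>. For small \<rho> write u f(a) - v f(b) = (u - v) f(a) + v
  (f(a) - f(b)) and apply the Schwarz bound at b; otherwise insert the factor \<rho>/r0 >= 1.
  Exchanging a with b and u with v settles c = b. The majorant S is left free so that it can be made
  constant on cells.\<close>

lemma pointwise_difference_bound:
  fixes f :: "complex ^ 'n \<Rightarrow> complex"
  assumes f: "holo_on unit_ball f" and ab: "a \<in> unit_ball" "b \<in> unit_ball" and r: "0 < r"
    and S: "\<And>y w. y \<in> unit_ball \<Longrightarrow> w \<in> hood y \<Longrightarrow> cmod (f w) \<le> S y"
    and c: "c = a \<or> c = b"
  shows "cmod (u * f a - v * f b) \<le> 32 / min r (1/64) *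
    (cmod (of_real (pseudo_hyp a b) * u) * S a + cmod (of_real (pseudo_hyp a b) * v) * S b
      + (if pseudo_hyp a b < r then cmod (u - v) else 0) * S c)"
proof -
  have main: "cmod (u * f a - v * f b) \<le> 32 / min r (1/64) *
    (cmod (of_real (pseudo_hyp a b) * u) * S a + cmod (of_real (pseudo_hyp a b) * v) * S b
      + (if pseudo_hyp a b < r then cmod (u - v) else 0) * S a)"
    if ab: "a \<in> unit_ball" "b \<in> unit_ball" for a b u v
  proof -
    define \<rho> where "\<rho> = pseudo_hyp a b"
    define r0 where "r0 = min r (1/64)"
    have r0: "0 < r0" "r0 \<le> 1/64" "r0 \<le> r" using r by (auto simp: r0_def)
    have \<rho>: "0 \<le> \<rho>" by (simp add: \<rho>_def pseudo_hyp_nonneg)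
    have fa: "cmod (f a) \<le> S a" "cmod (f b) \<le> S b" using S self_in_hood ab by auto
    have Sab: "0 \<le> S a" "0 \<le> S b" using fa norm_ge_zero order_trans by blast+
    have k: "32 \<le> 32 / r0" using r0 by (simp add: field_simps)
    define X where "X = cmod u * \<rho> * S a"
    define Y where "Y = cmod v * \<rho> * S b"
    define Z where "Z = (if \<rho> < r then cmod (u - v) else 0) * S a"
    have XYZ: "0 \<le> X" "0 \<le> Y" "0 \<le> Z" using \<rho> Sab by (auto simp: X_def Y_def Z_def)
    have "cmod (u * f a - v * f b) \<le> 32 / r0 * (X + Y + Z)"
    proof (cases "\<rho> < r0")
      case True
      have "cmod (f a - f b) \<le> 32 * pseudo_hyp b a * S b"
        by (rule hood_Schwarz[OF f ab]) (use True r0 S ab in \<open>auto simp: \<rho>_def pseudo_hyp_commute\<close>)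
      then have d: "cmod (f a - f b) \<le> 32 * \<rho> * S b" using ab by (simp add: \<rho>_def pseudo_hyp_commute)
      have "u * f a - v * f b = (u - v) * f a + v * (f a - f b)" by (simp add: algebra_simps)
      then have "cmod (u * f a - v * f b) \<le> cmod ((u - v) * f a) + cmod (v * (f a - f b))" by (metis norm_triangle_ineq)
      also have "cmod ((u - v) * f a) \<le> cmod (u - v) * S a" unfolding norm_mult by (intro mult_left_mono fa) auto
      also have "\<dots> = Z" using True r0 by (simp add: Z_def)
      also have "cmod (v * (f a - f b)) \<le> cmod v * (32 * \<rho> * S b)" unfolding norm_mult by (intro mult_left_mono d) auto
      also have "\<dots> = 32 * Y" by (simp add: Y_def)
      also have "Z + 32 * Y \<le> 32 * (X + Y + Z)" using XYZ by simp
      also have "\<dots> \<le> 32 / r0 * (X + Y + Z)" using XYZ by (intro mult_right_mono k) auto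
      finally show ?thesis by simp
    next
      case False
      then have rr: "1 \<le> \<rho> / r0" using r0 by simp
      have "cmod (u * f a - v * f b) \<le> cmod (u * f a) + cmod (v * f b)" by (rule norm_triangle_ineq4)
      also have "\<dots> \<le> cmod u * S a + cmod v * S b" unfolding norm_mult using fa by (intro add_mono mult_left_mono) auto
      also have "\<dots> = 1 * (cmod u * S a + cmod v * S b)" by simp
      also have "\<dots> \<le> \<rho> / r0 * (cmod u * S a + cmod v * S b)"
        using Sab by (intro mult_right_mono rr) auto
      also have "\<dots> = 1 / r0 * (X + Y)" by (simp add: X_def Y_def algebra_simps add_divide_distrib)
      also have "\<dots> \<le> 32 / r0 * (X + Y + Z)" using r0 XYZ by (intro mult_mono divide_right_mono) auto
      finally show ?thesis .
    qed
    also have "X = cmod (of_real (pseudo_hyp a b) * u) * S a" using \<rho> by (simp add: X_def \<rho>_def norm_mult)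
    also have "Y = cmod (of_real (pseudo_hyp a b) * v) * S b" using \<rho> by (simp add: Y_def \<rho>_def norm_mult)
    finally show ?thesis by (simp only: Z_def \<rho>_def r0_def)
  qed
  from c show ?thesis
  proof
    assume "c = a"
    then show ?thesis using main[OF ab] by simp
  next
    assume "c = b"
    have sym: "pseudo_hyp b a = pseudo_hyp a b" using ab by (simp add: pseudo_hyp_commute)
    show ?thesis using main[OF ab(2,1), of v u]
      unfolding sym norm_minus_commute[of v u] norm_minus_commute[of "v * f b"] \<open>c = b\<close> by (simp only: add_ac)
  qed
qed

lemma powr_add3_le:
  fixes x y z q :: real
  assumes "0 \<le> x" "0 \<le> y" "0 \<le> z" "0 < q"
  shows "(x + y + z) powr q \<le> 3 powr q * (x powr q + y powr q + z powr q)"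
proof -
  define m where "m = max x (max y z)"
  have "(x + y + z) powr q \<le> (3 * m) powr q" using assms by (intro powr_mono2) (auto simp: m_def)
  also have "\<dots> = 3 powr q * m powr q" using assms by (simp add: powr_mult m_def)
  also have "m powr q \<le> x powr q + y powr q + z powr q"
    unfolding m_def by (auto simp: max_def add_nonneg_nonneg)
  finally show ?thesis by simp
qed

lemma nn_integral_pullback:
  assumes [measurable]: "\<phi> \<in> \<mu> \<rightarrow>\<^sub>M N" "w \<in> borel_measurable \<mu>" "g \<in> borel_measurable N"
  shows "(\<integral>\<^sup>+y. g y \<partial>distr (density \<mu> w) N \<phi>) = (\<integral>\<^sup>+z. w z * g (\<phi> z) \<partial>\<mu>)"
  by (subst nn_integral_distr) (auto simp: nn_integral_density)

lemma holo_self_map_measurable: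
  fixes \<phi> :: "complex ^ 'n \<Rightarrow> complex ^ 'n"
  assumes "holo_self_map \<phi>"
  shows "\<phi> \<in> ball_space \<rightarrow>\<^sub>M ball_space"
proof -
  have "continuous_on unit_ball (\<lambda>z. \<chi> i. \<phi> z $ i)"
    using assms unfolding holo_self_map_def by (intro continuous_on_vec_lambda holo_on_continuous) auto
  then have "continuous_on unit_ball \<phi>" by simp
  then have "\<phi> \<in> borel_measurable ball_space"
    unfolding ball_space_def by (rule borel_measurable_continuous_on_restrict)
  moreover have "\<phi> \<in> space ball_space \<rightarrow> unit_ball"
    using assms by (auto simp: holo_self_map_def ball_space_def space_restrict_space)
  ultimately show ?thesis by (subst (2) ball_space_def) (rule measurable_restrict_space2)
qed

text \<open>The three weighted pullbacks are collected in the measure \<open>\<nu>\<close> only through its integrals, with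
  \<open>\<kappa>\<close> standing for whichever of the two maps occurs in the third one.\<close>
locale difference_operator = D_weight T \<omega> for T :: "'n::finite itself" and \<omega> +
  fixes p q r :: real
    and \<phi> \<psi> \<kappa> :: "complex ^ 'n \<Rightarrow> complex ^ 'n"
    and u v :: "complex ^ 'n \<Rightarrow> complex"
    and \<mu> \<nu> :: "(complex ^ 'n) measure"
  assumes pq: "0 < q" "q < p" and r: "0 < r"
    and maps: "holo_self_map \<phi>" "holo_self_map \<psi>" and \<kappa>: "\<kappa> = \<phi> \<or> \<kappa> = \<psi>"
    and uv: "u \<in> borel_measurable ball_space" "v \<in> borel_measurable ball_space"
    and sets_\<mu>: "sets \<mu> = sets ball_space" and sets_\<nu>: "sets \<nu> = sets ball_space"
    and carleson: "carleson q p \<omega> \<nu>"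
    and integral_\<nu>: "\<And>g. g \<in> borel_measurable ball_space \<Longrightarrow> (\<integral>\<^sup>+y. g y \<partial>\<nu>) =
      (\<integral>\<^sup>+z. ennreal (cmod (of_real (pseudo_hyp (\<phi> z) (\<psi> z)) * u z) powr q) * g (\<phi> z) \<partial>\<mu>)
      + (\<integral>\<^sup>+z. ennreal (cmod (of_real (pseudo_hyp (\<phi> z) (\<psi> z)) * v z) powr q) * g (\<psi> z) \<partial>\<mu>)
      + (\<integral>\<^sup>+z. indicator {z\<in>unit_ball. pseudo_hyp (\<phi> z) (\<psi> z) < r} z * ennreal (cmod (u z - v z) powr q) * g (\<kappa> z) \<partial>\<mu>)"
begin

definition Top :: "(complex ^ 'n \<Rightarrow> complex) \<Rightarrow> complex ^ 'n \<Rightarrow> complex" where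
  "Top f z = u z * f (\<phi> z) - v z * f (\<psi> z)"

lemma p_pos: "0 < p" using pq by simp

lemma space_\<mu>: "space \<mu> = unit_ball" using sets_\<mu> by (rule space_ball_space)

lemma maps_measurable [measurable]: "\<phi> \<in> \<mu> \<rightarrow>\<^sub>M ball_space" "\<psi> \<in> \<mu> \<rightarrow>\<^sub>M ball_space" "\<kappa> \<in> \<mu> \<rightarrow>\<^sub>M ball_space"
  using holo_self_map_measurable[OF maps(1)] holo_self_map_measurable[OF maps(2)] \<kappa>
  by (auto simp: measurable_cong_sets[OF sets_\<mu> refl])

lemma uv_measurable [measurable]: "u \<in> borel_measurable \<mu>" "v \<in> borel_measurable \<mu>"
  using uv by (auto simp: measurable_cong_sets[OF sets_\<mu> refl])

lemma maps_ball: "z \<in> unit_ball \<Longrightarrow> \<phi> z \<in> unit_ball" "z \<in> unit_ball \<Longrightarrow> \<psi> z \<in> unit_ball" "z \<in> unit_ball \<Longrightarrow> \<kappa> z \<in> unit_ball"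
  using maps \<kappa> unfolding holo_self_map_def by blast+

lemma id_measurable_ball_space: "(\<lambda>x. x) \<in> borel_measurable ball_space"
  unfolding ball_space_def by (rule measurable_restrict_space1) simp

lemma rho_measurable [measurable]: "(\<lambda>z. pseudo_hyp (\<phi> z) (\<psi> z)) \<in> borel_measurable \<mu>"
proof -
  have [measurable]: "\<phi> \<in> borel_measurable \<mu>" "\<psi> \<in> borel_measurable \<mu>"
    using measurable_compose[OF maps_measurable(1) id_measurable_ball_space]
      measurable_compose[OF maps_measurable(2) id_measurable_ball_space] by auto
  have "(\<lambda>z. sqrt (1 - bgap (\<phi> z) * bgap (\<psi> z) / (kdist (\<phi> z) (\<psi> z))\<^sup>2)) \<in> borel_measurable \<mu>" by measurable
  then show ?thesis
  proof (rule measurable_cong[THEN iffD1, rotated])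
    fix z assume "z \<in> space \<mu>"
    then have "z \<in> unit_ball" by (simp add: space_\<mu>)
    then show "sqrt (1 - bgap (\<phi> z) * bgap (\<psi> z) / (kdist (\<phi> z) (\<psi> z))\<^sup>2) = pseudo_hyp (\<phi> z) (\<psi> z)"
      by (intro pseudo_hyp_eq[symmetric] maps_ball)
  qed
qed

lemma Top_measurable: "holo_on unit_ball f \<Longrightarrow> Top f \<in> borel_measurable \<mu>"
proof -
  assume f: "holo_on unit_ball f"
  have [measurable]: "f \<in> borel_measurable ball_space" using holo_measurable_ball_space[OF f] by blast
  show ?thesis unfolding Top_def[abs_def] by measurable
qed

text \<open>S is the step function built from the local bounds \<open>x j\<close>, and g is its q-th
  power. The pointwise bound turns the left side into the three weighted pullbacks of g, that is,
  its integral against \<nu>. The 96 is 3 * 32: the 3 splits the q-th power of a sum of three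
  terms.\<close>

lemma Top_integral_le:
  assumes f: "holo_on unit_ball f"
    and Q: "\<And>j::nat. Q j \<in> sets ball_space" "disjoint_family Q" "(\<Union>j. Q j) = unit_ball"
    and x: "\<And>j. 0 \<le> x j" "\<And>j z w. z \<in> Q j \<Longrightarrow> w \<in> hood z \<Longrightarrow> cmod (f w) powr p \<le> x j"
  shows "(\<integral>\<^sup>+z. ennreal (cmod (Top f z) powr q) \<partial>\<mu>)
    \<le> ennreal ((96 / min r (1/64)) powr q) * (\<Sum>j. ennreal (x j powr (q / p)) * emeasure \<nu> (Q j))"
proof -
  define g where "g y = (\<Sum>j. ennreal (x j powr (q / p)) * indicator (Q j) y)" for y
  have [measurable]: "Q j \<in> sets ball_space" for j by (rule Q(1))
  have g[measurable]: "g \<in> borel_measurable ball_space" unfolding g_def by measurable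
  define idx where "idx y = (LEAST j. y \<in> Q j)" for y
  have idx: "y \<in> Q (idx y)" if "y \<in> unit_ball" for y
    unfolding idx_def using that Q(3) by (auto intro: LeastI)
  define S where "S y = x (idx y) powr (1 / p)" for y
  have gS: "g y = ennreal (S y powr q)" if y: "y \<in> unit_ball" for y
  proof -
    have "g y = (\<Sum>j. if j = idx y then ennreal (x j powr (q / p)) else 0)"
      unfolding g_def using idx[OF y] Q(2) by (intro suminf_cong) (auto simp: indicator_def disjoint_family_on_def)
    also have "\<dots> = (\<Sum>j\<in>{idx y}. if j = idx y then ennreal (x j powr (q / p)) else 0)"
      by (rule suminf_finite) auto
    finally show ?thesis by (simp add: S_def powr_powr)
  qed
  have S: "cmod (f w) \<le> S y" if "y \<in> unit_ball" "w \<in> hood y" for y w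
  proof -
    have "(cmod (f w) powr p) powr (1 / p) \<le> S y"
      unfolding S_def using x(2)[OF idx[OF that(1)] that(2)] p_pos by (intro powr_mono2) auto
    then show ?thesis using p_pos by (simp add: powr_powr)
  qed
  define D where "D = 32 / min r (1/64)"
  have D: "0 < D" using r by (simp add: D_def)
  let ?w1 = "\<lambda>z. ennreal (cmod (of_real (pseudo_hyp (\<phi> z) (\<psi> z)) * u z) powr q)"
  let ?w2 = "\<lambda>z. ennreal (cmod (of_real (pseudo_hyp (\<phi> z) (\<psi> z)) * v z) powr q)"
  let ?w3 = "\<lambda>z. indicator {z\<in>unit_ball. pseudo_hyp (\<phi> z) (\<psi> z) < r} z * ennreal (cmod (u z - v z) powr q)"
  have Gm: "{z\<in>unit_ball. pseudo_hyp (\<phi> z) (\<psi> z) < r} \<in> sets \<mu>"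
  proof -
    have "{z\<in>space \<mu>. pseudo_hyp (\<phi> z) (\<psi> z) < r} \<in> sets \<mu>" by measurable
    then show ?thesis by (simp add: space_\<mu>)
  qed
  note Gm[measurable]
  have pt: "ennreal (cmod (Top f z) powr q) \<le> ennreal ((3 * D) powr q) * (?w1 z * g (\<phi> z) + ?w2 z * g (\<psi> z) + ?w3 z * g (\<kappa> z))"
    if z: "z \<in> space \<mu>" for z
  proof -
    have zb: "z \<in> unit_ball" using z by (simp add: space_\<mu>)
    define X where "X = cmod (of_real (pseudo_hyp (\<phi> z) (\<psi> z)) * u z)"
    define Y where "Y = cmod (of_real (pseudo_hyp (\<phi> z) (\<psi> z)) * v z)"
    define Z where "Z = (if pseudo_hyp (\<phi> z) (\<psi> z) < r then cmod (u z - v z) else 0)"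
    have XYZ: "0 \<le> X" "0 \<le> Y" "0 \<le> Z" by (auto simp: X_def Y_def Z_def)
    have S0: "0 \<le> S y" for y by (simp add: S_def)
    have "cmod (Top f z) \<le> D * (X * S (\<phi> z) + Y * S (\<psi> z) + Z * S (\<kappa> z))"
      unfolding Top_def D_def X_def Y_def Z_def
      by (rule pointwise_difference_bound[OF f maps_ball(1)[OF zb] maps_ball(2)[OF zb] r S]) (use \<kappa> in auto)
    then have "cmod (Top f z) powr q \<le> (D * (X * S (\<phi> z) + Y * S (\<psi> z) + Z * S (\<kappa> z))) powr q"
      using pq by (intro powr_mono2) auto
    also have "\<dots> = D powr q * (X * S (\<phi> z) + Y * S (\<psi> z) + Z * S (\<kappa> z)) powr q"
      by (rule powr_mult)
    also have "\<dots> \<le> D powr q * (3 powr q * ((X * S (\<phi> z)) powr q + (Y * S (\<psi> z)) powr q + (Z * S (\<kappa> z)) powr q))"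
      using XYZ S0 pq by (intro mult_left_mono powr_add3_le) auto
    also have "\<dots> = (3 * D) powr q * (X powr q * S (\<phi> z) powr q + Y powr q * S (\<psi> z) powr q + Z powr q * S (\<kappa> z) powr q)"
      using XYZ S0 D by (simp add: powr_mult)
    finally have "ennreal (cmod (Top f z) powr q) \<le> ennreal ((3 * D) powr q * (X powr q * S (\<phi> z) powr q + Y powr q * S (\<psi> z) powr q + Z powr q * S (\<kappa> z) powr q))"
      by (rule ennreal_leI)
    also have "\<dots> = ennreal ((3 * D) powr q) * (ennreal (X powr q) * ennreal (S (\<phi> z) powr q) + ennreal (Y powr q) * ennreal (S (\<psi> z) powr q) + ennreal (Z powr q) * ennreal (S (\<kappa> z) powr q))"
      by (simp add: ennreal_mult)
    also have "ennreal (Z powr q) = ?w3 z" using zb by (simp add: Z_def)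
    finally show ?thesis
      unfolding gS[OF maps_ball(1)[OF zb]] gS[OF maps_ball(2)[OF zb]] gS[OF maps_ball(3)[OF zb]] X_def Y_def .
  qed
  have "(\<integral>\<^sup>+z. ennreal (cmod (Top f z) powr q) \<partial>\<mu>) \<le> (\<integral>\<^sup>+z. ennreal ((3 * D) powr q) * (?w1 z * g (\<phi> z) + ?w2 z * g (\<psi> z) + ?w3 z * g (\<kappa> z)) \<partial>\<mu>)"
    by (rule nn_integral_mono[OF pt])
  also have "\<dots> = ennreal ((3 * D) powr q) * (\<integral>\<^sup>+z. ?w1 z * g (\<phi> z) + ?w2 z * g (\<psi> z) + ?w3 z * g (\<kappa> z) \<partial>\<mu>)"
    by (rule nn_integral_cmult) measurable
  also have "(\<integral>\<^sup>+z. ?w1 z * g (\<phi> z) + ?w2 z * g (\<psi> z) + ?w3 z * g (\<kappa> z) \<partial>\<mu>) = (\<integral>\<^sup>+y. g y \<partial>\<nu>)"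
    unfolding integral_\<nu>[OF g] by (subst nn_integral_add, measurable, subst nn_integral_add, measurable)
  also have "\<dots> = (\<Sum>j. ennreal (x j powr (q / p)) * emeasure \<nu> (Q j))"
    unfolding g_def using Q(1) by (subst nn_integral_suminf) (auto simp: nn_integral_times_indicator sets_\<nu> measurable_cong_sets[OF sets_\<nu> refl])
  finally show ?thesis by (simp add: D_def)
qed

end

lemma lattice_cells:
  fixes a :: "nat \<Rightarrow> complex ^ 'n"
  assumes lat: "lattice a"
  shows "\<exists>Q. (\<forall>j. Q j \<in> sets ball_space) \<and> disjoint_family Q \<and> (\<Union>j. Q j) = unit_ball \<and> (\<forall>j. \<forall>z\<in>Q j. near 60 (a j) z)"
proof (intro exI[of _ "disjointed (\<lambda>j. {z \<in> unit_ball. near 60 (a j) z})"] conjI allI ballI)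
  let ?P = "\<lambda>j. {z \<in> unit_ball. near 60 (a j) z}"
  have "?P j \<in> sets borel" for j
  proof -
    have "?P j = unit_ball \<inter> {z. near 60 (a j) z}" by auto
    then show ?thesis by (metis near_set_borel sets.Int unit_ball_borel)
  qed
  then have P: "?P j \<in> sets ball_space" for j
    unfolding ball_space_def by (subst sets_restrict_space_iff) auto
  show "disjointed ?P j \<in> sets ball_space" for j
    using sets.range_disjointed_sets[of ?P ball_space] P by blast
  show "disjoint_family (disjointed ?P)" by (rule disjoint_family_disjointed)
  show "(\<Union>j. disjointed ?P j) = unit_ball"
    unfolding UN_disjointed_eq using lat by (auto simp: lattice_def)
  show "near 60 (a j) z" if "z \<in> disjointed ?P j" for j z
    using that disjointed_subset[of ?P j] by blast
qed

lemma ball_pow_diff_le: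
  assumes "0 < p"
  shows "ball_pow p (\<lambda>z. f z - g z) z \<le> ennreal (3 powr p) * (ball_pow p f z + ball_pow p g z)"
proof -
  have "cmod (f z - g z) powr p \<le> (cmod (f z) + cmod (g z) + 0) powr p"
    using assms norm_triangle_ineq4[of "f z" "g z"] by (intro powr_mono2) auto
  also have "\<dots> \<le> 3 powr p * (cmod (f z) powr p + cmod (g z) powr p + 0 powr p)"
    using assms by (intro powr_add3_le) auto
  finally have "ennreal (cmod (f z - g z) powr p) \<le> ennreal (3 powr p * (cmod (f z) powr p + cmod (g z) powr p))"
    using assms by (intro ennreal_leI) simp
  also have "\<dots> = ennreal (3 powr p) * (ennreal (cmod (f z) powr p) + ennreal (cmod (g z) powr p))"
    by (simp add: ennreal_mult)
  finally show ?thesis by (simp add: ball_pow_def indicator_def)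
qed

lemma tendsto_0_if_ennreal_small:
  fixes X :: "nat \<Rightarrow> ennreal"
  assumes "\<And>\<epsilon>::real. 0 < \<epsilon> \<Longrightarrow> \<exists>N. \<forall>k\<ge>N. X k \<le> ennreal \<epsilon>"
  shows "X \<longlonglongrightarrow> 0"
proof (rule order_tendstoI)
  fix y :: ennreal assume "0 < y"
  then obtain z where z: "0 < z" "z < y" using dense by blast
  then have "z < top" using top.not_eq_extremum by fastforce
  then obtain \<epsilon> where \<epsilon>: "z = ennreal \<epsilon>" "0 \<le> \<epsilon>" by (cases z rule: ennreal_cases) auto
  then have "0 < \<epsilon>" using z(1) by (simp add: ennreal_less_zero_iff)
  then obtain N where "\<forall>k\<ge>N. X k \<le> ennreal \<epsilon>" using assms by blast
  then show "eventually (\<lambda>k. X k < y) sequentially"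
    using z(2) unfolding \<epsilon>(1) eventually_sequentially by (meson le_less_trans)
qed simp

section \<open>Uniform tail estimate and compactness\<close>

context difference_operator
begin

lemma wnorm_diff_le:
  assumes "holo_on unit_ball f" "holo_on unit_ball g"
  shows "wnorm p (\<lambda>z. f z - g z) \<le> ennreal (3 powr p) * (wnorm p f + wnorm p g)"
proof -
  note [measurable] = borel_measurable_ball_pow[OF assms(1)] borel_measurable_ball_pow[OF assms(2)]
  have "wnorm p (\<lambda>z. f z - g z) \<le> (\<integral>\<^sup>+z. ennreal (3 powr p) * (ball_pow p f z * ennreal (\<omega> (norm z)) + ball_pow p g z * ennreal (\<omega> (norm z))) \<partial>lborel)"
    unfolding wnorm_def
  proof (rule nn_integral_mono)
    fix z
    show "ball_pow p (\<lambda>z. f z - g z) z * ennreal (\<omega> (norm z)) \<le> ennreal (3 powr p) * (ball_pow p f z * ennreal (\<omega> (norm z)) + ball_pow p g z * ennreal (\<omega> (norm z)))"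
      using mult_right_mono[OF ball_pow_diff_le[OF p_pos, of f g z], of "ennreal (\<omega> (norm z))"] by (simp add: distrib_right mult.assoc)
  qed
  also have "\<dots> = ennreal (3 powr p) * (wnorm p f + wnorm p g)"
    unfolding wnorm_def by (subst nn_integral_cmult, measurable) (subst nn_integral_add, measurable)
  finally show ?thesis .
qed

text \<open>The bound of \<open>hood_sup_le_local_mass\<close> for |f|^p on the neighbourhoods of
  points of the j-th cell. As \<open>enn2real\<close> sends infinity to 0, it is meaningful as a
  bound only where the local mass is finite.\<close>

definition coef :: "real \<Rightarrow> (nat \<Rightarrow> complex ^ 'n) \<Rightarrow> (complex ^ 'n \<Rightarrow> complex) \<Rightarrow> nat \<Rightarrow> real" where
  "coef K a f j = enn2real (ennreal (K / (1 - norm (a j)) ^ (CARD('n) + 1)) * local_mass p f (a j))"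

lemma coef_nonneg: "0 \<le> coef K a f j" by (simp add: coef_def)

text \<open>The region belonging to one centre lies in a fixed ball of radius sqrt (1 - \<beta>) <
  1, so uniform smallness there controls its local mass; e is chosen to make the final bound equal
  to \<delta>.\<close>

lemma coef_small:
  assumes lat: "lattice a" and K: "0 < K" and \<delta>: "0 < \<delta>"
  shows "\<exists>R<1. \<exists>e>0. \<forall>h. (\<forall>z. norm z \<le> R \<longrightarrow> cmod (h z) \<le> e) \<longrightarrow> coef K a h j \<le> \<delta>"
proof -
  have ab: "a j \<in> unit_ball" using lat by (simp add: lattice_def)
  define d where "d = 1 - norm (a j)"
  have d: "0 < d" using ab by (simp add: d_def)
  define V where "V = measure lborel (unit_ball :: (complex ^ 'n) set)"
  have eV: "emeasure lborel (unit_ball :: (complex ^ 'n) set) = ennreal V"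
    unfolding V_def using unit_ball_volume(2)[where 'n = 'n] by (intro emeasure_eq_ennreal_measure) auto
  have V: "0 < V" using unit_ball_volume(1)[where 'n = 'n] eV by (cases "V > 0") (auto simp: ennreal_neg not_less)
  define \<beta> where "\<beta> = bgap (a j) / (2 * near_const)"
  have \<beta>: "0 < \<beta>" using bgap_pos[OF ab] by (simp add: \<beta>_def near_const_def)
  define e where "e = (\<delta> * d ^ (CARD('n) + 1) / (K * V)) powr (1 / p)"
  have e: "0 < e" using \<delta> d K V by (simp add: e_def)
  have ep: "e powr p = \<delta> * d ^ (CARD('n) + 1) / (K * V)" using \<delta> d K V p_pos by (simp add: e_def powr_powr)
  have "coef K a h j \<le> \<delta>" if h: "\<forall>z. norm z \<le> sqrt (1 - \<beta>) \<longrightarrow> cmod (h z) \<le> e" for h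
  proof -
    have "local_mass p h (a j) \<le> (\<integral>\<^sup>+z. ennreal (e powr p) * indicator unit_ball z \<partial>(lborel :: (complex ^ 'n) measure))"
      unfolding local_mass_def
    proof (rule nn_integral_mono)
      fix z
      show "ball_pow p h z * indicator {z. near near_const (a j) z} z \<le> ennreal (e powr p) * indicator unit_ball z"
      proof (cases "z \<in> unit_ball \<and> near near_const (a j) z")
        case True
        have "bgap (a j) \<le> 2 * near_const * bgap z" using near_bgap(2)[of near_const "a j" z] True ab by blast
        then have "\<beta> \<le> bgap z" by (simp add: \<beta>_def near_const_def)
        then have "norm z \<le> sqrt (1 - \<beta>)" by (intro real_le_rsqrt) (simp add: bgap_def)
        then have "cmod (h z) \<le> e" using h by blast
        then have "cmod (h z) powr p \<le> e powr p" using p_pos by (intro powr_mono2) auto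
        then show ?thesis using True by (simp add: ball_pow_def ennreal_leI)
      next
        case False
        then show ?thesis by (auto simp: ball_pow_def indicator_def)
      qed
    qed
    also have "\<dots> = ennreal (e powr p * V)"
      using V by (subst nn_integral_times_indicator) (auto simp: eV ennreal_mult)
    finally have "ennreal (K / d ^ (CARD('n) + 1)) * local_mass p h (a j) \<le> ennreal (K / d ^ (CARD('n) + 1)) * ennreal (e powr p * V)"
      by (intro mult_left_mono) auto
    also have "\<dots> = ennreal (K / d ^ (CARD('n) + 1) * (e powr p * V))" using K d V by (subst ennreal_mult) auto
    also have "K / d ^ (CARD('n) + 1) * (e powr p * V) = \<delta>" unfolding ep using K d V by simp
    finally show ?thesis unfolding coef_def d_def using \<delta> by (intro enn2real_leI) auto
  qed
  moreover have "sqrt (1 - \<beta>) < 1" using \<beta> by simp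
  ultimately show ?thesis using e by blast
qed

text \<open>The number m of exceptional cells depends on \<eta> and M but not on f. Young's
  inequality charges a distant cell partly to its coefficient, whose weighted sum is at most K N M,
  and partly to the convergent series of the \<open>t j\<close>.\<close>

lemma Top_tail_estimate:
  assumes lat: "lattice a" and M: "0 \<le> M"
    and Q: "\<And>j::nat. Q j \<in> sets ball_space" "disjoint_family Q" "(\<Union>j. Q j) = unit_ball" "\<forall>j. \<forall>z\<in>Q j. near 60 (a j) z"
  shows "\<exists>K>0. \<exists>E>0. \<forall>\<eta>>0. \<exists>m. \<forall>f. holo_on unit_ball f \<longrightarrow> wnorm p f \<le> ennreal M \<longrightarrow>
    (\<integral>\<^sup>+z. ennreal (cmod (Top f z) powr q) \<partial>\<mu>) \<le> ennreal \<eta> + ennreal E * (\<Sum>j<m. ennreal (coef K a f j powr (q / p)) * emeasure \<nu> (Q j))"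
proof -
  have ab: "a j \<in> unit_ball" for j using lat by (simp add: lattice_def)
  obtain K where K: "0 < K" and sup0: "\<forall>p (f :: complex ^ 'n \<Rightarrow> complex) b z w. 0 < p \<longrightarrow> holo_on unit_ball f \<longrightarrow> b \<in> unit_ball \<longrightarrow> z \<in> unit_ball \<longrightarrow>
    near 60 b z \<longrightarrow> w \<in> hood z \<longrightarrow>
    ennreal (cmod (f w) powr p) \<le> ennreal (K / (1 - norm b) ^ (CARD('n) + 1)) * local_mass p f b"
    using hood_sup_le_local_mass by (elim exE conjE) (rule that)
  note sup = sup0[rule_format, OF p_pos]
  obtain N where N: "0 < N" and lsum0: "\<forall>p f. 0 < p \<longrightarrow> holo_on unit_ball f \<longrightarrow>
    (\<Sum>j. ennreal (tl (norm (a j)) / (1 - norm (a j))) * local_mass p f (a j)) \<le> ennreal N * wnorm p f"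
    using lattice_local_mass_sum[OF lat] by (elim exE conjE) (rule that)
  note lsum = lsum0[rule_format, OF p_pos]
  have Q\<nu>: "Q j \<in> sets \<nu>" for j using Q(1) by (simp add: sets_\<nu>)
  obtain t :: "nat \<Rightarrow> real" where t0: "\<forall>j. 0 \<le> t j" and ts: "summable t" and young0: "\<forall>\<eta>>0. \<exists>C\<ge>0. \<forall>j x. 0 \<le> x \<longrightarrow>
      ennreal (x powr (q / p)) * emeasure \<nu> (Q j) \<le> ennreal (\<eta> * (x * cellw (a j)) + C * t j)"
    using carleson_Young[OF lat pq carleson sets_\<nu> Q\<nu> Q(2) Q(4)] by (elim exE conjE) (rule that)
  have t: "0 \<le> t j" "summable t" for j using t0 ts by auto
  note young = young0[rule_format]
  define E where "E = (96 / min r (1/64)) powr q"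
  have E: "0 < E" using r by (simp add: E_def)
  \<comment> \<open>A single term of a bounded series with positive factor; this legitimates
    \<open>enn2real\<close> in \<open>coef\<close>.\<close>
  have lm_fin: "local_mass p f (a j) < \<infinity>" if f: "holo_on unit_ball f" "wnorm p f \<le> ennreal M" for f j
  proof -
    have "ennreal (tl (norm (a j)) / (1 - norm (a j))) * local_mass p f (a j) = (\<Sum>i\<in>{j}. ennreal (tl (norm (a i)) / (1 - norm (a i))) * local_mass p f (a i))" by simp
    also have "\<dots> \<le> (\<Sum>j. ennreal (tl (norm (a j)) / (1 - norm (a j))) * local_mass p f (a j))" by (rule sum_le_suminf) auto
    also have "\<dots> \<le> ennreal N * ennreal M" using lsum[OF f(1)] f(2) by (meson mult_left_mono order_trans zero_le)
    also have "\<dots> < \<infinity>" by (simp add: ennreal_mult_less_top)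
    finally have "ennreal (tl (norm (a j)) / (1 - norm (a j))) * local_mass p f (a j) < \<infinity>" .
    moreover have "0 < tl (norm (a j)) / (1 - norm (a j))" using tl_pos[of "norm (a j)"] ab[of j] by simp
    ultimately show ?thesis by (auto simp: ennreal_mult_less_top)
  qed
  have coef_eq: "ennreal (coef K a f j) = ennreal (K / (1 - norm (a j)) ^ (CARD('n) + 1)) * local_mass p f (a j)"
    if f: "holo_on unit_ball f" "wnorm p f \<le> ennreal M" for f j
    unfolding coef_def using lm_fin[OF f, of j] by (intro ennreal_enn2real) (simp add: ennreal_mult_less_top)
  have csum: "(\<Sum>j. ennreal (coef K a f j * cellw (a j))) \<le> ennreal (K * N * M)"
    if f: "holo_on unit_ball f" "wnorm p f \<le> ennreal M" for f
  proof -
    have "ennreal (coef K a f j * cellw (a j)) = ennreal K * (ennreal (tl (norm (a j)) / (1 - norm (a j))) * local_mass p f (a j))" for j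
    proof -
      define d where "d = 1 - norm (a j)"
      have d: "0 < d" using ab[of j] by (simp add: d_def)
      have "ennreal (coef K a f j * cellw (a j)) = ennreal (coef K a f j) * ennreal (cellw (a j))"
        using cellw_pos[OF ab[of j]] coef_nonneg by (intro ennreal_mult) auto
      also have "\<dots> = (ennreal (K / d ^ (CARD('n) + 1)) * ennreal (cellw (a j))) * local_mass p f (a j)"
        unfolding coef_eq[OF f] d_def by (simp only: mult_ac)
      also have "ennreal (K / d ^ (CARD('n) + 1)) * ennreal (cellw (a j)) = ennreal (K / d ^ (CARD('n) + 1) * cellw (a j))"
        using K d cellw_pos[OF ab[of j]] by (subst ennreal_mult) auto
      also have "K / d ^ (CARD('n) + 1) * cellw (a j) = K * (tl (norm (a j)) / d)"
        using d unfolding cellw_def d_def[symmetric] by simp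
      also have "ennreal (K * (tl (norm (a j)) / d)) = ennreal K * ennreal (tl (norm (a j)) / d)"
        using K d tl_nonneg by (intro ennreal_mult) auto
      finally show ?thesis by (simp add: d_def mult.assoc)
    qed
    then have "(\<Sum>j. ennreal (coef K a f j * cellw (a j))) = ennreal K * (\<Sum>j. ennreal (tl (norm (a j)) / (1 - norm (a j))) * local_mass p f (a j))"
      by simp
    also have "\<dots> \<le> ennreal K * (ennreal N * ennreal M)"
      by (intro mult_left_mono order_trans[OF lsum[OF f(1)]] f(2)) auto
    finally show ?thesis using K N M by (simp add: ennreal_mult mult.assoc)
  qed
  have "\<exists>m. \<forall>f. holo_on unit_ball f \<longrightarrow> wnorm p f \<le> ennreal M \<longrightarrow>
    (\<integral>\<^sup>+z. ennreal (cmod (Top f z) powr q) \<partial>\<mu>) \<le> ennreal \<eta> + ennreal E * (\<Sum>j<m. ennreal (coef K a f j powr (q / p)) * emeasure \<nu> (Q j))"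
    if \<eta>: "0 < \<eta>" for \<eta>
  proof -
    \<comment> \<open>Young's part and the tail of the series \<open>t\<close> each receive
      \<eta>/(2E); the added 1 keeps the divisor positive.\<close>
    define \<eta>1 where "\<eta>1 = \<eta> / (2 * E * (K * N * M + 1))"
    have KNM: "0 \<le> K * N * M" using K N M by simp
    have \<eta>1: "0 < \<eta>1" using \<eta> E KNM by (simp add: \<eta>1_def)
    obtain C where C: "0 \<le> C" "\<forall>j x. 0 \<le> x \<longrightarrow>
      ennreal (x powr (q / p)) * emeasure \<nu> (Q j) \<le> ennreal (\<eta>1 * (x * cellw (a j)) + C * t j)"
      using young[OF \<eta>1] by (elim exE conjE) (rule that)
    obtain m where m: "norm (\<Sum>i. t (i + m)) < \<eta> / (2 * E * (C + 1))"
      using suminf_exist_split[OF _ t(2), of "\<eta> / (2 * E * (C + 1))"] \<eta> E C(1) by auto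
    have st: "summable (\<lambda>i. t (i + m))" using t(2) by (simp add: summable_iff_shift)
    have tm: "(\<Sum>i. ennreal (C * t (i + m))) \<le> ennreal (\<eta> / (2 * E))"
    proof -
      have "(\<Sum>i. ennreal (C * t (i + m))) = ennreal (\<Sum>i. C * t (i + m))"
        using st C t(1) by (intro suminf_ennreal2) (auto intro: summable_mult)
      also have "(\<Sum>i. C * t (i + m)) = C * (\<Sum>i. t (i + m))" using st by (rule suminf_mult)
      also have "\<dots> \<le> (C + 1) * (\<eta> / (2 * E * (C + 1)))"
        using m C suminf_nonneg[OF st] t(1) by (intro mult_mono) auto
      also have "\<dots> = \<eta> / (2 * E)" using C E by simp
      finally show ?thesis by (simp add: ennreal_leI)
    qed
    have "(\<integral>\<^sup>+z. ennreal (cmod (Top f z) powr q) \<partial>\<mu>) \<le> ennreal \<eta> + ennreal E * (\<Sum>j<m. ennreal (coef K a f j powr (q / p)) * emeasure \<nu> (Q j))"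
      if f: "holo_on unit_ball f" "wnorm p f \<le> ennreal M" for f
    proof -
      define x where "x = coef K a f"
      have x0: "0 \<le> x j" for j by (simp add: x_def coef_nonneg)
      define G where "G j = ennreal (x j powr (q / p)) * emeasure \<nu> (Q j)" for j
      have "(\<integral>\<^sup>+z. ennreal (cmod (Top f z) powr q) \<partial>\<mu>) \<le> ennreal E * (\<Sum>j. G j)"
        unfolding E_def G_def
      proof (rule Top_integral_le[OF f(1) Q(1-3) x0])
        fix j z w assume z: "z \<in> Q j" and w: "w \<in> hood z"
        have zb: "z \<in> unit_ball" using z Q(3) by blast
        have "ennreal (cmod (f w) powr p) \<le> ennreal (x j)"
          unfolding x_def coef_eq[OF f] by (rule sup[OF f(1) ab zb Q(4)[rule_format, OF z] w])
        then show "cmod (f w) powr p \<le> x j" using x0 by simp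
      qed
      also have "(\<Sum>j. G j) = (\<Sum>j. G (j + m)) + (\<Sum>j<m. G j)"
        by (rule suminf_offset) (rule summableI)
      also have "(\<Sum>j. G (j + m)) \<le> ennreal (\<eta> / E)"
      proof -
        have "(\<Sum>j. G (j + m)) \<le> (\<Sum>j. ennreal \<eta>1 * ennreal (x (j + m) * cellw (a (j + m))) + ennreal (C * t (j + m)))"
        proof (intro suminf_le allI)
          fix j
          have "G (j + m) \<le> ennreal (\<eta>1 * (x (j + m) * cellw (a (j + m))) + C * t (j + m))"
            unfolding G_def using C(2) x0 by blast
          also have "\<dots> = ennreal (\<eta>1 * (x (j + m) * cellw (a (j + m)))) + ennreal (C * t (j + m))"
            using \<eta>1 x0 C t(1) less_imp_le[OF cellw_pos[OF ab]] by (intro ennreal_plus mult_nonneg_nonneg) auto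
          also have "ennreal (\<eta>1 * (x (j + m) * cellw (a (j + m)))) = ennreal \<eta>1 * ennreal (x (j + m) * cellw (a (j + m)))"
            using \<eta>1 x0 less_imp_le[OF cellw_pos[OF ab]] by (intro ennreal_mult mult_nonneg_nonneg) auto
          finally show "G (j + m) \<le> ennreal \<eta>1 * ennreal (x (j + m) * cellw (a (j + m))) + ennreal (C * t (j + m))" .
        qed auto
        also have "\<dots> = ennreal \<eta>1 * (\<Sum>j. ennreal (x (j + m) * cellw (a (j + m)))) + (\<Sum>j. ennreal (C * t (j + m)))"
          by (simp add: suminf_add[symmetric])
        also have "\<dots> \<le> ennreal \<eta>1 * ennreal (K * N * M) + ennreal (\<eta> / (2 * E))"
        proof (intro add_mono mult_left_mono tm)
          have "(\<Sum>j. ennreal (x (j + m) * cellw (a (j + m)))) \<le> (\<Sum>j. ennreal (x (j + m) * cellw (a (j + m)))) + (\<Sum>j<m. ennreal (x j * cellw (a j)))" by simp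
          also have "\<dots> = (\<Sum>j. ennreal (x j * cellw (a j)))"
            by (rule suminf_offset[symmetric]) (rule summableI)
          also have "\<dots> \<le> ennreal (K * N * M)" unfolding x_def by (rule csum[OF f])
          finally show "(\<Sum>j. ennreal (x (j + m) * cellw (a (j + m)))) \<le> ennreal (K * N * M)" .
        qed simp
        also have "\<dots> = ennreal (\<eta>1 * (K * N * M) + \<eta> / (2 * E))"
          using \<eta>1 KNM \<eta> E by (simp add: ennreal_mult[symmetric] ennreal_plus[symmetric] del: ennreal_plus)
        also have "\<dots> \<le> ennreal (\<eta> / E)"
        proof (rule ennreal_leI)
          have "\<eta>1 * (K * N * M) \<le> \<eta>1 * (K * N * M + 1)" using \<eta>1 by (intro mult_left_mono) auto
          also have "\<dots> = \<eta> / (2 * E)" using KNM by (simp add: \<eta>1_def)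
          finally show "\<eta>1 * (K * N * M) + \<eta> / (2 * E) \<le> \<eta> / E" by (simp add: field_simps)
        qed
        finally show ?thesis .
      qed
      finally have "(\<integral>\<^sup>+z. ennreal (cmod (Top f z) powr q) \<partial>\<mu>) \<le> ennreal E * (ennreal (\<eta> / E) + (\<Sum>j<m. G j))"
        by (meson add_right_mono mult_left_mono order_trans zero_le)
      also have "\<dots> = ennreal \<eta> + ennreal E * (\<Sum>j<m. G j)"
        using E \<eta> by (simp add: distrib_left ennreal_mult[symmetric])
      finally show ?thesis by (simp add: G_def x_def)
    qed
    then show ?thesis by blast
  qed
  then show ?thesis by (intro exI[of _ K] exI[of _ E] conjI allI impI K E)
qed

lemma wnorm_bound:
  "\<exists>V>0. \<forall>f M. holo_on unit_ball f \<longrightarrow> 0 \<le> M \<longrightarrow> Ap_norm_p p \<omega> f \<le> ennreal M \<longrightarrow> wnorm p f \<le> ennreal (V * M)"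
proof -
  define V where "V = measure lborel (unit_ball :: (complex ^ 'n) set)"
  have eV: "emeasure lborel (unit_ball :: (complex ^ 'n) set) = ennreal V"
    unfolding V_def using unit_ball_volume(2)[where 'n = 'n] by (intro emeasure_eq_ennreal_measure) auto
  have V: "0 < V" using unit_ball_volume(1)[where 'n = 'n] eV by (cases "V > 0") (auto simp: ennreal_neg not_less)
  have "wnorm p f \<le> ennreal (V * M)" if f: "holo_on unit_ball f" and M: "0 \<le> M" and le: "Ap_norm_p p \<omega> f \<le> ennreal M" for f M
  proof -
    have "wnorm p f = wnorm p f / ennreal V * ennreal V"
      using V by (simp add: ennreal_divide_times mult_divide_eq_ennreal)
    also have "\<dots> \<le> ennreal M * ennreal V"
      using le unfolding Ap_norm_p_eq[OF f] eV by (rule mult_right_mono) simp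
    finally show ?thesis using M V by (simp add: ennreal_mult mult.commute)
  qed
  then show ?thesis using V by (intro exI[of _ V]) simp
qed

lemma Top_diff: "Top (\<lambda>z. f z - g z) z = Top f z - Top g z"
  by (simp add: Top_def algebra_simps)

text \<open>The tail estimate is applied to differences of members of a locally uniformly Cauchy
  subsequence: their norms are bounded, while their coefficients in the finitely many remaining
  cells tend to 0. The limit is built pointwise and reached by Fatou, which works equally for q <
  1.\<close>

theorem Top_compact: "compact_op Top p \<omega> q \<mu>"
proof -
  obtain a :: "nat \<Rightarrow> complex ^ 'n" where lat: "lattice a" using lattice_exists by blast
  obtain Q where Q0: "\<forall>j. Q j \<in> sets ball_space" "disjoint_family Q" "(\<Union>j. Q j) = (unit_ball :: (complex ^ 'n) set)" "\<forall>j. \<forall>z\<in>Q j. near 60 (a j) z"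
    using lattice_cells[OF lat] by (elim exE conjE) (rule that)
  note Q = spec[OF Q0(1)] Q0(2-4)
  obtain V where V0: "0 < V" "\<forall>f M. holo_on unit_ball f \<longrightarrow> 0 \<le> M \<longrightarrow> Ap_norm_p p \<omega> f \<le> ennreal M \<longrightarrow> wnorm p f \<le> ennreal (V * M)"
    using wnorm_bound by (elim exE conjE) (rule that)
  note V = V0(1) V0(2)[rule_format]
  have Q\<nu>: "Q j \<in> sets \<nu>" for j using Q(1) by (simp add: sets_\<nu>)
  have Qfin: "emeasure \<nu> (Q j) < \<infinity>" for j
    using carleson_Young[OF lat pq carleson sets_\<nu> Q\<nu> Q(2) Q(4)] by (elim conjE) (rule spec)
  have Tfin: "Top f \<in> borel_measurable \<mu> \<and> (\<integral>\<^sup>+z. ennreal (cmod (Top f z) powr q) \<partial>\<mu>) < \<infinity>" if f: "f \<in> Bergman p \<omega>" for f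
  proof -
    have hf: "holo_on unit_ball f" and fin: "Ap_norm_p p \<omega> f < \<infinity>" using f by (auto simp: Bergman_def)
    define M where "M = enn2real (Ap_norm_p p \<omega> f)"
    have M: "0 \<le> M" "Ap_norm_p p \<omega> f \<le> ennreal M" using fin by (auto simp: M_def)
    have w: "wnorm p f \<le> ennreal (V * M)" by (rule V(2)[OF hf M])
    have VM: "0 \<le> V * M" using V(1) M by simp
    obtain K E where "0 < E" and est: "\<forall>\<eta>>0. \<exists>m. \<forall>f. holo_on unit_ball f \<longrightarrow> wnorm p f \<le> ennreal (V * M) \<longrightarrow>
      (\<integral>\<^sup>+z. ennreal (cmod (Top f z) powr q) \<partial>\<mu>) \<le> ennreal \<eta> + ennreal E * (\<Sum>j<m. ennreal (coef K a f j powr (q / p)) * emeasure \<nu> (Q j))"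
      using Top_tail_estimate[OF lat VM Q] by (elim exE conjE) (rule that)
    obtain m where "(\<integral>\<^sup>+z. ennreal (cmod (Top f z) powr q) \<partial>\<mu>) \<le> ennreal 1 + ennreal E * (\<Sum>j<m. ennreal (coef K a f j powr (q / p)) * emeasure \<nu> (Q j))"
      using est[rule_format, of 1] hf w by auto
    also have "\<dots> < \<infinity>" using Qfin by (simp add: ennreal_mult_less_top)
    finally show ?thesis using Top_measurable[OF hf] by blast
  qed
  have "\<exists>s g. strict_mono s \<and> g \<in> borel_measurable \<mu> \<and> (\<integral>\<^sup>+z. ennreal (cmod (g z) powr q) \<partial>\<mu>) < \<infinity> \<and>
       (\<lambda>k. \<integral>\<^sup>+z. ennreal (cmod (Top (fs (s k)) z - g z) powr q) \<partial>\<mu>) \<longlonglongrightarrow> 0"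
    if fs: "\<And>k. fs k \<in> Bergman p \<omega>" and bd: "\<And>k. Ap_norm_p p \<omega> (fs k) \<le> ennreal M0" for fs :: "nat \<Rightarrow> complex ^ 'n \<Rightarrow> complex" and M0
  proof -
    have hf: "holo_on unit_ball (fs k)" for k using fs by (simp add: Bergman_def)
    define M1 where "M1 = V * max M0 0"
    have M1: "0 \<le> M1" using V(1) by (simp add: M1_def)
    have w1: "wnorm p (fs k) \<le> ennreal M1" for k
      unfolding M1_def by (rule V(2)[OF hf]) (use order_trans[OF bd ennreal_leI] in auto)
    obtain s :: "nat \<Rightarrow> nat" where s: "strict_mono s" and cau: "\<forall>R<1. \<forall>e>0. \<exists>N. \<forall>m n x. N \<le> m \<and> N \<le> n \<and> norm x \<le> R \<longrightarrow> cmod (fs (s m) x - fs (s n) x) < e"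
      using locally_uniformly_Cauchy_subsequence[of p fs M1, OF p_pos hf M1 w1] by (elim exE conjE) (rule that)
    define F where "F k = fs (s k)" for k
    have hF: "holo_on unit_ball (F k)" for k by (simp add: F_def hf)
    define M where "M = 3 powr p * (M1 + M1)"
    have M: "0 \<le> M" using M1 by (simp add: M_def)
    have wd: "wnorm p (\<lambda>z. F k z - F l z) \<le> ennreal M" for k l
    proof -
      have "wnorm p (\<lambda>z. F k z - F l z) \<le> ennreal (3 powr p) * (wnorm p (F k) + wnorm p (F l))" by (rule wnorm_diff_le[OF hF hF])
      also have "\<dots> \<le> ennreal (3 powr p) * (ennreal M1 + ennreal M1)" unfolding F_def by (intro mult_left_mono add_mono w1) auto
      also have "\<dots> = ennreal M" unfolding M_def using M1 by (simp add: ennreal_mult flip: ennreal_plus)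
      finally show ?thesis .
    qed
    obtain K E where K: "0 < K" and E: "0 < E" and est: "\<forall>\<eta>>0. \<exists>m. \<forall>f. holo_on unit_ball f \<longrightarrow> wnorm p f \<le> ennreal M \<longrightarrow>
      (\<integral>\<^sup>+z. ennreal (cmod (Top f z) powr q) \<partial>\<mu>) \<le> ennreal \<eta> + ennreal E * (\<Sum>j<m. ennreal (coef K a f j powr (q / p)) * emeasure \<nu> (Q j))"
      using Top_tail_estimate[OF lat M Q] by (elim exE conjE) (rule that)
    have cauchy: "\<exists>N. \<forall>k l. N \<le> k \<longrightarrow> N \<le> l \<longrightarrow> (\<integral>\<^sup>+z. ennreal (cmod (Top (F k) z - Top (F l) z) powr q) \<partial>\<mu>) \<le> ennreal \<epsilon>"
      if \<epsilon>: "0 < \<epsilon>" for \<epsilon>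
    proof -
      obtain m where m: "\<And>f. holo_on unit_ball f \<Longrightarrow> wnorm p f \<le> ennreal M \<Longrightarrow>
        (\<integral>\<^sup>+z. ennreal (cmod (Top f z) powr q) \<partial>\<mu>) \<le> ennreal (\<epsilon> / 2) + ennreal E * (\<Sum>j<m. ennreal (coef K a f j powr (q / p)) * emeasure \<nu> (Q j))"
        using est[rule_format, of "\<epsilon> / 2"] \<epsilon> by auto
      define b where "b j = enn2real (emeasure \<nu> (Q j))" for j
      have eb: "emeasure \<nu> (Q j) = ennreal (b j)" for j using Qfin[of j] by (simp add: b_def less_top)
      have b0: "0 \<le> b j" for j by (simp add: b_def)
      define S where "S = (\<Sum>j<m. b j) + 1"
      have S: "0 < S" unfolding S_def using sum_nonneg[of "{..<m}" b] b0 by (simp add: add_nonneg_pos)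
      \<comment> \<open>The remaining cells then contribute at most E \<delta>^(q/p) S =
        \<epsilon>/2.\<close>
      define \<delta> where "\<delta> = (\<epsilon> / (2 * E * S)) powr (p / q)"
      have \<delta>: "0 < \<delta>" using \<epsilon> E S by (simp add: \<delta>_def)
      have \<delta>q: "\<delta> powr (q / p) = \<epsilon> / (2 * E * S)" using \<epsilon> E S pq by (simp add: \<delta>_def powr_powr)
      have "\<exists>N. \<forall>k l. N \<le> k \<longrightarrow> N \<le> l \<longrightarrow> coef K a (\<lambda>z. F k z - F l z) j \<le> \<delta>" for j
      proof -
        obtain R e where Re: "R < 1" "0 < e" "\<forall>h. (\<forall>z. norm z \<le> R \<longrightarrow> cmod (h z) \<le> e) \<longrightarrow> coef K a h j \<le> \<delta>"
          using coef_small[OF lat K \<delta>, of j] by blast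
        obtain N where N: "\<forall>m n x. N \<le> m \<and> N \<le> n \<and> norm x \<le> R \<longrightarrow> cmod (fs (s m) x - fs (s n) x) < e"
          using cau Re(1,2) by blast
        show ?thesis
        proof (intro exI[of _ N] allI impI)
          fix k l assume "N \<le> k" "N \<le> l"
          then have "\<forall>z. norm z \<le> R \<longrightarrow> cmod (F k z - F l z) \<le> e" using N by (simp add: F_def less_imp_le)
          then show "coef K a (\<lambda>z. F k z - F l z) j \<le> \<delta>" by (rule Re(3)[THEN spec, THEN mp])
        qed
      qed
      then obtain Nj where Nj: "\<And>j k l. Nj j \<le> k \<Longrightarrow> Nj j \<le> l \<Longrightarrow> coef K a (\<lambda>z. F k z - F l z) j \<le> \<delta>" by metis
      show ?thesis
      proof (intro exI[of _ "Max (insert 0 (Nj ` {..<m}))"] allI impI)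
        fix k l assume kl: "Max (insert 0 (Nj ` {..<m})) \<le> k" "Max (insert 0 (Nj ` {..<m})) \<le> l"
        have Nk: "Nj j \<le> k" "Nj j \<le> l" if "j < m" for j
        proof -
          have "Nj j \<le> Max (insert 0 (Nj ` {..<m}))" using that by (intro Max_ge) auto
          then show "Nj j \<le> k" "Nj j \<le> l" using kl by (meson order_trans)+
        qed
        let ?h = "\<lambda>z. F k z - F l z"
        have "(\<Sum>j<m. ennreal (coef K a ?h j powr (q / p)) * emeasure \<nu> (Q j)) \<le> (\<Sum>j<m. ennreal (\<delta> powr (q / p)) * ennreal (b j))"
          unfolding eb
        proof (intro sum_mono mult_right_mono ennreal_leI powr_mono2)
          fix j assume "j \<in> {..<m}"
          then show "coef K a ?h j \<le> \<delta>" using Nj[of j k l] Nk[of j] by simp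
        qed (use pq coef_nonneg in auto)
        also have "\<dots> = ennreal (\<delta> powr (q / p) * (\<Sum>j<m. b j))"
          using b0 by (simp add: sum_distrib_left[symmetric] sum_ennreal ennreal_mult sum_nonneg)
        also have "\<dots> \<le> ennreal (\<epsilon> / (2 * E))"
        proof (rule ennreal_leI)
          have "\<delta> powr (q / p) * (\<Sum>j<m. b j) \<le> \<delta> powr (q / p) * S" by (intro mult_left_mono) (auto simp: S_def)
          also have "\<dots> = \<epsilon> / (2 * E)" unfolding \<delta>q using S by simp
          finally show "\<delta> powr (q / p) * (\<Sum>j<m. b j) \<le> \<epsilon> / (2 * E)" .
        qed
        finally have 1: "(\<Sum>j<m. ennreal (coef K a ?h j powr (q / p)) * emeasure \<nu> (Q j)) \<le> ennreal (\<epsilon> / (2 * E))" .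
        have "(\<integral>\<^sup>+z. ennreal (cmod (Top (F k) z - Top (F l) z) powr q) \<partial>\<mu>) = (\<integral>\<^sup>+z. ennreal (cmod (Top ?h z) powr q) \<partial>\<mu>)"
          by (simp only: Top_diff)
        also have "\<dots> \<le> ennreal (\<epsilon> / 2) + ennreal E * (\<Sum>j<m. ennreal (coef K a ?h j powr (q / p)) * emeasure \<nu> (Q j))"
          by (rule m[OF holo_on_diff[OF hF hF] wd])
        also have "\<dots> \<le> ennreal (\<epsilon> / 2) + ennreal E * ennreal (\<epsilon> / (2 * E))"
          by (intro add_left_mono mult_left_mono 1) simp
        also have "\<dots> = ennreal (\<epsilon> / 2 + E * (\<epsilon> / (2 * E)))"
          using E \<epsilon> by (simp add: ennreal_mult[symmetric] ennreal_plus[symmetric] del: ennreal_plus)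
        also have "\<epsilon> / 2 + E * (\<epsilon> / (2 * E)) = \<epsilon>" using E by simp
        finally show "(\<integral>\<^sup>+z. ennreal (cmod (Top (F k) z - Top (F l) z) powr q) \<partial>\<mu>) \<le> ennreal \<epsilon>" .
      qed
    qed
    \<comment> \<open>Outside the ball this value is arbitrary; only values at \<phi> z and \<psi> z
      with z in the ball enter \<open>Top L\<close>.\<close>
    define L where "L y = lim (\<lambda>k. F k y)" for y
    have lim: "(\<lambda>k. F k y) \<longlonglongrightarrow> L y" if y: "y \<in> unit_ball" for y
    proof -
      have "Cauchy (\<lambda>k. F k y)"
      proof (rule metric_CauchyI)
        fix e :: real assume "0 < e"
        then obtain N where N: "\<forall>m n x. N \<le> m \<and> N \<le> n \<and> norm x \<le> norm y \<longrightarrow> cmod (fs (s m) x - fs (s n) x) < e"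
          using cau[rule_format, of "norm y" e] y by auto
        then show "\<exists>M. \<forall>m\<ge>M. \<forall>n\<ge>M. dist (F m y) (F n y) < e"
          by (intro exI[of _ N]) (auto simp: dist_norm F_def)
      qed
      then show ?thesis unfolding L_def by (simp add: Cauchy_convergent_iff convergent_LIMSEQ_iff)
    qed
    define g where "g = Top L"
    have limT: "(\<lambda>k. Top (F k) z) \<longlonglongrightarrow> g z" if "z \<in> space \<mu>" for z
      unfolding g_def Top_def using that maps_ball[of z] by (intro tendsto_intros lim) (auto simp: space_\<mu>)
    have mF[measurable]: "Top (F k) \<in> borel_measurable \<mu>" for k by (rule Top_measurable[OF hF])
    have mg[measurable]: "g \<in> borel_measurable \<mu>" by (rule borel_measurable_LIMSEQ_metric[OF mF limT])
    have small: "\<exists>N. \<forall>k\<ge>N. (\<integral>\<^sup>+z. ennreal (cmod (Top (F k) z - g z) powr q) \<partial>\<mu>) \<le> ennreal \<epsilon>" if \<epsilon>: "0 < \<epsilon>" for \<epsilon>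
    proof -
      obtain N where N: "\<And>k l. N \<le> k \<Longrightarrow> N \<le> l \<Longrightarrow> (\<integral>\<^sup>+z. ennreal (cmod (Top (F k) z - Top (F l) z) powr q) \<partial>\<mu>) \<le> ennreal \<epsilon>"
        using cauchy[OF \<epsilon>] by blast
      show ?thesis
      proof (intro exI[of _ N] allI impI)
        fix k assume k: "N \<le> k"
        \<comment> \<open>Fatou with k fixed and l tending to infinity passes the Cauchy bound to
          the limit g.\<close>
        have "(\<integral>\<^sup>+z. ennreal (cmod (Top (F k) z - g z) powr q) \<partial>\<mu>) = (\<integral>\<^sup>+z. liminf (\<lambda>l. ennreal (cmod (Top (F k) z - Top (F l) z) powr q)) \<partial>\<mu>)"
        proof (rule nn_integral_cong)
          fix z assume z: "z \<in> space \<mu>"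
          have "(\<lambda>l. cmod (Top (F k) z - Top (F l) z) powr q) \<longlonglongrightarrow> cmod (Top (F k) z - g z) powr q"
            using pq by (intro tendsto_powr' tendsto_intros limT z) auto
          then have "(\<lambda>l. ennreal (cmod (Top (F k) z - Top (F l) z) powr q)) \<longlonglongrightarrow> ennreal (cmod (Top (F k) z - g z) powr q)"
            by (rule tendsto_ennrealI)
          then show "ennreal (cmod (Top (F k) z - g z) powr q) = liminf (\<lambda>l. ennreal (cmod (Top (F k) z - Top (F l) z) powr q))"
            by (rule lim_imp_Liminf[OF sequentially_bot, symmetric])
        qed
        also have "\<dots> \<le> liminf (\<lambda>l. \<integral>\<^sup>+z. ennreal (cmod (Top (F k) z - Top (F l) z) powr q) \<partial>\<mu>)"
          by (rule nn_integral_liminf) measurable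
        also have "\<dots> \<le> limsup (\<lambda>l. \<integral>\<^sup>+z. ennreal (cmod (Top (F k) z - Top (F l) z) powr q) \<partial>\<mu>)"
          by (rule Liminf_le_Limsup) simp
        also have "\<dots> \<le> ennreal \<epsilon>"
          by (rule Limsup_bounded) (use N[OF k] in \<open>auto simp: eventually_sequentially\<close>)
        finally show "(\<integral>\<^sup>+z. ennreal (cmod (Top (F k) z - g z) powr q) \<partial>\<mu>) \<le> ennreal \<epsilon>" .
      qed
    qed
    have conv: "(\<lambda>k. \<integral>\<^sup>+z. ennreal (cmod (Top (F k) z - g z) powr q) \<partial>\<mu>) \<longlonglongrightarrow> 0"
    proof (rule tendsto_0_if_ennreal_small)
      fix \<epsilon> :: real assume "0 < \<epsilon>"
      then show "\<exists>N. \<forall>k\<ge>N. (\<integral>\<^sup>+z. ennreal (cmod (Top (F k) z - g z) powr q) \<partial>\<mu>) \<le> ennreal \<epsilon>" by (rule small)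
    qed
    have "(\<integral>\<^sup>+z. ennreal (cmod (g z) powr q) \<partial>\<mu>) < \<infinity>"
    proof -
      obtain N where N: "(\<integral>\<^sup>+z. ennreal (cmod (Top (F N) z - g z) powr q) \<partial>\<mu>) \<le> ennreal 1" using small[of 1] by auto
      have "(\<integral>\<^sup>+z. ennreal (cmod (g z) powr q) \<partial>\<mu>) \<le> (\<integral>\<^sup>+z. ennreal (3 powr q) * (ennreal (cmod (Top (F N) z) powr q) + ennreal (cmod (Top (F N) z - g z) powr q)) \<partial>\<mu>)"
      proof (rule nn_integral_mono)
        fix z
        have "cmod (g z) \<le> cmod (Top (F N) z) + cmod (Top (F N) z - g z) + 0"
          using norm_triangle_ineq4[of "Top (F N) z" "Top (F N) z - g z"] by simp
        then have "cmod (g z) powr q \<le> (cmod (Top (F N) z) + cmod (Top (F N) z - g z) + 0) powr q"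
          using pq by (intro powr_mono2) auto
        also have "\<dots> \<le> 3 powr q * (cmod (Top (F N) z) powr q + cmod (Top (F N) z - g z) powr q + 0 powr q)"
          using pq by (intro powr_add3_le) auto
        finally have "ennreal (cmod (g z) powr q) \<le> ennreal (3 powr q * (cmod (Top (F N) z) powr q + cmod (Top (F N) z - g z) powr q))"
          by (intro ennreal_leI) simp
        then show "ennreal (cmod (g z) powr q) \<le> ennreal (3 powr q) * (ennreal (cmod (Top (F N) z) powr q) + ennreal (cmod (Top (F N) z - g z) powr q))"
          by (simp add: ennreal_mult)
      qed
      also have "\<dots> = ennreal (3 powr q) * ((\<integral>\<^sup>+z. ennreal (cmod (Top (F N) z) powr q) \<partial>\<mu>) + (\<integral>\<^sup>+z. ennreal (cmod (Top (F N) z - g z) powr q) \<partial>\<mu>))"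
        by (subst nn_integral_cmult, measurable) (subst nn_integral_add, measurable)
      also have "\<dots> < \<infinity>"
        using Tfin[OF fs, of "s N"] le_less_trans[OF N ennreal_less_top] by (auto simp: F_def ennreal_mult_less_top)
      finally show ?thesis .
    qed
    then show ?thesis using s mg conv unfolding F_def by blast
  qed
  then show ?thesis unfolding compact_op_def using Tfin by blast
qed

end

theorem theorem4p5:
  fixes p q r :: real
    and \<omega> :: "real \<Rightarrow> real"
    and \<phi> \<psi> :: "complex ^ 'n \<Rightarrow> complex ^ 'n"
    and u v :: "complex ^ 'n \<Rightarrow> complex"
    and \<mu> :: "(complex ^ 'n) measure"
  assumes "0 < q" "q < p" "0 < r" "r < 1"
    and "D_class TYPE('n) \<omega>"
    and "holo_self_map \<phi>" "holo_self_map \<psi>"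
    and "u \<in> borel_measurable ball_space" "v \<in> borel_measurable ball_space"
    and "sets \<mu> = sets ball_space"
    and "carleson q p \<omega>
           (measure_add
             (measure_add
               (distr (density \<mu> (\<lambda>z. ennreal (norm (complex_of_real (pseudo_hyp (\<phi> z) (\<psi> z)) * u z) powr q))) ball_space \<phi>)
               (distr (density \<mu> (\<lambda>z. ennreal (norm (complex_of_real (pseudo_hyp (\<phi> z) (\<psi> z)) * v z) powr q))) ball_space \<psi>))
             (distr (density \<mu> (\<lambda>z. indicator {z\<in>unit_ball. pseudo_hyp (\<phi> z) (\<psi> z) < r} z * ennreal (norm (u z - v z) powr q))) ball_space \<phi>))
         \<or> carleson q p \<omega>
           (measure_add
             (measure_add
               (distr (density \<mu> (\<lambda>z. ennreal (norm (complex_of_real (pseudo_hyp (\<phi> z) (\<psi> z)) * u z) powr q))) ball_space \<phi>)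
               (distr (density \<mu> (\<lambda>z. ennreal (norm (complex_of_real (pseudo_hyp (\<phi> z) (\<psi> z)) * v z) powr q))) ball_space \<psi>))
             (distr (density \<mu> (\<lambda>z. indicator {z\<in>unit_ball. pseudo_hyp (\<phi> z) (\<psi> z) < r} z * ennreal (norm (u z - v z) powr q))) ball_space \<psi>))"
  shows "compact_op (\<lambda>f z. u z * f (\<phi> z) - v z * f (\<psi> z)) p \<omega> q \<mu>"
proof -
  define w1 where "w1 = (\<lambda>z. ennreal (norm (complex_of_real (pseudo_hyp (\<phi> z) (\<psi> z)) * u z) powr q))"
  define w2 where "w2 = (\<lambda>z. ennreal (norm (complex_of_real (pseudo_hyp (\<phi> z) (\<psi> z)) * v z) powr q))"
  define w3 where "w3 = (\<lambda>z. indicator {z\<in>unit_ball. pseudo_hyp (\<phi> z) (\<psi> z) < r} z * ennreal (norm (u z - v z) powr q))"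
  define N where "N \<kappa> = measure_add (measure_add (distr (density \<mu> w1) ball_space \<phi>) (distr (density \<mu> w2) ball_space \<psi>)) (distr (density \<mu> w3) ball_space \<kappa>)" for \<kappa>
  have "carleson q p \<omega> (N \<phi>) \<or> carleson q p \<omega> (N \<psi>)"
    using assms(11) unfolding N_def w1_def w2_def w3_def .
  \<comment> \<open>The two alternatives of the hypothesis differ only in the map of the third
    pullback, so one argument with \<kappa> covers both.\<close>
  then obtain \<kappa> where \<kappa>: "\<kappa> = \<phi> \<or> \<kappa> = \<psi>" and car: "carleson q p \<omega> (N \<kappa>)" by blast
  have sp: "space \<mu> = unit_ball" using assms(10) by (rule space_ball_space)
  have maps_m: "\<phi> \<in> \<mu> \<rightarrow>\<^sub>M ball_space" "\<psi> \<in> \<mu> \<rightarrow>\<^sub>M ball_space" "\<kappa> \<in> \<mu> \<rightarrow>\<^sub>M ball_space"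
    using holo_self_map_measurable[OF assms(6)] holo_self_map_measurable[OF assms(7)] \<kappa>
    by (auto simp: measurable_cong_sets[OF assms(10) refl])
  note [measurable] = maps_m
  have [measurable]: "u \<in> borel_measurable \<mu>" "v \<in> borel_measurable \<mu>"
    using assms(8,9) by (auto simp: measurable_cong_sets[OF assms(10) refl])
  have [measurable]: "(\<lambda>z. pseudo_hyp (\<phi> z) (\<psi> z)) \<in> borel_measurable \<mu>"
  proof -
    have "(\<lambda>x. x) \<in> borel_measurable (ball_space :: (complex ^ 'n) measure)"
      unfolding ball_space_def by (rule measurable_restrict_space1) simp
    then have [measurable]: "\<phi> \<in> borel_measurable \<mu>" "\<psi> \<in> borel_measurable \<mu>"
      using measurable_compose[OF maps_m(1)] measurable_compose[OF maps_m(2)] by auto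
    have "(\<lambda>z. sqrt (1 - bgap (\<phi> z) * bgap (\<psi> z) / (kdist (\<phi> z) (\<psi> z))\<^sup>2)) \<in> borel_measurable \<mu>" by measurable
    then show ?thesis
    proof (rule measurable_cong[THEN iffD1, rotated])
      fix z assume "z \<in> space \<mu>"
      then have "\<phi> z \<in> unit_ball" "\<psi> z \<in> unit_ball"
        using assms(6,7) unfolding holo_self_map_def sp by blast+
      then show "sqrt (1 - bgap (\<phi> z) * bgap (\<psi> z) / (kdist (\<phi> z) (\<psi> z))\<^sup>2) = pseudo_hyp (\<phi> z) (\<psi> z)"
        by (rule pseudo_hyp_eq[symmetric])
    qed
  qed
  have "{z\<in>space \<mu>. pseudo_hyp (\<phi> z) (\<psi> z) < r} \<in> sets \<mu>" by measurable
  then have [measurable]: "{z\<in>unit_ball. pseudo_hyp (\<phi> z) (\<psi> z) < r} \<in> sets \<mu>" by (simp only: sp)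
  have [measurable]: "w1 \<in> borel_measurable \<mu>" "w2 \<in> borel_measurable \<mu>" "w3 \<in> borel_measurable \<mu>"
    unfolding w1_def w2_def w3_def by measurable
  interpret difference_operator "TYPE('n)" \<omega> p q r \<phi> \<psi> \<kappa> u v \<mu> "N \<kappa>"
  proof
    show "sets (N \<kappa>) = sets ball_space" by (simp add: N_def sets_measure_add)
    fix g :: "complex ^ 'n \<Rightarrow> ennreal" assume g[measurable]: "g \<in> borel_measurable ball_space"
    have "(\<integral>\<^sup>+y. g y \<partial>N \<kappa>) = (\<integral>\<^sup>+z. w1 z * g (\<phi> z) \<partial>\<mu>) + (\<integral>\<^sup>+z. w2 z * g (\<psi> z) \<partial>\<mu>) + (\<integral>\<^sup>+z. w3 z * g (\<kappa> z) \<partial>\<mu>)"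
      unfolding N_def by (simp add: nn_integral_measure_add sets_measure_add nn_integral_pullback measurable_cong_sets[OF sets_measure_add refl])
    then show "(\<integral>\<^sup>+y. g y \<partial>N \<kappa>) =
      (\<integral>\<^sup>+z. ennreal (cmod (of_real (pseudo_hyp (\<phi> z) (\<psi> z)) * u z) powr q) * g (\<phi> z) \<partial>\<mu>)
      + (\<integral>\<^sup>+z. ennreal (cmod (of_real (pseudo_hyp (\<phi> z) (\<psi> z)) * v z) powr q) * g (\<psi> z) \<partial>\<mu>)
      + (\<integral>\<^sup>+z. indicator {z\<in>unit_ball. pseudo_hyp (\<phi> z) (\<psi> z) < r} z * ennreal (cmod (u z - v z) powr q) * g (\<kappa> z) \<partial>\<mu>)"
      by (simp only: w1_def w2_def w3_def)
  qed (rule assms(1-10) \<kappa> car)+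
  show ?thesis using Top_compact unfolding Top_def[abs_def] .
qed

end
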